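(* Let $s\ge1$ and $\varphi\in H^s(\mathbb{R})$. There exist $T=T(\|\varphi\|_{H^1})\in\,]0,1[$ (depending on $\varphi$ only through $\|\varphi\|_{H^1}$) and $C>0$ such that for every $\varepsilon\in\,]0,1[$ the solution $u_\varepsilon\in C(\mathbb{R};H^1(\mathbb{R}))$ of $$u_t+u_{xxx}+\varepsilon\,\partial_x^5u+u\,u_x=0,\qquad u(0)=\varphi,$$ satisfies $$\sup_{t\in[0,T]}\|u_\varepsilon(t)\|_{H^s}\le C\|\varphi\|_{H^s}.$$ Moreover, for every $R>0$ the family of solution maps $S_{K_\varepsilon}:\varphi\mapsto u_\varepsilon$, $\varepsilon\in\,]0,1[$, from $B(0,R)_{H^s}$ into $C([0,T(R)];H^s(\mathbb{R}))$ is equi-continuous, i.e. for every sequence $\{\varphi_n\}\subset B(0,R)_{H^s}$ converging to $\varphi$ in $H^s(\mathbb{R})$, $$\lim_{n\to\infty}\ \sup_{\varepsilon\in]0,1[}\ \|S_{K_\varepsilon}\varphi-S_{K_\varepsilon}\varphi_n\|_{L^\infty(0,T(R);H^s(\mathbb{R}))}=0 .$$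
   Context: $H^s(\mathbb{R})$ is the Sobolev space of real-valued functions with norm $\|f\|_{H^s}=\|J_x^sf\|_{L^2}$, where $J_x^s$ is the Fourier multiplier $(1+|\xi|^2)^{s/2}$. $B(0,R)_{H^s}$ is the ball of radius $R$ centred at $0$ in $H^s(\mathbb{R})$. $T(R)$ denotes the value at $R$ of the function $T(\cdot)$ giving the time $T=T(\|\varphi\|_{H^1})$ of the first part. For each fixed $\varepsilon>0$ the equation has, for each initial datum in $H^s(\mathbb{R})$, $s\ge1$, a unique global solution in $C(\mathbb{R};H^s(\mathbb{R}))$ (known result); this is the solution referred to, and $S_{K_\varepsilon}$ is the corresponding solution map. *)

theory Defs
  imports "HOL-Analysis.Analysis" "HOL-Probability.Essential_Supremum"
begin

text \<open>Elements of \<open>L\<^sup>2\<close> and of Sobolev spaces are represented by Borel functions, without passing to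
  the quotient by equality almost everywhere.\<close>

definition L2 :: "(real \<Rightarrow> complex) set" where
  "L2 = {f. f \<in> borel_measurable lborel \<and> integrable lborel (\<lambda>x. (cmod (f x))\<^sup>2)}"

definition L2_norm :: "(real \<Rightarrow> complex) \<Rightarrow> real" where
  "L2_norm f = sqrt (LINT x|lborel. (cmod (f x))\<^sup>2)"

text \<open>\<open>L2_fourier f g\<close>: the function \<open>g\<close> is (a representative of) the unitary Fourier transform of
  \<open>f\<close>, that is, the limit in \<open>L\<^sup>2\<close> of the Fourier integrals of the truncations of \<open>f\<close>. The
  distance is an extended nonnegative integral, so it is meaningful without prior knowledge that
  the truncated transforms lie in \<open>L\<^sup>2\<close>.\<close>

definition truncated_fourier :: "nat \<Rightarrow> (real \<Rightarrow> complex) \<Rightarrow> real \<Rightarrow> complex" where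
  "truncated_fourier N f \<xi> =
     complex_of_real (1 / sqrt (2 * pi)) * (LINT x:{- real N..real N}|lborel. cis (- (\<xi> * x)) * f x)"

definition L2_fourier :: "(real \<Rightarrow> complex) \<Rightarrow> (real \<Rightarrow> complex) \<Rightarrow> bool" where
  "L2_fourier f g \<longleftrightarrow> f \<in> L2 \<and> g \<in> L2 \<and>
     (\<lambda>N. \<integral>\<^sup>+ \<xi>. ennreal ((cmod (truncated_fourier N f \<xi> - g \<xi>))\<^sup>2) \<partial>lborel) \<longlonglongrightarrow> 0"

text \<open>\<open>is_bessel s f h\<close>: \<open>h = J\<^sup>s f\<close>, where \<open>J\<^sup>s\<close> is the Fourier multiplier with symbol
  \<open>(1 + |\<xi>|\<^sup>2)\<^bsup>s/2\<^esup>\<close> and both \<open>f\<close> and \<open>h\<close> are in \<open>L\<^sup>2\<close>. Since \<open>f \<in> L\<^sup>2\<close> is required, the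
  space \<open>Hs s\<close> below is the usual Sobolev space only for \<open>s \<ge> 0\<close>.\<close>

definition is_bessel :: "real \<Rightarrow> (real \<Rightarrow> complex) \<Rightarrow> (real \<Rightarrow> complex) \<Rightarrow> bool" where
  "is_bessel s f h \<longleftrightarrow>
     (\<exists>g. L2_fourier f g \<and> L2_fourier h (\<lambda>\<xi>. complex_of_real ((1 + \<bar>\<xi>\<bar>\<^sup>2) powr (s / 2)) * g \<xi>))"

definition bessel :: "real \<Rightarrow> (real \<Rightarrow> complex) \<Rightarrow> real \<Rightarrow> complex" where
  "bessel s f = (SOME h. is_bessel s f h)"

definition Hs :: "real \<Rightarrow> (real \<Rightarrow> real) set" where
  "Hs s = {f. \<exists>h. is_bessel s (\<lambda>x. complex_of_real (f x)) h}"

definition Hs_norm :: "real \<Rightarrow> (real \<Rightarrow> real) \<Rightarrow> real" where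
  "Hs_norm s f = L2_norm (bessel s (\<lambda>x. complex_of_real (f x)))"

text \<open>\<open>Hs_norm\<close> is meaningful only on \<open>Hs s\<close>; the extended norm is infinite elsewhere.\<close>

definition Hs_enorm :: "real \<Rightarrow> (real \<Rightarrow> real) \<Rightarrow> ennreal" where
  "Hs_enorm s f = (if f \<in> Hs s then ennreal (Hs_norm s f) else \<infinity>)"

definition Hs_ball :: "real \<Rightarrow> real \<Rightarrow> (real \<Rightarrow> real) set" where
  "Hs_ball s R = {f \<in> Hs s. Hs_norm s f < R}"

text \<open>A function of time and space is written \<open>u t x\<close>. The set \<open>C_Hs s I\<close> is
  \<open>C(I; H\<^sup>s)\<close>.\<close>

definition C_Hs :: "real \<Rightarrow> real set \<Rightarrow> (real \<Rightarrow> real \<Rightarrow> real) set" where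
  "C_Hs s I = {u. (\<forall>t\<in>I. u t \<in> Hs s) \<and>
     (\<forall>t\<^sub>0\<in>I. ((\<lambda>t. Hs_norm s (\<lambda>x. u t x - u t\<^sub>0 x)) \<longlongrightarrow> 0) (at t\<^sub>0 within I))}"

definition Linf_Hs_norm :: "real \<Rightarrow> real \<Rightarrow> (real \<Rightarrow> real \<Rightarrow> real) \<Rightarrow> ennreal" where
  "Linf_Hs_norm s T v = esssup (restrict_space lborel {0<..<T}) (\<lambda>t. Hs_enorm s (v t))"

definition test_function :: "(real \<Rightarrow> real) \<Rightarrow> bool" where
  "test_function \<eta> \<longleftrightarrow> (\<forall>k x. (deriv ^^ k) \<eta> differentiable at x) \<and> bounded {x. \<eta> x \<noteq> 0}"

text \<open>Solutions in \<open>C(\<real>; H\<^sup>1)\<close> of \<open>u\<^sub>t + u\<^sub>x\<^sub>x\<^sub>x + \<epsilon> \<partial>\<^sub>x\<^sup>5 u + u u\<^sub>x = 0\<close>, \<open>u(0) = \<phi>\<close>. The equation holds in the sense of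
  distributions in \<open>x\<close> at every time \<open>t\<close>, with \<open>u u\<^sub>x = \<partial>\<^sub>x (u\<^sup>2 / 2)\<close>; all \<open>x\<close>-derivatives have odd
  order, and so each integration by parts changes the sign.\<close>

definition kawahara_solution :: "real \<Rightarrow> (real \<Rightarrow> real) \<Rightarrow> (real \<Rightarrow> real \<Rightarrow> real) \<Rightarrow> bool" where
  "kawahara_solution \<epsilon> \<phi> u \<longleftrightarrow>
     u \<in> C_Hs 1 UNIV \<and>
     (AE x in lborel. u 0 x = \<phi> x) \<and>
     (\<forall>\<eta>. test_function \<eta> \<longrightarrow>
       (\<forall>t. ((\<lambda>\<tau>. LINT x|lborel. u \<tau> x * \<eta> x) has_real_derivative
              (LINT x|lborel. u t x * (deriv ^^ 3) \<eta> x + \<epsilon> * (u t x * (deriv ^^ 5) \<eta> x)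
                 + (u t x)\<^sup>2 / 2 * deriv \<eta> x)) (at t)))"

definition kawahara_solution_maps ::
    "real \<Rightarrow> (real \<Rightarrow> (real \<Rightarrow> real) \<Rightarrow> real \<Rightarrow> real \<Rightarrow> real) \<Rightarrow> bool" where
  "kawahara_solution_maps s S \<longleftrightarrow>
     (\<forall>\<epsilon>\<in>{0<..<1}. \<forall>\<phi>\<in>Hs s. kawahara_solution \<epsilon> \<phi> (S \<epsilon> \<phi>))"

end

theory Submission
  imports Defs "HOL-Probability.Probability"
begin

text \<open>Put \<open>p(\<xi>) = \<xi>\<^sup>3 - \<epsilon> \<xi>\<^sup>5\<close> and remove the linear evolution \<open>exp (i t p(\<xi>))\<close> from the Fourier
  transform of a solution, which gives its profile \<open>F(t, \<xi>)\<close>. The time derivative of a weighted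
  energy \<open>\<integral> a\<^sup>2 |F|\<^sup>2\<close> is a trilinear integral over the plane \<open>x + y + z = 0\<close> that oscillates in time with the frequency
  \<open>p(x) + p(y) + p(z) = x y z m\<close>, where \<open>m = 3 - (5 \<epsilon> / 2) (x\<^sup>2 + y\<^sup>2 + z\<^sup>2)\<close>. Let \<open>\<rho>\<close> be the largest of
  \<open>|x|, |y|, |z|\<close>. Where \<open>\<rho>\<close> is large and \<open>\<rho> |m| \<ge> 1\<close>, one integrates by parts in time: after
  symmetrisation the multiplier divided by the frequency gains a factor \<open>1 / \<rho>\<close>. Where
  \<open>\<rho> |m| < 1\<close>, the lines with fixed smallest variable meet the set in measure bounded uniformly in
  \<open>\<epsilon>\<close>, and the Cauchy-Schwarz inequality suffices. Hence every energy whose weight grows at most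
  polynomially at most doubles up to a time that depends only on the \<open>H\<^sup>1\<close> norm of the data, and in
  the same way the \<open>L\<^sup>2\<close> distance of two solutions at most grows by a constant factor. The weights
  \<open>(1 + \<xi>\<^sup>2)\<^bsup>s/2\<^esup>\<close> give the first claim. With the additional factor \<open>min (1, (1 + \<xi>\<^sup>2)\<^bsup>1/2\<^esup> / N)\<close> they bound the
  high frequencies of all solutions uniformly by those of the data, and the low frequencies are
  controlled by the \<open>L\<^sup>2\<close> distance; this is the equicontinuity. Solutions in the sense of
  distributions are tested with truncated exponentials in order to obtain the equation for \<open>F\<close>.\<close>

section \<open>Trilinear integrals over the plane \<open>x + y + z = 0\<close>\<close>

text \<open>The two dispersive terms have opposite effects: \<open>m\<close> can vanish once the
  frequencies reach size \<epsilon>^(-1/2), which tends to infinity as \<epsilon> tends to 0, so no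
  frequency cut-off independent of \<epsilon> removes the resonance. Integration by parts in time
  leaves boundary terms, so there is no differential inequality to which Gronwall would apply. They
  are made small by starting the integration by parts only above a frequency K, and the supremum of
  the energy over the time interval is then absorbed. Absorption needs a finite supremum; hence
  weights are first truncated, with constants that see a weight only through its growth exponent. In
  an H^s energy for the difference of two solutions more derivatives would fall on a solution than
  its data provide. Differences are therefore measured in L^2 only, where symmetrisation in the two
  slots of the difference moves the derivative to the sum of the solutions. All integrations by
  parts in time are done at fixed frequencies, so the profile must solve its equation at every
  frequency and every time, not almost everywhere.\<close>

type_synonym kernel = "real \<Rightarrow> real \<Rightarrow> real \<Rightarrow> real"
type_synonym evolution = "real \<Rightarrow> real \<Rightarrow> complex"

text \<open>With values in \<open>ennreal\<close>, products and integrals carry no integrability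
  conditions, while the bound \<open>A\<close> stays real so that constants are computed in the real
  numbers.\<close>

definition L2b :: "(real \<Rightarrow> ennreal) \<Rightarrow> real \<Rightarrow> bool" where
  "L2b F A \<longleftrightarrow> F \<in> borel_measurable borel \<and> 0 \<le> A \<and> (\<integral>\<^sup>+x. (F x)\<^sup>2 \<partial>lborel) \<le> ennreal (A\<^sup>2)"

definition L1b :: "(real \<Rightarrow> ennreal) \<Rightarrow> real \<Rightarrow> bool" where
  "L1b F A \<longleftrightarrow> F \<in> borel_measurable borel \<and> 0 \<le> A \<and> (\<integral>\<^sup>+x. F x \<partial>lborel) \<le> ennreal A"

lemma L2bD: "L2b F A \<Longrightarrow> F \<in> borel_measurable borel" "L2b F A \<Longrightarrow> 0 \<le> A"
    "L2b F A \<Longrightarrow> (\<integral>\<^sup>+x. (F x)\<^sup>2 \<partial>lborel) \<le> ennreal (A\<^sup>2)"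
  by (auto simp: L2b_def)

lemma L1bD: "L1b F A \<Longrightarrow> F \<in> borel_measurable borel" "L1b F A \<Longrightarrow> 0 \<le> A"
    "L1b F A \<Longrightarrow> (\<integral>\<^sup>+x. F x \<partial>lborel) \<le> ennreal A"
  by (auto simp: L1b_def)

lemma ennreal_power2_le_imp_le:
  fixes X :: ennreal
  assumes "X\<^sup>2 \<le> ennreal (c\<^sup>2)" "0 \<le> c"
  shows "X \<le> ennreal c"
proof (cases X)
  case (real r)
  with assms have "r\<^sup>2 \<le> c\<^sup>2"
    by (simp add: ennreal_power)
  with real assms show ?thesis
    by (metis abs_le_square_iff abs_of_nonneg ennreal_leI)
next
  case top
  with assms show ?thesis by (simp add: power2_eq_square top_unique ennreal_mult_top)
qed

lemma nn_integral_mult_le_sqrt: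
  assumes "f \<in> borel_measurable M" "g \<in> borel_measurable M" "0 \<le> A" "0 \<le> B"
    and "(\<integral>\<^sup>+x. (f x)\<^sup>2 \<partial>M) \<le> ennreal (A\<^sup>2)" "(\<integral>\<^sup>+x. (g x)\<^sup>2 \<partial>M) \<le> ennreal (B\<^sup>2)"
  shows "(\<integral>\<^sup>+x. f x * g x \<partial>M) \<le> ennreal (A * B)"
proof (rule ennreal_power2_le_imp_le)
  have "(\<integral>\<^sup>+x. f x * g x \<partial>M)\<^sup>2 \<le> (\<integral>\<^sup>+x. (f x)\<^sup>2 \<partial>M) * (\<integral>\<^sup>+x. (g x)\<^sup>2 \<partial>M)"
    by (rule Cauchy_Schwarz_nn_integral) fact+
  also have "\<dots> \<le> ennreal (A\<^sup>2) * ennreal (B\<^sup>2)"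
    by (intro mult_mono assms) auto
  finally show "(\<integral>\<^sup>+x. f x * g x \<partial>M)\<^sup>2 \<le> ennreal ((A * B)\<^sup>2)"
    by (simp add: ennreal_mult power_mult_distrib)
qed (use assms in simp)

lemma nn_integral_lborel_reflect:
  fixes f :: "real \<Rightarrow> ennreal"
  assumes [measurable]: "f \<in> borel_measurable borel"
  shows "(\<integral>\<^sup>+x. f (c - x) \<partial>lborel) = (\<integral>\<^sup>+x. f x \<partial>lborel)"
  by (subst nn_integral_real_affine[where c = "-1" and t = c and f = f]) (auto simp: one_ennreal_def[symmetric])

lemma nn_integral_lborel_shift:
  fixes f :: "real \<Rightarrow> ennreal"
  assumes [measurable]: "f \<in> borel_measurable borel"
  shows "(\<integral>\<^sup>+x. f (x - c) \<partial>lborel) = (\<integral>\<^sup>+x. f x \<partial>lborel)"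
  by (subst nn_integral_real_affine[where c = 1 and t = "-c" and f = f]) (auto simp: one_ennreal_def[symmetric])

abbreviation lborel2 :: "(real \<times> real) measure" where
  "lborel2 \<equiv> lborel \<Otimes>\<^sub>M lborel"

text \<open>The coordinates x and y parametrise the plane. The linear maps that permute the three
  variables have determinant 1 or -1 in these coordinates, so the integral is symmetric;
  \<open>trint_swap12\<close> and \<open>trint_swap23\<close> generate all permutations.\<close>

definition trint :: "(real \<Rightarrow> real \<Rightarrow> real \<Rightarrow> ennreal) \<Rightarrow> ennreal" where
  "trint H = (\<integral>\<^sup>+x. (\<integral>\<^sup>+y. H x y (- x - y) \<partial>lborel) \<partial>lborel)"

abbreviation borel3 :: "(real \<times> real \<times> real) measure" where
  "borel3 \<equiv> borel \<Otimes>\<^sub>M borel \<Otimes>\<^sub>M borel"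

abbreviation measurable3 :: "(real \<Rightarrow> real \<Rightarrow> real \<Rightarrow> 'a::topological_space) \<Rightarrow> bool" where
  "measurable3 H \<equiv> (\<lambda>(x, y, z). H x y z) \<in> borel_measurable borel3"

abbreviation trimeas :: "(real \<Rightarrow> real \<Rightarrow> real \<Rightarrow> ennreal) \<Rightarrow> bool" where
  "trimeas \<equiv> measurable3"

lemma trimeas_compose:
  assumes "trimeas H"
    "f \<in> measurable M borel" "g \<in> measurable M borel" "h \<in> measurable M borel"
  shows "(\<lambda>x. H (f x) (g x) (h x)) \<in> borel_measurable M"
proof -
  have "(\<lambda>x. (f x, g x, h x)) \<in> measurable M borel3"
    using assms by simp
  from measurable_compose[OF this assms(1)] show ?thesis by simp
qed

lemma trint_swap12:
  assumes "trimeas H"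
  shows "trint (\<lambda>x y z. H y x z) = trint H"
proof -
  have [measurable]: "(\<lambda>p. H (fst p) (snd p) (- fst p - snd p)) \<in> borel_measurable (borel \<Otimes>\<^sub>M borel)"
    by (rule trimeas_compose[OF assms]) measurable
  have "trint H = (\<integral>\<^sup>+y. (\<integral>\<^sup>+x. H x y (- x - y) \<partial>lborel) \<partial>lborel)"
    unfolding trint_def
    by (rule lborel_pair.Fubini'[symmetric]) (simp add: split_beta')
  moreover have "- x - y = - y - x" for x y :: real
    by simp
  ultimately show ?thesis by (simp add: trint_def)
qed

lemma trint_swap23:
  assumes "trimeas H"
  shows "trint (\<lambda>x y z. H x z y) = trint H"
proof -
  have "(\<integral>\<^sup>+y. H x (- x - y) y \<partial>lborel) = (\<integral>\<^sup>+y. H x y (- x - y) \<partial>lborel)" for x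
  proof -
    have m: "(\<lambda>y. H x y (- x - y)) \<in> borel_measurable borel"
      by (rule trimeas_compose[OF assms]) measurable
    show ?thesis
      using nn_integral_lborel_reflect[OF m, of "-x"] by simp
  qed
  then show ?thesis by (simp add: trint_def)
qed

lemma trint_mono:
  assumes "\<And>x y z. x + y + z = 0 \<Longrightarrow> H x y z \<le> G x y z"
  shows "trint H \<le> trint G"
  unfolding trint_def by (intro nn_integral_mono assms) auto

lemma trint_add:
  assumes "trimeas H" "trimeas G"
  shows "trint (\<lambda>x y z. H x y z + G x y z) = trint H + trint G"
proof -
  have [measurable]: "(\<lambda>p. H (fst p) (snd p) (- fst p - snd p)) \<in> borel_measurable (borel \<Otimes>\<^sub>M borel)"
    "(\<lambda>p. G (fst p) (snd p) (- fst p - snd p)) \<in> borel_measurable (borel \<Otimes>\<^sub>M borel)"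
    by (rule trimeas_compose[OF assms(1)]; measurable) (rule trimeas_compose[OF assms(2)]; measurable)
  have [measurable]: "(\<lambda>y. H x y (- x - y)) \<in> borel_measurable borel"
    "(\<lambda>y. G x y (- x - y)) \<in> borel_measurable borel" for x
    by (rule trimeas_compose[OF assms(1)]; measurable) (rule trimeas_compose[OF assms(2)]; measurable)
  have 1: "(\<lambda>x. \<integral>\<^sup>+y. H x y (- x - y) \<partial>lborel) \<in> borel_measurable borel"
    using lborel.borel_measurable_nn_integral[of "\<lambda>x y. H x y (- x - y)" borel]
    by (simp add: split_beta' cong: measurable_cong_sets)
  have 2: "(\<lambda>x. \<integral>\<^sup>+y. G x y (- x - y) \<partial>lborel) \<in> borel_measurable borel"
    using lborel.borel_measurable_nn_integral[of "\<lambda>x y. G x y (- x - y)" borel]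
    by (simp add: split_beta' cong: measurable_cong_sets)
  show ?thesis
    unfolding trint_def by (simp add: nn_integral_add 1 2)
qed

lemma trint_cmult:
  assumes "trimeas H"
  shows "trint (\<lambda>x y z. c * H x y z) = c * trint H"
proof -
  have [measurable]: "(\<lambda>p. H (fst p) (snd p) (- fst p - snd p)) \<in> borel_measurable (borel \<Otimes>\<^sub>M borel)"
    by (rule trimeas_compose[OF assms(1)]; measurable)
  have [measurable]: "(\<lambda>y. H x y (- x - y)) \<in> borel_measurable borel" for x
    by (rule trimeas_compose[OF assms(1)]; measurable)
  have 1: "(\<lambda>x. \<integral>\<^sup>+y. H x y (- x - y) \<partial>lborel) \<in> borel_measurable borel"
    using lborel.borel_measurable_nn_integral[of "\<lambda>x y. H x y (- x - y)" borel]
    by (simp add: split_beta' cong: measurable_cong_sets)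
  show ?thesis
    unfolding trint_def by (simp add: nn_integral_cmult 1)
qed

lemma trimeas_prod:
  assumes [measurable]: "F \<in> borel_measurable borel" "G \<in> borel_measurable borel" "H \<in> borel_measurable borel"
  shows "trimeas (\<lambda>x y z. F x * G y * H z)"
  by measurable

text \<open>Young's inequality in trilinear form: Cauchy-Schwarz in y is uniform in x and leaves the
  L^1 factor alone. The two variants below arise by permuting coordinates.\<close>

lemma trint_L1L2L2:
  assumes "L1b F A" "L2b G B" "L2b H C"
  shows "trint (\<lambda>x y z. F x * G y * H z) \<le> ennreal (A * B * C)"
proof -
  note [measurable] = L2bD(1)[OF assms(2)] L2bD(1)[OF assms(3)] L1bD(1)[OF assms(1)]
  have B: "(\<integral>\<^sup>+y. G y * H (- x - y) \<partial>lborel) \<le> ennreal (B * C)" for x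
  proof (rule nn_integral_mult_le_sqrt)
    show "(\<integral>\<^sup>+y. (H (- x - y))\<^sup>2 \<partial>lborel) \<le> ennreal (C\<^sup>2)"
      using nn_integral_lborel_reflect[of "\<lambda>x. (H x)\<^sup>2" "-x"] L2bD(3)[OF assms(3)] by simp
  qed (use L2bD[OF assms(2)] L2bD[OF assms(3)] in auto)
  have "trint (\<lambda>x y z. F x * G y * H z) = (\<integral>\<^sup>+x. F x * (\<integral>\<^sup>+y. G y * H (- x - y) \<partial>lborel) \<partial>lborel)"
    unfolding trint_def by (simp add: mult.assoc nn_integral_cmult)
  also have "\<dots> \<le> (\<integral>\<^sup>+x. F x * ennreal (B * C) \<partial>lborel)"
    by (intro nn_integral_mono mult_left_mono B) auto
  also have "\<dots> = (\<integral>\<^sup>+x. F x \<partial>lborel) * ennreal (B * C)"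
    by (simp add: nn_integral_multc)
  also have "\<dots> \<le> ennreal A * ennreal (B * C)"
    by (intro mult_right_mono L1bD assms) auto
  also have "\<dots> = ennreal (A * B * C)"
    using assms by (simp add: ennreal_mult L1bD L2bD mult.assoc)
  finally show ?thesis .
qed

lemma trint_L2L1L2:
  assumes "L2b F A" "L1b G B" "L2b H C"
  shows "trint (\<lambda>x y z. F x * G y * H z) \<le> ennreal (A * B * C)"
  using trint_L1L2L2[OF assms(2,1,3)] 
    trint_swap12[OF trimeas_prod, of G F H] L1bD[OF assms(2)] L2bD[OF assms(1)] L2bD[OF assms(3)]
  by (simp add: mult.commute)

lemma trint_L2L2L1:
  assumes "L2b F A" "L2b G B" "L1b H C"
  shows "trint (\<lambda>x y z. F x * G y * H z) \<le> ennreal (A * B * C)"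
  using trint_L2L1L2[OF assms(1,3,2)] 
    trint_swap23[OF trimeas_prod, of F H G] L1bD[OF assms(3)] L2bD[OF assms(1)] L2bD[OF assms(2)]
  by (simp add: mult.commute mult.left_commute)

text \<open>Here all three factors are only in L^2. Cauchy-Schwarz on the plane separates the
  indicator times \<open>F x\<close> from \<open>G y * H z\<close>: the square of the first,
  integrated in y, produces the length of the section, and the square of the second decouples. The
  price \<open>sqrt L\<close> takes the place of an L^1 norm.\<close>

lemma trint_sections:
  assumes "L2b F A" "L2b G B" "L2b H C"
    and S: "Measurable.pred borel3 (\<lambda>(x, y, z). S x y z)"
    and L: "\<And>x. emeasure lborel {y. S x y (- x - y)} \<le> ennreal L" "0 \<le> L"
  shows "trint (\<lambda>x y z. of_bool (S x y z) * (F x * G y * H z)) \<le> ennreal (sqrt L * (A * B * C))"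
proof -
  note [measurable] = L2bD(1)[OF assms(1)] L2bD(1)[OF assms(2)] L2bD(1)[OF assms(3)]
  have S'[measurable]: "Measurable.pred M (\<lambda>x. S (f x) (g x) (h x))"
    if "f \<in> measurable M borel" "g \<in> measurable M borel" "h \<in> measurable M borel"
    for f g h and M :: "'a measure"
  proof -
    have "(\<lambda>x. (f x, g x, h x)) \<in> measurable M borel3"
      using that by simp
    from measurable_compose[OF this S] show ?thesis by simp
  qed
  let ?P = "lborel \<Otimes>\<^sub>M (lborel :: real measure)"
  let ?f = "\<lambda>p. of_bool (S (fst p) (snd p) (- fst p - snd p)) * F (fst p) :: ennreal"
  let ?g = "\<lambda>p. G (snd p) * H (- fst p - snd p)"
  have ob[measurable]: "(\<lambda>p. of_bool (S (fst p) (snd p) (- fst p - snd p)) :: ennreal) \<in> borel_measurable ?P"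
    unfolding of_bool_def by measurable
  have ob2[measurable]: "(\<lambda>y. of_bool (S x y (- x - y)) :: ennreal) \<in> borel_measurable borel" for x
    unfolding of_bool_def by measurable
  have "trint (\<lambda>x y z. of_bool (S x y z) * (F x * G y * H z)) = (\<integral>\<^sup>+p. ?f p * ?g p \<partial>?P)"
    unfolding trint_def by (subst lborel.nn_integral_fst[symmetric]) (auto simp: mult.assoc)
  also have "\<dots> \<le> ennreal ((sqrt L * A) * (B * C))"
  proof (rule nn_integral_mult_le_sqrt)
    have "(\<integral>\<^sup>+p. (?f p)\<^sup>2 \<partial>?P) = (\<integral>\<^sup>+x. (\<integral>\<^sup>+y. of_bool (S x y (- x - y)) * (F x)\<^sup>2 \<partial>lborel) \<partial>lborel)"
      by (subst lborel.nn_integral_fst[symmetric]) (auto simp: power_mult_distrib intro!: nn_integral_cong)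
    also have "\<dots> = (\<integral>\<^sup>+x. emeasure lborel {y. S x y (- x - y)} * (F x)\<^sup>2 \<partial>lborel)"
    proof (intro nn_integral_cong)
      fix x
      have "(\<integral>\<^sup>+y. of_bool (S x y (- x - y)) * (F x)\<^sup>2 \<partial>lborel) = (\<integral>\<^sup>+y. of_bool (S x y (- x - y)) \<partial>lborel) * (F x)\<^sup>2"
        by (rule nn_integral_multc) simp
      also have "(\<integral>\<^sup>+y. of_bool (S x y (- x - y)) \<partial>lborel) = (\<integral>\<^sup>+y. indicator {y. S x y (- x - y)} y \<partial>lborel)"
        by (intro nn_integral_cong) (auto simp: indicator_def)
      also have "\<dots> = emeasure lborel {y. S x y (- x - y)}"
        by (rule nn_integral_indicator) measurable
      finally show "(\<integral>\<^sup>+y. of_bool (S x y (- x - y)) * (F x)\<^sup>2 \<partial>lborel) = emeasure lborel {y. S x y (- x - y)} * (F x)\<^sup>2" .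
    qed
    also have "\<dots> \<le> (\<integral>\<^sup>+x. ennreal L * (F x)\<^sup>2 \<partial>lborel)"
      by (intro nn_integral_mono mult_right_mono L) auto
    also have "\<dots> = ennreal L * (\<integral>\<^sup>+x. (F x)\<^sup>2 \<partial>lborel)"
      by (rule nn_integral_cmult) simp
    also have "\<dots> \<le> ennreal L * ennreal (A\<^sup>2)"
      by (intro mult_left_mono L2bD assms) auto
    finally show "(\<integral>\<^sup>+p. (?f p)\<^sup>2 \<partial>?P) \<le> ennreal ((sqrt L * A)\<^sup>2)"
      using L by (simp add: ennreal_mult power_mult_distrib)
    have comm: "- x - y = - y - x" for x y :: real
      by simp
    have "(\<integral>\<^sup>+p. (?g p)\<^sup>2 \<partial>?P) = (\<integral>\<^sup>+y. (\<integral>\<^sup>+x. (G y)\<^sup>2 * (H (- y - x))\<^sup>2 \<partial>lborel) \<partial>lborel)"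
      by (subst lborel_pair.nn_integral_snd[symmetric]) (auto simp: power_mult_distrib comm)
    also have "\<dots> = (\<integral>\<^sup>+y. (G y)\<^sup>2 * (\<integral>\<^sup>+x. (H x)\<^sup>2 \<partial>lborel) \<partial>lborel)"
      by (subst nn_integral_cmult) (auto simp: nn_integral_lborel_reflect[of "\<lambda>x. (H x)\<^sup>2"])
    also have "\<dots> = (\<integral>\<^sup>+y. (G y)\<^sup>2 \<partial>lborel) * (\<integral>\<^sup>+x. (H x)\<^sup>2 \<partial>lborel)"
      by (rule nn_integral_multc) simp
    also have "\<dots> \<le> ennreal (B\<^sup>2) * ennreal (C\<^sup>2)"
      by (intro mult_mono L2bD assms) auto
    finally show "(\<integral>\<^sup>+p. (?g p)\<^sup>2 \<partial>?P) \<le> ennreal ((B * C)\<^sup>2)"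
      by (simp add: ennreal_mult power_mult_distrib)
  qed (use L2bD[OF assms(1)] L2bD[OF assms(2)] L2bD[OF assms(3)] L in auto)
  finally show ?thesis by (simp add: mult.assoc)
qed

section \<open>Calculus of norm bounds and convolutions\<close>

lemma L2b_mono:
  assumes "L2b F A" "\<And>x. G x \<le> F x" "G \<in> borel_measurable borel" "A \<le> B"
  shows "L2b G B"
proof -
  have "(\<integral>\<^sup>+x. (G x)\<^sup>2 \<partial>lborel) \<le> (\<integral>\<^sup>+x. (F x)\<^sup>2 \<partial>lborel)"
    by (intro nn_integral_mono power_mono assms) auto
  also have "\<dots> \<le> ennreal (A\<^sup>2)"
    by (rule L2bD) fact
  also have "\<dots> \<le> ennreal (B\<^sup>2)"
    using assms L2bD(2)[OF assms(1)] by (intro ennreal_leI power_mono) auto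
  finally show ?thesis
    using assms L2bD(2)[OF assms(1)] by (auto simp: L2b_def)
qed

lemma L2b_cmult:
  assumes "L2b F A" "0 \<le> c"
  shows "L2b (\<lambda>x. ennreal c * F x) (c * A)"
proof -
  note [measurable] = L2bD(1)[OF assms(1)]
  have "(\<integral>\<^sup>+x. (ennreal c * F x)\<^sup>2 \<partial>lborel) = ennreal (c\<^sup>2) * (\<integral>\<^sup>+x. (F x)\<^sup>2 \<partial>lborel)"
    by (subst nn_integral_cmult[symmetric]) (auto simp: power_mult_distrib ennreal_power assms)
  also have "\<dots> \<le> ennreal (c\<^sup>2) * ennreal (A\<^sup>2)"
    by (intro mult_left_mono L2bD assms) auto
  finally show ?thesis
    using assms L2bD(2)[OF assms(1)] by (auto simp: L2b_def power_mult_distrib ennreal_mult)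
qed

lemma L1b_mult:
  assumes "L2b F A" "L2b G B"
  shows "L1b (\<lambda>x. F x * G x) (A * B)"
  using nn_integral_mult_le_sqrt[of F lborel G A B] L2bD[OF assms(1)] L2bD[OF assms(2)]
  by (auto simp: L1b_def)

lemma L2b_add:
  assumes "L2b F A" "L2b G B"
  shows "L2b (\<lambda>x. F x + G x) (A + B)"
proof -
  note [measurable] = L2bD(1)[OF assms(1)] L2bD(1)[OF assms(2)]
  have "(\<integral>\<^sup>+x. (F x + G x)\<^sup>2 \<partial>lborel) = (\<integral>\<^sup>+x. (F x)\<^sup>2 + ((G x)\<^sup>2 + 2 * (F x * G x)) \<partial>lborel)"
    by (intro nn_integral_cong) (simp add: power2_sum ac_simps)
  also have "\<dots> = (\<integral>\<^sup>+x. (F x)\<^sup>2 \<partial>lborel) + ((\<integral>\<^sup>+x. (G x)\<^sup>2 \<partial>lborel) + 2 * (\<integral>\<^sup>+x. F x * G x \<partial>lborel))"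
    by (simp add: nn_integral_add nn_integral_cmult)
  also have "\<dots> \<le> ennreal (A\<^sup>2) + (ennreal (B\<^sup>2) + ennreal 2 * ennreal (A * B))"
    using L1bD(3)[OF L1b_mult[OF assms]] L2bD(3)[OF assms(1)] L2bD(3)[OF assms(2)]
    by (intro add_mono mult_mono) auto
  also have "\<dots> = ennreal ((A + B)\<^sup>2)"
    using L2bD(2)[OF assms(1)] L2bD(2)[OF assms(2)]
    by (subst ennreal_mult[symmetric]; simp add: ennreal_plus[symmetric] power2_eq_square algebra_simps del: ennreal_plus)
  finally show ?thesis
    using L2bD(2)[OF assms(1)] L2bD(2)[OF assms(2)] by (auto simp: L2b_def)
qed

definition conv :: "(real \<Rightarrow> ennreal) \<Rightarrow> (real \<Rightarrow> ennreal) \<Rightarrow> real \<Rightarrow> ennreal" where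
  "conv F G x = (\<integral>\<^sup>+y. F y * G (x - y) \<partial>lborel)"

lemma measurable_conv [measurable (raw)]:
  assumes [measurable]: "F \<in> borel_measurable borel" "G \<in> borel_measurable borel"
  shows "conv F G \<in> borel_measurable borel"
proof -
  have "conv F G \<in> borel_measurable lborel"
    unfolding conv_def[abs_def] by measurable
  then show ?thesis by simp
qed

lemma conv_commute:
  assumes [measurable]: "F \<in> borel_measurable borel" "G \<in> borel_measurable borel"
  shows "conv F G x = conv G F x"
  using nn_integral_lborel_reflect[of "\<lambda>y. G y * F (x - y)" x]
  by (simp add: conv_def mult.commute)

text \<open>Young's inequality: Cauchy-Schwarz for the measure with density \<open>F\<close> bounds
  the square of the convolution by \<open>A\<close> times the convolution of \<open>F\<close> with
  the square of \<open>G\<close>; then Fubini.\<close>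

lemma L2b_conv:
  assumes "L1b F A" "L2b G B"
  shows "L2b (conv F G) (A * B)"
proof -
  note [measurable] = L1bD(1)[OF assms(1)] L2bD(1)[OF assms(2)]
  have 1: "(conv F G x)\<^sup>2 \<le> ennreal A * (\<integral>\<^sup>+y. F y * (G (x - y))\<^sup>2 \<partial>lborel)" for x
  proof -
    have "(conv F G x)\<^sup>2 = (\<integral>\<^sup>+y. 1 * G (x - y) \<partial>density lborel F)\<^sup>2"
      by (simp add: conv_def nn_integral_density)
    also have "\<dots> \<le> (\<integral>\<^sup>+y. 1\<^sup>2 \<partial>density lborel F) * (\<integral>\<^sup>+y. (G (x - y))\<^sup>2 \<partial>density lborel F)"
      by (rule Cauchy_Schwarz_nn_integral) auto
    also have "\<dots> = (\<integral>\<^sup>+y. F y \<partial>lborel) * (\<integral>\<^sup>+y. F y * (G (x - y))\<^sup>2 \<partial>lborel)"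
      by (subst (1 2) nn_integral_density) auto
    also have "\<dots> \<le> ennreal A * (\<integral>\<^sup>+y. F y * (G (x - y))\<^sup>2 \<partial>lborel)"
      by (intro mult_right_mono L1bD assms) auto
    finally show ?thesis .
  qed
  have "(\<integral>\<^sup>+x. (conv F G x)\<^sup>2 \<partial>lborel) \<le> (\<integral>\<^sup>+x. ennreal A * (\<integral>\<^sup>+y. F y * (G (x - y))\<^sup>2 \<partial>lborel) \<partial>lborel)"
    by (intro nn_integral_mono 1)
  also have "\<dots> = ennreal A * (\<integral>\<^sup>+x. (\<integral>\<^sup>+y. F y * (G (x - y))\<^sup>2 \<partial>lborel) \<partial>lborel)"
    by (rule nn_integral_cmult) simp
  also have "(\<integral>\<^sup>+x. (\<integral>\<^sup>+y. F y * (G (x - y))\<^sup>2 \<partial>lborel) \<partial>lborel)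
      = (\<integral>\<^sup>+y. (\<integral>\<^sup>+x. F y * (G (x - y))\<^sup>2 \<partial>lborel) \<partial>lborel)"
    by (rule lborel_pair.Fubini') simp
  also have "\<dots> = (\<integral>\<^sup>+y. F y * (\<integral>\<^sup>+x. (G x)\<^sup>2 \<partial>lborel) \<partial>lborel)"
    by (subst nn_integral_cmult) (auto simp: nn_integral_lborel_shift[of "\<lambda>x. (G x)\<^sup>2"])
  also have "\<dots> = (\<integral>\<^sup>+y. F y \<partial>lborel) * (\<integral>\<^sup>+x. (G x)\<^sup>2 \<partial>lborel)"
    by (rule nn_integral_multc) simp
  also have "ennreal A * \<dots> \<le> ennreal A * (ennreal A * ennreal (B\<^sup>2))"
    by (intro mult_left_mono mult_mono L1bD L2bD assms) auto
  also have "\<dots> = ennreal ((A * B)\<^sup>2)"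
    using L1bD(2)[OF assms(1)] by (simp add: ennreal_mult[symmetric] power2_eq_square algebra_simps)
  finally show ?thesis
    using L1bD(2)[OF assms(1)] L2bD(2)[OF assms(2)] by (auto simp: L2b_def)
qed

lemma L1b_conv:
  assumes "L1b F A" "L1b G B"
  shows "L1b (conv F G) (A * B)"
proof -
  note [measurable] = L1bD(1)[OF assms(1)] L1bD(1)[OF assms(2)]
  have "(\<integral>\<^sup>+x. conv F G x \<partial>lborel) = (\<integral>\<^sup>+y. (\<integral>\<^sup>+x. F y * G (x - y) \<partial>lborel) \<partial>lborel)"
    unfolding conv_def by (rule lborel_pair.Fubini') simp
  also have "\<dots> = (\<integral>\<^sup>+y. F y * (\<integral>\<^sup>+x. G x \<partial>lborel) \<partial>lborel)"
    by (subst nn_integral_cmult) (auto simp: nn_integral_lborel_shift)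
  also have "\<dots> = (\<integral>\<^sup>+y. F y \<partial>lborel) * (\<integral>\<^sup>+x. G x \<partial>lborel)"
    by (rule nn_integral_multc) simp
  also have "\<dots> \<le> ennreal A * ennreal B"
    by (intro mult_mono L1bD assms) auto
  finally show ?thesis
    using L1bD(2)[OF assms(1)] L1bD(2)[OF assms(2)] by (auto simp: L1b_def ennreal_mult)
qed

section \<open>Resonances and Fourier weights\<close>

text \<open>On the plane \<open>x + y + z = 0\<close> the half sum \<open>\<rho>\<close> of the absolute values is their maximum.\<close>

definition rho :: kernel where
  "rho x y z = (\<bar>x\<bar> + \<bar>y\<bar> + \<bar>z\<bar>) / 2"

definition phase :: "real \<Rightarrow> real \<Rightarrow> real" where
  "phase \<epsilon> x = x ^ 3 - \<epsilon> * x ^ 5"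

definition resfac :: "real \<Rightarrow> real \<Rightarrow> real \<Rightarrow> real \<Rightarrow> real" where
  "resfac \<epsilon> x y z = 3 - 5 * \<epsilon> / 2 * (x\<^sup>2 + y\<^sup>2 + z\<^sup>2)"

definition Phase :: "real \<Rightarrow> real \<Rightarrow> real \<Rightarrow> real \<Rightarrow> real" where
  "Phase \<epsilon> x y z = phase \<epsilon> x + phase \<epsilon> y + phase \<epsilon> z"

lemma measurable_cis [measurable]: "cis \<in> borel_measurable borel"
  by (intro borel_measurable_continuous_onI continuous_intros)

lemma measurable_cnj [measurable]: "cnj \<in> borel_measurable borel"
  by (intro borel_measurable_continuous_onI continuous_intros)

lemma measurable_phase [measurable]: "phase \<epsilon> \<in> borel_measurable borel"
  unfolding phase_def[abs_def] by measurable

lemma phase_minus [simp]: "phase \<epsilon> (- x) = - phase \<epsilon> x"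
  by (simp add: phase_def power_minus_odd)

text \<open>On the plane x + y + z = 0 the power sums obey x^3 + y^3 + z^3 = 3xyz and x^5 + y^5 +
  z^5 = (5/2) xyz (x^2 + y^2 + z^2).\<close>

lemma Phase_eq:
  assumes "x + y + z = 0"
  shows "Phase \<epsilon> x y z = x * y * z * resfac \<epsilon> x y z"
proof -
  from assms have z: "z = - x - y" by simp
  show ?thesis
    unfolding z Phase_def phase_def resfac_def
    by (simp add: field_simps power2_eq_square power3_eq_cube eval_nat_numeral)
qed

text \<open>When x is the smallest variable, the two others have opposite signs, so their absolute
  values differ by exactly |x|.\<close>

lemma rho_max:
  assumes "x + y + z = 0" "\<bar>x\<bar> \<le> \<bar>y\<bar>" "\<bar>x\<bar> \<le> \<bar>z\<bar>"
  shows "rho x y z = max \<bar>y\<bar> \<bar>z\<bar>" "max \<bar>y\<bar> \<bar>z\<bar> = min \<bar>y\<bar> \<bar>z\<bar> + \<bar>x\<bar>"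
proof -
  from assms(1) have z: "z = - x - y" by simp
  show "rho x y z = max \<bar>y\<bar> \<bar>z\<bar>"
    using assms unfolding z rho_def by (auto simp: abs_if max_def field_simps)
  show "max \<bar>y\<bar> \<bar>z\<bar> = min \<bar>y\<bar> \<bar>z\<bar> + \<bar>x\<bar>"
    using assms unfolding z by (auto simp: abs_if max_def min_def field_simps)
qed

text \<open>Uniformity in \<epsilon>: |m| \<le> 1 together with 3|x|/2 \<le> e forces \<epsilon> e^2
  \<ge> 3/10, so m varies in e at a rate 10 \<epsilon> e \<ge> 3/e. Since m is smaller than 1/e at
  both points, they are at distance at most 2/3, and \<epsilon> has cancelled.\<close>

lemma resonant_pair_close:
  fixes \<epsilon> x e f :: real
  assumes "0 < \<epsilon>" and ef: "0 < e" "e \<le> f" and xe: "3 / 2 * \<bar>x\<bar> \<le> e"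
    and re: "e * \<bar>3 - 15 / 4 * \<epsilon> * x\<^sup>2 - 5 * \<epsilon> * e\<^sup>2\<bar> < 1"
    and rf: "f * \<bar>3 - 15 / 4 * \<epsilon> * x\<^sup>2 - 5 * \<epsilon> * f\<^sup>2\<bar> < 1"
    and r1: "\<bar>3 - 15 / 4 * \<epsilon> * x\<^sup>2 - 5 * \<epsilon> * e\<^sup>2\<bar> \<le> 1"
  shows "f - e \<le> 2 / 3"
proof -
  define m where "m = (\<lambda>e. 3 - 15 / 4 * \<epsilon> * x\<^sup>2 - 5 * \<epsilon> * e\<^sup>2)"
  have "\<bar>3 / 2 * x\<bar> \<le> \<bar>e\<bar>" using xe ef by (simp add: abs_mult)
  then have "(3 / 2 * x)\<^sup>2 \<le> e\<^sup>2" by (simp only: abs_le_square_iff)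
  then have x2: "\<epsilon> * x\<^sup>2 \<le> \<epsilon> * (4 / 9 * e\<^sup>2)"
    using assms(1) by (intro mult_left_mono) (auto simp: power2_eq_square)
  have lo: "3 / 10 \<le> \<epsilon> * e\<^sup>2"
    using r1 x2 by (simp add: abs_le_iff algebra_simps)
  have e1: "e * \<bar>m f\<bar> \<le> f * \<bar>m f\<bar>" using ef by (intro mult_right_mono) auto
  have "e * (m e - m f) \<le> e * (\<bar>m e\<bar> + \<bar>m f\<bar>)" using ef by (intro mult_left_mono) auto
  also have "\<dots> < 2" using re rf e1 by (simp add: m_def algebra_simps)
  finally have "e * (5 * \<epsilon> * (f\<^sup>2 - e\<^sup>2)) < 2" by (simp add: m_def algebra_simps)
  moreover have "e * (5 * \<epsilon> * (f\<^sup>2 - e\<^sup>2)) = 5 * \<epsilon> * e * (f + e) * (f - e)"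
    by (simp add: power2_eq_square algebra_simps)
  moreover have "5 * \<epsilon> * e * (e + e) * (f - e) \<le> 5 * \<epsilon> * e * (f + e) * (f - e)"
    using assms(1) ef by (intro mult_right_mono mult_left_mono) auto
  moreover have "10 * (3 / 10) * (f - e) \<le> 10 * (\<epsilon> * e\<^sup>2) * (f - e)"
    using lo ef by (intro mult_right_mono mult_left_mono) auto
  ultimately show ?thesis by (simp add: power2_eq_square algebra_simps)
qed

definition resonant :: "real \<Rightarrow> real \<Rightarrow> real \<Rightarrow> real \<Rightarrow> bool" where
  "resonant \<epsilon> x y z \<longleftrightarrow> 1 \<le> rho x y z \<and> rho x y z * \<bar>resfac \<epsilon> x y z\<bar> < 1"

text \<open>For fixed smallest variable x the resonance depends on y only through |y + x/2|, which
  ranges over a short interval by \<open>resonant_pair_close\<close>; undoing the absolute value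
  gives two intervals.\<close>

lemma resonant_section:
  assumes "0 < \<epsilon>"
  shows "emeasure lborel {y. \<bar>x\<bar> \<le> \<bar>y\<bar> \<and> \<bar>x\<bar> \<le> \<bar>- x - y\<bar> \<and> resonant \<epsilon> x y (- x - y)} \<le> ennreal 3"
proof -
  define P where "P y \<longleftrightarrow> \<bar>x\<bar> \<le> \<bar>y\<bar> \<and> \<bar>x\<bar> \<le> \<bar>- x - y\<bar> \<and> resonant \<epsilon> x y (- x - y)" for y
  define U where "U = {y. P y}"
  define m where "m = (\<lambda>e. 3 - 15 / 4 * \<epsilon> * x\<^sup>2 - 5 * \<epsilon> * e\<^sup>2)"
  have [measurable]: "U \<in> sets borel"
    unfolding U_def P_def resonant_def rho_def resfac_def by measurable
  \<comment> \<open>|y + x/2| is half the distance of the two large variables, and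
    \<open>resfac\<close> is a quadratic polynomial in it. The condition \<open>1 \<le> rho\<close>
    turns rho |m| < 1 into |m| \<le> 1.\<close>
  have *: "3 / 2 * \<bar>x\<bar> \<le> \<bar>y + x / 2\<bar> \<and> 0 < \<bar>y + x / 2\<bar> \<and> \<bar>y + x / 2\<bar> * \<bar>m \<bar>y + x / 2\<bar>\<bar> < 1 \<and> \<bar>m \<bar>y + x / 2\<bar>\<bar> \<le> 1"
    if "P y" for y
  proof -
    define e where "e = \<bar>y + x / 2\<bar>"
    have y: "\<bar>x\<bar> \<le> \<bar>y\<bar>" "\<bar>x\<bar> \<le> \<bar>- x - y\<bar>" and r: "1 \<le> rho x y (- x - y)"
      and rm: "rho x y (- x - y) * \<bar>resfac \<epsilon> x y (- x - y)\<bar> < 1"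
      using that by (auto simp: P_def resonant_def)
    have e: "rho x y (- x - y) = e + \<bar>x\<bar> / 2"
      using y unfolding rho_def e_def by (auto simp: abs_if field_simps split: if_splits)
    have xe: "3 / 2 * \<bar>x\<bar> \<le> e"
      using y unfolding e_def by linarith
    have m: "resfac \<epsilon> x y (- x - y) = m e"
      unfolding resfac_def m_def e_def power2_abs by (simp add: power2_eq_square field_simps)
    have "e * \<bar>m e\<bar> \<le> (e + \<bar>x\<bar> / 2) * \<bar>m e\<bar>"
      by (intro mult_right_mono) auto
    then have 1: "e * \<bar>m e\<bar> < 1" using rm m e by simp
    have "1 * \<bar>m e\<bar> \<le> (e + \<bar>x\<bar> / 2) * \<bar>m e\<bar>"
      using r e by (intro mult_right_mono) auto
    then have 2: "\<bar>m e\<bar> \<le> 1" using rm m e by simp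
    have "0 < e" using r e xe by linarith
    with 1 2 xe show ?thesis by (simp add: e_def)
  qed
  have close: "\<bar>\<bar>y + x / 2\<bar> - \<bar>y' + x / 2\<bar>\<bar> \<le> 2 / 3" if "P y" "P y'" for y y'
    using resonant_pair_close[OF assms, of "\<bar>y + x / 2\<bar>" "\<bar>y' + x / 2\<bar>" x]
      resonant_pair_close[OF assms, of "\<bar>y' + x / 2\<bar>" "\<bar>y + x / 2\<bar>" x] *[OF that(1)] *[OF that(2)]
    by (auto simp: m_def abs_if split: if_splits)
  show ?thesis
  proof (cases "U = {}")
    case True
    then show ?thesis by (simp add: U_def P_def[symmetric])
  next
    case False
    then obtain y0 where y0: "P y0" by (auto simp: U_def)
    define e where "e = \<bar>y0 + x / 2\<bar>"
    \<comment> \<open>Two intervals of length 4/3 each, in total 8/3, rounded up to 3.\<close>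
    have "U \<subseteq> {e - x / 2 - 2 / 3 .. e - x / 2 + 2 / 3} \<union> {- e - x / 2 - 2 / 3 .. - e - x / 2 + 2 / 3}"
    proof
      fix y assume "y \<in> U"
      then have "\<bar>\<bar>y + x / 2\<bar> - e\<bar> \<le> 2 / 3" using close y0 by (auto simp: U_def e_def)
      then show "y \<in> {e - x / 2 - 2 / 3 .. e - x / 2 + 2 / 3} \<union> {- e - x / 2 - 2 / 3 .. - e - x / 2 + 2 / 3}"
        by (auto simp: abs_if split: if_splits)
    qed
    then have "emeasure lborel U \<le> emeasure lborel ({e - x / 2 - 2 / 3 .. e - x / 2 + 2 / 3} \<union> {- e - x / 2 - 2 / 3 .. - e - x / 2 + 2 / 3})"
      by (intro emeasure_mono) auto
    also have "\<dots> \<le> emeasure lborel {e - x / 2 - 2 / 3 .. e - x / 2 + 2 / 3} + emeasure lborel {- e - x / 2 - 2 / 3 .. - e - x / 2 + 2 / 3}"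
      by (rule emeasure_subadditive) auto
    also have "\<dots> = ennreal (8 / 3)"
      by (simp add: ennreal_plus[symmetric] del: ennreal_plus)
    also have "\<dots> \<le> ennreal 3"
      by (rule ennreal_leI) simp
    finally show ?thesis by (simp add: U_def P_def[symmetric])
  qed
qed

section \<open>Admissible Fourier weights and the symmetrised multiplier\<close>

text \<open>Admissible Fourier weights grow monotonically and at most polynomially, in the sense that
  \<open>a(x) / x\<^sup>q\<close> decreases. All constants below depend on the weight only through \<open>q\<close>.\<close>

definition weight :: "nat \<Rightarrow> (real \<Rightarrow> real) \<Rightarrow> bool" where
  "weight q a \<longleftrightarrow> a \<in> borel_measurable borel \<and> (\<forall>x. 0 \<le> a x) \<and> (\<forall>x y. \<bar>x\<bar> \<le> \<bar>y\<bar> \<longrightarrow> a x \<le> a y) \<and>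
     (\<forall>x y. 0 < x \<longrightarrow> x \<le> y \<longrightarrow> a y * x ^ q \<le> a x * y ^ q)"

lemma weight_abs: "weight q a \<Longrightarrow> a \<bar>x\<bar> = a x"
  unfolding weight_def by (intro antisym) auto

lemma weight_growth: "weight q a \<Longrightarrow> 0 < x \<Longrightarrow> x \<le> y \<Longrightarrow> a y * x ^ q \<le> a x * y ^ q"
  by (simp add: weight_def)

lemma weight_double:
  assumes "weight q a" "\<bar>y\<bar> \<le> 2 * \<bar>x\<bar>"
  shows "a y \<le> 2 ^ q * a x"
proof (cases "x = 0")
  case True
  with assms have "y = 0" by simp
  moreover have "1 * a 0 \<le> 2 ^ q * a 0"
    using assms(1) by (intro mult_right_mono) (auto simp: weight_def)
  ultimately show ?thesis using True by simp
next
  case False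
  have "a y \<le> a (2 * \<bar>x\<bar>)"
    using assms by (auto simp: weight_def)
  moreover have "a (2 * \<bar>x\<bar>) \<le> 2 ^ q * a x"
    using weight_growth[OF assms(1), of "\<bar>x\<bar>" "2 * \<bar>x\<bar>"] False
    by (simp add: weight_abs[OF assms(1)] power_mult_distrib mult.commute)
  ultimately show ?thesis by simp
qed

lemma weight_add:
  assumes "weight q a"
  shows "a (x + y) \<le> 2 ^ q * (a x + a y)"
proof -
  have nn: "0 \<le> a x" "0 \<le> a y" using assms by (auto simp: weight_def)
  have "\<bar>x + y\<bar> \<le> 2 * \<bar>x\<bar> \<or> \<bar>x + y\<bar> \<le> 2 * \<bar>y\<bar>" by linarith
  then show ?thesis
  proof
    assume "\<bar>x + y\<bar> \<le> 2 * \<bar>x\<bar>"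
    then have "a (x + y) \<le> 2 ^ q * a x" by (rule weight_double[OF assms])
    also have "\<dots> \<le> 2 ^ q * (a x + a y)" using nn by (intro mult_left_mono) auto
    finally show ?thesis .
  next
    assume "\<bar>x + y\<bar> \<le> 2 * \<bar>y\<bar>"
    then have "a (x + y) \<le> 2 ^ q * a y" by (rule weight_double[OF assms])
    also have "\<dots> \<le> 2 ^ q * (a x + a y)" using nn by (intro mult_left_mono) auto
    finally show ?thesis .
  qed
qed

text \<open>The energy with density \<open>(a x)\<^sup>2\<close> times the squared modulus changes
  in time by a trilinear integral with multiplier \<open>x * (a x)\<^sup>2\<close>. The other two
  factors are the same function, so averaging over the three variables replaces it by a third of
  this sum.\<close>

definition symmul :: "(real \<Rightarrow> real) \<Rightarrow> real \<Rightarrow> real \<Rightarrow> real \<Rightarrow> real" where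
  "symmul a x y z = x * (a x)\<^sup>2 + y * (a y)\<^sup>2 + z * (a z)\<^sup>2"

text \<open>In the first factor, 1 + 2q comes from the two large variables
  (\<open>weight_increment\<close>) and 1 from the small one; 2^q is the doubling constant of the
  weight, used to replace a(P)^2 by a(y) a(z).\<close>

definition mulconst :: "nat \<Rightarrow> real" where
  "mulconst q = (2 + 2 * real q) * 2 ^ q"

lemma mulconst_nonneg: "0 \<le> mulconst q"
  by (simp add: mulconst_def)

text \<open>A substitute for the mean value theorem, since truncated weights have corners. The
  growth condition bounds a(M)^2 from below by a(P)^2 (M/P)^(2q), and Bernoulli's inequality makes
  the loss linear in P - M.\<close>

lemma weight_increment:
  assumes a: "weight q a" and MP: "0 \<le> M" "M \<le> P"
  shows "P * (a P)\<^sup>2 - M * (a M)\<^sup>2 \<le> (1 + 2 * real q) * (P - M) * (a P)\<^sup>2"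
proof (cases "M = 0")
  case True
  have "1 * (P * (a P)\<^sup>2) \<le> (1 + 2 * real q) * (P * (a P)\<^sup>2)"
    using MP by (intro mult_right_mono) auto
  then show ?thesis using True by (simp add: mult_ac)
next
  case False
  have M: "0 < M" "0 < P" using False MP by auto
  have 1: "(1 - M / P) * (2 * real q) \<ge> 1 - (M / P) ^ (2 * q)"
    using Bernoulli_inequality[of "M / P - 1" "2 * q"] M MP by (simp add: algebra_simps)
  have "a P * M ^ q \<le> a M * P ^ q" using a M MP by (auto simp: weight_def)
  then have "(a P * M ^ q)\<^sup>2 \<le> (a M * P ^ q)\<^sup>2"
    using a M by (intro power_mono) (auto simp: weight_def)
  then have "(a P)\<^sup>2 * (M / P) ^ (2 * q) \<le> (a M)\<^sup>2"
    using M by (simp add: power_mult_distrib power_divide field_simps power_mult[symmetric] mult.commute)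
  then have "(a P)\<^sup>2 - (a M)\<^sup>2 \<le> (a P)\<^sup>2 * (1 - (M / P) ^ (2 * q))"
    by (simp add: algebra_simps)
  also have "\<dots> \<le> (a P)\<^sup>2 * ((1 - M / P) * (2 * real q))"
    using 1 by (intro mult_left_mono) auto
  finally have "M * ((a P)\<^sup>2 - (a M)\<^sup>2) \<le> M * ((a P)\<^sup>2 * ((1 - M / P) * (2 * real q)))"
    using M by (intro mult_left_mono) auto
  also have "\<dots> = (M / P) * ((P - M) * (2 * real q) * (a P)\<^sup>2)"
    using M by (simp add: field_simps)
  also have "\<dots> \<le> 1 * ((P - M) * (2 * real q) * (a P)\<^sup>2)"
    using M MP by (intro mult_right_mono mult_nonneg_nonneg) auto
  finally show ?thesis by (simp add: algebra_simps)
qed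

text \<open>The two large variables have opposite signs, so their terms cancel up to an increment of
  length |x|: the derivative falls on the smallest frequency.\<close>

lemma symmul_min_bound:
  assumes a: "weight q a" and xyz: "x + y + z = 0" "\<bar>x\<bar> \<le> \<bar>y\<bar>" "\<bar>x\<bar> \<le> \<bar>z\<bar>"
  shows "\<bar>symmul a x y z\<bar> \<le> mulconst q * (\<bar>x\<bar> * (a y * a z))"
proof -
  define P M where "P = max \<bar>y\<bar> \<bar>z\<bar>" and "M = min \<bar>y\<bar> \<bar>z\<bar>"
  have PM: "P = M + \<bar>x\<bar>" "0 \<le> M" "M \<le> P" "\<bar>x\<bar> \<le> M" using rho_max[OF xyz] xyz by (auto simp: P_def M_def)
  have opp: "y * z \<le> 0"
  proof (rule ccontr)
    assume "\<not> y * z \<le> 0"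
    then have "0 < y \<and> 0 < z \<or> y < 0 \<and> z < 0" by (simp add: not_le zero_less_mult_iff)
    then show False using xyz by auto
  qed
  have ay: "a \<bar>y\<bar> = a y" "a \<bar>z\<bar> = a z" by (rule weight_abs[OF a])+
  have eq: "\<bar>y * (a y)\<^sup>2 + z * (a z)\<^sup>2\<bar> = \<bar>P * (a P)\<^sup>2 - M * (a M)\<^sup>2\<bar>"
    using opp ay by (auto simp: P_def M_def max_def min_def abs_if mult_le_0_iff split: if_splits)
  have nn: "0 \<le> a t" for t using a by (auto simp: weight_def)
  have mono: "a s \<le> a t" if "\<bar>s\<bar> \<le> \<bar>t\<bar>" for s t using a that by (auto simp: weight_def)
  have "M * (a M)\<^sup>2 \<le> P * (a P)\<^sup>2"
    using PM nn mono[of M P] by (intro mult_mono power_mono) auto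
  then have 1: "\<bar>y * (a y)\<^sup>2 + z * (a z)\<^sup>2\<bar> \<le> (1 + 2 * real q) * \<bar>x\<bar> * (a P)\<^sup>2"
    using weight_increment[OF a PM(2,3)] PM(1) unfolding eq by simp
  have "(a x)\<^sup>2 \<le> (a P)\<^sup>2"
    using PM nn mono[of x P] by (intro power_mono) auto
  then have "\<bar>x * (a x)\<^sup>2\<bar> \<le> \<bar>x\<bar> * (a P)\<^sup>2"
    by (simp add: abs_mult mult_left_mono)
  with 1 have "\<bar>symmul a x y z\<bar> \<le> (2 + 2 * real q) * (\<bar>x\<bar> * (a P)\<^sup>2)"
    using abs_triangle_ineq[of "x * (a x)\<^sup>2" "y * (a y)\<^sup>2 + z * (a z)\<^sup>2"]
    unfolding symmul_def by (simp add: add.assoc distrib_right)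
  also have "(a P)\<^sup>2 \<le> 2 ^ q * (a y * a z)"
  proof -
    have "a P \<le> 2 ^ q * a M" using PM by (intro weight_double[OF a]) auto
    then have "a P * a P \<le> a P * (2 ^ q * a M)" using nn by (intro mult_left_mono) auto
    moreover have "a P * a M = a y * a z" using ay by (auto simp: P_def M_def max_def min_def)
    moreover have "a P * (2 ^ q * a M) = 2 ^ q * (a P * a M)" by simp
    ultimately show ?thesis by (simp add: power2_eq_square)
  qed
  then have "(2 + 2 * real q) * (\<bar>x\<bar> * (a P)\<^sup>2) \<le> (2 + 2 * real q) * (\<bar>x\<bar> * (2 ^ q * (a y * a z)))"
    by (intro mult_left_mono) auto
  finally show ?thesis by (simp add: mulconst_def mult_ac)
qed

text \<open>Both large variables are at least rho/2, so |Phase| \<ge> |x| (rho^2/2) / rho = |x| rho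
  / 2. The factor |x| cancels against \<open>symmul_min_bound\<close> and a full power of rho is
  gained. The second conclusion deals with quotients by 0: there x = 0, and the multiplier vanishes
  as well.\<close>

lemma symmul_quot_min_bound:
  assumes a: "weight q a" and xyz: "x + y + z = 0" "\<bar>x\<bar> \<le> \<bar>y\<bar>" "\<bar>x\<bar> \<le> \<bar>z\<bar>"
    and nr: "1 \<le> rho x y z * \<bar>resfac \<epsilon> x y z\<bar>"
  shows "\<bar>symmul a x y z / Phase \<epsilon> x y z\<bar> * rho x y z \<le> 2 * mulconst q * (a y * a z)"
    "Phase \<epsilon> x y z = 0 \<Longrightarrow> symmul a x y z = 0"
proof -
  define r where "r = rho x y z"
  have nn: "0 \<le> a t" for t using a by (auto simp: weight_def)
  have "0 \<le> r" "r \<noteq> 0" using nr by (simp add: r_def rho_def, auto simp: r_def)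
  then have r0: "0 < r" by simp
  have b1: "r = max \<bar>y\<bar> \<bar>z\<bar>" using rho_max(1)[OF xyz] by (simp only: r_def)
  have "\<bar>x\<bar> \<le> min \<bar>y\<bar> \<bar>z\<bar>" using xyz by simp
  then have b2: "r / 2 \<le> min \<bar>y\<bar> \<bar>z\<bar>" using b1 rho_max(2)[OF xyz] by linarith
  have "r * (r / 2) \<le> max \<bar>y\<bar> \<bar>z\<bar> * min \<bar>y\<bar> \<bar>z\<bar>"
    using r0 by (intro mult_mono b2) (simp_all add: b1[symmetric])
  also have "\<dots> = \<bar>y\<bar> * \<bar>z\<bar>" by (auto simp: max_def min_def)
  finally have yz: "r * r / 2 \<le> \<bar>y\<bar> * \<bar>z\<bar>" by simp
  have "\<bar>x\<bar> * (r * r / 2) * (1 / r) \<le> \<bar>x\<bar> * (\<bar>y\<bar> * \<bar>z\<bar>) * \<bar>resfac \<epsilon> x y z\<bar>"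
    using yz nr r0 by (intro mult_mono) (auto simp: r_def field_simps)
  also have "\<dots> = \<bar>Phase \<epsilon> x y z\<bar>" by (simp add: Phase_eq[OF xyz(1)] abs_mult)
  finally have lo: "\<bar>x\<bar> * r / 2 \<le> \<bar>Phase \<epsilon> x y z\<bar>" using r0 by simp
  have up: "\<bar>symmul a x y z\<bar> \<le> mulconst q * (\<bar>x\<bar> * (a y * a z))"
    by (rule symmul_min_bound[OF a xyz])
  show "symmul a x y z = 0" if "Phase \<epsilon> x y z = 0"
  proof -
    have "x = 0" using lo that r0 by (simp add: mult_le_0_iff)
    then show ?thesis using up by simp
  qed
  show "\<bar>symmul a x y z / Phase \<epsilon> x y z\<bar> * rho x y z \<le> 2 * mulconst q * (a y * a z)"
  proof (cases "Phase \<epsilon> x y z = 0")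
    case True
    then show ?thesis using nn mulconst_nonneg by simp
  next
    case False
    have "\<bar>symmul a x y z\<bar> * r \<le> mulconst q * (\<bar>x\<bar> * (a y * a z)) * r"
      using up r0 by (intro mult_right_mono) auto
    also have "\<dots> = 2 * mulconst q * (a y * a z) * (\<bar>x\<bar> * r / 2)" by simp
    also have "\<dots> \<le> 2 * mulconst q * (a y * a z) * \<bar>Phase \<epsilon> x y z\<bar>"
      using lo nn mulconst_nonneg by (intro mult_left_mono) auto
    finally show ?thesis using False by (simp add: r_def[symmetric] field_simps abs_divide)
  qed
qed

section \<open>Oscillatory integrals in time\<close>

lemma trint_pair:
  assumes "trimeas H"
  shows "trint H = (\<integral>\<^sup>+p. H (fst p) (snd p) (- fst p - snd p) \<partial>lborel2)"
proof -
  have [measurable]: "(\<lambda>p. H (fst p) (snd p) (- fst p - snd p)) \<in> borel_measurable lborel2"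
    by (rule trimeas_compose[OF assms]) measurable
  show ?thesis
    unfolding trint_def by (subst lborel.nn_integral_fst[symmetric]) auto
qed

text \<open>Differentiability in time is pointwise in the frequency rather than in a function space,
  so that at each fixed frequency the calculus of one real variable applies.\<close>

definition curve :: "evolution \<Rightarrow> evolution \<Rightarrow> bool" where
  "curve F D \<longleftrightarrow> (\<forall>\<tau>. F \<tau> \<in> borel_measurable borel) \<and> (\<forall>\<tau>. D \<tau> \<in> borel_measurable borel) \<and>
     (\<forall>\<tau> \<xi>. ((\<lambda>\<tau>. F \<tau> \<xi>) has_vector_derivative D \<tau> \<xi>) (at \<tau>)) \<and>
     (\<forall>\<xi>. continuous_on UNIV (\<lambda>\<tau>. D \<tau> \<xi>))"

lemma curveD:
  assumes "curve F D"
  shows "F \<tau> \<in> borel_measurable borel" "D \<tau> \<in> borel_measurable borel"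
    "((\<lambda>\<tau>. F \<tau> \<xi>) has_vector_derivative D \<tau> \<xi>) (at \<tau>)"
    "continuous_on UNIV (\<lambda>\<tau>. D \<tau> \<xi>)" "continuous_on UNIV (\<lambda>\<tau>. F \<tau> \<xi>)"
proof -
  show 3: "((\<lambda>\<tau>. F \<tau> \<xi>) has_vector_derivative D \<tau> \<xi>) (at \<tau>)" for \<tau>
    using assms by (auto simp: curve_def)
  show "continuous_on UNIV (\<lambda>\<tau>. F \<tau> \<xi>)"
    using 3 by (auto intro!: continuous_at_imp_continuous_on has_vector_derivative_continuous)
qed (use assms in \<open>auto simp: curve_def\<close>)

text \<open>Rounding the time down to a multiple of 1/(n+1) leaves countably many slices, each
  measurable; continuity in time gives the pointwise limit. Joint measurability is what Fubini
  requires.\<close>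

lemma caratheodory_measurable:
  fixes F :: evolution
  assumes [measurable]: "\<And>\<tau>. F \<tau> \<in> borel_measurable borel"
    and cont: "\<And>\<xi>. continuous_on UNIV (\<lambda>\<tau>. F \<tau> \<xi>)"
  shows "(\<lambda>p. F (fst p) (snd p)) \<in> borel_measurable (borel \<Otimes>\<^sub>M borel)"
proof (rule borel_measurable_LIMSEQ_metric)
  fix n :: nat
  show "(\<lambda>p. F (real_of_int \<lfloor>real (Suc n) * fst p\<rfloor> / real (Suc n)) (snd p)) \<in> borel_measurable (borel \<Otimes>\<^sub>M borel)"
    by (rule measurable_compose_countable[where g = "\<lambda>p. \<lfloor>real (Suc n) * fst p\<rfloor>" and f = "\<lambda>k p. F (real_of_int k / real (Suc n)) (snd p)"])
      measurable
next
  fix p :: "real \<times> real"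
  have "(\<lambda>n. real_of_int \<lfloor>real (Suc n) * fst p\<rfloor> / real (Suc n)) \<longlonglongrightarrow> fst p"
  proof (rule real_tendsto_sandwich)
    show "eventually (\<lambda>n. fst p - 1 / real (Suc n) \<le> real_of_int \<lfloor>real (Suc n) * fst p\<rfloor> / real (Suc n)) sequentially"
    proof (intro always_eventually allI)
      fix n
      have "real (Suc n) * fst p - 1 \<le> real_of_int \<lfloor>real (Suc n) * fst p\<rfloor>" by linarith
      then have "(real (Suc n) * fst p - 1) / real (Suc n) \<le> real_of_int \<lfloor>real (Suc n) * fst p\<rfloor> / real (Suc n)"
        by (intro divide_right_mono) auto
      then show "fst p - 1 / real (Suc n) \<le> real_of_int \<lfloor>real (Suc n) * fst p\<rfloor> / real (Suc n)"
        by (simp add: diff_divide_distrib)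
    qed
    show "eventually (\<lambda>n. real_of_int \<lfloor>real (Suc n) * fst p\<rfloor> / real (Suc n) \<le> fst p) sequentially"
      by (intro always_eventually allI) (simp add: divide_le_eq mult.commute)
    have "(\<lambda>n. 1 / real (Suc n)) \<longlonglongrightarrow> 0" by (rule LIMSEQ_Suc[OF lim_1_over_n])
    then show "(\<lambda>n. fst p - 1 / real (Suc n)) \<longlonglongrightarrow> fst p"
      using tendsto_diff[OF tendsto_const[of "fst p"], of "\<lambda>n. 1 / real (Suc n)" 0 sequentially] by simp
  qed simp
  then show "(\<lambda>n. F (real_of_int \<lfloor>real (Suc n) * fst p\<rfloor> / real (Suc n)) (snd p)) \<longlonglongrightarrow> F (fst p) (snd p)"
    using cont[of "snd p"] by (intro continuous_on_tendsto_compose[OF cont[of "snd p"]]) auto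
qed

lemma caratheodory_compose:
  assumes "(\<lambda>p. F (fst p) (snd p)) \<in> borel_measurable (borel \<Otimes>\<^sub>M borel)"
    "f \<in> borel_measurable M" "g \<in> borel_measurable M"
  shows "(\<lambda>x. (F :: real \<Rightarrow> real \<Rightarrow> complex) (f x) (g x)) \<in> borel_measurable M"
proof -
  have "(\<lambda>x. (f x, g x)) \<in> measurable M (borel \<Otimes>\<^sub>M borel)" using assms by simp
  from measurable_compose[OF this assms(1)] show ?thesis by simp
qed

lemma curve_measurable:
  assumes "curve F D" "f \<in> borel_measurable M" "g \<in> borel_measurable M"
  shows "(\<lambda>x. F (f x) (g x)) \<in> borel_measurable M" "(\<lambda>x. D (f x) (g x)) \<in> borel_measurable M"
  using caratheodory_compose[OF caratheodory_measurable assms(2,3), of F]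
    caratheodory_compose[OF caratheodory_measurable assms(2,3), of D] curveD[OF assms(1)] by blast+

text \<open>The oscillating factor is the derivative of itself divided by i \<Omega>. Division by 0
  yields 0, so where \<Omega> vanishes the bound is valid only because \<mu> is assumed to vanish
  there too.\<close>

lemma oscillatory_ibp:
  fixes G G' :: "real \<Rightarrow> complex" and \<mu> \<Omega> t :: real
  assumes t: "0 \<le> t" and G: "\<And>\<tau>. (G has_vector_derivative G' \<tau>) (at \<tau>)" "continuous_on UNIV G'"
    and 0: "\<Omega> = 0 \<Longrightarrow> \<mu> = 0"
  shows "ennreal (cmod (LINT \<tau>|lborel. indicator {0..t} \<tau> *\<^sub>R (complex_of_real \<mu> * cis (\<tau> * \<Omega>) * G \<tau>)))
    \<le> ennreal \<bar>\<mu> / \<Omega>\<bar> * (ennreal (cmod (G t)) + ennreal (cmod (G 0))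
        + (\<integral>\<^sup>+\<tau>. indicator {0..t} \<tau> * ennreal (cmod (G' \<tau>)) \<partial>lborel))"
proof (cases "\<Omega> = 0")
  case True
  with 0 show ?thesis by simp
next
  case False
  have contG: "continuous_on UNIV G"
    using G(1) by (auto intro: continuous_at_imp_continuous_on has_vector_derivative_continuous)
  define H where "H = (\<lambda>\<tau>. cis (\<tau> * \<Omega>) * G \<tau>)"
  define h1 where "h1 = (\<lambda>\<tau>. \<i> * complex_of_real \<Omega> * (cis (\<tau> * \<Omega>) * G \<tau>))"
  define h2 where "h2 = (\<lambda>\<tau>. cis (\<tau> * \<Omega>) * G' \<tau>)"
  have dcis: "((\<lambda>\<tau>. cis (\<tau> * \<Omega>)) has_vector_derivative (\<i> * complex_of_real \<Omega> * cis (\<tau> * \<Omega>))) (at \<tau>)" for \<tau>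
    unfolding cis_conv_exp by (auto intro!: derivative_eq_intros has_vector_derivative_real_field)
  have dH: "(H has_vector_derivative (h1 \<tau> + h2 \<tau>)) (at \<tau>)" for \<tau>
    unfolding H_def h1_def h2_def
    by (rule has_vector_derivative_eq_rhs[OF has_vector_derivative_mult[OF dcis G(1)]]) (simp add: algebra_simps)
  have c1: "continuous_on UNIV h1" "continuous_on UNIV h2"
    unfolding h1_def h2_def using contG G(2) by (auto intro!: continuous_intros)
  have i1: "integrable lborel (\<lambda>\<tau>. indicator {0..t} \<tau> *\<^sub>R h1 \<tau>)" "integrable lborel (\<lambda>\<tau>. indicator {0..t} \<tau> *\<^sub>R h2 \<tau>)"
    using borel_integrable_atLeastAtMost'[OF continuous_on_subset[OF c1(1) subset_UNIV], of 0 t]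
      borel_integrable_atLeastAtMost'[OF continuous_on_subset[OF c1(2) subset_UNIV], of 0 t]
    unfolding set_integrable_def .
  have "(LINT \<tau>|lborel. indicator {0..t} \<tau> *\<^sub>R (h1 \<tau> + h2 \<tau>)) = H t - H 0"
    by (rule integral_FTC_atLeastAtMost[OF t has_vector_derivative_at_within[OF dH]
          continuous_on_subset[OF continuous_on_add[OF c1] subset_UNIV]])
  then have e: "(LINT \<tau>|lborel. indicator {0..t} \<tau> *\<^sub>R h1 \<tau>) = H t - H 0 - (LINT \<tau>|lborel. indicator {0..t} \<tau> *\<^sub>R h2 \<tau>)"
    using i1 by (simp add: scaleR_add_right eq_diff_eq)
  have "(LINT \<tau>|lborel. indicator {0..t} \<tau> *\<^sub>R (complex_of_real \<mu> * cis (\<tau> * \<Omega>) * G \<tau>))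
      = (LINT \<tau>|lborel. (complex_of_real \<mu> / (\<i> * complex_of_real \<Omega>)) * (indicator {0..t} \<tau> *\<^sub>R h1 \<tau>))"
    using False by (intro Bochner_Integration.integral_cong) (auto simp: h1_def)
  also have "\<dots> = (complex_of_real \<mu> / (\<i> * complex_of_real \<Omega>)) * (H t - H 0 - (LINT \<tau>|lborel. indicator {0..t} \<tau> *\<^sub>R h2 \<tau>))"
    unfolding e[symmetric] by (rule Bochner_Integration.integral_mult_right) (use i1 in auto)
  finally have "cmod (LINT \<tau>|lborel. indicator {0..t} \<tau> *\<^sub>R (complex_of_real \<mu> * cis (\<tau> * \<Omega>) * G \<tau>))
      = \<bar>\<mu> / \<Omega>\<bar> * cmod (H t - H 0 - (LINT \<tau>|lborel. indicator {0..t} \<tau> *\<^sub>R h2 \<tau>))"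
    by (simp add: norm_mult norm_divide abs_divide)
  also have "\<dots> \<le> \<bar>\<mu> / \<Omega>\<bar> * (cmod (G t) + cmod (G 0) + cmod (LINT \<tau>|lborel. indicator {0..t} \<tau> *\<^sub>R h2 \<tau>))"
  proof (intro mult_left_mono)
    have "cmod (H \<tau>) = cmod (G \<tau>)" for \<tau> by (simp add: H_def norm_mult)
    then show "cmod (H t - H 0 - (LINT \<tau>|lborel. indicator {0..t} \<tau> *\<^sub>R h2 \<tau>))
        \<le> cmod (G t) + cmod (G 0) + cmod (LINT \<tau>|lborel. indicator {0..t} \<tau> *\<^sub>R h2 \<tau>)"
      using norm_triangle_ineq4[of "H t - H 0" "LINT \<tau>|lborel. indicator {0..t} \<tau> *\<^sub>R h2 \<tau>"]
        norm_triangle_ineq4[of "H t" "H 0"] by simp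
  qed simp
  finally have "ennreal (cmod (LINT \<tau>|lborel. indicator {0..t} \<tau> *\<^sub>R (complex_of_real \<mu> * cis (\<tau> * \<Omega>) * G \<tau>)))
    \<le> ennreal \<bar>\<mu> / \<Omega>\<bar> * (ennreal (cmod (G t)) + ennreal (cmod (G 0)) + ennreal (cmod (LINT \<tau>|lborel. indicator {0..t} \<tau> *\<^sub>R h2 \<tau>)))"
    by (simp add: ennreal_mult[symmetric] ennreal_plus[symmetric] ennreal_leI del: ennreal_plus)
  also have "ennreal (cmod (LINT \<tau>|lborel. indicator {0..t} \<tau> *\<^sub>R h2 \<tau>)) \<le> (\<integral>\<^sup>+\<tau>. ennreal (norm (indicator {0..t} \<tau> *\<^sub>R h2 \<tau>)) \<partial>lborel)"
    by (rule integral_norm_bound_ennreal) (rule i1)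
  also have "\<dots> = (\<integral>\<^sup>+\<tau>. indicator {0..t} \<tau> * ennreal (cmod (G' \<tau>)) \<partial>lborel)"
    by (intro nn_integral_cong) (auto simp: h2_def norm_mult indicator_def)
  finally show ?thesis by (simp add: add_left_mono mult_left_mono)
qed

definition oscil :: "kernel \<Rightarrow> kernel \<Rightarrow>
    evolution \<Rightarrow> evolution \<Rightarrow> evolution \<Rightarrow>
    real \<Rightarrow> real \<times> real \<Rightarrow> complex" where
  "oscil \<mu> \<Omega> F1 F2 F3 \<tau> p = complex_of_real (\<mu> (fst p) (snd p) (- fst p - snd p))
     * cis (\<tau> * \<Omega> (fst p) (snd p) (- fst p - snd p))
     * (F1 \<tau> (fst p) * F2 \<tau> (snd p) * F3 \<tau> (- fst p - snd p))"

lemma trimeas_of_real: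
  assumes "measurable3 \<mu>"
    "f \<in> borel_measurable M" "g \<in> borel_measurable M" "h \<in> borel_measurable M"
  shows "(\<lambda>p. \<mu> (f p) (g p) (h p) :: real) \<in> borel_measurable M"
proof -
  have "(\<lambda>x. (f x, g x, h x)) \<in> measurable M borel3" using assms by simp
  from measurable_compose[OF this assms(1)] show ?thesis by simp
qed

abbreviation nrm :: "evolution \<Rightarrow> real \<Rightarrow> real \<Rightarrow> ennreal" where
  "nrm F \<tau> x \<equiv> ennreal (cmod (F \<tau> x))"

abbreviation nrm3 :: "evolution \<Rightarrow> evolution \<Rightarrow> evolution \<Rightarrow> real \<Rightarrow> real \<Rightarrow> real \<Rightarrow> real \<Rightarrow> ennreal" where
  "nrm3 F G H \<tau> x y z \<equiv> nrm F \<tau> x * nrm G \<tau> y * nrm H \<tau> z"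

abbreviation dnrm3 :: "evolution \<Rightarrow> evolution \<Rightarrow> evolution \<Rightarrow> evolution \<Rightarrow> evolution \<Rightarrow> evolution \<Rightarrow>
    real \<Rightarrow> real \<Rightarrow> real \<Rightarrow> real \<Rightarrow> ennreal" where
  "dnrm3 F DF G DG H DH \<tau> x y z \<equiv> nrm3 DF G H \<tau> x y z + nrm3 F DG H \<tau> x y z + nrm3 F G DH \<tau> x y z"

abbreviation osc_int :: "real \<Rightarrow> kernel \<Rightarrow> kernel \<Rightarrow>
    evolution \<Rightarrow> evolution \<Rightarrow> evolution \<Rightarrow> complex" where
  "osc_int t \<mu> \<Omega> F G H \<equiv> (LINT \<tau>|lborel. indicator {0..t} \<tau> *\<^sub>R (LINT p|lborel2. oscil \<mu> \<Omega> F G H \<tau> p))"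

text \<open>\<open>P\<close> marks the set on which one integrates by parts in time; off
  \<open>P\<close> absolute values suffice. \<open>c1\<close> bounds the integrand off
  \<open>P\<close>, \<open>c2\<close> the boundary term at each of the two ends, and
  \<open>c3\<close> the terms in which one of the three factors is differentiated in time.\<close>

theorem oscillatory_bound:
  fixes \<mu> \<Omega> :: kernel
  assumes t: "0 \<le> t" and curves: "curve F1 D1" "curve F2 D2" "curve F3 D3"
    and m\<mu>: "measurable3 \<mu>"
    and m\<Omega>: "measurable3 \<Omega>"
    and mP: "Measurable.pred borel3 (\<lambda>(x, y, z). P x y z)"
    and P0: "\<And>x y z. x + y + z = 0 \<Longrightarrow> P x y z \<Longrightarrow> \<Omega> x y z = 0 \<Longrightarrow> \<mu> x y z = 0"
    and int: "integrable (lborel \<Otimes>\<^sub>M lborel2) (\<lambda>(\<tau>, p). indicator {0..t} \<tau> *\<^sub>R oscil \<mu> \<Omega> F1 F2 F3 \<tau> p)"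
    and b1: "\<And>\<tau>. 0 \<le> \<tau> \<Longrightarrow> \<tau> \<le> t \<Longrightarrow>
      trint (\<lambda>x y z. of_bool (\<not> P x y z) * ennreal \<bar>\<mu> x y z\<bar> * (nrm3 F1 F2 F3 \<tau> x y z)) \<le> ennreal c1"
    and b2: "\<And>\<tau>. 0 \<le> \<tau> \<Longrightarrow> \<tau> \<le> t \<Longrightarrow>
      trint (\<lambda>x y z. of_bool (P x y z) * ennreal \<bar>\<mu> x y z / \<Omega> x y z\<bar> * (nrm3 F1 F2 F3 \<tau> x y z)) \<le> ennreal c2"
    and b3: "\<And>\<tau>. 0 \<le> \<tau> \<Longrightarrow> \<tau> \<le> t \<Longrightarrow>
      trint (\<lambda>x y z. of_bool (P x y z) * ennreal \<bar>\<mu> x y z / \<Omega> x y z\<bar> *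
        (dnrm3 F1 D1 F2 D2 F3 D3 \<tau> x y z)) \<le> ennreal c3"
    and c: "0 \<le> c1" "0 \<le> c2" "0 \<le> c3"
  shows "cmod (osc_int t \<mu> \<Omega> F1 F2 F3)
    \<le> t * c1 + 2 * c2 + t * c3"
proof -
  interpret pair_sigma_finite lborel "lborel \<Otimes>\<^sub>M lborel :: (real \<times> real) measure"
    by (intro pair_sigma_finite.intro lborel.sigma_finite_measure_axioms sigma_finite_pair_measure)
  define z where "z p = - fst p - snd p" for p :: "real \<times> real"
  have [measurable]: "z \<in> borel_measurable lborel2" unfolding z_def by measurable
  define G where "G p \<tau> = F1 \<tau> (fst p) * F2 \<tau> (snd p) * F3 \<tau> (z p)" for p \<tau>
  define G' where "G' p \<tau> = D1 \<tau> (fst p) * F2 \<tau> (snd p) * F3 \<tau> (z p) + F1 \<tau> (fst p) * D2 \<tau> (snd p) * F3 \<tau> (z p)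
     + F1 \<tau> (fst p) * F2 \<tau> (snd p) * D3 \<tau> (z p)" for p \<tau>
  define H where "H \<tau> p = nrm D1 \<tau> (fst p) * nrm F2 \<tau> (snd p) * nrm F3 \<tau> (z p) + nrm3 F1 D2 F3 \<tau> (fst p) (snd p) (z p)
     + nrm3 F1 F2 D3 \<tau> (fst p) (snd p) (z p)" for p \<tau>
  define N where "N \<tau> p = nrm F1 \<tau> (fst p) * nrm F2 \<tau> (snd p) * nrm F3 \<tau> (z p)" for p \<tau>
  define m where "m p = \<mu> (fst p) (snd p) (z p)" for p
  define w where "w p = \<Omega> (fst p) (snd p) (z p)" for p
  define Q where "Q p = P (fst p) (snd p) (z p)" for p
  have [measurable]: "m \<in> borel_measurable lborel2" "w \<in> borel_measurable lborel2"
    unfolding m_def[abs_def] w_def[abs_def] by (auto intro!: trimeas_of_real[OF m\<mu>] trimeas_of_real[OF m\<Omega>])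
  have [measurable]: "Measurable.pred lborel2 Q"
  proof -
    have "(\<lambda>p. (fst p, snd p, z p)) \<in> measurable lborel2 borel3" by measurable
    from measurable_compose[OF this mP] show ?thesis by (simp add: Q_def[abs_def])
  qed
  have [measurable]: "(\<lambda>x. F1 (f x) (g x)) \<in> borel_measurable M" "(\<lambda>x. D1 (f x) (g x)) \<in> borel_measurable M"
    "(\<lambda>x. F2 (f x) (g x)) \<in> borel_measurable M" "(\<lambda>x. D2 (f x) (g x)) \<in> borel_measurable M"
    "(\<lambda>x. F3 (f x) (g x)) \<in> borel_measurable M" "(\<lambda>x. D3 (f x) (g x)) \<in> borel_measurable M"
    if "f \<in> borel_measurable M" "g \<in> borel_measurable M" for f g and M :: "'z measure"
    by (rule curve_measurable[OF curves(1) that] curve_measurable[OF curves(2) that] curve_measurable[OF curves(3) that])+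
  have mN[measurable]: "(\<lambda>x. N (f x) (g x)) \<in> borel_measurable M"  "(\<lambda>x. H (f x) (g x)) \<in> borel_measurable M"
     if [measurable]: "f \<in> borel_measurable M" "g \<in> measurable M lborel2" for f g and M :: "'z measure"
  proof -
    have [measurable]: "(\<lambda>x. fst (g x)) \<in> borel_measurable M" "(\<lambda>x. snd (g x)) \<in> borel_measurable M"
      using measurable_compose[OF that(2) measurable_fst] measurable_compose[OF that(2) measurable_snd] by simp_all
    show "(\<lambda>x. N (f x) (g x)) \<in> borel_measurable M" "(\<lambda>x. H (f x) (g x)) \<in> borel_measurable M"
      unfolding N_def H_def z_def by measurable
  qed
  have mN'[measurable]: "(\<lambda>\<tau>. N \<tau> p) \<in> borel_measurable borel" "(\<lambda>\<tau>. H \<tau> p) \<in> borel_measurable borel" for p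
    by (rule mN[of "\<lambda>\<tau>. \<tau>" borel "\<lambda>_. p"]; simp add: space_pair_measure)+
  have [measurable]: "(\<lambda>p. of_bool (Q p) :: ennreal) \<in> borel_measurable lborel2" "(\<lambda>p. of_bool (\<not> Q p) :: ennreal) \<in> borel_measurable lborel2"
    unfolding of_bool_def by measurable
  define a1 a2 a3 where "a1 \<tau> p = of_bool (\<not> Q p) * ennreal \<bar>m p\<bar> * N \<tau> p"
    and "a2 \<tau> p = of_bool (Q p) * ennreal \<bar>m p / w p\<bar> * N \<tau> p"
    and "a3 \<tau> p = of_bool (Q p) * ennreal \<bar>m p / w p\<bar> * H \<tau> p" for \<tau> p
  have am: "(\<lambda>x. a1 (f x) (g x)) \<in> borel_measurable M" "(\<lambda>x. a2 (f x) (g x)) \<in> borel_measurable M"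
      "(\<lambda>x. a3 (f x) (g x)) \<in> borel_measurable M"
     if [measurable]: "f \<in> borel_measurable M" "g \<in> measurable M lborel2" for f g and M :: "'z measure"
    unfolding a1_def a2_def a3_def by measurable
  note [measurable] = am
  have [measurable]: "a1 \<tau> \<in> borel_measurable lborel2" "a2 \<tau> \<in> borel_measurable lborel2" "a3 \<tau> \<in> borel_measurable lborel2" for \<tau>
    unfolding a1_def a2_def a3_def by measurable
  have tri: "(\<integral>\<^sup>+p. a1 \<tau> p \<partial>lborel2) \<le> ennreal c1" "(\<integral>\<^sup>+p. a2 \<tau> p \<partial>lborel2) \<le> ennreal c2"
    "(\<integral>\<^sup>+p. a3 \<tau> p \<partial>lborel2) \<le> ennreal c3" if \<tau>: "0 \<le> \<tau>" "\<tau> \<le> t" for \<tau>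
  proof -
    note [measurable] = m\<mu> m\<Omega> mP
    have [measurable]: "(\<lambda>x. of_bool (P (fst x) (fst (snd x)) (snd (snd x))) :: ennreal) \<in> borel_measurable borel3"
      "(\<lambda>x. of_bool (\<not> P (fst x) (fst (snd x)) (snd (snd x))) :: ennreal) \<in> borel_measurable borel3"
      unfolding of_bool_def using mP by (simp_all add: split_beta')
    have [measurable]: "(\<lambda>x. \<mu> (fst x) (fst (snd x)) (snd (snd x))) \<in> borel_measurable borel3"
     "(\<lambda>x. \<Omega> (fst x) (fst (snd x)) (snd (snd x))) \<in> borel_measurable borel3"
      using m\<mu> m\<Omega> by (simp_all add: split_beta')
    show "(\<integral>\<^sup>+p. a1 \<tau> p \<partial>lborel2) \<le> ennreal c1"
      using b1[OF \<tau>] by (subst (asm) trint_pair) (auto simp: split_beta' a1_def Q_def m_def N_def z_def)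
    show "(\<integral>\<^sup>+p. a2 \<tau> p \<partial>lborel2) \<le> ennreal c2"
      using b2[OF \<tau>] by (subst (asm) trint_pair) (auto simp: split_beta' a2_def Q_def m_def N_def w_def z_def)
    show "(\<integral>\<^sup>+p. a3 \<tau> p \<partial>lborel2) \<le> ennreal c3"
      using b3[OF \<tau>] by (subst (asm) trint_pair) (auto simp: split_beta' a3_def Q_def m_def H_def w_def z_def)
  qed
  \<comment> \<open>Bounds on the plane at each time become bounds for the integral over the plane
    of the integral over time, at the cost of the factor t.\<close>
  have fub: "(\<integral>\<^sup>+p. (\<integral>\<^sup>+\<tau>. indicator {0..t} \<tau> * f \<tau> p \<partial>lborel) \<partial>lborel2) \<le> ennreal (t * c)"
    if [measurable]: "(\<lambda>q. f (fst q) (snd q)) \<in> borel_measurable (lborel \<Otimes>\<^sub>M lborel2)" "\<And>\<tau>. f \<tau> \<in> borel_measurable lborel2"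
      and f: "\<And>\<tau>. 0 \<le> \<tau> \<Longrightarrow> \<tau> \<le> t \<Longrightarrow> (\<integral>\<^sup>+p. f \<tau> p \<partial>lborel2) \<le> ennreal c" and c: "0 \<le> c" for f c
  proof -
    have "(\<integral>\<^sup>+p. (\<integral>\<^sup>+\<tau>. indicator {0..t} \<tau> * f \<tau> p \<partial>lborel) \<partial>lborel2)
       = (\<integral>\<^sup>+\<tau>. (\<integral>\<^sup>+p. indicator {0..t} \<tau> * f \<tau> p \<partial>lborel2) \<partial>lborel)"
      by (rule Fubini') (simp add: split_beta')
    also have "\<dots> = (\<integral>\<^sup>+\<tau>. indicator {0..t} \<tau> * (\<integral>\<^sup>+p. f \<tau> p \<partial>lborel2) \<partial>lborel)"
      by (subst nn_integral_cmult) auto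
    also have "\<dots> \<le> (\<integral>\<^sup>+\<tau>. ennreal c * indicator {0..t} \<tau> \<partial>lborel)"
      using f by (intro nn_integral_mono) (auto simp: indicator_def)
    also have "\<dots> = ennreal (t * c)"
      using t c by (simp add: nn_integral_cmult ennreal_mult[symmetric] mult.commute)
    finally show ?thesis .
  qed
  have osc: "oscil \<mu> \<Omega> F1 F2 F3 \<tau> p = complex_of_real (m p) * cis (\<tau> * w p) * G p \<tau>" for \<tau> p
    by (simp add: oscil_def m_def w_def G_def z_def)
  have NG: "ennreal (cmod (G p \<tau>)) = N \<tau> p" for p \<tau>
    by (simp add: G_def N_def norm_mult ennreal_mult)
  have dG: "((\<lambda>\<tau>. G p \<tau>) has_vector_derivative G' p \<tau>) (at \<tau>)" for p \<tau>
    unfolding G_def G'_def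
    by (rule has_vector_derivative_eq_rhs,
        (rule has_vector_derivative_mult curveD(3)[OF curves(1)] curveD(3)[OF curves(2)] curveD(3)[OF curves(3)])+)
      (simp add: algebra_simps)
  have cG: "continuous_on UNIV (G' p)" for p
    unfolding G'_def by (intro continuous_intros curveD(4,5)[OF curves(1)] curveD(4,5)[OF curves(2)] curveD(4,5)[OF curves(3)])
  have HG: "ennreal (cmod (G' p \<tau>)) \<le> H \<tau> p" for p \<tau>
  proof -
    have "cmod (G' p \<tau>) \<le> cmod (D1 \<tau> (fst p)) * cmod (F2 \<tau> (snd p)) * cmod (F3 \<tau> (z p)) + cmod (F1 \<tau> (fst p)) * cmod (D2 \<tau> (snd p)) * cmod (F3 \<tau> (z p))
     + cmod (F1 \<tau> (fst p)) * cmod (F2 \<tau> (snd p)) * cmod (D3 \<tau> (z p))"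
      unfolding G'_def norm_mult[symmetric] by (intro norm_triangle_le add_mono order_refl)
    then show ?thesis
      unfolding H_def by (simp add: ennreal_mult[symmetric] ennreal_plus[symmetric] ennreal_leI del: ennreal_plus)
  qed
  \<comment> \<open>The order of integration is exchanged first: the oscillation is exploited in
    time at a fixed point of the plane.\<close>
  have "(osc_int t \<mu> \<Omega> F1 F2 F3)
      = (LINT p|lborel2. LINT \<tau>|lborel. indicator {0..t} \<tau> *\<^sub>R oscil \<mu> \<Omega> F1 F2 F3 \<tau> p)"
    using Fubini_integral[OF int] by simp
  then have "ennreal (cmod (osc_int t \<mu> \<Omega> F1 F2 F3))
      \<le> (\<integral>\<^sup>+p. ennreal (cmod (LINT \<tau>|lborel. indicator {0..t} \<tau> *\<^sub>R oscil \<mu> \<Omega> F1 F2 F3 \<tau> p)) \<partial>lborel2)"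
    using integral_norm_bound_ennreal[OF integrable_snd[OF int]] by simp
  also have "\<dots> \<le> (\<integral>\<^sup>+p. (\<integral>\<^sup>+\<tau>. indicator {0..t} \<tau> * a1 \<tau> p \<partial>lborel)
      + (a2 t p + a2 0 p
      + (\<integral>\<^sup>+\<tau>. indicator {0..t} \<tau> * a3 \<tau> p \<partial>lborel)) \<partial>lborel2)"
  proof (intro nn_integral_mono)
    fix p :: "real \<times> real"
    show "ennreal (cmod (LINT \<tau>|lborel. indicator {0..t} \<tau> *\<^sub>R oscil \<mu> \<Omega> F1 F2 F3 \<tau> p)) \<le>
      (\<integral>\<^sup>+\<tau>. indicator {0..t} \<tau> * a1 \<tau> p \<partial>lborel)
      + (a2 t p + a2 0 p
      + (\<integral>\<^sup>+\<tau>. indicator {0..t} \<tau> * a3 \<tau> p \<partial>lborel))"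
    proof (cases "Q p")
      case True
      have "ennreal (cmod (LINT \<tau>|lborel. indicator {0..t} \<tau> *\<^sub>R oscil \<mu> \<Omega> F1 F2 F3 \<tau> p))
        \<le> ennreal \<bar>m p / w p\<bar> * (N t p + N 0 p + (\<integral>\<^sup>+\<tau>. indicator {0..t} \<tau> * ennreal (cmod (G' p \<tau>)) \<partial>lborel))"
        unfolding osc NG[symmetric]
        by (rule oscillatory_ibp[OF t dG cG]) (use True P0[of "fst p" "snd p" "z p"] in \<open>auto simp: Q_def w_def m_def z_def\<close>)
      also have "\<dots> \<le> ennreal \<bar>m p / w p\<bar> * (N t p + N 0 p + (\<integral>\<^sup>+\<tau>. indicator {0..t} \<tau> * H \<tau> p \<partial>lborel))"
        by (intro mult_left_mono add_mono nn_integral_mono HG order_refl) simp_all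
      also have "\<dots> = ennreal \<bar>m p / w p\<bar> * N t p + ennreal \<bar>m p / w p\<bar> * N 0 p
          + (\<integral>\<^sup>+\<tau>. ennreal \<bar>m p / w p\<bar> * (indicator {0..t} \<tau> * H \<tau> p) \<partial>lborel)"
        by (subst nn_integral_cmult) (simp_all add: mN' distrib_left)
      finally show ?thesis using True by (simp add: a1_def a2_def a3_def mult.left_commute add.assoc)
    next
      case False
      have "ennreal (cmod (LINT \<tau>|lborel. indicator {0..t} \<tau> *\<^sub>R oscil \<mu> \<Omega> F1 F2 F3 \<tau> p))
        \<le> (\<integral>\<^sup>+\<tau>. ennreal (norm (indicator {0..t} \<tau> *\<^sub>R oscil \<mu> \<Omega> F1 F2 F3 \<tau> p)) \<partial>lborel)"
      proof (rule integral_norm_bound_ennreal)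
        have "continuous_on UNIV (\<lambda>\<tau>. oscil \<mu> \<Omega> F1 F2 F3 \<tau> p)"
          unfolding oscil_def by (intro continuous_intros curveD(4,5)[OF curves(1)] curveD(4,5)[OF curves(2)] curveD(4,5)[OF curves(3)])
        then show "integrable lborel (\<lambda>\<tau>. indicator {0..t} \<tau> *\<^sub>R oscil \<mu> \<Omega> F1 F2 F3 \<tau> p)"
          using borel_integrable_atLeastAtMost'[OF continuous_on_subset[OF _ subset_UNIV], of "\<lambda>\<tau>. oscil \<mu> \<Omega> F1 F2 F3 \<tau> p" 0 t]
          unfolding set_integrable_def by blast
      qed
      also have "\<dots> = (\<integral>\<^sup>+\<tau>. indicator {0..t} \<tau> * a1 \<tau> p \<partial>lborel)"
        using False by (intro nn_integral_cong) (auto simp: a1_def osc norm_mult ennreal_mult NG indicator_def)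
      finally show ?thesis using False by (simp add: a2_def a3_def)
    qed
  qed
  also have "\<dots> = (\<integral>\<^sup>+p. (\<integral>\<^sup>+\<tau>. indicator {0..t} \<tau> * a1 \<tau> p \<partial>lborel) \<partial>lborel2)
      + ((\<integral>\<^sup>+p. a2 t p \<partial>lborel2) + (\<integral>\<^sup>+p. a2 0 p \<partial>lborel2) + (\<integral>\<^sup>+p. (\<integral>\<^sup>+\<tau>. indicator {0..t} \<tau> * a3 \<tau> p \<partial>lborel) \<partial>lborel2))"
    by (simp add: nn_integral_add)
  also have "\<dots> \<le> ennreal (t * c1) + (ennreal c2 + ennreal c2 + ennreal (t * c3))"
    by (intro add_mono fub tri c) (use t in simp_all)
  also have "\<dots> = ennreal (t * c1 + 2 * c2 + t * c3)"
    using t c by (simp add: ennreal_plus[symmetric] del: ennreal_plus)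
  finally show ?thesis
    by (rule ennreal_le_iff[THEN iffD1, rotated]) (use t c in simp)
qed

section \<open>The energy identity\<close>

lemma curves_product_measurable:
  assumes "curve F1 D1" "curve F2 D2" "curve F3 D3"
    and m\<mu>: "measurable3 \<mu>"
    and m\<Omega>: "measurable3 \<Omega>"
    and f: "f \<in> borel_measurable M" and g: "g \<in> measurable M (borel \<Otimes>\<^sub>M borel)"
  shows "(\<lambda>q. oscil \<mu> \<Omega> F1 F2 F3 (f q) (g q)) \<in> borel_measurable M"
proof -
  note [measurable] = f
  have [measurable]: "(\<lambda>x. fst (g x)) \<in> borel_measurable M" "(\<lambda>x. snd (g x)) \<in> borel_measurable M"
    using measurable_compose[OF g measurable_fst] measurable_compose[OF g measurable_snd] by simp_all
  have [measurable]: "(\<lambda>q. F1 (f q) (fst (g q))) \<in> borel_measurable M" "(\<lambda>q. F2 (f q) (snd (g q))) \<in> borel_measurable M"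
    "(\<lambda>q. F3 (f q) (- fst (g q) - snd (g q))) \<in> borel_measurable M"
    by (rule curve_measurable[OF assms(1)] curve_measurable[OF assms(2)] curve_measurable[OF assms(3)]; measurable)+
  have [measurable]: "(\<lambda>q. \<mu> (fst (g q)) (snd (g q)) (- fst (g q) - snd (g q))) \<in> borel_measurable M"
    "(\<lambda>q. \<Omega> (fst (g q)) (snd (g q)) (- fst (g q) - snd (g q))) \<in> borel_measurable M"
    by (rule trimeas_of_real[OF m\<mu>] trimeas_of_real[OF m\<Omega>]; measurable)+
  show ?thesis
    unfolding oscil_def by measurable
qed

lemma norm_oscil:
  "ennreal (cmod (oscil \<mu> \<Omega> F1 F2 F3 \<tau> p)) = ennreal \<bar>\<mu> (fst p) (snd p) (- fst p - snd p)\<bar> *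
     (nrm3 F1 F2 F3 \<tau> (fst p) (snd p) (- fst p - snd p))"
  by (simp add: oscil_def norm_mult ennreal_mult mult.assoc)

lemma trimeas_norm:
  assumes c: "curve F1 D1" "curve F2 D2" "curve F3 D3"
    and m\<mu>: "measurable3 \<mu>"
  shows "trimeas (\<lambda>x y z. ennreal \<bar>\<mu> x y z\<bar> * (nrm3 F1 F2 F3 \<tau> x y z))"
proof -
  note [measurable] = curveD(1)[OF c(1)] curveD(1)[OF c(2)] curveD(1)[OF c(3)]
  have [measurable]: "(\<lambda>p. \<mu> (fst p) (fst (snd p)) (snd (snd p))) \<in> borel_measurable borel3"
    using m\<mu> by (simp add: split_beta')
  show ?thesis unfolding split_beta' by measurable
qed

text \<open>A bound uniform in time gives joint integrability in time and plane, the hypothesis of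
  every use of Fubini below.\<close>

lemma oscil_integrable:
  assumes c: "curve F1 D1" "curve F2 D2" "curve F3 D3"
    and m\<mu>: "measurable3 \<mu>"
    and m\<Omega>: "measurable3 \<Omega>"
    and b: "\<And>\<tau>. 0 \<le> \<tau> \<Longrightarrow> \<tau> \<le> t \<Longrightarrow>
      trint (\<lambda>x y z. ennreal \<bar>\<mu> x y z\<bar> * (nrm3 F1 F2 F3 \<tau> x y z)) \<le> ennreal C"
  shows "integrable (lborel \<Otimes>\<^sub>M lborel2) (\<lambda>(\<tau>, p). indicator {0..t} \<tau> *\<^sub>R oscil \<mu> \<Omega> F1 F2 F3 \<tau> p)"
    and "0 \<le> \<tau> \<Longrightarrow> \<tau> \<le> t \<Longrightarrow> integrable lborel2 (oscil \<mu> \<Omega> F1 F2 F3 \<tau>)"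
proof -
  have sets: "sets lborel2 = sets (borel \<Otimes>\<^sub>M borel)" by (rule sets_pair_measure_cong) auto
  have [measurable]: "oscil \<mu> \<Omega> F1 F2 F3 \<tau> \<in> borel_measurable lborel2" for \<tau>
    using curves_product_measurable[OF c m\<mu> m\<Omega>, of "\<lambda>_. \<tau>" lborel2 "\<lambda>p. p"] by (simp add: measurable_ident_sets[OF sets])
  have m2[measurable]: "(\<lambda>q. oscil \<mu> \<Omega> F1 F2 F3 (fst q) (snd q)) \<in> borel_measurable (lborel \<Otimes>\<^sub>M lborel2)"
  proof (rule curves_product_measurable[OF c m\<mu> m\<Omega>])
    have "fst \<in> measurable (lborel \<Otimes>\<^sub>M lborel2) lborel" by (rule measurable_fst)
    then show "fst \<in> borel_measurable (lborel \<Otimes>\<^sub>M lborel2)" by simp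
    have "snd \<in> measurable (lborel \<Otimes>\<^sub>M lborel2) lborel2" by (rule measurable_snd)
    then show "snd \<in> measurable (lborel \<Otimes>\<^sub>M lborel2) (borel \<Otimes>\<^sub>M borel)"
      by (simp cong: measurable_cong_sets[OF refl sets])
  qed
  have slice: "(\<integral>\<^sup>+p. ennreal (cmod (oscil \<mu> \<Omega> F1 F2 F3 \<tau> p)) \<partial>lborel2) \<le> ennreal C" if "0 \<le> \<tau>" "\<tau> \<le> t" for \<tau>
    using b[OF that] unfolding norm_oscil by (subst (asm) trint_pair[OF trimeas_norm[OF c m\<mu>]])
  show "integrable lborel2 (oscil \<mu> \<Omega> F1 F2 F3 \<tau>)" if "0 \<le> \<tau>" "\<tau> \<le> t"
    using slice[OF that] by (auto simp: integrable_iff_bounded intro: le_less_trans)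
  show "integrable (lborel \<Otimes>\<^sub>M lborel2) (\<lambda>(\<tau>, p). indicator {0..t} \<tau> *\<^sub>R oscil \<mu> \<Omega> F1 F2 F3 \<tau> p)"
  proof (rule integrableI_bounded)
    show "(\<lambda>(\<tau>, p). indicator {0..t} \<tau> *\<^sub>R oscil \<mu> \<Omega> F1 F2 F3 \<tau> p) \<in> borel_measurable (lborel \<Otimes>\<^sub>M lborel2)"
      unfolding split_beta' by measurable
    have "(\<integral>\<^sup>+q. norm (case q of (\<tau>, p) \<Rightarrow> indicator {0..t} \<tau> *\<^sub>R oscil \<mu> \<Omega> F1 F2 F3 \<tau> p) \<partial>(lborel \<Otimes>\<^sub>M lborel2))
       = (\<integral>\<^sup>+\<tau>. (\<integral>\<^sup>+p. norm (indicator {0..t} \<tau> *\<^sub>R oscil \<mu> \<Omega> F1 F2 F3 \<tau> p) \<partial>lborel2) \<partial>lborel)"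
      by (subst lborel_pair.P.nn_integral_fst[symmetric]) (auto simp: split_beta')
    also have "\<dots> \<le> (\<integral>\<^sup>+\<tau>. ennreal C * indicator {0..t} \<tau> \<partial>lborel)"
      using slice by (intro nn_integral_mono) (auto simp: indicator_def)
    also have "\<dots> < \<infinity>"
      by (subst nn_integral_cmult) (auto simp: ennreal_mult_less_top emeasure_lborel_Icc_eq)
    finally show "(\<integral>\<^sup>+q. norm (case q of (\<tau>, p) \<Rightarrow> indicator {0..t} \<tau> *\<^sub>R oscil \<mu> \<Omega> F1 F2 F3 \<tau> p) \<partial>(lborel \<Otimes>\<^sub>M lborel2)) < \<infinity>" .
  qed
qed

lemma lborel_pair_integral_swap:
  fixes g :: "real \<times> real \<Rightarrow> complex"
  assumes "integrable lborel2 g"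
  shows "(LINT p|lborel2. g (snd p, fst p)) = (LINT p|lborel2. g p)"
    "integrable lborel2 (\<lambda>p. g (snd p, fst p))"
  using lborel_pair.integral_product_swap[of g] lborel_pair.integrable_product_swap[OF assms]
    borel_measurable_integrable[OF assms] by (simp_all add: split_beta')

lemma lborel_pair_integral_shear:
  fixes g :: "real \<times> real \<Rightarrow> complex"
  assumes "integrable lborel2 g"
  shows "(LINT p|lborel2. g (fst p, - fst p - snd p)) = (LINT p|lborel2. g p)"
    "integrable lborel2 (\<lambda>p. g (fst p, - fst p - snd p))"
proof -
  note [measurable] = borel_measurable_integrable[OF assms]
  show int: "integrable lborel2 (\<lambda>p. g (fst p, - fst p - snd p))"
  proof (rule integrableI_bounded)
    show [measurable]: "(\<lambda>p. g (fst p, - fst p - snd p)) \<in> borel_measurable lborel2"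
      by measurable
    have "(\<integral>\<^sup>+p. norm (g (fst p, - fst p - snd p)) \<partial>lborel2) = (\<integral>\<^sup>+x. (\<integral>\<^sup>+y. norm (g (x, - x - y)) \<partial>lborel) \<partial>lborel)"
      by (subst lborel.nn_integral_fst[symmetric]) auto
    also have "\<dots> = (\<integral>\<^sup>+x. (\<integral>\<^sup>+y. norm (g (x, y)) \<partial>lborel) \<partial>lborel)"
      by (intro nn_integral_cong nn_integral_lborel_reflect[of "\<lambda>y. ennreal (norm (g (x, y)))" for x]) measurable
    also have "\<dots> = (\<integral>\<^sup>+p. norm (g p) \<partial>lborel2)"
      by (subst lborel.nn_integral_fst) auto
    finally show "(\<integral>\<^sup>+p. norm (g (fst p, - fst p - snd p)) \<partial>lborel2) < \<infinity>"
      using assms by (simp add: integrable_iff_bounded)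
  qed
  have "(LINT p|lborel2. g (fst p, - fst p - snd p)) = (LINT x|lborel. LINT y|lborel. g (x, - x - y))"
    by (subst lborel_pair.integral_fst'[OF int, symmetric]) simp
  also have "\<dots> = (LINT x|lborel. LINT y|lborel. g (x, y))"
  proof (rule Bochner_Integration.integral_cong[OF refl])
    fix x
    show "(LINT y|lborel. g (x, - x - y)) = (LINT y|lborel. g (x, y))"
      using lborel_integral_real_affine[of "-1" "\<lambda>y. g (x, y)" "- x"] by simp
  qed
  also have "\<dots> = (LINT p|lborel2. g p)"
    by (rule lborel_pair.integral_fst'[OF assms])
  finally show "(LINT p|lborel2. g (fst p, - fst p - snd p)) = (LINT p|lborel2. g p)" .
qed

abbreviation interaction :: "real \<Rightarrow> real \<Rightarrow> (real \<Rightarrow> complex) \<Rightarrow> (real \<Rightarrow> complex) \<Rightarrow> real \<Rightarrow> complex" where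
  "interaction \<epsilon> \<tau> z w \<xi> \<equiv> (LINT \<eta>|lborel. (cis (\<tau> * phase \<epsilon> \<eta>) * z \<eta>) * (cis (\<tau> * phase \<epsilon> (\<xi> - \<eta>)) * w (\<xi> - \<eta>)))"

text \<open>A linear equation for \<open>W\<close> with coefficient \<open>Z\<close>, so that one
  identity serves twice: with W = Z = F for a single solution, and with W = F - G, Z = F + G for the
  difference of two. \<open>A\<close> plays the role of a squared weight.\<close>

locale flow =
  fixes \<epsilon> c0 t Am B V :: real and W DW Z DZ :: evolution and A :: "real \<Rightarrow> real"
  assumes curves: "curve W DW" "curve Z DZ"
    and real_W: "W \<tau> (- \<xi>) = cnj (W \<tau> \<xi>)"
    and DW: "DW \<tau> \<xi> = - \<i> * complex_of_real (c0 * \<xi>) * cis (- (\<tau> * phase \<epsilon> \<xi>)) *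
        interaction \<epsilon> \<tau> (Z \<tau>) (W \<tau>) \<xi>"
    and A: "A \<in> borel_measurable borel" "\<And>\<xi>. 0 \<le> A \<xi>" "\<And>\<xi>. A \<xi> \<le> Am" "\<And>\<xi>. A (- \<xi>) = A \<xi>"
    and t: "0 \<le> t" and c0: "0 \<le> c0"
    and bW: "\<And>\<tau>. 0 \<le> \<tau> \<Longrightarrow> \<tau> \<le> t \<Longrightarrow> L2b (nrm W \<tau>) V"
    and bxW: "\<And>\<tau>. 0 \<le> \<tau> \<Longrightarrow> \<tau> \<le> t \<Longrightarrow> L2b (\<lambda>x. ennreal \<bar>x\<bar> * nrm W \<tau> x) B"
    and bZ: "\<And>\<tau>. 0 \<le> \<tau> \<Longrightarrow> \<tau> \<le> t \<Longrightarrow> L1b (nrm Z \<tau>) B"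
begin

definition energy :: "real \<Rightarrow> real" where
  "energy \<tau> = (LINT \<xi>|lborel. A \<xi> * (cmod (W \<tau> \<xi>))\<^sup>2)"

text \<open>The multiplier before symmetrisation: the derivative of the nonlinearity meets the
  energy weight at the same frequency.\<close>

definition mu0 :: kernel where
  "mu0 x y z = x * A x"

lemma Am: "0 \<le> Am"
  using A(2)[of 0] A(3)[of 0] by simp

lemma measurable_Phase:
  "measurable3 (Phase \<epsilon>)"
  unfolding Phase_def phase_def by measurable

lemma measurable_mu0:
  "measurable3 mu0"
  unfolding mu0_def using A(1) by measurable

lemma bAxW:
  assumes "0 \<le> \<tau>" "\<tau> \<le> t"
  shows "L2b (\<lambda>x. ennreal \<bar>x * A x\<bar> * nrm W \<tau> x) (Am * B)"
proof (rule L2b_mono[OF L2b_cmult[OF bxW[OF assms] Am] _ _ order_refl])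
  note [measurable] = curveD(1)[OF curves(1)] A(1)
  show "(\<lambda>x. ennreal \<bar>x * A x\<bar> * nrm W \<tau> x) \<in> borel_measurable borel" by measurable
  fix x
  have "\<bar>x * A x\<bar> \<le> Am * \<bar>x\<bar>"
    using A(2,3)[of x] by (simp add: abs_mult mult.commute mult_right_mono)
  then have "\<bar>x * A x\<bar> * cmod (W \<tau> x) \<le> Am * \<bar>x\<bar> * cmod (W \<tau> x)"
    by (intro mult_right_mono) auto
  then show "ennreal \<bar>x * A x\<bar> * nrm W \<tau> x \<le> ennreal Am * (ennreal \<bar>x\<bar> * nrm W \<tau> x)"
    using Am by (simp add: ennreal_mult[symmetric] mult.assoc ennreal_leI)
qed

lemma mu0_bound:
  assumes "0 \<le> \<tau>" "\<tau> \<le> t"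
  shows "trint (\<lambda>x y z. ennreal \<bar>mu0 x y z\<bar> * (nrm3 W Z W \<tau> x y z)) \<le> ennreal (Am * B * B * V)"
  using trint_L2L1L2[OF bAxW[OF assms] bZ[OF assms] bW[OF assms]] by (simp add: mu0_def mult.assoc)

lemmas oscil_mu0_integrable = oscil_integrable[OF curves(1) curves(2) curves(1) measurable_mu0 measurable_Phase mu0_bound]

text \<open>For a real solution the conjugate at \<xi> is the value at -\<xi>. With x = -\<xi> the
  pairing of \<open>W\<close> with its convolution becomes an integral over x + y + z = 0, and the
  three linear phases add up to \<open>Phase\<close>.\<close>

lemma energy_density_slice:
  assumes "0 \<le> \<tau>" "\<tau> \<le> t"
  shows "(LINT \<xi>|lborel. 2 * A \<xi> * Re (cnj (W \<tau> \<xi>) * DW \<tau> \<xi>))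
     = - 2 * c0 * Im (LINT p|lborel2. oscil mu0 (Phase \<epsilon>) W Z W \<tau> p)"
proof -
  define w z where "w = (\<lambda>\<xi>. cis (\<tau> * phase \<epsilon> \<xi>) * W \<tau> \<xi>)" and "z = (\<lambda>\<xi>. cis (\<tau> * phase \<epsilon> \<xi>) * Z \<tau> \<xi>)"
  define g where "g = (\<lambda>\<xi>. complex_of_real (\<xi> * A \<xi>) * cnj (w \<xi>) * (LINT \<eta>|lborel. z \<eta> * w (\<xi> - \<eta>)))"
  have e: "complex_of_real (A \<xi>) * (cnj (W \<tau> \<xi>) * DW \<tau> \<xi>) = - \<i> * complex_of_real c0 * g \<xi>" for \<xi>
  proof -
    have I: "interaction \<epsilon> \<tau> (Z \<tau>) (W \<tau>) \<xi>
       = (LINT \<eta>|lborel. z \<eta> * w (\<xi> - \<eta>))"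
      unfolding w_def z_def ..
    have "cnj (w \<xi>) = cis (- (\<tau> * phase \<epsilon> \<xi>)) * cnj (W \<tau> \<xi>)"
      by (simp add: w_def cis_cnj)
    then show ?thesis
      unfolding DW g_def I by simp
  qed
  have osc: "oscil mu0 (Phase \<epsilon>) W Z W \<tau> (x, y) = complex_of_real (x * A x) * w x * (z y * w (- x - y))" for x y
  proof -
    have "cis (\<tau> * Phase \<epsilon> x y (- x - y)) = cis (\<tau> * phase \<epsilon> x) * cis (\<tau> * phase \<epsilon> y) * cis (\<tau> * phase \<epsilon> (- x - y))"
      by (simp add: cis_mult Phase_def distrib_left)
    then show ?thesis
      by (simp add: oscil_def mu0_def w_def z_def mult_ac)
  qed
  \<comment> \<open>The evenness of \<open>A\<close> and the factor \<xi> account for the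
    sign.\<close>
  have gm: "g (- x) = - (LINT y|lborel. oscil mu0 (Phase \<epsilon>) W Z W \<tau> (x, y))" for x
  proof -
    have "w (- x) = cnj (w x)" by (simp add: w_def real_W cis_cnj)
    then show ?thesis unfolding osc g_def by (simp add: A(4))
  qed
  have int: "integrable lborel2 (oscil mu0 (Phase \<epsilon>) W Z W \<tau>)"
    by (rule oscil_mu0_integrable) (use assms in auto)
  have "(LINT \<xi>|lborel. g \<xi>) = (LINT x|lborel. g (- x))"
    by (subst lborel_integral_real_affine[where c = "-1" and t = 0]) auto
  also have "\<dots> = - (LINT x|lborel. LINT y|lborel. oscil mu0 (Phase \<epsilon>) W Z W \<tau> (x, y))"
    by (simp add: gm)
  also have "\<dots> = - (LINT p|lborel2. oscil mu0 (Phase \<epsilon>) W Z W \<tau> p)"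
    using lborel_pair.integral_fst'[OF int] by simp
  finally have G: "(LINT \<xi>|lborel. g \<xi>) = - (LINT p|lborel2. oscil mu0 (Phase \<epsilon>) W Z W \<tau> p)" .
  have gi: "integrable lborel g"
  proof -
    have "integrable lborel (\<lambda>x. - (LINT y|lborel. oscil mu0 (Phase \<epsilon>) W Z W \<tau> (x, y)))"
      using lborel_pair.integrable_fst'[OF int] by simp
    then have "integrable lborel (\<lambda>x. g (- x))" by (simp add: gm)
    then show ?thesis using lborel_integrable_real_affine_iff[of "-1" g 0] by simp
  qed
  have "2 * A \<xi> * Re (cnj (W \<tau> \<xi>) * DW \<tau> \<xi>) = 2 * c0 * Im (g \<xi>)" for \<xi>
  proof -
    have "2 * A \<xi> * Re (cnj (W \<tau> \<xi>) * DW \<tau> \<xi>) = 2 * Re (complex_of_real (A \<xi>) * (cnj (W \<tau> \<xi>) * DW \<tau> \<xi>))"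
      by simp
    also have "\<dots> = 2 * c0 * Im (g \<xi>)" unfolding e by simp
    finally show ?thesis .
  qed
  then have eq: "(\<lambda>\<xi>. 2 * A \<xi> * Re (cnj (W \<tau> \<xi>) * DW \<tau> \<xi>)) = (\<lambda>\<xi>. 2 * c0 * Im (g \<xi>))"
    by (rule ext)
  have "(LINT \<xi>|lborel. 2 * A \<xi> * Re (cnj (W \<tau> \<xi>) * DW \<tau> \<xi>)) = 2 * c0 * (LINT \<xi>|lborel. Im (g \<xi>))"
    unfolding eq by simp
  also have "(LINT \<xi>|lborel. Im (g \<xi>)) = Im (LINT \<xi>|lborel. g \<xi>)"
    using integral_Im[OF gi] by simp
  finally show ?thesis unfolding G by simp
qed

lemma norm_DW_le:
  "nrm DW \<tau> \<xi> \<le> ennreal c0 * (ennreal \<bar>\<xi>\<bar> * conv (nrm Z \<tau>) (nrm W \<tau>) \<xi>)"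
proof -
  define I where "I = interaction \<epsilon> \<tau> (Z \<tau>) (W \<tau>) \<xi>"
  have "ennreal (cmod I) \<le> (\<integral>\<^sup>+\<eta>. ennreal (cmod ((cis (\<tau> * phase \<epsilon> \<eta>) * Z \<tau> \<eta>) * (cis (\<tau> * phase \<epsilon> (\<xi> - \<eta>)) * W \<tau> (\<xi> - \<eta>)))) \<partial>lborel)"
  proof (cases "integrable lborel (\<lambda>\<eta>. (cis (\<tau> * phase \<epsilon> \<eta>) * Z \<tau> \<eta>) * (cis (\<tau> * phase \<epsilon> (\<xi> - \<eta>)) * W \<tau> (\<xi> - \<eta>)))")
    case True
    then show ?thesis unfolding I_def by (rule integral_norm_bound_ennreal)
  next
    \<comment> \<open>A function that is not integrable has integral 0, so the bound is
      trivial.\<close>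
    case False
    then show ?thesis unfolding I_def by (simp add: not_integrable_integral_eq)
  qed
  also have "\<dots> = conv (nrm Z \<tau>) (nrm W \<tau>) \<xi>"
    unfolding conv_def by (intro nn_integral_cong) (simp add: norm_mult ennreal_mult)
  finally have "ennreal (cmod I) \<le> conv (nrm Z \<tau>) (nrm W \<tau>) \<xi>" .
  then have "ennreal (c0 * \<bar>\<xi>\<bar>) * ennreal (cmod I) \<le> ennreal (c0 * \<bar>\<xi>\<bar>) * conv (nrm Z \<tau>) (nrm W \<tau>) \<xi>"
    by (rule mult_left_mono) simp
  then show ?thesis
    unfolding DW I_def[symmetric] using c0 by (simp add: norm_mult abs_mult ennreal_mult mult.assoc)
qed

text \<open>The energy itself is never differentiated. The fundamental theorem of calculus is
  applied at each frequency, and Fubini then exchanges the integrals in time and frequency.\<close>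

theorem energy_identity:
  "energy t - energy 0 = - 2 * c0 *
     Im (osc_int t mu0 (Phase \<epsilon>) W Z W)"
proof -
  define e where "e = (\<lambda>\<tau> \<xi>. 2 * A \<xi> * Re (cnj (W \<tau> \<xi>) * DW \<tau> \<xi>))"
  note [measurable] = A(1) curveD(1)[OF curves(1)] curveD(2)[OF curves(1)] curveD(1)[OF curves(2)]
  have [measurable]: "(\<lambda>q. W (f q) (g q)) \<in> borel_measurable M" "(\<lambda>q. DW (f q) (g q)) \<in> borel_measurable M"
    if "f \<in> borel_measurable M" "g \<in> borel_measurable M" for f g and M :: "'z measure"
    by (rule curve_measurable[OF curves(1) that])+
  have [measurable]: "cnj \<in> borel_measurable borel"
    by (intro borel_measurable_continuous_onI continuous_intros)
  \<comment> \<open>Domination for Fubini: the factor \<xi> of \<open>DW\<close> is moved to the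
    other copy of \<open>W\<close>, where \<open>bAxW\<close> bounds it in L^2, and the convolution
    that remains is in L^2 by Young.\<close>
  have enorm: "(\<integral>\<^sup>+\<xi>. ennreal \<bar>e \<tau> \<xi>\<bar> \<partial>lborel) \<le> ennreal (2 * c0 * (Am * B * (B * V)))" if \<tau>: "0 \<le> \<tau>" "\<tau> \<le> t" for \<tau>
  proof -
    have "ennreal \<bar>e \<tau> \<xi>\<bar> \<le> ennreal (2 * c0) * ((ennreal \<bar>\<xi> * A \<xi>\<bar> * nrm W \<tau> \<xi>) * conv (nrm Z \<tau>) (nrm W \<tau>) \<xi>)" for \<xi>
    proof -
      have "\<bar>e \<tau> \<xi>\<bar> \<le> 2 * A \<xi> * cmod (cnj (W \<tau> \<xi>) * DW \<tau> \<xi>)"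
        unfolding e_def abs_mult using A(2)[of \<xi>] by (intro mult_mono abs_Re_le_cmod) auto
      then have "ennreal \<bar>e \<tau> \<xi>\<bar> \<le> ennreal (2 * A \<xi>) * (nrm W \<tau> \<xi> * nrm DW \<tau> \<xi>)"
        using A(2)[of \<xi>] by (simp add: norm_mult ennreal_mult[symmetric] ennreal_leI)
      also have "\<dots> \<le> ennreal (2 * A \<xi>) * (nrm W \<tau> \<xi> * (ennreal c0 * (ennreal \<bar>\<xi>\<bar> * conv (nrm Z \<tau>) (nrm W \<tau>) \<xi>)))"
        by (intro mult_left_mono norm_DW_le) auto
      also have "\<dots> = ennreal (2 * c0) * ((ennreal \<bar>\<xi> * A \<xi>\<bar> * nrm W \<tau> \<xi>) * conv (nrm Z \<tau>) (nrm W \<tau>) \<xi>)"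
        using A(2)[of \<xi>] c0 by (simp add: abs_mult ennreal_mult mult_ac)
      finally show ?thesis .
    qed
    then have "(\<integral>\<^sup>+\<xi>. ennreal \<bar>e \<tau> \<xi>\<bar> \<partial>lborel)
        \<le> (\<integral>\<^sup>+\<xi>. ennreal (2 * c0) * ((ennreal \<bar>\<xi> * A \<xi>\<bar> * nrm W \<tau> \<xi>) * conv (nrm Z \<tau>) (nrm W \<tau>) \<xi>) \<partial>lborel)"
      by (intro nn_integral_mono)
    also have "\<dots> = ennreal (2 * c0) * (\<integral>\<^sup>+\<xi>. (ennreal \<bar>\<xi> * A \<xi>\<bar> * nrm W \<tau> \<xi>) * conv (nrm Z \<tau>) (nrm W \<tau>) \<xi> \<partial>lborel)"
      by (rule nn_integral_cmult) measurable
    also have "\<dots> \<le> ennreal (2 * c0) * ennreal (Am * B * (B * V))"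
      by (intro mult_left_mono L1bD(3)[OF L1b_mult[OF bAxW[OF \<tau>] L2b_conv[OF bZ[OF \<tau>] bW[OF \<tau>]]]]) auto
    finally show ?thesis
      using c0 by (simp add: ennreal_mult'[symmetric])
  qed
  have int: "integrable lborel2 (\<lambda>(\<tau>, \<xi>). indicator {0..t} \<tau> *\<^sub>R e \<tau> \<xi>)"
  proof (rule integrableI_bounded)
    show "(\<lambda>(\<tau>, \<xi>). indicator {0..t} \<tau> *\<^sub>R e \<tau> \<xi>) \<in> borel_measurable lborel2"
      unfolding e_def split_beta' by measurable
    then have "(\<integral>\<^sup>+q. norm (case q of (\<tau>, \<xi>) \<Rightarrow> indicator {0..t} \<tau> *\<^sub>R e \<tau> \<xi>) \<partial>lborel2)
       = (\<integral>\<^sup>+\<tau>. (\<integral>\<^sup>+\<xi>. norm (indicator {0..t} \<tau> *\<^sub>R e \<tau> \<xi>) \<partial>lborel) \<partial>lborel)"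
      by (subst lborel.nn_integral_fst[symmetric]) (auto simp: split_beta')
    also have "\<dots> \<le> (\<integral>\<^sup>+\<tau>. ennreal (2 * c0 * (Am * B * (B * V))) * indicator {0..t} \<tau> \<partial>lborel)"
      using enorm by (intro nn_integral_mono) (auto simp: indicator_def)
    also have "\<dots> < \<infinity>"
      by (subst nn_integral_cmult) (auto simp: ennreal_mult_less_top emeasure_lborel_Icc_eq)
    finally show "(\<integral>\<^sup>+q. norm (case q of (\<tau>, \<xi>) \<Rightarrow> indicator {0..t} \<tau> *\<^sub>R e \<tau> \<xi>) \<partial>lborel2) < \<infinity>" .
  qed
  have ftc: "A \<xi> * (cmod (W t \<xi>))\<^sup>2 - A \<xi> * (cmod (W 0 \<xi>))\<^sup>2 = (LINT \<tau>|lborel. indicator {0..t} \<tau> *\<^sub>R e \<tau> \<xi>)" for \<xi>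
  proof (rule integral_FTC_atLeastAtMost[OF t, symmetric])
    have "((\<lambda>\<tau>. cnj (W \<tau> \<xi>) * W \<tau> \<xi>) has_vector_derivative (cnj (W \<tau> \<xi>) * DW \<tau> \<xi> + cnj (DW \<tau> \<xi>) * W \<tau> \<xi>)) (at \<tau>)" for \<tau>
      by (intro has_vector_derivative_mult has_vector_derivative_cnj curveD(3)[OF curves(1)])
    from bounded_linear.has_vector_derivative[OF bounded_linear_Re this]
    have "((\<lambda>\<tau>. Re (cnj (W \<tau> \<xi>) * W \<tau> \<xi>)) has_vector_derivative Re (cnj (W \<tau> \<xi>) * DW \<tau> \<xi> + cnj (DW \<tau> \<xi>) * W \<tau> \<xi>)) (at \<tau>)" for \<tau>
      by simp
    moreover have "Re (cnj u * u) = (cmod u)\<^sup>2" for u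
      unfolding cmod_power2 by (simp add: power2_eq_square)
    moreover have "Re (cnj u * v + cnj v * u) = 2 * Re (cnj u * v)" for u v
      by simp
    ultimately have "((\<lambda>\<tau>. (cmod (W \<tau> \<xi>))\<^sup>2) has_vector_derivative 2 * Re (cnj (W \<tau> \<xi>) * DW \<tau> \<xi>)) (at \<tau>)" for \<tau>
      by (simp only:)
    from has_vector_derivative_mult_right[OF this, of "A \<xi>"]
    show "((\<lambda>\<tau>. A \<xi> * (cmod (W \<tau> \<xi>))\<^sup>2) has_vector_derivative e \<tau> \<xi>) (at \<tau> within {0..t})" for \<tau>
      unfolding e_def by (auto intro: has_vector_derivative_at_within simp: mult_ac)
    have "continuous_on UNIV (\<lambda>\<tau>. e \<tau> \<xi>)"
      unfolding e_def by (intro continuous_intros curveD(4,5)[OF curves(1)])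
    then show "continuous_on {0..t} (\<lambda>\<tau>. e \<tau> \<xi>)" by (rule continuous_on_subset) simp
  qed
  have inte: "integrable lborel (\<lambda>\<xi>. A \<xi> * (cmod (W \<tau> \<xi>))\<^sup>2)" if \<tau>: "0 \<le> \<tau>" "\<tau> \<le> t" for \<tau>
  proof (rule integrableI_bounded)
    have "(\<integral>\<^sup>+\<xi>. norm (A \<xi> * (cmod (W \<tau> \<xi>))\<^sup>2) \<partial>lborel) \<le> (\<integral>\<^sup>+\<xi>. ennreal Am * (nrm W \<tau> \<xi>)\<^sup>2 \<partial>lborel)"
      using A(2,3) Am by (intro nn_integral_mono) (auto simp: abs_mult ennreal_power ennreal_mult[symmetric] intro!: ennreal_leI mult_right_mono)
    also have "\<dots> = ennreal Am * (\<integral>\<^sup>+\<xi>. (nrm W \<tau> \<xi>)\<^sup>2 \<partial>lborel)"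
      by (rule nn_integral_cmult) measurable
    also have "\<dots> < \<infinity>"
      using le_less_trans[OF L2bD(3)[OF bW[OF \<tau>]] ennreal_less_top] by (simp add: ennreal_mult_less_top)
    finally show "(\<integral>\<^sup>+\<xi>. norm (A \<xi> * (cmod (W \<tau> \<xi>))\<^sup>2) \<partial>lborel) < \<infinity>" .
  qed measurable
  have "energy t - energy 0 = (LINT \<xi>|lborel. A \<xi> * (cmod (W t \<xi>))\<^sup>2 - A \<xi> * (cmod (W 0 \<xi>))\<^sup>2)"
    unfolding energy_def using inte t by (simp add: Bochner_Integration.integral_diff)
  also have "\<dots> = (LINT \<xi>|lborel. LINT \<tau>|lborel. indicator {0..t} \<tau> *\<^sub>R e \<tau> \<xi>)"
    unfolding ftc ..
  also have "\<dots> = (LINT \<tau>|lborel. LINT \<xi>|lborel. indicator {0..t} \<tau> *\<^sub>R e \<tau> \<xi>)"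
    by (rule lborel_pair.Fubini_integral[OF int])
  also have "\<dots> = (LINT \<tau>|lborel. indicator {0..t} \<tau> *\<^sub>R (- 2 * c0 * Im (LINT p|lborel2. oscil mu0 (Phase \<epsilon>) W Z W \<tau> p)))"
    using energy_density_slice
    by (intro Bochner_Integration.integral_cong refl) (auto simp: e_def indicator_def)
  also have "\<dots> = (LINT \<tau>|lborel. - 2 * c0 * Im (indicator {0..t} \<tau> *\<^sub>R (LINT p|lborel2. oscil mu0 (Phase \<epsilon>) W Z W \<tau> p)))"
    by (intro Bochner_Integration.integral_cong refl) simp
  also have "\<dots> = - 2 * c0 * (LINT \<tau>|lborel. Im (indicator {0..t} \<tau> *\<^sub>R (LINT p|lborel2. oscil mu0 (Phase \<epsilon>) W Z W \<tau> p)))"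
    by simp
  also have "(LINT \<tau>|lborel. Im (indicator {0..t} \<tau> *\<^sub>R (LINT p|lborel2. oscil mu0 (Phase \<epsilon>) W Z W \<tau> p)))
     = Im (osc_int t mu0 (Phase \<epsilon>) W Z W)"
  proof (rule integral_Im)
    interpret P: pair_sigma_finite lborel "lborel \<Otimes>\<^sub>M lborel :: (real \<times> real) measure"
      by (intro pair_sigma_finite.intro lborel.sigma_finite_measure_axioms sigma_finite_pair_measure)
    show "integrable lborel (\<lambda>\<tau>. indicator {0..t} \<tau> *\<^sub>R (LINT p|lborel2. oscil mu0 (Phase \<epsilon>) W Z W \<tau> p))"
      using P.integrable_fst'[OF oscil_mu0_integrable(1)] by simp
  qed
  finally show ?thesis .
qed

end

section \<open>The a priori estimate\<close>

lemma trimeas_swap12: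
  assumes "trimeas H" shows "trimeas (\<lambda>x y z. H y x z)"
  unfolding split_beta' by (rule trimeas_compose[OF assms]) measurable

lemma trimeas_swap13:
  assumes "trimeas H" shows "trimeas (\<lambda>x y z. H z y x)"
  unfolding split_beta' by (rule trimeas_compose[OF assms]) measurable

lemma trimeas_swap23:
  assumes "trimeas H" shows "trimeas (\<lambda>x y z. H x z y)"
  unfolding split_beta' by (rule trimeas_compose[OF assms]) measurable

lemma trint_swap13:
  assumes "trimeas H"
  shows "trint (\<lambda>x y z. H z y x) = trint H"
  using trint_swap12[OF trimeas_swap23[OF trimeas_swap12[OF assms]]]
    trint_swap23[OF trimeas_swap12[OF assms]] trint_swap12[OF assms] by simp

text \<open>Here \<open>H1\<close> controls the case in which x is the distinguished variable,
  either the smallest one or the one whose factor is differentiated in time. The other two cases are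
  images under a transposition, which leaves \<open>trint\<close> unchanged; hence the factor
  3.\<close>

lemma trint_symmetric_bound:
  assumes H: "trimeas H1" and h: "trint H1 \<le> ennreal h" "0 \<le> h"
    and le: "\<And>x y z. x + y + z = 0 \<Longrightarrow> H x y z \<le> H1 x y z + (H1 y x z + H1 z y x)"
  shows "trint H \<le> ennreal (3 * h)"
proof -
  have m: "trimeas (\<lambda>x y z. H1 y x z + H1 z y x)"
    using trimeas_swap12[OF H] trimeas_swap13[OF H] unfolding split_beta' by measurable
  have "trint H \<le> trint (\<lambda>x y z. H1 x y z + (H1 y x z + H1 z y x))"
    by (rule trint_mono) (rule le)
  also have "\<dots> = trint H1 + (trint H1 + trint H1)"
    by (simp add: trint_add[OF H m] trint_add[OF trimeas_swap12[OF H] trimeas_swap13[OF H]] trint_swap12[OF H] trint_swap13[OF H])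
  also have "\<dots> \<le> ennreal h + (ennreal h + ennreal h)"
    by (intro add_mono h)
  also have "\<dots> = ennreal (3 * h)"
    using h by (simp add: ennreal_plus[symmetric] del: ennreal_plus)
  finally show ?thesis .
qed

lemma trimeas_add:
  assumes "trimeas H" "trimeas G" shows "trimeas (\<lambda>x y z. H x y z + G x y z)"
  using assms unfolding split_beta' by measurable

lemma trimeas_cmult:
  assumes "trimeas H" shows "trimeas (\<lambda>x y z. c * H x y z)"
  using assms unfolding split_beta' by measurable

lemma trint_le_add:
  assumes "trimeas H1" "trimeas H2" "trint H1 \<le> ennreal h1" "trint H2 \<le> ennreal h2" "0 \<le> h1" "0 \<le> h2"
  shows "trint (\<lambda>x y z. H1 x y z + H2 x y z) \<le> ennreal (h1 + h2)"
  using assms by (simp add: trint_add add_mono)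

lemma trint_le_cmult:
  assumes "trimeas H" "trint H \<le> ennreal h" "0 \<le> c" "0 \<le> h"
  shows "trint (\<lambda>x y z. ennreal c * H x y z) \<le> ennreal (c * h)"
  using assms by (simp add: trint_cmult ennreal_mult mult_left_mono)

lemma rho_swap12: "rho y x z = rho x y z" and rho_swap13: "rho z y x = rho x y z" and rho_swap23: "rho x z y = rho x y z"
  by (simp_all add: rho_def)

lemma resfac_swap12: "resfac \<epsilon> y x z = resfac \<epsilon> x y z" and resfac_swap13: "resfac \<epsilon> z y x = resfac \<epsilon> x y z"
    and resfac_swap23: "resfac \<epsilon> x z y = resfac \<epsilon> x y z"
  by (simp_all add: resfac_def algebra_simps)

lemma resonant_swap12: "resonant \<epsilon> y x z = resonant \<epsilon> x y z" and resonant_swap13: "resonant \<epsilon> z y x = resonant \<epsilon> x y z"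
    and resonant_swap23: "resonant \<epsilon> x z y = resonant \<epsilon> x y z"
  by (simp_all add: resonant_def rho_swap12 rho_swap13 rho_swap23 resfac_swap12 resfac_swap13 resfac_swap23)

lemma Phase_swap12: "Phase \<epsilon> y x z = Phase \<epsilon> x y z" and Phase_swap13: "Phase \<epsilon> z y x = Phase \<epsilon> x y z"
    and Phase_swap23: "Phase \<epsilon> x z y = Phase \<epsilon> x y z"
  by (simp_all add: Phase_def)

lemma symmul_swap12: "symmul a y x z = symmul a x y z" and symmul_swap13: "symmul a z y x = symmul a x y z"
    and symmul_swap23: "symmul a x z y = symmul a x y z"
  by (simp_all add: symmul_def)

lemmas swaps = rho_swap12 rho_swap13 rho_swap23 resfac_swap12 resfac_swap13 resfac_swap23
  resonant_swap12 resonant_swap13 resonant_swap23 Phase_swap12 Phase_swap13 Phase_swap23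
  symmul_swap12 symmul_swap13 symmul_swap23

lemma min_cases:
  fixes x y z :: real
  obtains "\<bar>x\<bar> \<le> \<bar>y\<bar>" "\<bar>x\<bar> \<le> \<bar>z\<bar>" | "\<bar>y\<bar> \<le> \<bar>x\<bar>" "\<bar>y\<bar> \<le> \<bar>z\<bar>" | "\<bar>z\<bar> \<le> \<bar>y\<bar>" "\<bar>z\<bar> \<le> \<bar>x\<bar>"
  by linarith

lemma symmul_quot_bound:
  assumes a: "weight q a" and xyz: "x + y + z = 0" and nr: "1 \<le> rho x y z * \<bar>resfac \<epsilon> x y z\<bar>"
  shows "\<bar>symmul a x y z / Phase \<epsilon> x y z\<bar> * rho x y z \<le> 2 * mulconst q * (a y * a z + a x * a z + a x * a y)"
    and "Phase \<epsilon> x y z = 0 \<Longrightarrow> symmul a x y z = 0"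
proof -
  have nn: "0 \<le> a t" for t using a by (auto simp: weight_def)
  have le: "2 * mulconst q * (a y * a z) \<le> 2 * mulconst q * (a y * a z + a x * a z + a x * a y)"
    "2 * mulconst q * (a x * a z) \<le> 2 * mulconst q * (a y * a z + a x * a z + a x * a y)"
    "2 * mulconst q * (a y * a x) \<le> 2 * mulconst q * (a y * a z + a x * a z + a x * a y)"
    using nn mulconst_nonneg by (auto intro!: mult_left_mono simp: mult.commute)
  have *: "\<bar>symmul a x y z / Phase \<epsilon> x y z\<bar> * rho x y z \<le> 2 * mulconst q * (a y * a z + a x * a z + a x * a y)
     \<and> (Phase \<epsilon> x y z = 0 \<longrightarrow> symmul a x y z = 0)"
  proof (cases rule: min_cases[of x y z])
    case 1
    then show ?thesis
      using symmul_quot_min_bound[OF a xyz 1 nr] le by force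
  next
    case 2
    have "y + x + z = 0" "1 \<le> rho y x z * \<bar>resfac \<epsilon> y x z\<bar>" using xyz nr by (simp_all add: swaps)
    from symmul_quot_min_bound[OF a this(1) 2 this(2)] le
    show ?thesis by (auto simp: swaps)
  next
    case 3
    have "z + y + x = 0" "1 \<le> rho z y x * \<bar>resfac \<epsilon> z y x\<bar>" using xyz nr by (simp_all add: swaps)
    from symmul_quot_min_bound[OF a this(1) 3 this(2)] le
    show ?thesis by (auto simp: swaps)
  qed
  then show "\<bar>symmul a x y z / Phase \<epsilon> x y z\<bar> * rho x y z \<le> 2 * mulconst q * (a y * a z + a x * a z + a x * a y)"
    "Phase \<epsilon> x y z = 0 \<Longrightarrow> symmul a x y z = 0" by auto
qed

lemma abs_le_rho:
  assumes "x + y + z = 0"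
  shows "\<bar>x\<bar> \<le> rho x y z" "\<bar>y\<bar> \<le> rho x y z" "\<bar>z\<bar> \<le> rho x y z"
  using assms unfolding rho_def by (auto simp: abs_if)

lemma measurable_rho:
  "measurable3 rho"
  unfolding rho_def by measurable

lemma measurable_resfac:
  "measurable3 (resfac \<epsilon>)"
  unfolding resfac_def by measurable

lemma measurable_resonant:
  "Measurable.pred borel3 (\<lambda>(x, y, z). resonant \<epsilon> x y z)"
  unfolding resonant_def using measurable_rho measurable_resfac[of \<epsilon>] by (simp add: split_beta')

lemma measurable_of_bool:
  assumes "Measurable.pred M P"
  shows "(\<lambda>x. of_bool (P x) :: ennreal) \<in> borel_measurable M"
  using assms unfolding of_bool_def by measurable

text \<open>The constant 2 bounds the square root of the section length 3.\<close>

lemma trint_resonant: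
  assumes "0 < \<epsilon>" "L2b F A" "L2b G B" "L2b H C"
  shows "trint (\<lambda>x y z. of_bool (\<bar>x\<bar> \<le> \<bar>y\<bar> \<and> \<bar>x\<bar> \<le> \<bar>z\<bar> \<and> resonant \<epsilon> x y z) * (F x * G y * H z)) \<le> ennreal (2 * (A * B * C))"
proof -
  have "trint (\<lambda>x y z. of_bool (\<bar>x\<bar> \<le> \<bar>y\<bar> \<and> \<bar>x\<bar> \<le> \<bar>z\<bar> \<and> resonant \<epsilon> x y z) * (F x * G y * H z)) \<le> ennreal (sqrt 3 * (A * B * C))"
  proof (rule trint_sections[OF assms(2-4)])
    show "Measurable.pred borel3 (\<lambda>(x, y, z). \<bar>x\<bar> \<le> \<bar>y\<bar> \<and> \<bar>x\<bar> \<le> \<bar>z\<bar> \<and> resonant \<epsilon> x y z)"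
      using measurable_resonant[of \<epsilon>] unfolding split_beta' by measurable
  qed (use resonant_section[OF assms(1)] in auto)
  also have "\<dots> \<le> ennreal (2 * (A * B * C))"
    using L2bD(2)[OF assms(2)] L2bD(2)[OF assms(3)] L2bD(2)[OF assms(4)]
    by (intro ennreal_leI mult_right_mono real_le_lsqrt) auto
  finally show ?thesis .
qed

text \<open>Every term must be quadratic in the weighted norm V; the third factor is paid for by the
  unweighted bound B. The term t (K + 2) stems from frequencies below K and from the resonant set,
  4/K from the boundary terms, and the last one from time derivatives. The bound M of the weight
  makes integrals converge but does not enter the estimate.\<close>

theorem apriori_step:
  fixes a :: "real \<Rightarrow> real" and F D :: evolution and \<epsilon> c0 t B V K :: real
  assumes "0 < \<epsilon>" and a: "weight q a" "\<And>x. a x \<le> M" and c: "curve F D"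
    and real: "\<And>\<tau> \<xi>. F \<tau> (- \<xi>) = cnj (F \<tau> \<xi>)"
    and D: "\<And>\<tau> \<xi>. D \<tau> \<xi> = - \<i> * complex_of_real (c0 * \<xi>) * cis (- (\<tau> * phase \<epsilon> \<xi>)) *
        interaction \<epsilon> \<tau> (F \<tau>) (F \<tau>) \<xi>"
    and t: "0 \<le> t" and c0: "0 \<le> c0" and K: "1 \<le> K"
    and b2: "\<And>\<tau>. 0 \<le> \<tau> \<Longrightarrow> \<tau> \<le> t \<Longrightarrow> L2b (nrm F \<tau>) B"
    and bx: "\<And>\<tau>. 0 \<le> \<tau> \<Longrightarrow> \<tau> \<le> t \<Longrightarrow> L2b (\<lambda>x. ennreal \<bar>x\<bar> * nrm F \<tau> x) B"
    and b1: "\<And>\<tau>. 0 \<le> \<tau> \<Longrightarrow> \<tau> \<le> t \<Longrightarrow> L1b (nrm F \<tau>) B"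
    and bv: "\<And>\<tau>. 0 \<le> \<tau> \<Longrightarrow> \<tau> \<le> t \<Longrightarrow> L2b (\<lambda>x. ennreal (a x) * nrm F \<tau> x) V"
  shows "\<bar>(LINT \<xi>|lborel. (a \<xi>)\<^sup>2 * (cmod (F t \<xi>))\<^sup>2) - (LINT \<xi>|lborel. (a \<xi>)\<^sup>2 * (cmod (F 0 \<xi>))\<^sup>2)\<bar>
    \<le> 2 * c0 * mulconst q * (t * (K + 2) + 4 / K + t * (2 * c0 * (1 + 2 ^ (q + 2)) * B)) * B * V\<^sup>2"
proof -
  have nn: "0 \<le> a x" for x using a(1) by (auto simp: weight_def)
  have [measurable]: "a \<in> borel_measurable borel" using a(1) by (auto simp: weight_def)
  interpret flow \<epsilon> c0 t "M\<^sup>2" B B F D F D "\<lambda>x. (a x)\<^sup>2"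
  proof
    show "(a \<xi>)\<^sup>2 \<le> M\<^sup>2" for \<xi> using a(2)[of \<xi>] nn[of \<xi>] by (intro power_mono) auto
    show "(a (- \<xi>))\<^sup>2 = (a \<xi>)\<^sup>2" for \<xi> using weight_abs[OF a(1), of \<xi>] weight_abs[OF a(1), of "-\<xi>"] by simp
  qed (use assms in auto)
  have B: "0 \<le> B" "0 \<le> V" using L2bD(2)[OF b2[of 0]] L2bD(2)[OF bv[of 0]] t by auto
  \<comment> \<open>\<open>P\<close> asks for a large maximal frequency, so that the gain 1/rho is
    at most 1/K, and for non-resonance. Its complement is low frequency or resonant.\<close>
  define P where "P x y z \<longleftrightarrow> K \<le> rho x y z \<and> 1 \<le> rho x y z * \<bar>resfac \<epsilon> x y z\<bar>" for x y z
  define \<mu> where "\<mu> = symmul a"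
  note mC = mulconst_nonneg[of q]
  have m\<mu>: "measurable3 \<mu>"
    unfolding \<mu>_def symmul_def by measurable
  have mP: "Measurable.pred borel3 (\<lambda>(x, y, z). P x y z)"
    unfolding P_def using measurable_rho measurable_resfac[of \<epsilon>] by (simp add: split_beta')
  have mF[measurable]: "nrm F \<tau> \<in> borel_measurable borel" for \<tau> using curveD(1)[OF c] by auto
  have mDn[measurable]: "nrm D \<tau> \<in> borel_measurable borel" for \<tau> using curveD(2)[OF c] by auto
  have sym: "\<mu> y x z = \<mu> x y z" "\<mu> z y x = \<mu> x y z" "P y x z = P x y z" "P z y x = P x y z"
    "\<mu> x z y = \<mu> x y z" "P x z y = P x y z" for x y z
    by (simp_all add: \<mu>_def P_def swaps)
  {
    fix \<tau> assume \<tau>: "0 \<le> \<tau>" "\<tau> \<le> t"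
    define f v where "f = nrm F \<tau>" and "v = (\<lambda>x. ennreal (a x) * nrm F \<tau> x)"
    define g where "g = (\<lambda>x. ennreal \<bar>x\<bar> * nrm F \<tau> x)"
    have [measurable]: "f \<in> borel_measurable borel" "v \<in> borel_measurable borel" "g \<in> borel_measurable borel"
      unfolding f_def v_def g_def by measurable
    have feq: "nrm F \<tau> x = f x" for x by (simp add: f_def)
    have bnds: "L2b v V" "L1b f B" "L2b g B" "L2b f B"
      using bv[OF \<tau>] b1[OF \<tau>] bx[OF \<tau>] b2[OF \<tau>] by (simp_all add: f_def v_def g_def)
    have low: "trint (\<lambda>x y z. ennreal K * (f x * v y * v z)) \<le> ennreal (K * (B * V * V))"
      using K B by (intro trint_le_cmult trint_L1L2L2 bnds trimeas_prod mult_nonneg_nonneg) auto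
    have res: "trint (\<lambda>x y z. of_bool (\<bar>x\<bar> \<le> \<bar>y\<bar> \<and> \<bar>x\<bar> \<le> \<bar>z\<bar> \<and> resonant \<epsilon> x y z) * (g x * v y * v z)) \<le> ennreal (2 * (B * V * V))"
      by (rule trint_resonant) (use bnds assms in auto)
    have mres: "trimeas (\<lambda>x y z. of_bool (\<bar>x\<bar> \<le> \<bar>y\<bar> \<and> \<bar>x\<bar> \<le> \<bar>z\<bar> \<and> resonant \<epsilon> x y z) * (g x * v y * v z))"
    proof -
      have [measurable]: "(\<lambda>q. of_bool (\<bar>fst q\<bar> \<le> \<bar>fst (snd q)\<bar> \<and> \<bar>fst q\<bar> \<le> \<bar>snd (snd q)\<bar> \<and> resonant \<epsilon> (fst q) (fst (snd q)) (snd (snd q))) :: ennreal)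
          \<in> borel_measurable borel3"
        using measurable_resonant[of \<epsilon>] by (intro measurable_of_bool) (simp add: split_beta')
      show ?thesis unfolding split_beta' by measurable
    qed
    \<comment> \<open>After |x| has been isolated by \<open>symmul_min_bound\<close>, it is at most
      K at low frequency and otherwise joins \<open>f\<close> to form the L^2 function
      \<open>g\<close>, which \<open>trint_resonant\<close> can use.\<close>
    define H1 where "H1 x y z = ennreal (mulconst q) * (ennreal K * (f x * v y * v z)
        + of_bool (\<bar>x\<bar> \<le> \<bar>y\<bar> \<and> \<bar>x\<bar> \<le> \<bar>z\<bar> \<and> resonant \<epsilon> x y z) * (g x * v y * v z))" for x y z
    have mlow: "trimeas (\<lambda>x y z. ennreal K * (f x * v y * v z))" by measurable
    have mH1: "trimeas H1"
      unfolding H1_def by (rule trimeas_cmult[OF trimeas_add[OF mlow mres]])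
    have H1: "trint H1 \<le> ennreal (mulconst q * (K * (B * V * V) + 2 * (B * V * V)))"
      unfolding H1_def
      by (rule trint_le_cmult[OF trimeas_add[OF mlow mres] trint_le_add[OF mlow mres low res]]) (use K B mC in auto)
    have pw: "of_bool (\<not> P x y z) * ennreal \<bar>\<mu> x y z\<bar> * (f x * f y * f z) \<le> H1 x y z"
      if xyz: "x + y + z = 0" "\<bar>x\<bar> \<le> \<bar>y\<bar>" "\<bar>x\<bar> \<le> \<bar>z\<bar>" for x y z
    proof (cases "P x y z")
      case True then show ?thesis by simp
    next
      case False
      have "ennreal \<bar>\<mu> x y z\<bar> * (f x * f y * f z) \<le> ennreal (mulconst q * (\<bar>x\<bar> * (a y * a z))) * (f x * f y * f z)"
        unfolding \<mu>_def by (intro mult_right_mono ennreal_leI symmul_min_bound[OF a(1) xyz]) auto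
      also have "\<dots> = ennreal (mulconst q) * (ennreal \<bar>x\<bar> * (f x * v y * v z))"
        using nn mC by (simp add: ennreal_mult v_def f_def mult_ac)
      also have "\<dots> \<le> H1 x y z"
      proof (cases "rho x y z < K")
        case True
        have "\<bar>x\<bar> \<le> K" using abs_le_rho(1)[OF xyz(1)] True by simp
        then have "ennreal \<bar>x\<bar> * (f x * v y * v z) \<le> ennreal K * (f x * v y * v z)"
          by (intro mult_right_mono ennreal_leI) auto
        then show ?thesis unfolding H1_def by (intro mult_left_mono) (auto intro: order_trans add_increasing2)
      next
        case F: False
        have "resonant \<epsilon> x y z" using False F K unfolding P_def resonant_def by auto
        then have "ennreal \<bar>x\<bar> * (f x * v y * v z) = of_bool (\<bar>x\<bar> \<le> \<bar>y\<bar> \<and> \<bar>x\<bar> \<le> \<bar>z\<bar> \<and> resonant \<epsilon> x y z) * (g x * v y * v z)"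
          using xyz by (simp add: g_def f_def mult_ac)
        then show ?thesis unfolding H1_def by (intro mult_left_mono) (auto intro: order_trans add_increasing)
      qed
      finally show ?thesis using False by simp
    qed
    have e1: "trint (\<lambda>x y z. of_bool (\<not> P x y z) * ennreal \<bar>\<mu> x y z\<bar> * (nrm3 F F F \<tau> x y z))
       \<le> ennreal (3 * (mulconst q * (K * (B * V * V) + 2 * (B * V * V))))"
      unfolding feq
    proof (rule trint_symmetric_bound[OF mH1 H1])
      show "0 \<le> mulconst q * (K * (B * V * V) + 2 * (B * V * V))" using mC K B by auto
      fix x y z :: real assume xyz: "x + y + z = 0"
      have s: "y + x + z = 0" "z + y + x = 0" using xyz by auto
      show "of_bool (\<not> P x y z) * ennreal \<bar>\<mu> x y z\<bar> * (f x * f y * f z) \<le> H1 x y z + (H1 y x z + H1 z y x)"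
      proof (cases rule: min_cases[of x y z])
        case 1
        from pw[OF xyz 1] show ?thesis by (simp add: add_increasing2)
      next
        case 2
        from pw[OF s(1) 2] have "of_bool (\<not> P x y z) * ennreal \<bar>\<mu> x y z\<bar> * (f x * f y * f z) \<le> H1 y x z"
          by (simp add: sym mult_ac)
        then show ?thesis by (simp add: add_increasing add_increasing2)
      next
        case 3
        from pw[OF s(2) 3] have "of_bool (\<not> P x y z) * ennreal \<bar>\<mu> x y z\<bar> * (f x * f y * f z) \<le> H1 z y x"
          by (simp add: sym mult_ac)
        then show ?thesis by (simp add: add_increasing add_increasing2)
      qed
    qed
    have quot: "ennreal \<bar>\<mu> x y z / Phase \<epsilon> x y z\<bar> * ennreal (rho x y z) \<le> ennreal (2 * mulconst q) *
        (ennreal (a y) * ennreal (a z) + ennreal (a x) * ennreal (a z) + ennreal (a x) * ennreal (a y))"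
      if "x + y + z = 0" "P x y z" for x y z
      using symmul_quot_bound(1)[OF a(1) that(1), of \<epsilon>] that(2) nn mC
      by (simp add: P_def \<mu>_def ennreal_mult[symmetric] ennreal_plus[symmetric] ennreal_leI rho_def del: ennreal_plus)
    \<comment> \<open>Boundary terms: the gain 1/rho \<le> 1/K is simply kept as a small
      constant.\<close>
    define H2 where "H2 x y z = ennreal (2 * mulconst q / K) * (f x * v y * v z)" for x y z
    have mH2: "trimeas H2" unfolding H2_def by measurable
    have H2: "trint H2 \<le> ennreal (2 * mulconst q / K * (B * V * V))"
      unfolding H2_def using K B mC by (intro trint_le_cmult trint_L1L2L2 bnds trimeas_prod mult_nonneg_nonneg) auto
    have e2: "trint (\<lambda>x y z. of_bool (P x y z) * ennreal \<bar>\<mu> x y z / Phase \<epsilon> x y z\<bar> * (nrm3 F F F \<tau> x y z))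
       \<le> ennreal (3 * (2 * mulconst q / K * (B * V * V)))"
      unfolding feq
    proof (rule trint_symmetric_bound[OF mH2 H2])
      show "0 \<le> 2 * mulconst q / K * (B * V * V)" using mC K B by auto
      fix x y z :: real assume xyz: "x + y + z = 0"
      show "of_bool (P x y z) * ennreal \<bar>\<mu> x y z / Phase \<epsilon> x y z\<bar> * (f x * f y * f z) \<le> H2 x y z + (H2 y x z + H2 z y x)"
      proof (cases "P x y z")
        case True
        have "ennreal \<bar>\<mu> x y z / Phase \<epsilon> x y z\<bar> = ennreal (1 / K) * (ennreal \<bar>\<mu> x y z / Phase \<epsilon> x y z\<bar> * ennreal K)"
          using K by (simp add: ennreal_mult[symmetric])
        also have "\<dots> \<le> ennreal (1 / K) * (ennreal \<bar>\<mu> x y z / Phase \<epsilon> x y z\<bar> * ennreal (rho x y z))"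
          using True by (intro mult_left_mono ennreal_leI) (auto simp: P_def)
        also have "\<dots> \<le> ennreal (1 / K) * (ennreal (2 * mulconst q) *
            (ennreal (a y) * ennreal (a z) + ennreal (a x) * ennreal (a z) + ennreal (a x) * ennreal (a y)))"
          by (intro mult_left_mono quot[OF xyz True]) auto
        also have "\<dots> = ennreal (2 * mulconst q / K) *
            (ennreal (a y) * ennreal (a z) + ennreal (a x) * ennreal (a z) + ennreal (a x) * ennreal (a y))"
          using K mC by (simp add: ennreal_mult[symmetric] mult.assoc[symmetric])
        finally have "ennreal \<bar>\<mu> x y z / Phase \<epsilon> x y z\<bar> * (f x * f y * f z) \<le> ennreal (2 * mulconst q / K) *
            (ennreal (a y) * ennreal (a z) + ennreal (a x) * ennreal (a z) + ennreal (a x) * ennreal (a y)) * (f x * f y * f z)"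
          by (rule mult_right_mono) simp
        also have "\<dots> = H2 x y z + (H2 y x z + H2 z y x)"
          by (simp add: H2_def v_def f_def distrib_left distrib_right mult_ac add_ac)
        finally show ?thesis using True by simp
      qed simp
    qed
    \<comment> \<open>The time derivative of the profile is bounded by c0 |x| times this
      self-convolution.\<close>
    define r where "r = conv f f"
    define s where "s = (\<lambda>x. ennreal (a x) * r x)"
    have mr[measurable]: "r \<in> borel_measurable borel" unfolding r_def by measurable
    have ms[measurable]: "s \<in> borel_measurable borel" unfolding s_def by measurable
    have br: "L1b r (B * B)" unfolding r_def by (intro L1b_conv bnds)
    \<comment> \<open>The weight distributes over the convolution: a(x) \<le> 2^q (a(y) + a(x - y)),
      so one of the two factors carries it.\<close>
    have bs: "L2b s (2 ^ q * (B * V + B * V))"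
    proof (rule L2b_mono[OF L2b_cmult[OF L2b_add[OF L2b_conv[OF bnds(2,1)] L2b_conv[OF bnds(2,1)]]] _ ms order_refl])
      fix x
      have "s x = (\<integral>\<^sup>+y. ennreal (a x) * (f y * f (x - y)) \<partial>lborel)"
        unfolding s_def r_def conv_def by (rule nn_integral_cmult[symmetric]) measurable
      also have "\<dots> \<le> (\<integral>\<^sup>+y. ennreal (2 ^ q) * (f y * v (x - y) + v y * f (x - y)) \<partial>lborel)"
      proof (intro nn_integral_mono)
        fix y
        have "a x \<le> 2 ^ q * (a y + a (x - y))" using weight_add[OF a(1), of y "x - y"] by simp
        then have "ennreal (a x) \<le> ennreal (2 ^ q) * (ennreal (a y) + ennreal (a (x - y)))"
          using nn by (simp add: ennreal_mult[symmetric] ennreal_plus[symmetric] ennreal_leI del: ennreal_plus)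
        then have "ennreal (a x) * (f y * f (x - y)) \<le> ennreal (2 ^ q) * (ennreal (a y) + ennreal (a (x - y))) * (f y * f (x - y))"
          by (rule mult_right_mono) simp
        also have "\<dots> = ennreal (2 ^ q) * (f y * v (x - y) + v y * f (x - y))"
          by (simp add: v_def f_def distrib_left distrib_right mult_ac add_ac)
        finally show "ennreal (a x) * (f y * f (x - y)) \<le> ennreal (2 ^ q) * (f y * v (x - y) + v y * f (x - y))" .
      qed
      also have "\<dots> = ennreal (2 ^ q) * ((\<integral>\<^sup>+y. f y * v (x - y) \<partial>lborel) + (\<integral>\<^sup>+y. v y * f (x - y) \<partial>lborel))"
        by (subst nn_integral_cmult) (auto simp: nn_integral_add)
      also have "\<dots> = ennreal (2 ^ q) * (conv f v x + conv f v x)"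
        using conv_commute[of v f x] by (simp add: conv_def)
      finally show "s x \<le> ennreal (2 ^ q) * (conv f v x + conv f v x)" .
    qed simp
    define H3 where "H3 x y z = of_bool (P x y z) * ennreal \<bar>\<mu> x y z / Phase \<epsilon> x y z\<bar> * (nrm D \<tau> x * f y * f z)" for x y z
    have mH3: "trimeas H3"
    proof -
      have [measurable]: "(\<lambda>q. of_bool (P (fst q) (fst (snd q)) (snd (snd q))) :: ennreal) \<in> borel_measurable borel3"
        using mP by (intro measurable_of_bool) (simp add: split_beta')
      have [measurable]: "(\<lambda>q. \<mu> (fst q) (fst (snd q)) (snd (snd q))) \<in> borel_measurable borel3"
        "(\<lambda>q. Phase \<epsilon> (fst q) (fst (snd q)) (snd (snd q))) \<in> borel_measurable borel3"
        using m\<mu> measurable_Phase by (simp_all add: split_beta')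
      show ?thesis unfolding H3_def split_beta' by measurable
    qed
    define h3 where "h3 = 2 * mulconst q * c0 * (B * B * V * V + (2 ^ q * (B * V + B * V) * B * V + 2 ^ q * (B * V + B * V) * V * B))"
    have H3: "trint H3 \<le> ennreal h3"
    proof -
      have "trint H3 \<le> trint (\<lambda>x y z. ennreal (2 * mulconst q * c0) * (r x * v y * v z + (s x * f y * v z + s x * v y * f z)))"
      proof (rule trint_mono)
        fix x y z :: real assume xyz: "x + y + z = 0"
        show "H3 x y z \<le> ennreal (2 * mulconst q * c0) * (r x * v y * v z + (s x * f y * v z + s x * v y * f z))"
        proof (cases "P x y z")
          case True
          \<comment> \<open>The derivative |x| produced by the equation is at most rho, which is
            exactly what the non-resonant quotient gains.\<close>
          have "nrm D \<tau> x \<le> ennreal c0 * (ennreal \<bar>x\<bar> * r x)"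
            unfolding r_def f_def by (rule norm_DW_le)
          also have "\<dots> \<le> ennreal c0 * (ennreal (rho x y z) * r x)"
            by (intro mult_left_mono mult_right_mono ennreal_leI abs_le_rho(1)[OF xyz]) auto
          finally have "H3 x y z \<le> ennreal \<bar>\<mu> x y z / Phase \<epsilon> x y z\<bar> * (ennreal c0 * (ennreal (rho x y z) * r x) * f y * f z)"
            unfolding H3_def using True by (auto intro!: mult_left_mono mult_right_mono)
          also have "\<dots> = ennreal c0 * (ennreal \<bar>\<mu> x y z / Phase \<epsilon> x y z\<bar> * ennreal (rho x y z)) * (r x * f y * f z)"
            by (simp add: mult_ac)
          also have "\<dots> \<le> ennreal c0 * (ennreal (2 * mulconst q) *
              (ennreal (a y) * ennreal (a z) + ennreal (a x) * ennreal (a z) + ennreal (a x) * ennreal (a y))) * (r x * f y * f z)"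
            by (intro mult_left_mono mult_right_mono quot[OF xyz True]) auto
          also have "\<dots> = (ennreal c0 * ennreal (2 * mulconst q)) * (r x * v y * v z + (s x * f y * v z + s x * v y * f z))"
            by (simp add: v_def s_def f_def distrib_left distrib_right mult_ac add_ac)
          also have "ennreal c0 * ennreal (2 * mulconst q) = ennreal (2 * mulconst q * c0)"
            using c0 mC by (simp add: ennreal_mult[symmetric] mult_ac)
          finally show ?thesis .
        qed (simp add: H3_def)
      qed
      also have "\<dots> \<le> ennreal h3"
      proof -
        have m: "trimeas (\<lambda>x y z. r x * v y * v z)" "trimeas (\<lambda>x y z. s x * f y * v z)" "trimeas (\<lambda>x y z. s x * v y * f z)"
          by measurable
        show ?thesis
          unfolding h3_def
          by (rule trint_le_cmult[OF trimeas_add[OF m(1) trimeas_add[OF m(2,3)]] trint_le_add[OF m(1) trimeas_add[OF m(2,3)]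
                  trint_L1L2L2[OF br bnds(1,1)] trint_le_add[OF m(2,3) trint_L2L1L2[OF bs bnds(2,1)] trint_L2L2L1[OF bs bnds(1,2)]]]])
            (use c0 mC B in auto)
      qed
      finally show ?thesis .
    qed
    have e3: "trint (\<lambda>x y z. of_bool (P x y z) * ennreal \<bar>\<mu> x y z / Phase \<epsilon> x y z\<bar> *
        (dnrm3 F D F D F D \<tau> x y z)) \<le> ennreal (3 * h3)"
    proof (rule trint_symmetric_bound[OF mH3 H3])
      show "0 \<le> h3" using mC B c0 by (auto simp: h3_def)
      fix x y z :: real
      show "of_bool (P x y z) * ennreal \<bar>\<mu> x y z / Phase \<epsilon> x y z\<bar> *
        (dnrm3 F D F D F D \<tau> x y z) \<le> H3 x y z + (H3 y x z + H3 z y x)"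
      proof -
        define k where "k x y z = of_bool (P x y z) * ennreal \<bar>\<mu> x y z / Phase \<epsilon> x y z\<bar>" for x y z
        have "k y x z = k x y z" "k z y x = k x y z"
          by (simp_all add: k_def sym swaps)
        then have "H3 y x z = k x y z * (nrm D \<tau> y * f x * f z)" "H3 z y x = k x y z * (nrm D \<tau> z * f y * f x)"
          "H3 x y z = k x y z * (nrm D \<tau> x * f y * f z)"
          by (simp_all only: H3_def k_def)
        then show ?thesis
          unfolding k_def[symmetric] by (simp add: f_def distrib_left mult_ac add_ac)
      qed
    qed
    note e1 e2 e3[unfolded h3_def]
  } note slices = this
  \<comment> \<open>A crude bound in terms of M, needed for integrability only.\<close>
  have bound\<mu>: "trint (\<lambda>x y z. ennreal \<bar>\<mu> x y z\<bar> * (nrm3 F F F \<tau> x y z)) \<le> ennreal (3 * (M\<^sup>2 * B * B * B))"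
    if \<tau>: "0 \<le> \<tau>" "\<tau> \<le> t" for \<tau>
  proof (rule trint_symmetric_bound[OF trimeas_norm[OF c c c measurable_mu0] mu0_bound[OF \<tau>]])
    fix x y z :: real
    have "\<bar>\<mu> x y z\<bar> \<le> \<bar>mu0 x y z\<bar> + (\<bar>mu0 y x z\<bar> + \<bar>mu0 z y x\<bar>)"
      unfolding \<mu>_def symmul_def mu0_def by linarith
    then have "ennreal \<bar>\<mu> x y z\<bar> \<le> ennreal \<bar>mu0 x y z\<bar> + (ennreal \<bar>mu0 y x z\<bar> + ennreal \<bar>mu0 z y x\<bar>)"
      by (simp add: ennreal_plus[symmetric] ennreal_leI del: ennreal_plus)
    then have "ennreal \<bar>\<mu> x y z\<bar> * (nrm3 F F F \<tau> x y z)
       \<le> (ennreal \<bar>mu0 x y z\<bar> + (ennreal \<bar>mu0 y x z\<bar> + ennreal \<bar>mu0 z y x\<bar>)) * (nrm3 F F F \<tau> x y z)"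
      by (rule mult_right_mono) simp
    then show "ennreal \<bar>\<mu> x y z\<bar> * (nrm3 F F F \<tau> x y z) \<le>
      ennreal \<bar>mu0 x y z\<bar> * (nrm3 F F F \<tau> x y z) +
      (ennreal \<bar>mu0 y x z\<bar> * (nrm3 F F F \<tau> y x z) + ennreal \<bar>mu0 z y x\<bar> * (nrm3 F F F \<tau> z y x))"
      by (simp add: distrib_left distrib_right mult_ac)
  qed (use B in auto)
  note int\<mu> = oscil_integrable[OF c c c m\<mu> measurable_Phase bound\<mu>]
  \<comment> \<open>\<open>g1\<close> and \<open>g2\<close> are \<open>g\<close> with the derivative
    in the second and third slot. The three integrals agree, and their integrands add up to the
    symmetrised one.\<close>
  have sl: "(LINT p|lborel2. oscil mu0 (Phase \<epsilon>) F F F \<tau> p) = (1 / 3) * (LINT p|lborel2. oscil \<mu> (Phase \<epsilon>) F F F \<tau> p)"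
    if \<tau>: "0 \<le> \<tau>" "\<tau> \<le> t" for \<tau>
  proof -
    define g where "g = oscil mu0 (Phase \<epsilon>) F F F \<tau>"
    have gi: "integrable lborel2 g" unfolding g_def by (rule oscil_mu0_integrable) (use \<tau> in auto)
    define g1 where "g1 = (\<lambda>p. g (snd p, fst p))"
    define g2 where "g2 = (\<lambda>p. g1 (fst p, - fst p - snd p))"
    have i1: "(LINT p|lborel2. g1 p) = (LINT p|lborel2. g p)" "integrable lborel2 g1"
      unfolding g1_def by (rule lborel_pair_integral_swap[OF gi])+
    have i2: "(LINT p|lborel2. g2 p) = (LINT p|lborel2. g p)" "integrable lborel2 g2"
      unfolding g2_def using lborel_pair_integral_shear[OF i1(2)] i1(1) by simp_all
    have "oscil \<mu> (Phase \<epsilon>) F F F \<tau> p = g p + g1 p + g2 p" for p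
    proof -
      define x y z where "x = fst p" and "y = snd p" and "z = - fst p - snd p"
      have z: "- y - x = z" "- z - x = y" "- x - y = z" by (simp_all add: x_def y_def z_def)
      have "g p = complex_of_real (x * (a x)\<^sup>2) * (cis (\<tau> * Phase \<epsilon> x y z) * (F \<tau> x * F \<tau> y * F \<tau> z))"
        by (simp add: g_def oscil_def mu0_def x_def y_def z_def mult.assoc)
      moreover have "g1 p = complex_of_real (y * (a y)\<^sup>2) * (cis (\<tau> * Phase \<epsilon> x y z) * (F \<tau> x * F \<tau> y * F \<tau> z))"
        unfolding g1_def g_def oscil_def mu0_def fst_conv snd_conv x_def[symmetric] y_def[symmetric] z Phase_swap12[of \<epsilon> y x z]
        by (simp add: mult_ac)
      moreover have "g2 p = complex_of_real (z * (a z)\<^sup>2) * (cis (\<tau> * Phase \<epsilon> x y z) * (F \<tau> x * F \<tau> y * F \<tau> z))"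
      proof -
        have "Phase \<epsilon> z x y = Phase \<epsilon> x y z" by (simp add: Phase_def)
        then show ?thesis
          unfolding g2_def g1_def g_def oscil_def mu0_def fst_conv snd_conv x_def[symmetric] y_def[symmetric] z
          by (simp add: mult_ac)
      qed
      moreover have "oscil \<mu> (Phase \<epsilon>) F F F \<tau> p = complex_of_real (\<mu> x y z) * (cis (\<tau> * Phase \<epsilon> x y z) * (F \<tau> x * F \<tau> y * F \<tau> z))"
        by (simp add: oscil_def x_def y_def z_def mult.assoc)
      ultimately show ?thesis
        by (simp only: \<mu>_def symmul_def of_real_add distrib_right)
    qed
    then have "(LINT p|lborel2. oscil \<mu> (Phase \<epsilon>) F F F \<tau> p) = (LINT p|lborel2. g p + g1 p + g2 p)"
      by simp
    also have "\<dots> = 3 * (LINT p|lborel2. g p)"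
      using gi i1 i2 by simp
    finally show ?thesis by (simp add: g_def)
  qed
  \<comment> \<open>Each constant carries the 3 of \<open>trint_symmetric_bound\<close>, which
    cancels the 1/3 of the symmetrisation.\<close>
  define c1 c2 c3 where "c1 = 3 * (mulconst q * (K * (B * V * V) + 2 * (B * V * V)))"
    and "c2 = 3 * (2 * mulconst q / K * (B * V * V))"
    and "c3 = 3 * (2 * mulconst q * c0 * (B * B * V * V + (2 ^ q * (B * V + B * V) * B * V + 2 ^ q * (B * V + B * V) * V * B)))"
  have cn: "0 \<le> c1" "0 \<le> c2" "0 \<le> c3" using mC K B c0 by (auto simp: c1_def c2_def c3_def)
  have osc: "cmod (osc_int t \<mu> (Phase \<epsilon>) F F F) \<le> t * c1 + 2 * c2 + t * c3"
  proof (rule oscillatory_bound[where P = P, OF t c c c m\<mu> measurable_Phase mP _ int\<mu>(1) _ _ _ cn])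
    show "\<mu> x y z = 0" if "x + y + z = 0" "P x y z" "Phase \<epsilon> x y z = 0" for x y z
      using symmul_quot_bound(2)[OF a(1) that(1), of \<epsilon>] that by (simp add: P_def \<mu>_def)
  qed (use slices in \<open>simp_all only: c1_def c2_def c3_def\<close>)
  have "energy t - energy 0 = - 2 * c0 * Im (osc_int t mu0 (Phase \<epsilon>) F F F)"
    by (rule energy_identity)
  also have "(osc_int t mu0 (Phase \<epsilon>) F F F)
     = (LINT \<tau>|lborel. (1 / 3) * (indicator {0..t} \<tau> *\<^sub>R (LINT p|lborel2. oscil \<mu> (Phase \<epsilon>) F F F \<tau> p)))"
    using sl by (intro Bochner_Integration.integral_cong refl) (auto simp: indicator_def)
  also have "\<dots> = (1 / 3) * (osc_int t \<mu> (Phase \<epsilon>) F F F)"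
    by (rule Bochner_Integration.integral_mult_right_zero)
  finally have "\<bar>energy t - energy 0\<bar> = 2 * c0 / 3 * \<bar>Im (osc_int t \<mu> (Phase \<epsilon>) F F F)\<bar>"
    using c0 by (simp add: abs_mult)
  also have "\<dots> \<le> 2 * c0 / 3 * (t * c1 + 2 * c2 + t * c3)"
    using c0 by (intro mult_left_mono order_trans[OF abs_Im_le_cmod osc]) auto
  also have "\<dots> = 2 * c0 * mulconst q * (t * (K + 2) + 4 / K + t * (2 * c0 * (1 + 2 ^ (q + 2)) * B)) * B * V\<^sup>2"
    using K by (simp add: c1_def c2_def c3_def power_add power2_eq_square field_simps)
  finally show ?thesis by (simp add: energy_def)
qed

section \<open>The estimate for differences\<close>

text \<open>The Japanese bracket.\<close>

definition jb :: "real \<Rightarrow> real" where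
  "jb x = sqrt (1 + x\<^sup>2)"

lemma jb_ge: "1 \<le> jb x" "\<bar>x\<bar> \<le> jb x" "0 < jb x"
  by (auto simp: jb_def intro: real_le_rsqrt add_pos_nonneg)

lemma jb_power2: "(jb x)\<^sup>2 = 1 + x\<^sup>2"
  by (simp add: jb_def add_nonneg_nonneg)

lemma measurable_jb [measurable]: "jb \<in> borel_measurable borel"
  unfolding jb_def[abs_def] by measurable

text \<open>The squared norm is \<pi>, which is at most 4. This is how an H^1 bound controls the L^1
  norm of the Fourier transform.\<close>

lemma L2b_inverse_jb: "L2b (\<lambda>x. ennreal (1 / jb x)) 2"
proof -
  have half: "(\<integral>\<^sup>+x. ennreal (inverse (1 + x\<^sup>2)) * indicator {0..} x \<partial>lborel) = ennreal (pi / 2 - arctan 0)"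
    by (rule nn_integral_FTC_atLeast)
      (auto intro!: derivative_eq_intros tendsto_arctan_at_top simp: add_nonneg_nonneg)
  have half': "(\<integral>\<^sup>+x. ennreal (inverse (1 + x\<^sup>2)) * indicator {..0} x \<partial>lborel) = ennreal (pi / 2 - arctan 0)"
  proof -
    have "(\<integral>\<^sup>+x. ennreal (inverse (1 + x\<^sup>2)) * indicator {..0} x \<partial>lborel) = (\<integral>\<^sup>+x. ennreal (inverse (1 + x\<^sup>2)) * indicator {0..} x \<partial>lborel)"
      by (subst nn_integral_lborel_reflect[of _ 0, symmetric]) (auto intro!: nn_integral_cong simp: indicator_def)
    then show ?thesis using half by simp
  qed
  have "(\<integral>\<^sup>+x. (ennreal (1 / jb x))\<^sup>2 \<partial>lborel) \<le> (\<integral>\<^sup>+x. ennreal (inverse (1 + x\<^sup>2)) * indicator {0..} x + ennreal (inverse (1 + x\<^sup>2)) * indicator {..0} x \<partial>lborel)"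
  proof (intro nn_integral_mono)
    fix x :: real
    have "(ennreal (1 / jb x))\<^sup>2 = ennreal (inverse (1 + x\<^sup>2))"
      using jb_ge(3)[of x] by (simp add: ennreal_power power_divide jb_power2 inverse_eq_divide)
    then show "(ennreal (1 / jb x))\<^sup>2 \<le> ennreal (inverse (1 + x\<^sup>2)) * indicator {0..} x + ennreal (inverse (1 + x\<^sup>2)) * indicator {..0} x"
      by (auto simp: indicator_def)
  qed
  also have "\<dots> = ennreal (pi / 2) + ennreal (pi / 2)"
    using half half' by (subst nn_integral_add) auto
  also have "\<dots> = ennreal pi"
    by (simp add: ennreal_plus[symmetric] del: ennreal_plus)
  also have "\<dots> \<le> ennreal (2\<^sup>2)"
    using pi_less_4 by (intro ennreal_leI) simp
  finally show ?thesis
    by (simp add: L2b_def)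
qed

text \<open>For differences only the L^2 norm V of W may enter, so an L^1 factor has to be produced
  from it: here by restriction to low frequencies, in the next lemma by a gained factor
  1/|x|.\<close>

lemma L1b_low:
  assumes "L2b F V" "1 \<le> K"
  shows "L1b (\<lambda>x. of_bool (\<bar>x\<bar> \<le> K) * F x) (2 * K * V)"
proof -
  note [measurable] = L2bD(1)[OF assms(1)]
  have [measurable]: "(\<lambda>x::real. of_bool (\<bar>x\<bar> \<le> K) :: ennreal) \<in> borel_measurable borel"
    by (rule measurable_of_bool) measurable
  have "L2b (\<lambda>x. of_bool (\<bar>x\<bar> \<le> K)) (2 * K)"
    unfolding L2b_def
  proof (intro conjI)
    have "(\<integral>\<^sup>+x. (of_bool (\<bar>x\<bar> \<le> K))\<^sup>2 \<partial>lborel) = (\<integral>\<^sup>+x. indicator {- K..K} x \<partial>lborel)"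
      by (intro nn_integral_cong) (auto simp: indicator_def abs_le_iff)
    also have "\<dots> = ennreal (2 * K)" using assms by simp
    also have "\<dots> \<le> ennreal ((2 * K)\<^sup>2)" using assms(2) by (intro ennreal_leI) (simp add: power2_eq_square)
    finally show "(\<integral>\<^sup>+x. (of_bool (\<bar>x\<bar> \<le> K))\<^sup>2 \<partial>lborel) \<le> ennreal ((2 * K)\<^sup>2)" .
  qed (use assms in auto)
  from L1b_mult[OF this assms(1)] show ?thesis .
qed

text \<open>For |x| \<ge> 1 the bracket is at most 2|x|, so 1/|x| has L^2 norm at most twice that of
  1/jb.\<close>

lemma L1b_div:
  assumes "L2b F V" "1 \<le> K"
  shows "L1b (\<lambda>x. ennreal (if K \<le> \<bar>x\<bar> then 1 / \<bar>x\<bar> else 0) * F x) (4 * V)"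
proof -
  note [measurable] = L2bD(1)[OF assms(1)]
  have "L2b (\<lambda>x. ennreal 2 * ennreal (1 / jb x)) (2 * 2)"
    by (rule L2b_cmult[OF L2b_inverse_jb]) simp
  then have "L2b (\<lambda>x. ennreal (if K \<le> \<bar>x\<bar> then 1 / \<bar>x\<bar> else 0)) (2 * 2)"
  proof (rule L2b_mono)
    fix x :: real
    have "jb x \<le> 2 * \<bar>x\<bar>" if "K \<le> \<bar>x\<bar>"
      unfolding jb_def
    proof (rule real_le_lsqrt)
      have "1 * 1 \<le> \<bar>x\<bar> * \<bar>x\<bar>" using that assms(2) by (intro mult_mono) auto
      then show "1 + x\<^sup>2 \<le> (2 * \<bar>x\<bar>)\<^sup>2" by (simp add: power2_eq_square)
    qed (auto)
    then have "(if K \<le> \<bar>x\<bar> then 1 / \<bar>x\<bar> else 0) \<le> 2 * (1 / jb x)"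
      using jb_ge(3)[of x] assms(2) by (auto simp: field_simps)
    then show "ennreal (if K \<le> \<bar>x\<bar> then 1 / \<bar>x\<bar> else 0) \<le> ennreal 2 * ennreal (1 / jb x)"
      using jb_ge(3)[of x] by (subst ennreal_mult[symmetric]) (auto intro: ennreal_leI)
  qed auto
  from L1b_mult[OF this assms(1)] show ?thesis by simp
qed

text \<open>\<open>trint_resonant\<close> once for each choice of the smallest variable.\<close>

lemma trint_resonant2:
  assumes "0 < \<epsilon>" "L2b F A" "L2b G B" "L2b H C"
  shows "trint (\<lambda>x y z. of_bool (resonant \<epsilon> x y z) * (F x * G y * H z)) \<le> ennreal (6 * (A * B * C))"
proof -
  note [measurable] = L2bD(1)[OF assms(2)] L2bD(1)[OF assms(3)] L2bD(1)[OF assms(4)]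
  have pos: "0 \<le> A * B * C" using L2bD(2)[OF assms(2)] L2bD(2)[OF assms(3)] L2bD(2)[OF assms(4)] by auto
  define R where "R x y z \<longleftrightarrow> \<bar>x\<bar> \<le> \<bar>y\<bar> \<and> \<bar>x\<bar> \<le> \<bar>z\<bar> \<and> resonant \<epsilon> x y z" for x y z
  have [measurable]: "(\<lambda>q. of_bool (R (fst q) (fst (snd q)) (snd (snd q))) :: ennreal) \<in> borel_measurable borel3"
    unfolding R_def using measurable_resonant[of \<epsilon>] by (intro measurable_of_bool) (simp add: split_beta')
  have m: "trimeas (\<lambda>x y z. of_bool (R x y z) * (F x * G y * H z))" "trimeas (\<lambda>x y z. of_bool (R x y z) * (G x * F y * H z))"
    "trimeas (\<lambda>x y z. of_bool (R x y z) * (H x * G y * F z))"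
    unfolding split_beta' by measurable
  have "trint (\<lambda>x y z. of_bool (resonant \<epsilon> x y z) * (F x * G y * H z)) \<le>
      trint (\<lambda>x y z. of_bool (R x y z) * (F x * G y * H z) + (of_bool (R y x z) * (G y * F x * H z) + of_bool (R z y x) * (H z * G y * F x)))"
  proof (rule trint_mono)
    fix x y z :: real
    show "of_bool (resonant \<epsilon> x y z) * (F x * G y * H z) \<le> of_bool (R x y z) * (F x * G y * H z) + (of_bool (R y x z) * (G y * F x * H z) + of_bool (R z y x) * (H z * G y * F x))"
    proof (cases rule: min_cases[of x y z])
      case 1
      then have "resonant \<epsilon> x y z = R x y z" by (simp add: R_def)
      then show ?thesis by (simp add: add_increasing2)
    next
      case 2
      then have "resonant \<epsilon> x y z = R y x z" by (simp add: R_def resonant_swap12)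
      then show ?thesis by (simp add: add_increasing add_increasing2 mult_ac)
    next
      case 3
      then have "resonant \<epsilon> x y z = R z y x" by (simp add: R_def resonant_swap13)
      then show ?thesis by (simp add: add_increasing add_increasing2 mult_ac)
    qed
  qed
  also have "\<dots> \<le> ennreal (2 * (A * B * C) + (2 * (B * A * C) + 2 * (C * B * A)))"
  proof (rule trint_le_add[OF m(1) trimeas_add[OF trimeas_swap12[OF m(2)] trimeas_swap13[OF m(3)]] _ trint_le_add[OF trimeas_swap12[OF m(2)] trimeas_swap13[OF m(3)]]])
    show "trint (\<lambda>x y z. of_bool (R x y z) * (F x * G y * H z)) \<le> ennreal (2 * (A * B * C))"
      unfolding R_def by (rule trint_resonant[OF assms])
    show "trint (\<lambda>x y z. of_bool (R y x z) * (G y * F x * H z)) \<le> ennreal (2 * (B * A * C))"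
      using trint_swap12[OF m(2)] trint_resonant[OF assms(1,3,2,4)] by (simp add: R_def)
    show "trint (\<lambda>x y z. of_bool (R z y x) * (H z * G y * F x)) \<le> ennreal (2 * (C * B * A))"
      using trint_swap13[OF m(3)] trint_resonant[OF assms(1,4,3,2)] by (simp add: R_def)
  qed (use pos in \<open>auto simp: mult_ac\<close>)
  finally show ?thesis by (simp add: mult_ac)
qed

text \<open>|x| \<le> |x - y| + |y| puts the derivative on one factor, while the other stays in L^1.
  This bounds the time derivative of a profile in L^2.\<close>

lemma L2b_abs_conv:
  assumes "L1b F A" "L2b F A'" "L2b (\<lambda>x. ennreal \<bar>x\<bar> * F x) A"
  shows "L2b (\<lambda>x. ennreal \<bar>x\<bar> * conv F F x) (2 * (A * A))"
proof -
  note [measurable] = L1bD(1)[OF assms(1)]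
  define G where "G = (\<lambda>x. ennreal \<bar>x\<bar> * F x)"
  have [measurable]: "G \<in> borel_measurable borel" unfolding G_def by measurable
  have G: "L2b G A" using assms(3) by (simp add: G_def)
  have "L2b (\<lambda>x. conv F G x + conv F G x) (A * A + A * A)"
    by (rule L2b_add[OF L2b_conv[OF assms(1) G] L2b_conv[OF assms(1) G]])
  then show ?thesis
  proof (rule L2b_mono)
    fix x
    have "ennreal \<bar>x\<bar> * conv F F x = (\<integral>\<^sup>+y. ennreal \<bar>x\<bar> * (F y * F (x - y)) \<partial>lborel)"
      unfolding conv_def by (rule nn_integral_cmult[symmetric]) measurable
    also have "\<dots> \<le> (\<integral>\<^sup>+y. F y * G (x - y) + G y * F (x - y) \<partial>lborel)"
    proof (intro nn_integral_mono)
      fix y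
      have "\<bar>x\<bar> \<le> \<bar>x - y\<bar> + \<bar>y\<bar>" by linarith
      then have "ennreal \<bar>x\<bar> \<le> ennreal \<bar>x - y\<bar> + ennreal \<bar>y\<bar>"
        by (simp add: ennreal_plus[symmetric] ennreal_leI del: ennreal_plus)
      then have "ennreal \<bar>x\<bar> * (F y * F (x - y)) \<le> (ennreal \<bar>x - y\<bar> + ennreal \<bar>y\<bar>) * (F y * F (x - y))"
        by (rule mult_right_mono) simp
      then show "ennreal \<bar>x\<bar> * (F y * F (x - y)) \<le> F y * G (x - y) + G y * F (x - y)"
        by (simp add: G_def distrib_left distrib_right mult_ac)
    qed
    also have "\<dots> = conv F G x + conv G F x"
      unfolding conv_def by (rule nn_integral_add) measurable
    also have "conv G F x = conv F G x" by (rule conv_commute) measurable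
    finally show "ennreal \<bar>x\<bar> * conv F F x \<le> conv F G x + conv F G x" .
  qed (use assms in \<open>auto simp: measurable_conv\<close>)
qed

text \<open>The multiplier y divides the phase xyzm. What remains is 1/(xzm), and non-resonance
  replaces 1/|m| by rho.\<close>

lemma diff_quot_bound:
  assumes xyz: "x + y + z = 0" and K: "1 \<le> K" "K \<le> \<bar>x\<bar>" "K \<le> \<bar>z\<bar>"
    and nr: "1 \<le> rho x y z * \<bar>resfac \<epsilon> x y z\<bar>"
  shows "\<bar>y / Phase \<epsilon> x y z\<bar> \<le> rho x y z / (\<bar>x\<bar> * \<bar>z\<bar>)" and "Phase \<epsilon> x y z = 0 \<Longrightarrow> y = 0"
proof -
  have r: "0 < rho x y z" using K by (simp add: rho_def)
  then have m: "0 < \<bar>resfac \<epsilon> x y z\<bar>" using nr by (cases "resfac \<epsilon> x y z = 0") auto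
  have xz: "0 < \<bar>x\<bar> * \<bar>z\<bar>" using K by (intro mult_pos_pos) auto
  show "Phase \<epsilon> x y z = 0 \<Longrightarrow> y = 0"
    using m xz by (auto simp: Phase_eq[OF xyz])
  show "\<bar>y / Phase \<epsilon> x y z\<bar> \<le> rho x y z / (\<bar>x\<bar> * \<bar>z\<bar>)"
  proof (cases "y = 0")
    case True
    then show ?thesis using r xz by simp
  next
    case False
    have "\<bar>y / Phase \<epsilon> x y z\<bar> = 1 / (\<bar>x\<bar> * \<bar>z\<bar> * \<bar>resfac \<epsilon> x y z\<bar>)"
      using False by (simp add: Phase_eq[OF xyz] abs_divide abs_mult)
    also have "\<dots> \<le> rho x y z / (\<bar>x\<bar> * \<bar>z\<bar>)"
    proof -
      have "x \<noteq> 0" "z \<noteq> 0" using K by auto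
      then show ?thesis using nr m by (simp add: field_simps)
    qed
    finally show ?thesis .
  qed
qed

text \<open>The first bound yields a factor 1/|x| or 1/|z|, enough for smallness or for an L^1 norm.
  The second is for the case in which the time derivative of W brings a factor |x|: the surplus |y|
  then falls on Z, where a derivative is available.\<close>

lemma rho_quot_bound:
  assumes xyz: "x + y + z = 0" and x: "0 < \<bar>x\<bar>" and z: "0 < \<bar>z\<bar>"
  shows "rho x y z / (\<bar>x\<bar> * \<bar>z\<bar>) \<le> 2 * (1 / \<bar>x\<bar> + 1 / \<bar>z\<bar>)"
    and "\<bar>x\<bar> * (rho x y z / (\<bar>x\<bar> * \<bar>z\<bar>)) \<le> 1 + \<bar>y\<bar> * (1 / \<bar>z\<bar>)"
proof -
  have "rho x y z \<le> 2 * (\<bar>x\<bar> + \<bar>z\<bar>)" "rho x y z \<le> \<bar>z\<bar> + \<bar>y\<bar>"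
    using xyz unfolding rho_def by (auto simp: abs_if)
  then show "rho x y z / (\<bar>x\<bar> * \<bar>z\<bar>) \<le> 2 * (1 / \<bar>x\<bar> + 1 / \<bar>z\<bar>)" "\<bar>x\<bar> * (rho x y z / (\<bar>x\<bar> * \<bar>z\<bar>)) \<le> 1 + \<bar>y\<bar> * (1 / \<bar>z\<bar>)"
    using x z by (simp_all add: field_simps)
qed

text \<open>The integral is symmetric in the two slots x and z of W only. Averaging the multiplier x
  over them gives (x + z)/2 = -y/2, so the derivative moves from W to Z and the L^2 norm of W
  suffices. \<open>B2\<close> bounds the time derivative of Z.\<close>

theorem difference_step:
  fixes W DW Z DZ :: evolution and \<epsilon> c0 t B B2 V K :: real
  assumes "0 < \<epsilon>" and cW: "curve W DW" and cZ: "curve Z DZ"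
    and real: "\<And>\<tau> \<xi>. W \<tau> (- \<xi>) = cnj (W \<tau> \<xi>)"
    and DW: "\<And>\<tau> \<xi>. DW \<tau> \<xi> = - \<i> * complex_of_real (c0 * \<xi>) * cis (- (\<tau> * phase \<epsilon> \<xi>)) *
        interaction \<epsilon> \<tau> (Z \<tau>) (W \<tau>) \<xi>"
    and t: "0 \<le> t" and c0: "0 \<le> c0" and K: "1 \<le> K"
    and bW: "\<And>\<tau>. 0 \<le> \<tau> \<Longrightarrow> \<tau> \<le> t \<Longrightarrow> L2b (nrm W \<tau>) V"
    and bxW: "\<And>\<tau>. 0 \<le> \<tau> \<Longrightarrow> \<tau> \<le> t \<Longrightarrow> L2b (\<lambda>x. ennreal \<bar>x\<bar> * nrm W \<tau> x) B"
    and bZ: "\<And>\<tau>. 0 \<le> \<tau> \<Longrightarrow> \<tau> \<le> t \<Longrightarrow> L1b (nrm Z \<tau>) B"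
    and bxZ: "\<And>\<tau>. 0 \<le> \<tau> \<Longrightarrow> \<tau> \<le> t \<Longrightarrow> L2b (\<lambda>x. ennreal \<bar>x\<bar> * nrm Z \<tau> x) B"
    and DZ: "\<And>\<tau> x. 0 \<le> \<tau> \<Longrightarrow> \<tau> \<le> t \<Longrightarrow> nrm DZ \<tau> x \<le> G \<tau> x"
    and bG: "\<And>\<tau>. 0 \<le> \<tau> \<Longrightarrow> \<tau> \<le> t \<Longrightarrow> L2b (G \<tau>) B2"
  shows "\<bar>(LINT \<xi>|lborel. (cmod (W t \<xi>))\<^sup>2) - (LINT \<xi>|lborel. (cmod (W 0 \<xi>))\<^sup>2)\<bar>
    \<le> 2 * c0 * (t * ((2 * K + 3) * B) + 4 * B / K + t * (8 * B2 + 10 * c0 * B\<^sup>2)) * V\<^sup>2"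
proof -
  interpret flow \<epsilon> c0 t 1 B V W DW Z DZ "\<lambda>x. 1"
    by unfold_locales (use assms in auto)
  have B: "0 \<le> B" "0 \<le> V" "0 \<le> B2"
    using L2bD(2)[OF bxW[of 0]] L2bD(2)[OF bW[of 0]] L2bD(2)[OF bG[of 0]] t by auto
  \<comment> \<open>Now both frequencies of W must be large, because the gain is 1/|x| + 1/|z| and
    not a power of the maximum.\<close>
  define P where "P x y z \<longleftrightarrow> K \<le> \<bar>x\<bar> \<and> K \<le> \<bar>z\<bar> \<and> 1 \<le> rho x y z * \<bar>resfac \<epsilon> x y z\<bar>" for x y z
  define \<mu> :: kernel where "\<mu> x y z = - (y / 2)" for x y z
  have m\<mu>: "measurable3 \<mu>"
    unfolding \<mu>_def by measurable
  have mP: "Measurable.pred borel3 (\<lambda>(x, y, z). P x y z)"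
    unfolding P_def using measurable_rho measurable_resfac[of \<epsilon>] by (simp add: split_beta')
  have P1: "\<bar>\<mu> x y z / Phase \<epsilon> x y z\<bar> \<le> rho x y z / (\<bar>x\<bar> * \<bar>z\<bar>) / 2" "0 < \<bar>x\<bar>" "0 < \<bar>z\<bar>"
    if "x + y + z = 0" "P x y z" for x y z
    using diff_quot_bound(1)[OF that(1) K, of \<epsilon>] that(2) K by (auto simp: P_def \<mu>_def abs_mult)
  {
    fix \<tau> assume \<tau>: "0 \<le> \<tau>" "\<tau> \<le> t"
    define w z where "w = nrm W \<tau>" and "z = nrm Z \<tau>"
    define xz where "xz = (\<lambda>x. ennreal \<bar>x\<bar> * nrm Z \<tau> x)"
    define lo where "lo = (\<lambda>x. of_bool (\<bar>x\<bar> \<le> K) * w x)"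
    define hi where "hi = (\<lambda>x. ennreal (if K \<le> \<bar>x\<bar> then 1 / \<bar>x\<bar> else 0) * w x)"
    define r where "r = conv z w"
    have bw: "L2b w V" and bz: "L1b z B" and bxz: "L2b xz B" and blo: "L1b lo (2 * K * V)" and bhi: "L1b hi (4 * V)"
      and bg: "L2b (G \<tau>) B2"
      using bW[OF \<tau>] bZ[OF \<tau>] bxZ[OF \<tau>] L1b_low[OF bW[OF \<tau>] K] L1b_div[OF bW[OF \<tau>] K] bG[OF \<tau>]
      by (simp_all add: w_def z_def xz_def lo_def hi_def)
    have br: "L2b r (B * V)" unfolding r_def by (rule L2b_conv[OF bz bw])
    note [measurable] = L2bD(1)[OF bw] L1bD(1)[OF bz] L2bD(1)[OF bxz] L1bD(1)[OF blo] L1bD(1)[OF bhi] L2bD(1)[OF bg] L2bD(1)[OF br]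
    have feq: "nrm W \<tau> x = w x" "nrm Z \<tau> x = z x" for x by (simp_all add: w_def z_def)
    have m1: "trimeas (\<lambda>x y zz. lo x * xz y * w zz)" "trimeas (\<lambda>x y zz. w x * xz y * lo zz)"
      by measurable
    have m2: "trimeas (\<lambda>x y zz. of_bool (resonant \<epsilon> x y zz) * (w x * xz y * w zz))"
    proof -
      have [measurable]: "(\<lambda>q. of_bool (resonant \<epsilon> (fst q) (fst (snd q)) (snd (snd q))) :: ennreal) \<in> borel_measurable borel3"
        using measurable_resonant[of \<epsilon>] by (intro measurable_of_bool) (simp add: split_beta')
      show ?thesis unfolding split_beta' by measurable
    qed
    have e1: "trint (\<lambda>x y zz. of_bool (\<not> P x y zz) * ennreal \<bar>\<mu> x y zz\<bar> * (nrm3 W Z W \<tau> x y zz))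
       \<le> ennreal (1 / 2 * (2 * K * V * B * V + (V * B * (2 * K * V) + 6 * (V * B * V))))"
    proof -
      have "trint (\<lambda>x y zz. of_bool (\<not> P x y zz) * ennreal \<bar>\<mu> x y zz\<bar> * (nrm3 W Z W \<tau> x y zz))
        \<le> trint (\<lambda>x y zz. ennreal (1 / 2) * (lo x * xz y * w zz + (w x * xz y * lo zz + of_bool (resonant \<epsilon> x y zz) * (w x * xz y * w zz))))"
      proof (rule trint_mono)
        fix x y zz :: real assume xyz: "x + y + zz = 0"
        have half: "ennreal \<bar>\<mu> x y zz\<bar> = ennreal (1 / 2) * ennreal \<bar>y\<bar>"
          by (subst ennreal_mult[symmetric]) (simp_all add: \<mu>_def)
        show "of_bool (\<not> P x y zz) * ennreal \<bar>\<mu> x y zz\<bar> * (nrm3 W Z W \<tau> x y zz)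
           \<le> ennreal (1 / 2) * (lo x * xz y * w zz + (w x * xz y * lo zz + of_bool (resonant \<epsilon> x y zz) * (w x * xz y * w zz)))"
        proof (cases "P x y zz")
          case False
          \<comment> \<open>Off \<open>P\<close> either one frequency of W is at most K, which makes
            that factor L^1, or the triple is resonant.\<close>
          have *: "w x * xz y * w zz \<le> lo x * xz y * w zz + (w x * xz y * lo zz + of_bool (resonant \<epsilon> x y zz) * (w x * xz y * w zz))"
          proof -
            consider "\<bar>x\<bar> \<le> K" | "\<bar>zz\<bar> \<le> K" | "K < \<bar>x\<bar>" "K < \<bar>zz\<bar>" by linarith
            then show ?thesis
            proof cases
              case 1
              then have "lo x = w x" by (simp add: lo_def)
              then show ?thesis by (simp add: add_increasing2)
            next
              case 2
              then have "lo zz = w zz" by (simp add: lo_def)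
              then show ?thesis by (simp add: add_increasing add_increasing2)
            next
              case 3
              have "1 \<le> rho x y zz" using 3 K abs_le_rho(1)[OF xyz] by linarith
              then have "resonant \<epsilon> x y zz" using False 3 by (auto simp: P_def resonant_def)
              then show ?thesis by (simp add: add_increasing)
            qed
          qed
          have "ennreal \<bar>\<mu> x y zz\<bar> * (nrm3 W Z W \<tau> x y zz) = ennreal (1 / 2) * (w x * xz y * w zz)"
            unfolding half by (simp add: w_def xz_def mult_ac)
          also have "\<dots> \<le> ennreal (1 / 2) * (lo x * xz y * w zz + (w x * xz y * lo zz + of_bool (resonant \<epsilon> x y zz) * (w x * xz y * w zz)))"
            by (intro mult_left_mono *) simp
          finally show ?thesis using False by simp
        qed simp
      qed
      also have "\<dots> \<le> ennreal (1 / 2 * (2 * K * V * B * V + (V * B * (2 * K * V) + 6 * (V * B * V))))"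
        by (rule trint_le_cmult[OF trimeas_add[OF m1(1) trimeas_add[OF m1(2) m2]] trint_le_add[OF m1(1) trimeas_add[OF m1(2) m2]
             trint_L1L2L2[OF blo bxz bw] trint_le_add[OF m1(2) m2 trint_L2L2L1[OF bw bxz blo] trint_resonant2[OF assms(1) bw bxz bw]]]])
          (use B K in auto)
      finally show ?thesis .
    qed
    have m3: "trimeas (\<lambda>x y zz. w x * z y * w zz)" by measurable
    have e2: "trint (\<lambda>x y zz. of_bool (P x y zz) * ennreal \<bar>\<mu> x y zz / Phase \<epsilon> x y zz\<bar> * (nrm3 W Z W \<tau> x y zz))
       \<le> ennreal (2 / K * (V * B * V))"
    proof -
      have "trint (\<lambda>x y zz. of_bool (P x y zz) * ennreal \<bar>\<mu> x y zz / Phase \<epsilon> x y zz\<bar> * (nrm3 W Z W \<tau> x y zz))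
         \<le> trint (\<lambda>x y zz. ennreal (2 / K) * (w x * z y * w zz))"
      proof (rule trint_mono)
        fix x y zz :: real assume xyz: "x + y + zz = 0"
        show "of_bool (P x y zz) * ennreal \<bar>\<mu> x y zz / Phase \<epsilon> x y zz\<bar> * (nrm3 W Z W \<tau> x y zz)
          \<le> ennreal (2 / K) * (w x * z y * w zz)"
        proof (cases "P x y zz")
          case True
          note p = P1[OF xyz True]
          have "1 / \<bar>x\<bar> \<le> 1 / K" "1 / \<bar>zz\<bar> \<le> 1 / K" using True K by (auto simp: P_def intro!: divide_left_mono mult_pos_pos)
          then have "\<bar>\<mu> x y zz / Phase \<epsilon> x y zz\<bar> \<le> 2 / K"
            using p(1) rho_quot_bound(1)[OF xyz p(2,3)] by (simp add: field_simps)
          then have "ennreal \<bar>\<mu> x y zz / Phase \<epsilon> x y zz\<bar> * (w x * z y * w zz) \<le> ennreal (2 / K) * (w x * z y * w zz)"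
            by (intro mult_right_mono ennreal_leI) auto
          then show ?thesis using True by (simp add: feq)
        qed simp
      qed
      also have "\<dots> \<le> ennreal (2 / K * (V * B * V))"
        by (rule trint_le_cmult[OF m3 trint_L2L1L2[OF bw bz bw]]) (use B K in auto)
      finally show ?thesis .
    qed
    have m4: "trimeas (\<lambda>x y zz. hi x * G \<tau> y * w zz)" "trimeas (\<lambda>x y zz. w x * G \<tau> y * hi zz)"
      "trimeas (\<lambda>x y zz. r x * z y * w zz)" "trimeas (\<lambda>x y zz. r x * xz y * hi zz)"
      "trimeas (\<lambda>x y zz. w x * z y * r zz)" "trimeas (\<lambda>x y zz. hi x * xz y * r zz)"
      by measurable
    have e3: "trint (\<lambda>x y zz. of_bool (P x y zz) * ennreal \<bar>\<mu> x y zz / Phase \<epsilon> x y zz\<bar> *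
        (dnrm3 W DW Z DZ W DW \<tau> x y zz)) \<le>
       ennreal ((4 * V * B2 * V + V * B2 * (4 * V)) + c0 * ((B * V * B * V + B * V * B * (4 * V)) + (V * B * (B * V) + 4 * V * B * (B * V))))"
    proof -
      have "trint (\<lambda>x y zz. of_bool (P x y zz) * ennreal \<bar>\<mu> x y zz / Phase \<epsilon> x y zz\<bar> *
        (dnrm3 W DW Z DZ W DW \<tau> x y zz))
       \<le> trint (\<lambda>x y zz. (hi x * G \<tau> y * w zz + w x * G \<tau> y * hi zz)
          + ennreal c0 * ((r x * z y * w zz + r x * xz y * hi zz) + (w x * z y * r zz + hi x * xz y * r zz)))"
      proof (rule trint_mono)
        fix x y zz :: real assume xyz: "x + y + zz = 0"
        show "of_bool (P x y zz) * ennreal \<bar>\<mu> x y zz / Phase \<epsilon> x y zz\<bar> *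
          (dnrm3 W DW Z DZ W DW \<tau> x y zz) \<le> (hi x * G \<tau> y * w zz + w x * G \<tau> y * hi zz)
          + ennreal c0 * ((r x * z y * w zz + r x * xz y * hi zz) + (w x * z y * r zz + hi x * xz y * r zz))"
        proof (cases "P x y zz")
          case True
          note p = P1[OF xyz True]
          define k where "k = ennreal \<bar>\<mu> x y zz / Phase \<epsilon> x y zz\<bar>"
          have hx: "hi x = ennreal (1 / \<bar>x\<bar>) * w x" "hi zz = ennreal (1 / \<bar>zz\<bar>) * w zz"
            using True by (auto simp: hi_def P_def)
          have q0: "\<bar>\<mu> x y zz / Phase \<epsilon> x y zz\<bar> \<le> 1 / \<bar>x\<bar> + 1 / \<bar>zz\<bar>"
          proof -
            have "a \<le> b / 2 \<Longrightarrow> b \<le> 2 * c \<Longrightarrow> a \<le> c" for a b c :: real by linarith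
            from this[OF p(1) rho_quot_bound(1)[OF xyz p(2,3)]] show ?thesis .
          qed
          have half: "u / 2 \<le> u" if "0 \<le> u" for u :: real
            using that by simp
          have r0: "0 \<le> rho x y zz / (\<bar>x\<bar> * \<bar>zz\<bar>)"
            by (simp add: rho_def)
          have q1: "\<bar>x\<bar> * \<bar>\<mu> x y zz / Phase \<epsilon> x y zz\<bar> \<le> 1 + \<bar>y\<bar> * (1 / \<bar>zz\<bar>)"
          proof -
            \<comment> \<open>The factor 1/2 of the multiplier is given away here.\<close>
            have "rho x y zz / (\<bar>x\<bar> * \<bar>zz\<bar>) / 2 \<le> rho x y zz / (\<bar>x\<bar> * \<bar>zz\<bar>)"
              by (rule half[OF r0])
            then have "\<bar>x\<bar> * \<bar>\<mu> x y zz / Phase \<epsilon> x y zz\<bar> \<le> \<bar>x\<bar> * (rho x y zz / (\<bar>x\<bar> * \<bar>zz\<bar>))"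
              using p(1) by (intro mult_left_mono) auto
            then show ?thesis using rho_quot_bound(2)[OF xyz p(2,3)] by linarith
          qed
          have q2: "\<bar>zz\<bar> * \<bar>\<mu> x y zz / Phase \<epsilon> x y zz\<bar> \<le> 1 + \<bar>y\<bar> * (1 / \<bar>x\<bar>)"
          proof -
            have zyx: "zz + y + x = 0" using xyz by simp
            have "rho x y zz / (\<bar>x\<bar> * \<bar>zz\<bar>) / 2 \<le> rho zz y x / (\<bar>zz\<bar> * \<bar>x\<bar>)"
            proof -
              have "rho zz y x = rho x y zz" by (rule rho_swap13)
              then show ?thesis unfolding mult.commute[of "\<bar>zz\<bar>"] using half[OF r0] by simp
            qed
            then have "\<bar>zz\<bar> * \<bar>\<mu> x y zz / Phase \<epsilon> x y zz\<bar> \<le> \<bar>zz\<bar> * (rho zz y x / (\<bar>zz\<bar> * \<bar>x\<bar>))"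
              using p(1) by (intro mult_left_mono) auto
            then show ?thesis using rho_quot_bound(2)[OF zyx p(3,2)] by linarith
          qed
          have k0: "k \<le> ennreal (1 / \<bar>x\<bar>) + ennreal (1 / \<bar>zz\<bar>)"
            unfolding k_def using q0 by (simp add: ennreal_plus[symmetric] ennreal_leI del: ennreal_plus)
          have k1: "ennreal \<bar>x\<bar> * k \<le> 1 + ennreal \<bar>y\<bar> * ennreal (1 / \<bar>zz\<bar>)"
            unfolding k_def using q1
            by (simp add: ennreal_mult[symmetric] ennreal_plus[symmetric] ennreal_1[symmetric] ennreal_leI del: ennreal_plus ennreal_1)
          have k2: "ennreal \<bar>zz\<bar> * k \<le> 1 + ennreal \<bar>y\<bar> * ennreal (1 / \<bar>x\<bar>)"
            unfolding k_def using q2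
            by (simp add: ennreal_mult[symmetric] ennreal_plus[symmetric] ennreal_1[symmetric] ennreal_leI del: ennreal_plus ennreal_1)
          \<comment> \<open>Derivative on Z: the gained 1/|x| or 1/|z| turns one factor W into the
            L^1 function \<open>hi\<close>, leaving L^2 for the other W and for
            \<open>G\<close>.\<close>
          have T2: "k * (w x * nrm DZ \<tau> y * w zz) \<le> hi x * G \<tau> y * w zz + w x * G \<tau> y * hi zz"
          proof -
            have "k * (w x * nrm DZ \<tau> y * w zz) \<le> (ennreal (1 / \<bar>x\<bar>) + ennreal (1 / \<bar>zz\<bar>)) * (w x * G \<tau> y * w zz)"
              by (intro mult_mono k0 DZ[OF \<tau>] mult_left_mono mult_right_mono) auto
            also have "\<dots> = hi x * G \<tau> y * w zz + w x * G \<tau> y * hi zz"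
              by (simp add: hx distrib_left distrib_right mult_ac)
            finally show ?thesis .
          qed
          \<comment> \<open>Derivative on W: its factor |x| consumes the gain in x. What is left is
            bounded, or it is |y|/|z|, shared between \<open>xz\<close> and
            \<open>hi\<close>.\<close>
          have T1: "k * (nrm DW \<tau> x * z y * w zz) \<le> ennreal c0 * (r x * z y * w zz + r x * xz y * hi zz)"
          proof -
            have "k * (nrm DW \<tau> x * z y * w zz) \<le> k * ((ennreal c0 * (ennreal \<bar>x\<bar> * r x)) * z y * w zz)"
              using norm_DW_le[of \<tau> x] unfolding r_def w_def z_def by (intro mult_left_mono mult_right_mono) auto
            also have "\<dots> = ennreal c0 * ((ennreal \<bar>x\<bar> * k) * (r x * z y * w zz))"
              by (simp add: mult_ac)
            also have "\<dots> \<le> ennreal c0 * ((1 + ennreal \<bar>y\<bar> * ennreal (1 / \<bar>zz\<bar>)) * (r x * z y * w zz))"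
              by (intro mult_left_mono mult_right_mono k1) auto
            also have "\<dots> = ennreal c0 * (r x * z y * w zz + r x * xz y * hi zz)"
              by (simp add: hx xz_def z_def distrib_left distrib_right mult_ac)
            finally show ?thesis .
          qed
          have T3: "k * (w x * z y * nrm DW \<tau> zz) \<le> ennreal c0 * (w x * z y * r zz + hi x * xz y * r zz)"
          proof -
            have "k * (w x * z y * nrm DW \<tau> zz) \<le> k * (w x * z y * (ennreal c0 * (ennreal \<bar>zz\<bar> * r zz)))"
              using norm_DW_le[of \<tau> zz] unfolding r_def w_def z_def by (intro mult_left_mono mult_right_mono) auto
            also have "\<dots> = ennreal c0 * ((ennreal \<bar>zz\<bar> * k) * (w x * z y * r zz))"
              by (simp add: mult_ac)
            also have "\<dots> \<le> ennreal c0 * ((1 + ennreal \<bar>y\<bar> * ennreal (1 / \<bar>x\<bar>)) * (w x * z y * r zz))"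
              by (intro mult_left_mono mult_right_mono k2) auto
            also have "\<dots> = ennreal c0 * (w x * z y * r zz + hi x * xz y * r zz)"
              by (simp add: hx xz_def z_def distrib_left distrib_right mult_ac)
            finally show ?thesis .
          qed
          have "k * (nrm DW \<tau> x * z y * w zz + w x * nrm DZ \<tau> y * w zz + w x * z y * nrm DW \<tau> zz)
             = k * (w x * nrm DZ \<tau> y * w zz) + (k * (nrm DW \<tau> x * z y * w zz) + k * (w x * z y * nrm DW \<tau> zz))"
            by (simp add: distrib_left add_ac)
          also have "\<dots> \<le> (hi x * G \<tau> y * w zz + w x * G \<tau> y * hi zz) + (ennreal c0 * (r x * z y * w zz + r x * xz y * hi zz)
             + ennreal c0 * (w x * z y * r zz + hi x * xz y * r zz))"
            by (intro add_mono T1 T2 T3)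
          finally show ?thesis using True
            unfolding k_def[symmetric] by (simp add: feq distrib_left)
        qed simp
      qed
      also have "\<dots> \<le> ennreal ((4 * V * B2 * V + V * B2 * (4 * V)) + c0 * ((B * V * B * V + B * V * B * (4 * V)) + (V * B * (B * V) + 4 * V * B * (B * V))))"
        by (rule trint_le_add[OF trimeas_add[OF m4(1,2)] trimeas_cmult[OF trimeas_add[OF trimeas_add[OF m4(3,4)] trimeas_add[OF m4(5,6)]]]
             trint_le_add[OF m4(1,2) trint_L1L2L2[OF bhi bg bw] trint_L2L2L1[OF bw bg bhi]]
             trint_le_cmult[OF trimeas_add[OF trimeas_add[OF m4(3,4)] trimeas_add[OF m4(5,6)]]
               trint_le_add[OF trimeas_add[OF m4(3,4)] trimeas_add[OF m4(5,6)]
                 trint_le_add[OF m4(3,4) trint_L2L1L2[OF br bz bw] trint_L2L2L1[OF br bxz bhi]]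
                 trint_le_add[OF m4(5,6) trint_L2L1L2[OF bw bz br] trint_L1L2L2[OF bhi bxz br]]]]])
          (use B K c0 in auto)
      finally show ?thesis .
    qed
    note e1 e2 e3
  } note slices = this
  have bound\<mu>: "trint (\<lambda>x y z. ennreal \<bar>\<mu> x y z\<bar> * (nrm3 W Z W \<tau> x y z)) \<le> ennreal (2 * (1 * B * B * V))"
    if \<tau>: "0 \<le> \<tau>" "\<tau> \<le> t" for \<tau>
  proof -
    let ?H = "\<lambda>x y z. ennreal \<bar>mu0 x y z\<bar> * (nrm3 W Z W \<tau> x y z)"
    have m: "trimeas ?H" by (rule trimeas_norm[OF cW cZ cW measurable_mu0])
    have "trint (\<lambda>x y z. ennreal \<bar>\<mu> x y z\<bar> * (nrm3 W Z W \<tau> x y z)) \<le> trint (\<lambda>x y z. ?H x y z + ?H z y x)"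
    proof (rule trint_mono)
      fix x y z :: real assume "x + y + z = 0"
      then have "\<bar>\<mu> x y z\<bar> \<le> \<bar>x\<bar> + \<bar>z\<bar>" unfolding \<mu>_def by linarith
      then have "ennreal \<bar>\<mu> x y z\<bar> * (nrm3 W Z W \<tau> x y z) \<le> (ennreal \<bar>x\<bar> + ennreal \<bar>z\<bar>) * (nrm3 W Z W \<tau> x y z)"
        by (intro mult_right_mono) (auto simp: ennreal_plus[symmetric] intro!: ennreal_leI simp del: ennreal_plus)
      then show "ennreal \<bar>\<mu> x y z\<bar> * (nrm3 W Z W \<tau> x y z) \<le> ?H x y z + ?H z y x"
        by (simp add: mu0_def distrib_left distrib_right mult_ac)
    qed
    also have "\<dots> \<le> ennreal (1 * B * B * V + 1 * B * B * V)"
      using mu0_bound[OF \<tau>] B by (intro trint_le_add m trimeas_swap13[OF m]) (simp_all add: trint_swap13[OF m])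
    finally show ?thesis by (simp add: mult.assoc)
  qed
  note int\<mu> = oscil_integrable[OF cW cZ cW m\<mu> measurable_Phase bound\<mu>]
  \<comment> \<open>\<open>g3\<close> is \<open>g\<close> with x and z exchanged. Since W occupies
    both slots, only the multiplier changes.\<close>
  have sl: "(LINT p|lborel2. oscil mu0 (Phase \<epsilon>) W Z W \<tau> p) = (LINT p|lborel2. oscil \<mu> (Phase \<epsilon>) W Z W \<tau> p)"
    if \<tau>: "0 \<le> \<tau>" "\<tau> \<le> t" for \<tau>
  proof -
    define g where "g = oscil mu0 (Phase \<epsilon>) W Z W \<tau>"
    have gi: "integrable lborel2 g" unfolding g_def by (rule oscil_mu0_integrable) (use \<tau> in auto)
    define g1 where "g1 = (\<lambda>p. g (snd p, fst p))"
    define g2 where "g2 = (\<lambda>p. g1 (fst p, - fst p - snd p))"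
    define g3 where "g3 = (\<lambda>p. g2 (snd p, fst p))"
    have i1: "(LINT p|lborel2. g1 p) = (LINT p|lborel2. g p)" "integrable lborel2 g1"
      unfolding g1_def by (rule lborel_pair_integral_swap[OF gi])+
    have i2: "(LINT p|lborel2. g2 p) = (LINT p|lborel2. g p)" "integrable lborel2 g2"
      unfolding g2_def using lborel_pair_integral_shear[OF i1(2)] i1(1) by simp_all
    have i3: "(LINT p|lborel2. g3 p) = (LINT p|lborel2. g p)" "integrable lborel2 g3"
      unfolding g3_def using lborel_pair_integral_swap[OF i2(2)] i2(1) by simp_all
    have "oscil \<mu> (Phase \<epsilon>) W Z W \<tau> p = (1 / 2) * (g p + g3 p)" for p
    proof -
      define x y z where "x = fst p" and "y = snd p" and "z = - fst p - snd p"
      have z: "- y - x = z" "- z - y = x" "- x - y = z" by (simp_all add: x_def y_def z_def)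
      have "g p = complex_of_real x * (cis (\<tau> * Phase \<epsilon> x y z) * (W \<tau> x * Z \<tau> y * W \<tau> z))"
        by (simp add: g_def oscil_def mu0_def x_def y_def z_def mult.assoc)
      moreover have "g3 p = complex_of_real z * (cis (\<tau> * Phase \<epsilon> x y z) * (W \<tau> x * Z \<tau> y * W \<tau> z))"
      proof -
        have "Phase \<epsilon> z y x = Phase \<epsilon> x y z" by (simp add: Phase_def)
        then show ?thesis
          unfolding g3_def g2_def g1_def g_def oscil_def mu0_def fst_conv snd_conv x_def[symmetric] y_def[symmetric] z
          by (simp add: mult_ac)
      qed
      moreover have "oscil \<mu> (Phase \<epsilon>) W Z W \<tau> p = complex_of_real (\<mu> x y z) * (cis (\<tau> * Phase \<epsilon> x y z) * (W \<tau> x * Z \<tau> y * W \<tau> z))"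
        by (simp add: oscil_def x_def y_def z_def mult.assoc)
      moreover have "complex_of_real (\<mu> x y z) = (1 / 2) * (complex_of_real x + complex_of_real z)"
        by (simp add: \<mu>_def x_def y_def z_def)
      ultimately show ?thesis
        by (simp only: distrib_right mult.assoc)
    qed
    then have "(LINT p|lborel2. oscil \<mu> (Phase \<epsilon>) W Z W \<tau> p) = (LINT p|lborel2. (1 / 2) * (g p + g3 p))"
      by (rule arg_cong[OF ext])
    also have "\<dots> = (1 / 2) * (LINT p|lborel2. g p + g3 p)"
      by (rule Bochner_Integration.integral_mult_right_zero)
    also have "\<dots> = (LINT p|lborel2. g p)"
      using gi i3 by simp
    finally show ?thesis by (simp add: g_def)
  qed
  define c1 c2 c3 where "c1 = 1 / 2 * (2 * K * V * B * V + (V * B * (2 * K * V) + 6 * (V * B * V)))"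
    and "c2 = 2 / K * (V * B * V)"
    and "c3 = (4 * V * B2 * V + V * B2 * (4 * V)) + c0 * ((B * V * B * V + B * V * B * (4 * V)) + (V * B * (B * V) + 4 * V * B * (B * V)))"
  have cn: "0 \<le> c1" "0 \<le> c2" "0 \<le> c3" using K B c0 by (auto simp: c1_def c2_def c3_def)
  have osc: "cmod (osc_int t \<mu> (Phase \<epsilon>) W Z W) \<le> t * c1 + 2 * c2 + t * c3"
  proof (rule oscillatory_bound[where P = P, OF t cW cZ cW m\<mu> measurable_Phase mP _ int\<mu>(1) _ _ _ cn])
    show "\<mu> x y z = 0" if "x + y + z = 0" "P x y z" "Phase \<epsilon> x y z = 0" for x y z
      using diff_quot_bound(2)[OF that(1) K, of \<epsilon>] that by (simp add: P_def \<mu>_def)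
  qed (use slices in \<open>simp_all only: c1_def c2_def c3_def\<close>)
  have "energy t - energy 0 = - 2 * c0 * Im (osc_int t mu0 (Phase \<epsilon>) W Z W)"
    by (rule energy_identity)
  also have "(osc_int t mu0 (Phase \<epsilon>) W Z W)
     = (osc_int t \<mu> (Phase \<epsilon>) W Z W)"
    using sl by (intro Bochner_Integration.integral_cong refl) (auto simp: indicator_def)
  finally have "\<bar>energy t - energy 0\<bar> = 2 * c0 * \<bar>Im (osc_int t \<mu> (Phase \<epsilon>) W Z W)\<bar>"
    using c0 by (simp add: abs_mult)
  also have "\<dots> \<le> 2 * c0 * (t * c1 + 2 * c2 + t * c3)"
    using c0 by (intro mult_left_mono order_trans[OF abs_Im_le_cmod osc]) auto
  also have "\<dots> \<le> 2 * c0 * ((t * ((2 * K + 3) * B) + 4 * B / K + t * (8 * B2 + 10 * c0 * B\<^sup>2)) * V\<^sup>2)"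
    using K c0 by (intro mult_left_mono) (simp_all add: c1_def c2_def c3_def power2_eq_square field_simps)
  finally show ?thesis by (simp add: energy_def mult.assoc)
qed

section \<open>Uniform times for profiles\<close>

text \<open>Truncation keeps the exponent q, hence all constants are uniform in the height
  M.\<close>

lemma weight_min:
  assumes "weight q a" "0 \<le> M"
  shows "weight q (\<lambda>x. min (a x) M)"
  unfolding weight_def
proof (intro conjI allI impI)
  show "(\<lambda>x. min (a x) M) \<in> borel_measurable borel" using assms by (auto simp: weight_def)
  show "0 \<le> min (a x) M" for x using assms by (auto simp: weight_def)
  show "min (a x) M \<le> min (a y) M" if "\<bar>x\<bar> \<le> \<bar>y\<bar>" for x y
  proof -
    have "a x \<le> a y" using assms that by (auto simp: weight_def)
    then show ?thesis by linarith
  qed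
  fix x y :: real assume xy: "0 < x" "x \<le> y"
  have p: "x ^ q \<le> y ^ q" using xy by (intro power_mono) auto
  show "min (a y) M * x ^ q \<le> min (a x) M * y ^ q"
  proof (cases "a x \<le> M")
    case True
    have "min (a y) M * x ^ q \<le> a y * x ^ q" using xy by (intro mult_right_mono) auto
    also have "\<dots> \<le> a x * y ^ q" using weight_growth[OF assms(1) xy] .
    finally show ?thesis using True by simp
  next
    case False
    have "min (a y) M * x ^ q \<le> M * y ^ q" using p xy assms by (intro mult_mono) auto
    then show ?thesis using False by simp
  qed
qed

lemma weight_mult:
  assumes a: "weight q a" and b: "weight r b"
  shows "weight (q + r) (\<lambda>x. a x * b x)"
  unfolding weight_def
proof (intro conjI allI impI)
  have [measurable]: "a \<in> borel_measurable borel" "b \<in> borel_measurable borel" using assms by (auto simp: weight_def)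
  show "(\<lambda>x. a x * b x) \<in> borel_measurable borel" by measurable
  have nn: "0 \<le> a x" "0 \<le> b x" for x using assms by (auto simp: weight_def)
  then show "0 \<le> a x * b x" for x by simp
  show "a x * b x \<le> a y * b y" if "\<bar>x\<bar> \<le> \<bar>y\<bar>" for x y
    using assms that nn by (intro mult_mono) (auto simp: weight_def)
  fix x y :: real assume xy: "0 < x" "x \<le> y"
  have "(a y * x ^ q) * (b y * x ^ r) \<le> (a x * y ^ q) * (b x * y ^ r)"
    using xy nn by (intro mult_mono weight_growth[OF a xy] weight_growth[OF b xy]) auto
  then show "a y * b y * x ^ (q + r) \<le> a x * b x * y ^ (q + r)"
    by (simp add: power_add mult_ac)
qed

lemma weight_const: "0 \<le> c \<Longrightarrow> weight q (\<lambda>x. c)"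
  by (auto simp: weight_def intro!: mult_left_mono power_mono)

lemma weight_le:
  assumes "weight q a" "q \<le> r"
  shows "weight r a"
  using weight_mult[OF assms(1) weight_const[of 1 "r - q"]] assms(2) by simp

lemma weight_jb: "weight 1 jb"
  unfolding weight_def
proof (intro conjI allI impI)
  show "jb x \<le> jb y" if "\<bar>x\<bar> \<le> \<bar>y\<bar>" for x y
    using that by (simp add: jb_def abs_le_square_iff)
  fix x y :: real assume xy: "0 < x" "x \<le> y"
  have "x\<^sup>2 \<le> y\<^sup>2" using xy by (intro power_mono) auto
  then have "(1 + y\<^sup>2) * x\<^sup>2 \<le> (1 + x\<^sup>2) * y\<^sup>2" by (simp add: algebra_simps)
  then have "sqrt ((1 + y\<^sup>2) * x\<^sup>2) \<le> sqrt ((1 + x\<^sup>2) * y\<^sup>2)" by simp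
  then show "jb y * x ^ 1 \<le> jb x * y ^ 1" using xy by (simp add: jb_def real_sqrt_mult)
qed (use jb_ge(3) in \<open>auto intro: less_imp_le\<close>)

text \<open>For 0 < x \<le> y the ratio of brackets is at most y/x, and s \<le> q lets the power of
  y/x \<ge> 1 be raised to q.\<close>

lemma weight_jb_powr:
  assumes "0 \<le> s" "s \<le> real q"
  shows "weight q (\<lambda>x. jb x powr s)"
  unfolding weight_def
proof (intro conjI allI impI)
  show "jb x powr s \<le> jb y powr s" if "\<bar>x\<bar> \<le> \<bar>y\<bar>" for x y
    using that assms weight_jb jb_ge(3)[of x] by (intro powr_mono2) (auto simp: weight_def)
  fix x y :: real assume xy: "0 < x" "x \<le> y"
  have "jb y * x \<le> jb x * y" using weight_growth[OF weight_jb xy] by simp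
  then have "jb y / jb x \<le> y / x" using xy jb_ge(3)[of x] by (simp add: field_simps)
  then have "(jb y / jb x) powr s \<le> (y / x) powr s"
    using jb_ge(3) assms by (intro powr_mono2) (auto simp: less_imp_le)
  also have "\<dots> \<le> (y / x) powr real q" using xy assms by (intro powr_mono) auto
  also have "\<dots> = (y / x) ^ q" using xy by (intro powr_realpow) auto
  finally have "jb y powr s / jb x powr s \<le> y ^ q / x ^ q"
    using jb_ge(3)[of x] jb_ge(3)[of y] by (simp add: powr_divide less_imp_le power_divide)
  then show "jb y powr s * x ^ q \<le> jb x powr s * y ^ q"
    using xy jb_ge(3)[of x] by (simp add: field_simps)
qed auto

text \<open>The 1/2 stems from u u_x = (u^2/2)_x, the remaining factor from the convolution theorem
  for the unitary transform.\<close>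

definition c_nl :: real where
  "c_nl = 1 / (2 * sqrt (2 * pi))"

lemma c_nl: "0 \<le> c_nl" "c_nl \<le> 1"
proof -
  have "1 \<le> sqrt (2 * pi)" using pi_gt3 by (intro real_le_rsqrt) auto
  then have "1 \<le> 2 * sqrt (2 * pi)" by linarith
  then show "c_nl \<le> 1" unfolding c_nl_def by (subst divide_le_eq_1_pos) linarith+
qed (simp add: c_nl_def)

definition profile_rhs :: "real \<Rightarrow> evolution \<Rightarrow> real \<Rightarrow> real \<Rightarrow> complex" where
  "profile_rhs \<epsilon> F \<tau> \<xi> = - \<i> * complex_of_real (c_nl * \<xi>) * cis (- (\<tau> * phase \<epsilon> \<xi>)) *
      interaction \<epsilon> \<tau> (F \<tau>) (F \<tau>) \<xi>"

definition h1n :: "(real \<Rightarrow> complex) \<Rightarrow> real" where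
  "h1n f = (LINT x|lborel. (jb x)\<^sup>2 * (cmod (f x))\<^sup>2)"

text \<open>The Fourier transform of a solution with the linear evolution \<open>exp (i t (\<xi>\<^sup>3 - \<epsilon> \<xi>\<^sup>5))\<close>
  removed.\<close>

definition profile :: "real \<Rightarrow> evolution \<Rightarrow> bool" where
  "profile \<epsilon> F \<longleftrightarrow> curve F (profile_rhs \<epsilon> F) \<and> (\<forall>\<tau> \<xi>. F \<tau> (- \<xi>) = cnj (F \<tau> \<xi>)) \<and>
     (\<forall>\<tau>. integrable lborel (\<lambda>x. (jb x)\<^sup>2 * (cmod (F \<tau> x))\<^sup>2)) \<and> continuous_on UNIV (\<lambda>\<tau>. h1n (F \<tau>))"

lemma L2b_h1n:
  assumes "F \<in> borel_measurable borel" "integrable lborel (\<lambda>x. (jb x)\<^sup>2 * (cmod (F x))\<^sup>2)" "h1n F \<le> B\<^sup>2" "0 \<le> B"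
  shows "L2b (\<lambda>x. ennreal (jb x) * ennreal (cmod (F x))) B"
proof -
  note [measurable] = assms(1)
  have "(\<integral>\<^sup>+x. (ennreal (jb x) * ennreal (cmod (F x)))\<^sup>2 \<partial>lborel) = (\<integral>\<^sup>+x. ennreal ((jb x)\<^sup>2 * (cmod (F x))\<^sup>2) \<partial>lborel)"
    using jb_ge(3) by (intro nn_integral_cong) (simp add: power_mult_distrib ennreal_power ennreal_mult[symmetric] less_imp_le)
  also have "\<dots> = ennreal (h1n F)"
    unfolding h1n_def by (rule nn_integral_eq_integral[OF assms(2)]) simp
  finally show ?thesis using assms by (auto simp: L2b_def intro!: ennreal_leI)
qed

lemma L2b_jb_imp:
  assumes "L2b (\<lambda>x. ennreal (jb x) * F x) B" "F \<in> borel_measurable borel"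
  shows "L2b F B" "L2b (\<lambda>x. ennreal \<bar>x\<bar> * F x) B" "L1b F (2 * B)"
proof -
  note [measurable] = assms(2)
  have "1 * F x \<le> ennreal (jb x) * F x" for x
    using jb_ge(1)[of x] by (intro mult_right_mono) auto
  then show "L2b F B" by (intro L2b_mono[OF assms(1)]) auto
  have "ennreal \<bar>x\<bar> * F x \<le> ennreal (jb x) * F x" for x
    using jb_ge(2)[of x] by (intro mult_right_mono ennreal_leI) auto
  then show "L2b (\<lambda>x. ennreal \<bar>x\<bar> * F x) B" by (intro L2b_mono[OF assms(1)]) auto
  have "ennreal (1 / jb x) * (ennreal (jb x) * F x) = F x" for x
    using jb_ge(3)[of x] by (simp add: mult.assoc[symmetric] ennreal_mult[symmetric])
  then show "L1b F (2 * B)" using L1b_mult[OF L2b_inverse_jb assms(1)] by simp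
qed

text \<open>The order matters: the boundary terms do not shrink with time, so K is fixed first,
  which makes them at most 1/4; T is then small compared with the K-dependent growth. The 2 in the
  denominator of T keeps T below 1.\<close>

lemma choose_parameters:
  fixes X :: real and Y :: "real \<Rightarrow> real"
  assumes "0 \<le> X" "\<And>K. 1 \<le> K \<Longrightarrow> 0 \<le> Y K"
  obtains K T where "1 \<le> K" "0 < T" "T < 1" "\<And>t. 0 \<le> t \<Longrightarrow> t \<le> T \<Longrightarrow> X * (t * Y K + 4 / K) \<le> 1 / 2"
proof
  define K where "K = 1 + 16 * X"
  define T where "T = 1 / (4 * X * Y K + 2)"
  show K: "1 \<le> K" using assms by (simp add: K_def)
  then have Y: "0 \<le> Y K" by (rule assms)
  then have XY: "0 \<le> X * Y K" using assms by simp
  then show "0 < T" "T < 1" by (simp_all add: T_def)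
  fix t assume t: "0 \<le> t" "t \<le> T"
  have "X * Y K * t \<le> X * Y K * T" using XY t by (intro mult_left_mono) auto
  also have "\<dots> \<le> 1 / 4" using XY by (simp add: T_def field_simps)
  finally have "X * (t * Y K) \<le> 1 / 4" by (simp add: mult_ac)
  moreover have "X * (4 / K) \<le> 1 / 4" using assms(1) by (simp add: K_def field_simps)
  ultimately show "X * (t * Y K + 4 / K) \<le> 1 / 2" by (simp add: distrib_left)
qed

text \<open>Takes the place of Gronwall: half of the supremum is absorbed, which is legitimate
  because \<open>bdd\<close> makes the supremum finite. No continuity of E is required.\<close>

lemma sup_absorb:
  fixes E :: "real \<Rightarrow> real"
  assumes t: "0 \<le> t" and bdd: "\<And>\<tau>. 0 \<le> \<tau> \<Longrightarrow> \<tau> \<le> t \<Longrightarrow> E \<tau> \<le> C"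
    and step: "\<And>\<tau> S. 0 \<le> \<tau> \<Longrightarrow> \<tau> \<le> t \<Longrightarrow> (\<And>\<sigma>. 0 \<le> \<sigma> \<Longrightarrow> \<sigma> \<le> t \<Longrightarrow> E \<sigma> \<le> S) \<Longrightarrow> E \<tau> \<le> E 0 + S / 2"
  shows "\<And>\<tau>. 0 \<le> \<tau> \<Longrightarrow> \<tau> \<le> t \<Longrightarrow> E \<tau> \<le> 2 * E 0"
proof -
  define S where "S = (SUP \<tau>\<in>{0..t}. E \<tau>)"
  have bddA: "bdd_above (E ` {0..t})" by (rule bdd_aboveI2[where M = C]) (use bdd in auto)
  have le: "E \<sigma> \<le> S" if "0 \<le> \<sigma>" "\<sigma> \<le> t" for \<sigma>
    unfolding S_def using that by (intro cSUP_upper[OF _ bddA]) auto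
  have "S \<le> E 0 + S / 2"
    unfolding S_def by (rule cSUP_least) (use t step le in \<open>auto simp: S_def[symmetric]\<close>)
  then have "S \<le> 2 * E 0" by simp
  with le show "\<And>\<tau>. 0 \<le> \<tau> \<Longrightarrow> \<tau> \<le> t \<Longrightarrow> E \<tau> \<le> 2 * E 0" by (meson order_trans)
qed

lemma weighted_L2:
  assumes "L2b (\<lambda>x. ennreal (jb x) * ennreal (cmod (f x))) B" "f \<in> borel_measurable borel"
    "weight q a" "\<And>x. a x \<le> M"
  shows "integrable lborel (\<lambda>x. (a x)\<^sup>2 * (cmod (f x))\<^sup>2)" 
    "(LINT x|lborel. (a x)\<^sup>2 * (cmod (f x))\<^sup>2) \<le> M\<^sup>2 * B\<^sup>2"
    "(\<integral>\<^sup>+x. (ennreal (a x) * ennreal (cmod (f x)))\<^sup>2 \<partial>lborel) = ennreal (LINT x|lborel. (a x)\<^sup>2 * (cmod (f x))\<^sup>2)"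
proof -
  note [measurable] = assms(2)
  have [measurable]: "a \<in> borel_measurable borel" using assms(3) by (simp add: weight_def)
  have nn: "0 \<le> a x" for x using assms(3) by (auto simp: weight_def)
  have M: "0 \<le> M" using nn[of 0] assms(4)[of 0] by simp
  have f: "L2b (\<lambda>x. ennreal (cmod (f x))) B"
    by (rule L2b_jb_imp(1)[OF assms(1)]) measurable
  have "L2b (\<lambda>x. ennreal (a x) * ennreal (cmod (f x))) (M * B)"
    by (rule L2b_mono[OF L2b_cmult[OF f M]]) (use assms(4) in \<open>auto intro!: mult_right_mono ennreal_leI\<close>)
  from L2bD(3)[OF this]
  have b: "(\<integral>\<^sup>+x. (ennreal (a x) * ennreal (cmod (f x)))\<^sup>2 \<partial>lborel) \<le> ennreal (M\<^sup>2 * B\<^sup>2)"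
    by (simp add: power_mult_distrib)
  have eq: "(ennreal (a x) * ennreal (cmod (f x)))\<^sup>2 = ennreal ((a x)\<^sup>2 * (cmod (f x))\<^sup>2)" for x
    using nn by (simp add: power_mult_distrib ennreal_power ennreal_mult)
  show int: "integrable lborel (\<lambda>x. (a x)\<^sup>2 * (cmod (f x))\<^sup>2)"
  proof (rule integrableI_bounded)
    show "(\<integral>\<^sup>+x. ennreal (norm ((a x)\<^sup>2 * (cmod (f x))\<^sup>2)) \<partial>lborel) < \<infinity>"
      using b unfolding eq by (auto intro: le_less_trans)
  qed measurable
  show e: "(\<integral>\<^sup>+x. (ennreal (a x) * ennreal (cmod (f x)))\<^sup>2 \<partial>lborel) = ennreal (LINT x|lborel. (a x)\<^sup>2 * (cmod (f x))\<^sup>2)"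
    unfolding eq by (rule nn_integral_eq_integral[OF int]) simp
  show "(LINT x|lborel. (a x)\<^sup>2 * (cmod (f x))\<^sup>2) \<le> M\<^sup>2 * B\<^sup>2"
    using b unfolding e by (simp add: ennreal_le_iff)
qed

text \<open>T is fixed before \<epsilon>, the profile and the weight, so it depends on B and q
  alone. The bound of the weight serves only to make the energy finite for
  \<open>sup_absorb\<close>.\<close>

lemma apriori_bounded_weight:
  fixes B :: real
  assumes "0 \<le> B"
  obtains T where "0 < T" "T < 1"
    "\<And>\<epsilon> F a M t. 0 < \<epsilon> \<Longrightarrow> profile \<epsilon> F \<Longrightarrow> weight q a \<Longrightarrow> (\<And>x. a x \<le> M) \<Longrightarrow> 0 \<le> t \<Longrightarrow> t \<le> T \<Longrightarrow>
       (\<And>\<tau>. 0 \<le> \<tau> \<Longrightarrow> \<tau> \<le> t \<Longrightarrow> L2b (\<lambda>x. ennreal (jb x) * nrm F \<tau> x) B) \<Longrightarrow>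
       (LINT x|lborel. (a x)\<^sup>2 * (cmod (F t x))\<^sup>2) \<le> 2 * (LINT x|lborel. (a x)\<^sup>2 * (cmod (F 0 x))\<^sup>2)"
proof -
  \<comment> \<open>2B is the L^1 bound of \<open>L2b_jb_imp\<close>, which also dominates the two
    L^2 bounds.\<close>
  define X where "X = 2 * c_nl * mulconst q * (2 * B)"
  define Y where "Y K = K + 2 + 2 * c_nl * (1 + 2 ^ (q + 2)) * (2 * B)" for K
  have X: "0 \<le> X" unfolding X_def using c_nl mulconst_nonneg assms by auto
  have Y: "0 \<le> Y K" if "1 \<le> K" for K unfolding Y_def using c_nl that assms by (intro add_nonneg_nonneg mult_nonneg_nonneg) auto
  obtain K T where K: "1 \<le> K" and T: "0 < T" "T < 1" and small: "\<And>t. 0 \<le> t \<Longrightarrow> t \<le> T \<Longrightarrow> X * (t * Y K + 4 / K) \<le> 1 / 2"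
    using choose_parameters[OF X, of Y] Y by blast
  show ?thesis
  proof (rule that[OF T])
    fix \<epsilon> F a M t
    assume \<epsilon>: "0 < \<epsilon>" and F: "profile \<epsilon> F" and a: "weight q a" "\<And>x. a x \<le> M" and t: "0 \<le> t" "t \<le> T"
      and bd: "\<And>\<tau>. 0 \<le> \<tau> \<Longrightarrow> \<tau> \<le> t \<Longrightarrow> L2b (\<lambda>x. ennreal (jb x) * nrm F \<tau> x) B"
    have c: "curve F (profile_rhs \<epsilon> F)" using F by (simp add: profile_def)
    have Fm: "F \<tau> \<in> borel_measurable borel" for \<tau> by (rule curveD(1)[OF c])
    have nFm: "nrm F \<tau> \<in> borel_measurable borel" for \<tau> using Fm by measurable
    have am[measurable]: "a \<in> borel_measurable borel" using a(1) by (simp add: weight_def)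
    define E where "E \<tau> = (LINT x|lborel. (a x)\<^sup>2 * (cmod (F \<tau> x))\<^sup>2)" for \<tau>
    have "E t \<le> 2 * E 0"
    proof (rule sup_absorb[of t E])
      show "E \<tau> \<le> M\<^sup>2 * B\<^sup>2" if "0 \<le> \<tau>" "\<tau> \<le> t" for \<tau>
        unfolding E_def by (rule weighted_L2(2)[OF bd[OF that] Fm a])
      fix \<tau> S assume \<tau>: "0 \<le> \<tau>" "\<tau> \<le> t" and S: "\<And>\<sigma>. 0 \<le> \<sigma> \<Longrightarrow> \<sigma> \<le> t \<Longrightarrow> E \<sigma> \<le> S"
      have "0 \<le> E 0" unfolding E_def by (rule Bochner_Integration.integral_nonneg) simp
      then have S0: "0 \<le> S" using S[of 0] t by simp
      have V: "L2b (\<lambda>x. ennreal (a x) * nrm F \<sigma> x) (sqrt S)" if "0 \<le> \<sigma>" "\<sigma> \<le> \<tau>" for \<sigma>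
      proof -
        have s: "0 \<le> \<sigma>" "\<sigma> \<le> t" using that \<tau> by auto
        show ?thesis
          unfolding L2b_def weighted_L2(3)[OF bd[OF s] Fm a]
          using S[OF s] S0 nFm by (auto simp: E_def ennreal_leI)
      qed
      have "\<bar>E \<tau> - E 0\<bar> \<le> 2 * c_nl * mulconst q * (\<tau> * (K + 2) + 4 / K + \<tau> * (2 * c_nl * (1 + 2 ^ (q + 2)) * (2 * B))) * (2 * B) * (sqrt S)\<^sup>2"
        unfolding E_def
      proof (rule apriori_step[OF \<epsilon> a c _ _ \<tau>(1) c_nl(1) K])
        show "F \<tau> (- \<xi>) = cnj (F \<tau> \<xi>)" for \<tau> \<xi> using F by (simp add: profile_def)
        fix \<sigma> assume s: "0 \<le> \<sigma>" "\<sigma> \<le> \<tau>"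
        then have s': "0 \<le> \<sigma>" "\<sigma> \<le> t" using \<tau> by auto
        note b = L2b_jb_imp[OF bd[OF s'] nFm]
        show "L2b (nrm F \<sigma>) (2 * B)" by (rule L2b_mono[OF b(1)]) (use nFm assms in auto)
        show "L2b (\<lambda>x. ennreal \<bar>x\<bar> * nrm F \<sigma> x) (2 * B)" by (rule L2b_mono[OF b(2)]) (use nFm assms in auto)
        show "L1b (nrm F \<sigma>) (2 * B)" by (rule b(3))
        show "L2b (\<lambda>x. ennreal (a x) * nrm F \<sigma> x) (sqrt S)" by (rule V[OF s])
      qed (simp add: profile_rhs_def)
      also have "\<dots> = X * (\<tau> * Y K + 4 / K) * S"
        using S0 by (simp add: X_def Y_def algebra_simps)
      also have "\<dots> \<le> 1 / 2 * S"
        using small[of \<tau>] \<tau> t S0 by (intro mult_right_mono) auto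
      finally show "E \<tau> \<le> E 0 + S / 2" by linarith
    qed (use t in auto)
    then show "(LINT x|lborel. (a x)\<^sup>2 * (cmod (F t x))\<^sup>2) \<le> 2 * (LINT x|lborel. (a x)\<^sup>2 * (cmod (F 0 x))\<^sup>2)"
      by (simp add: E_def)
  qed
qed

text \<open>A squared norm that may be infinite; finiteness at later times is then a conclusion,
  which is persistence of regularity.\<close>

definition wn :: "(real \<Rightarrow> real) \<Rightarrow> (real \<Rightarrow> complex) \<Rightarrow> ennreal" where
  "wn a f = (\<integral>\<^sup>+x. (ennreal (a x) * ennreal (cmod (f x)))\<^sup>2 \<partial>lborel)"

text \<open>The truncations of the weight at height n share one T, so monotone convergence passes to
  unbounded weights.\<close>

lemma apriori_weight:
  fixes B :: real
  assumes "0 \<le> B"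
  obtains T where "0 < T" "T < 1"
    "\<And>\<epsilon> F a t. 0 < \<epsilon> \<Longrightarrow> profile \<epsilon> F \<Longrightarrow> weight q a \<Longrightarrow> 0 \<le> t \<Longrightarrow> t \<le> T \<Longrightarrow>
       (\<And>\<tau>. 0 \<le> \<tau> \<Longrightarrow> \<tau> \<le> t \<Longrightarrow> L2b (\<lambda>x. ennreal (jb x) * nrm F \<tau> x) B) \<Longrightarrow>
       wn a (F t) \<le> 2 * wn a (F 0)"
proof -
  obtain T where T: "0 < T" "T < 1"
    and ap: "\<And>\<epsilon> F a M t. 0 < \<epsilon> \<Longrightarrow> profile \<epsilon> F \<Longrightarrow> weight q a \<Longrightarrow> (\<And>x. a x \<le> M) \<Longrightarrow> 0 \<le> t \<Longrightarrow> t \<le> T \<Longrightarrow>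
       (\<And>\<tau>. 0 \<le> \<tau> \<Longrightarrow> \<tau> \<le> t \<Longrightarrow> L2b (\<lambda>x. ennreal (jb x) * nrm F \<tau> x) B) \<Longrightarrow>
       (LINT x|lborel. (a x)\<^sup>2 * (cmod (F t x))\<^sup>2) \<le> 2 * (LINT x|lborel. (a x)\<^sup>2 * (cmod (F 0 x))\<^sup>2)"
    using apriori_bounded_weight[OF assms, of q] by blast
  show ?thesis
  proof (rule that[OF T])
    fix \<epsilon> F a t
    assume \<epsilon>: "0 < \<epsilon>" and F: "profile \<epsilon> F" and a: "weight q a" and t: "0 \<le> t" "t \<le> T"
      and bd: "\<And>\<tau>. 0 \<le> \<tau> \<Longrightarrow> \<tau> \<le> t \<Longrightarrow> L2b (\<lambda>x. ennreal (jb x) * nrm F \<tau> x) B"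
    have Fm[measurable]: "F \<tau> \<in> borel_measurable borel" for \<tau> using F curveD(1) by (auto simp: profile_def)
    have am[measurable]: "a \<in> borel_measurable borel" using a by (simp add: weight_def)
    have trunc: "wn (\<lambda>x. min (a x) (real n)) (F t) \<le> 2 * wn a (F 0)" for n
    proof -
      have w: "weight q (\<lambda>x. min (a x) (real n))" by (rule weight_min[OF a]) simp
      have le: "\<And>x. min (a x) (real n) \<le> real n" by simp
      have 1: "wn (\<lambda>x. min (a x) (real n)) (F \<tau>) = ennreal (LINT x|lborel. (min (a x) (real n))\<^sup>2 * (cmod (F \<tau> x))\<^sup>2)"
        if "0 \<le> \<tau>" "\<tau> \<le> t" for \<tau>
        unfolding wn_def by (rule weighted_L2(3)[OF bd[OF that] Fm w le])
      have "wn (\<lambda>x. min (a x) (real n)) (F t) \<le> ennreal (2 * (LINT x|lborel. (min (a x) (real n))\<^sup>2 * (cmod (F 0 x))\<^sup>2))"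
        unfolding 1[OF t(1) order_refl] by (intro ennreal_leI ap[OF \<epsilon> F w le t bd])
      also have "\<dots> = 2 * wn (\<lambda>x. min (a x) (real n)) (F 0)"
        using t by (simp add: 1 ennreal_mult)
      also have "\<dots> \<le> 2 * wn a (F 0)"
        unfolding wn_def by (intro mult_left_mono nn_integral_mono power_mono mult_right_mono ennreal_leI) auto
      finally show ?thesis .
    qed
    have "wn a (F t) = (\<integral>\<^sup>+x. (SUP n. (ennreal (min (a x) (real n)) * nrm F t x)\<^sup>2) \<partial>lborel)"
      unfolding wn_def
    proof (intro nn_integral_cong antisym)
      fix x
      obtain n where "a x \<le> real n" using real_arch_simple by blast
      then have "(ennreal (a x) * nrm F t x)\<^sup>2 = (ennreal (min (a x) (real n)) * nrm F t x)\<^sup>2" by simp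
      then show "(ennreal (a x) * nrm F t x)\<^sup>2 \<le> (SUP n. (ennreal (min (a x) (real n)) * nrm F t x)\<^sup>2)"
        by (simp only:) (rule SUP_upper, rule UNIV_I)
      show "(SUP n. (ennreal (min (a x) (real n)) * nrm F t x)\<^sup>2) \<le> (ennreal (a x) * nrm F t x)\<^sup>2"
        by (intro SUP_least power_mono mult_right_mono ennreal_leI) auto
    qed
    also have "\<dots> = (SUP n. \<integral>\<^sup>+x. (ennreal (min (a x) (real n)) * nrm F t x)\<^sup>2 \<partial>lborel)"
    proof (rule nn_integral_monotone_convergence_SUP)
      show "incseq (\<lambda>n x. (ennreal (min (a x) (real n)) * nrm F t x)\<^sup>2)"
        by (intro monoI le_funI power_mono mult_right_mono ennreal_leI) auto
    qed measurable
    also have "\<dots> \<le> 2 * wn a (F 0)"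
      using trunc by (intro SUP_least) (simp add: wn_def)
    finally show "wn a (F t) \<le> 2 * wn a (F 0)" .
  qed
qed

lemma wn_jb:
  assumes "profile \<epsilon> F"
  shows "wn jb (F \<tau>) = ennreal (h1n (F \<tau>))"
proof -
  have "(ennreal (jb x) * nrm F \<tau> x)\<^sup>2 = ennreal ((jb x)\<^sup>2 * (cmod (F \<tau> x))\<^sup>2)" for x
    using jb_ge(3)[of x] by (simp add: power_mult_distrib ennreal_power ennreal_mult)
  then show ?thesis
    unfolding wn_def h1n_def using assms
    by (simp add: profile_def nn_integral_eq_integral)
qed

text \<open>Removes the assumption of an H^1 bound on the time interval by a continuity argument: at
  the first time at which the H^1 norm reaches 2R + 1, the doubling estimate for the weight
  \<open>jb\<close> already gives a squared norm of at most 2R^2.\<close>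

theorem apriori:
  fixes R :: real
  assumes "0 \<le> R" "1 \<le> q"
  obtains T where "0 < T" "T < 1"
    "\<And>\<epsilon> F a t. 0 < \<epsilon> \<Longrightarrow> profile \<epsilon> F \<Longrightarrow> h1n (F 0) \<le> R\<^sup>2 \<Longrightarrow> weight q a \<Longrightarrow> 0 \<le> t \<Longrightarrow> t \<le> T \<Longrightarrow>
       wn a (F t) \<le> 2 * wn a (F 0)"
    "\<And>\<epsilon> F t. 0 < \<epsilon> \<Longrightarrow> profile \<epsilon> F \<Longrightarrow> h1n (F 0) \<le> R\<^sup>2 \<Longrightarrow> 0 \<le> t \<Longrightarrow> t \<le> T \<Longrightarrow>
       L2b (\<lambda>x. ennreal (jb x) * nrm F t x) (2 * R + 1)"
proof -
  define B where "B = 2 * R + 1"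
  have B: "0 \<le> B" using assms by (simp add: B_def)
  obtain T where T: "0 < T" "T < 1"
    and ap: "\<And>\<epsilon> F a t. 0 < \<epsilon> \<Longrightarrow> profile \<epsilon> F \<Longrightarrow> weight q a \<Longrightarrow> 0 \<le> t \<Longrightarrow> t \<le> T \<Longrightarrow>
       (\<And>\<tau>. 0 \<le> \<tau> \<Longrightarrow> \<tau> \<le> t \<Longrightarrow> L2b (\<lambda>x. ennreal (jb x) * nrm F \<tau> x) B) \<Longrightarrow>
       wn a (F t) \<le> 2 * wn a (F 0)"
    using apriori_weight[OF B, of q] by blast
  have main: "h1n (F t) \<le> B\<^sup>2"
    if \<epsilon>: "0 < \<epsilon>" and F: "profile \<epsilon> F" and F0: "h1n (F 0) \<le> R\<^sup>2" and t: "0 \<le> t" "t \<le> T" for \<epsilon> F t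
  proof (rule ccontr)
    assume "\<not> h1n (F t) \<le> B\<^sup>2"
    then have big: "B\<^sup>2 \<le> h1n (F t)" by simp
    \<comment> \<open>The summand 1 in B makes this strict even when R = 0.\<close>
    have RB: "2 * R\<^sup>2 < B\<^sup>2" using assms by (simp add: B_def power2_eq_square algebra_simps add_pos_nonneg)
    then have "R\<^sup>2 < B\<^sup>2" using zero_le_power2[of R] by linarith
    have cont: "continuous_on S (\<lambda>\<tau>. h1n (F \<tau>))" for S
      using F continuous_on_subset by (auto simp: profile_def)
    \<comment> \<open>\<open>Inf S\<close> is the first time at which the threshold is reached; it
      is attained because S is closed.\<close>
    define S where "S = {\<tau> \<in> {0..t}. B\<^sup>2 \<le> h1n (F \<tau>)}"
    have "S = {0..t} \<inter> (\<lambda>\<tau>. h1n (F \<tau>)) -` {B\<^sup>2..}" by (auto simp: S_def)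
    then have "closed S"
      using continuous_closed_preimage[OF cont[of "{0..t}"] closed_atLeastAtMost closed_atLeast] by simp
    moreover have "S \<noteq> {}" using big t by (auto simp: S_def)
    moreover have "bdd_below S" by (rule bdd_belowI[of _ 0]) (auto simp: S_def)
    ultimately have "Inf S \<in> S" using closed_contains_Inf by blast
    then have s: "0 \<le> Inf S" "Inf S \<le> t" "B\<^sup>2 \<le> h1n (F (Inf S))" by (auto simp: S_def)
    have lower: "h1n (F \<tau>) < B\<^sup>2" if "0 \<le> \<tau>" "\<tau> < Inf S" for \<tau>
    proof (rule ccontr)
      assume "\<not> h1n (F \<tau>) < B\<^sup>2"
      then have "\<tau> \<in> S" using that s by (auto simp: S_def)
      then have "Inf S \<le> \<tau>" using \<open>bdd_below S\<close> by (rule cInf_lower)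
      then show False using that by simp
    qed
    have s0: "0 < Inf S" using s F0 \<open>R\<^sup>2 < B\<^sup>2\<close> by (cases "Inf S = 0") auto
    have le: "h1n (F \<tau>) \<le> B\<^sup>2" if "0 \<le> \<tau>" "\<tau> \<le> Inf S" for \<tau>
    proof (cases "\<tau> = Inf S")
      case True
      \<comment> \<open>At the critical time itself the bound follows from the left limit, so that
        the a priori bound covers the closed interval.\<close>
      have "h1n (F (Inf S)) \<le> B\<^sup>2"
      proof (rule tendsto_upperbound)
        have "continuous_on UNIV (\<lambda>\<tau>. h1n (F \<tau>))" by (rule cont)
        then have "isCont (\<lambda>\<tau>. h1n (F \<tau>)) (Inf S)" by (simp add: continuous_on_eq_continuous_at)
        then show "((\<lambda>\<tau>. h1n (F \<tau>)) \<longlongrightarrow> h1n (F (Inf S))) (at_left (Inf S))"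
          unfolding isCont_def by (rule filterlim_at_split[THEN iffD1, THEN conjunct1])
        show "eventually (\<lambda>\<tau>. h1n (F \<tau>) \<le> B\<^sup>2) (at_left (Inf S))"
          using eventually_at_left_real[OF s0] by eventually_elim (use lower in \<open>auto intro: less_imp_le\<close>)
      qed simp
      then show ?thesis using True by simp
    next
      case False
      then show ?thesis using lower[of \<tau>] that by (auto intro: less_imp_le)
    qed
    have "wn jb (F (Inf S)) \<le> 2 * wn jb (F 0)"
    proof (rule ap[OF \<epsilon> F weight_le[OF weight_jb assms(2)] s(1)])
      show "Inf S \<le> T" using s t by simp
      show "L2b (\<lambda>x. ennreal (jb x) * nrm F \<tau> x) B" if "0 \<le> \<tau>" "\<tau> \<le> Inf S" for \<tau>
        using F le[OF that] B by (intro L2b_h1n) (auto simp: profile_def curve_def)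
    qed
    moreover have "0 \<le> h1n (F \<tau>)" for \<tau> unfolding h1n_def by (rule Bochner_Integration.integral_nonneg) simp
    ultimately have "h1n (F (Inf S)) \<le> 2 * h1n (F 0)"
      unfolding wn_jb[OF F] by (simp add: ennreal_mult[symmetric] ennreal_numeral[symmetric] ennreal_le_iff del: ennreal_numeral)
    then show False using s F0 RB by linarith
  qed
  have L2: "L2b (\<lambda>x. ennreal (jb x) * nrm F t x) B"
    if "0 < \<epsilon>" "profile \<epsilon> F" "h1n (F 0) \<le> R\<^sup>2" "0 \<le> t" "t \<le> T" for \<epsilon> F t
    using main[OF that] that(2) B by (intro L2b_h1n) (auto simp: profile_def curve_def)
  show ?thesis
  proof (rule that[OF T])
    fix \<epsilon> F t
    assume F: "0 < \<epsilon>" "profile \<epsilon> F" "h1n (F 0) \<le> R\<^sup>2" and t: "0 \<le> t" "t \<le> T"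
    show "L2b (\<lambda>x. ennreal (jb x) * nrm F t x) (2 * R + 1)"
      using L2[OF F t] by (simp only: B_def)
    fix a assume "weight q a"
    then show "wn a (F t) \<le> 2 * wn a (F 0)"
      by (rule ap[OF F(1,2) _ t L2[OF F]]) (use t in auto)
  qed
qed

lemma integrable_convolution:
  fixes f g :: "real \<Rightarrow> complex"
  assumes "L2b (\<lambda>x. ennreal (cmod (f x))) A" "L2b (\<lambda>x. ennreal (cmod (g x))) B"
    and [measurable]: "f \<in> borel_measurable borel" "g \<in> borel_measurable borel"
  shows "integrable lborel (\<lambda>y. f y * g (x - y))"
proof (rule integrableI_bounded)
  have "(\<integral>\<^sup>+y. ennreal (norm (f y * g (x - y))) \<partial>lborel) = (\<integral>\<^sup>+y. ennreal (cmod (f y)) * ennreal (cmod (g (x - y))) \<partial>lborel)"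
    by (simp add: norm_mult ennreal_mult)
  also have "\<dots> \<le> ennreal (A * B)"
  proof (rule nn_integral_mult_le_sqrt)
    show "(\<integral>\<^sup>+y. (ennreal (cmod (g (x - y))))\<^sup>2 \<partial>lborel) \<le> ennreal (B\<^sup>2)"
      using nn_integral_lborel_reflect[of "\<lambda>y. (ennreal (cmod (g y)))\<^sup>2" x] L2bD(3)[OF assms(2)] by simp
  qed (use L2bD[OF assms(1)] L2bD[OF assms(2)] in auto)
  finally show "(\<integral>\<^sup>+y. ennreal (norm (f y * g (x - y))) \<partial>lborel) < \<infinity>"
    by (rule le_less_trans) simp
qed measurable

lemma convolution_commute:
  fixes f g :: "real \<Rightarrow> complex"
  shows "(LINT y|lborel. f y * g (x - y)) = (LINT y|lborel. g y * f (x - y))"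
  by (subst lborel_integral_real_affine[where c = "-1" and t = x]) (simp_all add: mult.commute)

lemma curve_add:
  assumes "curve F D" "curve G E"
  shows "curve (\<lambda>\<tau> x. F \<tau> x + G \<tau> x) (\<lambda>\<tau> x. D \<tau> x + E \<tau> x)"
  using assms unfolding curve_def
  by (auto intro!: borel_measurable_add has_vector_derivative_add continuous_on_add)

lemma curve_diff:
  assumes "curve F D" "curve G E"
  shows "curve (\<lambda>\<tau> x. F \<tau> x - G \<tau> x) (\<lambda>\<tau> x. D \<tau> x - E \<tau> x)"
  using assms unfolding curve_def
  by (auto intro!: borel_measurable_diff has_vector_derivative_diff continuous_on_diff)

lemma norm_profile_rhs:
  "nrm (profile_rhs \<epsilon> F) \<tau> \<xi> \<le> ennreal c_nl * (ennreal \<bar>\<xi>\<bar> * conv (nrm F \<tau>) (nrm F \<tau>) \<xi>)"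
proof -
  define I where "I = interaction \<epsilon> \<tau> (F \<tau>) (F \<tau>) \<xi>"
  have "ennreal (cmod I) \<le> (\<integral>\<^sup>+\<eta>. ennreal (cmod ((cis (\<tau> * phase \<epsilon> \<eta>) * F \<tau> \<eta>) * (cis (\<tau> * phase \<epsilon> (\<xi> - \<eta>)) * F \<tau> (\<xi> - \<eta>)))) \<partial>lborel)"
  proof (cases "integrable lborel (\<lambda>\<eta>. (cis (\<tau> * phase \<epsilon> \<eta>) * F \<tau> \<eta>) * (cis (\<tau> * phase \<epsilon> (\<xi> - \<eta>)) * F \<tau> (\<xi> - \<eta>)))")
    case True
    then show ?thesis unfolding I_def by (rule integral_norm_bound_ennreal)
  next
    case False
    then show ?thesis unfolding I_def by (simp add: not_integrable_integral_eq)
  qed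
  also have "\<dots> = conv (nrm F \<tau>) (nrm F \<tau>) \<xi>"
    unfolding conv_def by (intro nn_integral_cong) (simp add: norm_mult ennreal_mult)
  finally have "ennreal (c_nl * \<bar>\<xi>\<bar>) * ennreal (cmod I) \<le> ennreal (c_nl * \<bar>\<xi>\<bar>) * conv (nrm F \<tau>) (nrm F \<tau>) \<xi>"
    by (rule mult_left_mono) simp
  then show ?thesis
    unfolding profile_rhs_def I_def[symmetric] using c_nl(1) by (simp add: norm_mult abs_mult ennreal_mult mult.assoc)
qed

lemma profile_L2:
  assumes "profile \<epsilon> F"
  shows "L2b (nrm F \<tau>) (sqrt (h1n (F \<tau>)))"
proof -
  have h: "0 \<le> h1n (F \<tau>)" unfolding h1n_def by (rule Bochner_Integration.integral_nonneg) simp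
  have m[measurable]: "F \<tau> \<in> borel_measurable borel" using assms by (auto simp: profile_def curve_def)
  show ?thesis
    by (rule L2b_jb_imp(1), rule L2b_h1n) (use assms h in \<open>auto simp: profile_def curve_def\<close>)
qed

text \<open>Convolution is commutative, so F*F - G*G = (F + G)*(F - G), which is the form of
  \<open>flow\<close>.\<close>

lemma profile_rhs_diff:
  assumes F: "profile \<epsilon> F" and G: "profile \<epsilon> G"
  shows "profile_rhs \<epsilon> F \<tau> \<xi> - profile_rhs \<epsilon> G \<tau> \<xi> = - \<i> * complex_of_real (c_nl * \<xi>) * cis (- (\<tau> * phase \<epsilon> \<xi>)) *
      (LINT \<eta>|lborel. (cis (\<tau> * phase \<epsilon> \<eta>) * (F \<tau> \<eta> + G \<tau> \<eta>)) * (cis (\<tau> * phase \<epsilon> (\<xi> - \<eta>)) * (F \<tau> (\<xi> - \<eta>) - G \<tau> (\<xi> - \<eta>))))"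
proof -
  define f g where "f = (\<lambda>\<xi>. cis (\<tau> * phase \<epsilon> \<xi>) * F \<tau> \<xi>)" and "g = (\<lambda>\<xi>. cis (\<tau> * phase \<epsilon> \<xi>) * G \<tau> \<xi>)"
  have [measurable]: "F \<tau> \<in> borel_measurable borel" "G \<tau> \<in> borel_measurable borel"
    using assms by (auto simp: profile_def curve_def)
  have m: "f \<in> borel_measurable borel" "g \<in> borel_measurable borel" unfolding f_def g_def by measurable
  have b: "L2b (\<lambda>x. ennreal (cmod (f x))) (sqrt (h1n (F \<tau>)))" "L2b (\<lambda>x. ennreal (cmod (g x))) (sqrt (h1n (G \<tau>)))"
    using profile_L2[OF F] profile_L2[OF G] by (simp_all add: f_def g_def norm_mult)
  have i: "integrable lborel (\<lambda>\<eta>. f \<eta> * f (\<xi> - \<eta>))" "integrable lborel (\<lambda>\<eta>. g \<eta> * g (\<xi> - \<eta>))"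
    "integrable lborel (\<lambda>\<eta>. f \<eta> * g (\<xi> - \<eta>))" "integrable lborel (\<lambda>\<eta>. g \<eta> * f (\<xi> - \<eta>))"
    by (rule integrable_convolution b m)+
  have "(LINT \<eta>|lborel. (cis (\<tau> * phase \<epsilon> \<eta>) * (F \<tau> \<eta> + G \<tau> \<eta>)) * (cis (\<tau> * phase \<epsilon> (\<xi> - \<eta>)) * (F \<tau> (\<xi> - \<eta>) - G \<tau> (\<xi> - \<eta>))))
      = (LINT \<eta>|lborel. f \<eta> * f (\<xi> - \<eta>) - f \<eta> * g (\<xi> - \<eta>) + (g \<eta> * f (\<xi> - \<eta>) - g \<eta> * g (\<xi> - \<eta>)))"
    by (intro Bochner_Integration.integral_cong refl) (simp add: f_def g_def algebra_simps)
  also have "\<dots> = (LINT \<eta>|lborel. f \<eta> * f (\<xi> - \<eta>)) - (LINT \<eta>|lborel. g \<eta> * g (\<xi> - \<eta>))"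
    using i convolution_commute[of f g \<xi>] by simp
  finally show ?thesis
    unfolding profile_rhs_def f_def g_def by (simp only: right_diff_distrib)
qed

text \<open>Both solutions are bounded in H^1, but the distance is propagated in L^2 alone; T
  depends only on the common H^1 bound.\<close>

theorem difference:
  fixes B :: real
  assumes "0 \<le> B"
  obtains T where "0 < T" "T < 1"
    "\<And>\<epsilon> F G t. 0 < \<epsilon> \<Longrightarrow> profile \<epsilon> F \<Longrightarrow> profile \<epsilon> G \<Longrightarrow> 0 \<le> t \<Longrightarrow> t \<le> T \<Longrightarrow>
       (\<And>\<tau>. 0 \<le> \<tau> \<Longrightarrow> \<tau> \<le> t \<Longrightarrow> L2b (\<lambda>x. ennreal (jb x) * nrm F \<tau> x) B) \<Longrightarrow>
       (\<And>\<tau>. 0 \<le> \<tau> \<Longrightarrow> \<tau> \<le> t \<Longrightarrow> L2b (\<lambda>x. ennreal (jb x) * nrm G \<tau> x) B) \<Longrightarrow>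
       wn (\<lambda>_. 1) (\<lambda>x. F t x - G t x) \<le> 2 * wn (\<lambda>_. 1) (\<lambda>x. F 0 x - G 0 x)"
proof -
  \<comment> \<open>The sum F + G has weighted norm at most 2B, hence L^1 norm at most 4B.\<close>
  define B' where "B' = 4 * B"
  define B2 where "B2 = c_nl * (2 * (2 * B * (2 * B)) + 2 * (2 * B * (2 * B)))"
  \<comment> \<open>B' + 1 dominates both B', the coefficient of the boundary terms, and 1, that of
    the terms linear in time.\<close>
  define X where "X = 2 * c_nl * (B' + 1)"
  define Y where "Y K = (2 * K + 3) * B' + (8 * B2 + 10 * c_nl * B'\<^sup>2)" for K
  have B': "0 \<le> B'" "0 \<le> B2" using assms c_nl by (auto simp: B'_def B2_def)
  have X: "0 \<le> X" unfolding X_def using c_nl B' by auto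
  have Y: "0 \<le> Y K" if "1 \<le> K" for K unfolding Y_def using c_nl that B' by (intro add_nonneg_nonneg mult_nonneg_nonneg) auto
  obtain K T where K: "1 \<le> K" and T: "0 < T" "T < 1" and small: "\<And>t. 0 \<le> t \<Longrightarrow> t \<le> T \<Longrightarrow> X * (t * Y K + 4 / K) \<le> 1 / 2"
    using choose_parameters[OF X, of Y] Y by blast
  show ?thesis
  proof (rule that[OF T])
    fix \<epsilon> F G t
    assume \<epsilon>: "0 < \<epsilon>" and F: "profile \<epsilon> F" and G: "profile \<epsilon> G" and t: "0 \<le> t" "t \<le> T"
      and bF: "\<And>\<tau>. 0 \<le> \<tau> \<Longrightarrow> \<tau> \<le> t \<Longrightarrow> L2b (\<lambda>x. ennreal (jb x) * nrm F \<tau> x) B"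
      and bG: "\<And>\<tau>. 0 \<le> \<tau> \<Longrightarrow> \<tau> \<le> t \<Longrightarrow> L2b (\<lambda>x. ennreal (jb x) * nrm G \<tau> x) B"
    have c: "curve F (profile_rhs \<epsilon> F)" "curve G (profile_rhs \<epsilon> G)" using F G by (simp_all add: profile_def)
    have Fm[measurable]: "F \<tau> \<in> borel_measurable borel" "G \<tau> \<in> borel_measurable borel" for \<tau> 
      using curveD(1)[OF c(1)] curveD(1)[OF c(2)] by auto
    define W where "W = (\<lambda>\<tau> x. F \<tau> x - G \<tau> x)"
    define Z where "Z = (\<lambda>\<tau> x. F \<tau> x + G \<tau> x)"
    have [measurable]: "W \<tau> \<in> borel_measurable borel" "Z \<tau> \<in> borel_measurable borel" for \<tau>
      unfolding W_def Z_def by measurable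
    have nW: "nrm W \<tau> x \<le> nrm F \<tau> x + nrm G \<tau> x" and nZ: "nrm Z \<tau> x \<le> nrm F \<tau> x + nrm G \<tau> x" for \<tau> x
      unfolding W_def Z_def
      by (auto simp: ennreal_plus[symmetric] intro!: ennreal_leI norm_triangle_ineq norm_triangle_ineq4 simp del: ennreal_plus)
    have W2: "L2b (\<lambda>x. ennreal (jb x) * nrm W \<tau> x) (B + B)" and Z2: "L2b (\<lambda>x. ennreal (jb x) * nrm Z \<tau> x) (B + B)"
      if s: "0 \<le> \<tau>" "\<tau> \<le> t" for \<tau>
    proof -
      have W: "ennreal (jb x) * nrm W \<tau> x \<le> ennreal (jb x) * nrm F \<tau> x + ennreal (jb x) * nrm G \<tau> x" for x
        unfolding distrib_left[symmetric] by (rule mult_left_mono[OF nW]) simp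
      have Z: "ennreal (jb x) * nrm Z \<tau> x \<le> ennreal (jb x) * nrm F \<tau> x + ennreal (jb x) * nrm G \<tau> x" for x
        unfolding distrib_left[symmetric] by (rule mult_left_mono[OF nZ]) simp
      show "L2b (\<lambda>x. ennreal (jb x) * nrm W \<tau> x) (B + B)"
        by (rule L2b_mono[OF L2b_add[OF bF[OF s] bG[OF s]] W _ order_refl]) measurable
      show "L2b (\<lambda>x. ennreal (jb x) * nrm Z \<tau> x) (B + B)"
        by (rule L2b_mono[OF L2b_add[OF bF[OF s] bG[OF s]] Z _ order_refl]) measurable
    qed
    define E where "E \<tau> = (LINT x|lborel. (cmod (W \<tau> x))\<^sup>2)" for \<tau>
    have one: "weight 0 (\<lambda>x. 1)" by (rule weight_const) simp
    have wl: "wn (\<lambda>_. 1) (W \<tau>) = ennreal (E \<tau>)" "E \<tau> \<le> (B + B)\<^sup>2" if s: "0 \<le> \<tau>" "\<tau> \<le> t" for \<tau>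
      using weighted_L2(2,3)[OF W2[OF s] _ one order_refl] by (simp_all add: wn_def E_def)
    have E0: "0 \<le> E \<tau>" for \<tau> unfolding E_def by (rule Bochner_Integration.integral_nonneg) simp
    have "E t \<le> 2 * E 0"
    proof (rule sup_absorb[of t E])
      fix \<tau> S assume \<tau>: "0 \<le> \<tau>" "\<tau> \<le> t" and S: "\<And>\<sigma>. 0 \<le> \<sigma> \<Longrightarrow> \<sigma> \<le> t \<Longrightarrow> E \<sigma> \<le> S"
      have S0: "0 \<le> S" using S[of 0] E0[of 0] t by simp
      \<comment> \<open>A majorant of the time derivative of F + G; its L^2 bound from
        \<open>L2b_abs_conv\<close> is \<open>B2\<close>.\<close>
      define H where "H = (\<lambda>\<tau> x. ennreal c_nl * (ennreal \<bar>x\<bar> * conv (nrm F \<tau>) (nrm F \<tau>) x + ennreal \<bar>x\<bar> * conv (nrm G \<tau>) (nrm G \<tau>) x))"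
      have "\<bar>E \<tau> - E 0\<bar> \<le> 2 * c_nl * (\<tau> * ((2 * K + 3) * B') + 4 * B' / K + \<tau> * (8 * B2 + 10 * c_nl * B'\<^sup>2)) * (sqrt S)\<^sup>2"
        unfolding E_def
      proof (rule difference_step[where G = H and W = W and Z = Z and \<epsilon> = \<epsilon>, OF \<epsilon> curve_diff[OF c, folded W_def] curve_add[OF c, folded Z_def] _ _ \<tau>(1) c_nl(1) K])
        show "W \<tau> (- \<xi>) = cnj (W \<tau> \<xi>)" for \<tau> \<xi> using F G by (simp add: profile_def W_def)
        show "profile_rhs \<epsilon> F \<tau> \<xi> - profile_rhs \<epsilon> G \<tau> \<xi> = - \<i> * complex_of_real (c_nl * \<xi>) * cis (- (\<tau> * phase \<epsilon> \<xi>)) *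
          interaction \<epsilon> \<tau> (Z \<tau>) (W \<tau>) \<xi>" for \<tau> \<xi>
          unfolding W_def Z_def by (rule profile_rhs_diff[OF F G])
        fix \<sigma> assume s: "0 \<le> \<sigma>" "\<sigma> \<le> \<tau>"
        then have s': "0 \<le> \<sigma>" "\<sigma> \<le> t" using \<tau> by auto
        have m: "nrm W \<sigma> \<in> borel_measurable borel" "nrm Z \<sigma> \<in> borel_measurable borel"
          "nrm F \<sigma> \<in> borel_measurable borel" "nrm G \<sigma> \<in> borel_measurable borel" by measurable
        note w = L2b_jb_imp[OF W2[OF s'] m(1)] and z = L2b_jb_imp[OF Z2[OF s'] m(2)]
        note f = L2b_jb_imp[OF bF[OF s'] m(3)] and g = L2b_jb_imp[OF bG[OF s'] m(4)]
        show "L2b (nrm W \<sigma>) (sqrt S)"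
          unfolding L2b_def using S[OF s'] wl(1)[OF s'] S0 m(1) by (simp add: wn_def ennreal_leI)
        show "L2b (\<lambda>x. ennreal \<bar>x\<bar> * nrm W \<sigma> x) B'" by (rule L2b_mono[OF w(2)]) (use assms in \<open>auto simp: B'_def\<close>)
        show "L2b (\<lambda>x. ennreal \<bar>x\<bar> * nrm Z \<sigma> x) B'" by (rule L2b_mono[OF z(2)]) (use assms in \<open>auto simp: B'_def\<close>)
        show "L1b (nrm Z \<sigma>) B'" using z(3) by (simp add: B'_def)
        have F': "L2b (\<lambda>x. ennreal \<bar>x\<bar> * nrm F \<sigma> x) (2 * B)" by (rule L2b_mono[OF f(2)]) (use assms in auto)
        have G': "L2b (\<lambda>x. ennreal \<bar>x\<bar> * nrm G \<sigma> x) (2 * B)" by (rule L2b_mono[OF g(2)]) (use assms in auto)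
        show "L2b (H \<sigma>) B2"
          unfolding H_def B2_def
          by (rule L2b_cmult[OF L2b_add[OF L2b_abs_conv[OF f(3,1) F'] L2b_abs_conv[OF g(3,1) G']] c_nl(1)])
        fix x
        have "ennreal (cmod (profile_rhs \<epsilon> F \<sigma> x + profile_rhs \<epsilon> G \<sigma> x)) \<le> nrm (profile_rhs \<epsilon> F) \<sigma> x + nrm (profile_rhs \<epsilon> G) \<sigma> x"
          by (auto simp: ennreal_plus[symmetric] intro!: ennreal_leI norm_triangle_ineq simp del: ennreal_plus)
        also have "\<dots> \<le> H \<sigma> x"
          unfolding H_def distrib_left by (intro add_mono norm_profile_rhs)
        finally show "ennreal (cmod (profile_rhs \<epsilon> F \<sigma> x + profile_rhs \<epsilon> G \<sigma> x)) \<le> H \<sigma> x" .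
      qed
      also have "\<dots> \<le> X * (\<tau> * Y K + 4 / K) * S"
      proof -
        have "2 * c_nl * (\<tau> * ((2 * K + 3) * B') + 4 * B' / K + \<tau> * (8 * B2 + 10 * c_nl * B'\<^sup>2)) = 2 * c_nl * (1 * (\<tau> * Y K) + B' * (4 / K))"
          by (simp add: Y_def algebra_simps)
        also have "\<dots> \<le> 2 * c_nl * ((B' + 1) * (\<tau> * Y K) + (B' + 1) * (4 / K))"
          using c_nl B' \<tau> Y[OF K] K by (intro mult_left_mono add_mono mult_right_mono) auto
        also have "\<dots> = X * (\<tau> * Y K + 4 / K)"
        proof -
          have "2 * c_nl * ((B' + 1) * u + (B' + 1) * v) = X * (u + v)" for u v
            by (simp add: X_def algebra_simps)
          then show ?thesis .
        qed
        finally show ?thesis using S0 by (simp add: mult_right_mono)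
      qed
      also have "\<dots> \<le> 1 / 2 * S"
        using small[of \<tau>] \<tau> t S0 by (intro mult_right_mono) auto
      finally show "E \<tau> \<le> E 0 + S / 2" by linarith
    qed (use t wl(2) in auto)
    then show "wn (\<lambda>_. 1) (\<lambda>x. F t x - G t x) \<le> 2 * wn (\<lambda>_. 1) (\<lambda>x. F 0 x - G 0 x)"
      using wl(1)[of t] wl(1)[of 0] t E0
      by (simp add: W_def ennreal_mult[symmetric] ennreal_numeral[symmetric] ennreal_leI del: ennreal_numeral)
  qed
qed

section \<open>Plancherel theorem\<close>

lemma L2_measurable: "f \<in> L2 \<Longrightarrow> f \<in> borel_measurable borel"
  by (simp add: L2_def)

lemma L2_norm_nonneg [simp]: "0 \<le> L2_norm f"
  by (simp add: L2_norm_def)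

lemma L2_norm_power2: "(L2_norm f)\<^sup>2 = (LINT x|lborel. (cmod (f x))\<^sup>2)"
  by (simp add: L2_norm_def)

lemma L2_nn:
  assumes "f \<in> L2"
  shows "(\<integral>\<^sup>+x. ennreal ((cmod (f x))\<^sup>2) \<partial>lborel) = ennreal ((L2_norm f)\<^sup>2)"
  unfolding L2_norm_power2 using assms by (simp add: L2_def nn_integral_eq_integral)

lemma L2D: 
  assumes "f \<in> L2" shows "L2b (\<lambda>x. ennreal (cmod (f x))) (L2_norm f)"
proof -
  have [measurable]: "f \<in> borel_measurable borel" using assms by (rule L2_measurable)
  have "(\<lambda>x. ennreal (cmod (f x))) \<in> borel_measurable borel" by measurable
  then show ?thesis using L2_nn[OF assms] by (simp add: L2b_def ennreal_power)
qed

lemma L2I: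
  assumes "L2b (\<lambda>x. ennreal (cmod (f x))) A" "f \<in> borel_measurable borel"
  shows "f \<in> L2" "L2_norm f \<le> A"
proof -
  note [measurable] = assms(2)
  have n: "(\<integral>\<^sup>+x. ennreal ((cmod (f x))\<^sup>2) \<partial>lborel) \<le> ennreal (A\<^sup>2)"
    using L2bD(3)[OF assms(1)] by (simp add: ennreal_power)
  have "integrable lborel (\<lambda>x. (cmod (f x))\<^sup>2)"
  proof (rule integrableI_bounded)
    show "(\<integral>\<^sup>+x. ennreal (norm ((cmod (f x))\<^sup>2)) \<partial>lborel) < \<infinity>"
      using le_less_trans[OF n ennreal_less_top] by simp
  qed measurable
  then show f: "f \<in> L2" by (simp add: L2_def)
  have "ennreal ((L2_norm f)\<^sup>2) \<le> ennreal (A\<^sup>2)" using n by (simp add: L2_nn[OF f])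
  then have "(L2_norm f)\<^sup>2 \<le> A\<^sup>2" by (simp add: ennreal_le_iff)
  then show "L2_norm f \<le> A" using L2bD(2)[OF assms(1)] by (rule power2_le_imp_le)
qed

lemma L2_add:
  assumes "f \<in> L2" "g \<in> L2"
  shows "(\<lambda>x. f x + g x) \<in> L2" "L2_norm (\<lambda>x. f x + g x) \<le> L2_norm f + L2_norm g"
proof -
  note [measurable] = L2_measurable[OF assms(1)] L2_measurable[OF assms(2)]
  have "L2b (\<lambda>x. ennreal (cmod (f x + g x))) (L2_norm f + L2_norm g)"
  proof (rule L2b_mono[OF L2b_add[OF L2D[OF assms(1)] L2D[OF assms(2)]] _ _ order_refl])
    show "ennreal (cmod (f x + g x)) \<le> ennreal (cmod (f x)) + ennreal (cmod (g x))" for x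
      by (simp add: ennreal_plus[symmetric] ennreal_leI norm_triangle_ineq del: ennreal_plus)
  qed measurable
  from L2I[OF this] show "(\<lambda>x. f x + g x) \<in> L2" "L2_norm (\<lambda>x. f x + g x) \<le> L2_norm f + L2_norm g"
    by auto
qed

lemma L2_cmult:
  assumes "f \<in> L2"
  shows "(\<lambda>x. c * f x) \<in> L2" "L2_norm (\<lambda>x. c * f x) = cmod c * L2_norm f"
  using assms by (auto simp: L2_def L2_norm_def norm_mult power_mult_distrib real_sqrt_mult)

lemma L2_diff:
  assumes "f \<in> L2" "g \<in> L2"
  shows "(\<lambda>x. f x - g x) \<in> L2" "L2_norm (\<lambda>x. f x - g x) \<le> L2_norm f + L2_norm g"
  using L2_add[OF assms(1) L2_cmult(1)[OF assms(2), of "-1"]] L2_cmult(2)[OF assms(2), of "-1"] by auto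

lemma L2_norm_minus_commute: "L2_norm (\<lambda>x. f x - g x) = L2_norm (\<lambda>x. g x - f x)"
  by (simp add: L2_norm_def norm_minus_commute)

lemma L2_triangle:
  assumes "f \<in> L2" "g \<in> L2" "h \<in> L2"
  shows "L2_norm (\<lambda>x. f x - h x) \<le> L2_norm (\<lambda>x. f x - g x) + L2_norm (\<lambda>x. g x - h x)"
  using L2_add(2)[OF L2_diff(1)[OF assms(1,2)] L2_diff(1)[OF assms(2,3)]] by simp

lemma L2_norm_triangle_diff:
  assumes "f \<in> L2" "g \<in> L2"
  shows "\<bar>L2_norm f - L2_norm g\<bar> \<le> L2_norm (\<lambda>x. f x - g x)"
  using L2_add(2)[OF assms(1) L2_diff(1)[OF assms(2,1)]] L2_add(2)[OF assms(2) L2_diff(1)[OF assms]]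
    L2_norm_minus_commute[of f g] by simp

lemma L2_tendsto_norm:
  assumes "\<And>n. u n \<in> L2" "g \<in> L2" "((\<lambda>n. L2_norm (\<lambda>x. u n x - g x)) \<longlongrightarrow> 0) F"
  shows "((\<lambda>n. L2_norm (u n)) \<longlongrightarrow> L2_norm g) F"
proof (rule LIM_zero_cancel, rule Lim_null_comparison[OF _ assms(3)])
  show "\<forall>\<^sub>F n in F. norm (L2_norm (u n) - L2_norm g) \<le> L2_norm (\<lambda>x. u n x - g x)"
    using L2_norm_triangle_diff[OF assms(1,2)] by simp
qed

lemma L2_mult:
  assumes "f \<in> L2" "g \<in> L2"
  shows "integrable lborel (\<lambda>x. f x * g x)" "cmod (LINT x|lborel. f x * g x) \<le> L2_norm f * L2_norm g"
proof -
  note [measurable] = L2_measurable[OF assms(1)] L2_measurable[OF assms(2)]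
  have b: "(\<integral>\<^sup>+x. ennreal (norm (f x * g x)) \<partial>lborel) \<le> ennreal (L2_norm f * L2_norm g)"
    using L1bD(3)[OF L1b_mult[OF L2D[OF assms(1)] L2D[OF assms(2)]]] by (simp add: norm_mult ennreal_mult)
  show i: "integrable lborel (\<lambda>x. f x * g x)"
    by (rule integrableI_bounded) (use le_less_trans[OF b ennreal_less_top] in simp_all)
  have "ennreal (cmod (LINT x|lborel. f x * g x)) \<le> ennreal (L2_norm f * L2_norm g)"
    using integral_norm_bound_ennreal[OF i] b by (rule order_trans)
  then show "cmod (LINT x|lborel. f x * g x) \<le> L2_norm f * L2_norm g"
    by (subst (asm) ennreal_le_iff) auto
qed

lemma L2_norm_eq_0:
  assumes "f \<in> L2" "L2_norm f = 0"
  shows "AE x in lborel. f x = 0"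
proof -
  note [measurable] = L2_measurable[OF assms(1)]
  have "(\<integral>\<^sup>+x. ennreal ((cmod (f x))\<^sup>2) \<partial>lborel) = 0"
    by (simp add: L2_nn[OF assms(1)] assms(2))
  then have "AE x in lborel. ennreal ((cmod (f x))\<^sup>2) = 0"
    by (subst (asm) nn_integral_0_iff_AE) auto
  then show ?thesis by eventually_elim simp
qed

lemma L2_cong_AE:
  assumes "f \<in> L2" "AE x in lborel. f x = g x" "g \<in> borel_measurable borel"
  shows "g \<in> L2" "L2_norm g = L2_norm f"
proof -
  have ae: "AE x in lborel. (cmod (f x))\<^sup>2 = (cmod (g x))\<^sup>2" using assms(2) by eventually_elim simp
  have [measurable]: "f \<in> borel_measurable borel" "g \<in> borel_measurable borel" using assms by (auto simp: L2_def)
  have "integrable lborel (\<lambda>x. (cmod (g x))\<^sup>2)"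
    using assms(1) by (subst integrable_cong_AE[where g = "\<lambda>x. (cmod (f x))\<^sup>2"]) (use ae in \<open>auto simp: L2_def eq_commute\<close>)
  then show "g \<in> L2" using assms by (simp add: L2_def)
  show "L2_norm g = L2_norm f"
    unfolding L2_norm_def by (rule arg_cong[where f = sqrt], rule integral_cong_AE) (use ae in \<open>auto simp: eq_commute\<close>)
qed

lemma L2_dominated:
  fixes u :: "nat \<Rightarrow> real \<Rightarrow> complex"
  assumes "\<And>n. u n \<in> borel_measurable borel" "f \<in> borel_measurable borel"
    and "AE x in lborel. (\<lambda>n. u n x) \<longlonglongrightarrow> f x"
    and "integrable lborel w" "\<And>n. AE x in lborel. (cmod (u n x - f x))\<^sup>2 \<le> w x"
  shows "(\<lambda>n. L2_norm (\<lambda>x. u n x - f x)) \<longlonglongrightarrow> 0"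
proof -
  note [measurable] = assms(1,2)
  have "(\<lambda>n. LINT x|lborel. (cmod (u n x - f x))\<^sup>2) \<longlonglongrightarrow> integral\<^sup>L lborel (\<lambda>x :: real. 0 :: real)"
  proof (rule Bochner_Integration.integral_dominated_convergence[where w = w])
    show "AE x in lborel. (\<lambda>n. (cmod (u n x - f x))\<^sup>2) \<longlonglongrightarrow> 0"
      using assms(3)
    proof eventually_elim
      case (elim x)
      then have "(\<lambda>n. (cmod (u n x - f x))\<^sup>2) \<longlonglongrightarrow> (cmod (f x - f x))\<^sup>2"
        by (intro tendsto_intros)
      then show ?case by simp
    qed
  qed (use assms(4,5) in auto)
  then have "(\<lambda>n. sqrt (LINT x|lborel. (cmod (u n x - f x))\<^sup>2)) \<longlonglongrightarrow> sqrt 0"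
    by (intro tendsto_real_sqrt) simp
  then show ?thesis by (simp add: L2_norm_def)
qed

lemma L2_compact_support:
  assumes "f \<in> borel_measurable borel" "\<And>x. cmod (f x) \<le> C * indicator {-R..R} x" "0 \<le> C"
  shows "f \<in> L2" "integrable lborel f"
proof -
  note [measurable] = assms(1)
  have i: "integrable lborel (\<lambda>x. K * indicator {-R..R} x :: real)" for K
    by (intro integrable_mult_right integrable_real_indicator) (auto simp: emeasure_lborel_Icc_eq)
  have "integrable lborel (\<lambda>x. (cmod (f x))\<^sup>2)"
  proof (rule Bochner_Integration.integrable_bound[OF i[of "C\<^sup>2"]])
    show "AE x in lborel. norm ((cmod (f x))\<^sup>2) \<le> norm (C\<^sup>2 * indicator {-R..R} x)"
    proof (intro AE_I2)
      fix x
      have "(cmod (f x))\<^sup>2 \<le> (C * indicator {-R..R} x)\<^sup>2"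
        using assms(2) by (intro power_mono) auto
      then show "norm ((cmod (f x))\<^sup>2) \<le> norm (C\<^sup>2 * indicator {-R..R} x)"
        by (auto simp: indicator_def split: if_splits)
    qed
  qed measurable
  then show "f \<in> L2" by (simp add: L2_def)
  show "integrable lborel f"
    by (rule Bochner_Integration.integrable_bound[OF i[of C]]) (use assms in \<open>auto intro: order_trans abs_ge_self\<close>)
qed

text \<open>After truncation in height and support the function is bounded and measurable, hence an
  almost everywhere limit of continuous functions; these are then corrected so that dominated
  convergence applies.\<close>

lemma L2_dense:
  assumes f: "f \<in> L2" and e: "0 < e"
  obtains h C R where "continuous_on UNIV h" "0 \<le> C" "\<And>x. cmod (h x) \<le> C * indicator {-R..R} x"
    "L2_norm (\<lambda>x. f x - h x) < e"
proof -
  note fm[measurable] = L2_measurable[OF f]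
  define u where "u n x = (if \<bar>x\<bar> \<le> real n \<and> cmod (f x) \<le> real n then f x else 0)" for n x
  have [measurable]: "u n \<in> borel_measurable borel" for n unfolding u_def by measurable
  have "(\<lambda>n. L2_norm (\<lambda>x. u n x - f x)) \<longlonglongrightarrow> 0"
  proof (rule L2_dominated[where w = "\<lambda>x. (cmod (f x))\<^sup>2"])
    show "AE x in lborel. (\<lambda>n. u n x) \<longlonglongrightarrow> f x"
    proof (intro AE_I2)
      fix x
      obtain N where N: "max \<bar>x\<bar> (cmod (f x)) \<le> real N" using real_arch_simple by blast
      have "eventually (\<lambda>n. u n x = f x) sequentially"
        using eventually_ge_at_top[of N] by eventually_elim (use N in \<open>auto simp: u_def\<close>)
      then show "(\<lambda>n. u n x) \<longlonglongrightarrow> f x" by (rule tendsto_eventually)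
    qed
    show "AE x in lborel. (cmod (u n x - f x))\<^sup>2 \<le> (cmod (f x))\<^sup>2" for n
      by (intro AE_I2) (auto simp: u_def)
  qed (use f in \<open>auto simp: L2_def\<close>)
  then have "eventually (\<lambda>n. L2_norm (\<lambda>x. u n x - f x) < e / 2) sequentially"
    using e by (intro order_tendstoD(2)) auto
  then obtain N where N: "L2_norm (\<lambda>x. u N x - f x) < e / 2" by (auto simp: eventually_sequentially)
  define g where "g = u N"
  have gm[measurable]: "g \<in> borel_measurable borel" unfolding g_def by measurable
  have gb: "cmod (g x) \<le> real N" "\<bar>x\<bar> > real N \<Longrightarrow> g x = 0" for x by (auto simp: g_def u_def)
  \<comment> \<open>Measurability in this sense means approximation by continuous functions off a
    negligible set.\<close>
  have "g measurable_on UNIV"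
    by (rule lebesgue_measurable_imp_measurable_on) (simp_all add: measurable_completion)
  then obtain Z v where Z: "negligible Z" and vc: "\<And>n. continuous_on UNIV (v n)" and vl: "\<And>x. x \<notin> Z \<Longrightarrow> (\<lambda>n. v n x) \<longlonglongrightarrow> g x"
    unfolding measurable_on_def by auto
  \<comment> \<open>Nearest point projection onto the ball of radius N: continuous, enforces a
    uniform bound and fixes all values of g.\<close>
  define cl :: "complex \<Rightarrow> complex" where "cl = closest_point (cball 0 (real N))"
  have clc: "continuous_on T cl" for T
    unfolding cl_def by (rule continuous_on_closest_point) auto
  have clb: "cmod (cl z) \<le> real N" for z
    using closest_point_in_set[of "cball 0 (real N)" z] by (simp add: cl_def)
  have cls: "cl z = z" if "cmod z \<le> real N" for z
    unfolding cl_def by (rule closest_point_self) (use that in simp)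
  \<comment> \<open>A continuous cut-off that is 1 on the support of g and vanishes outside the
    interval of radius N + 1.\<close>
  define th :: "real \<Rightarrow> real" where "th x = max 0 (min 1 (real N + 1 - \<bar>x\<bar>))" for x
  define h where "h n x = complex_of_real (th x) * cl (v n x)" for n x
  have hc: "continuous_on UNIV (h n)" for n
    unfolding h_def th_def by (intro continuous_intros continuous_on_compose2[OF clc vc]) auto
  have hb: "cmod (h n x) \<le> real N * indicator {-(real N + 1)..real N + 1} x" for n x
  proof -
    have "\<bar>th x\<bar> \<le> indicator {-(real N + 1)..real N + 1} x"
      by (auto simp: th_def indicator_def)
    then have "\<bar>th x\<bar> * cmod (cl (v n x)) \<le> indicator {-(real N + 1)..real N + 1} x * real N"
      by (intro mult_mono clb) auto
    then show ?thesis by (simp add: h_def norm_mult mult.commute)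
  qed
  have [measurable]: "h n \<in> borel_measurable borel" for n
    by (rule borel_measurable_continuous_onI[OF hc])
  have "(\<lambda>n. L2_norm (\<lambda>x. h n x - g x)) \<longlonglongrightarrow> 0"
  proof (rule L2_dominated[where w = "\<lambda>x. (2 * real N)\<^sup>2 * indicator {-(real N + 1)..real N + 1} x"])
    have "AE x in lebesgue. x \<notin> Z"
      using Z by (intro AE_not_in) (simp only: negligible_iff_null_sets)
    then have "AE x in lborel. x \<notin> Z"
      by (simp only: AE_completion_iff)
    then show "AE x in lborel. (\<lambda>n. h n x) \<longlonglongrightarrow> g x"
    proof eventually_elim
      case (elim x)
      have "isCont cl (g x)" using clc[of UNIV] by (simp add: continuous_on_eq_continuous_at)
      then have "(\<lambda>n. cl (v n x)) \<longlonglongrightarrow> cl (g x)" using vl[OF elim] by (rule isCont_tendsto_compose)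
      then have "(\<lambda>n. h n x) \<longlonglongrightarrow> complex_of_real (th x) * g x"
        unfolding h_def cls[OF gb(1)] by (intro tendsto_intros)
      moreover have "complex_of_real (th x) * g x = g x"
        using gb(2)[of x] by (cases "\<bar>x\<bar> > real N") (auto simp: th_def)
      ultimately show ?case by simp
    qed
    show "integrable lborel (\<lambda>x. (2 * real N)\<^sup>2 * indicator {-(real N + 1)..real N + 1} x :: real)"
      by (intro integrable_mult_right integrable_real_indicator) (auto simp: emeasure_lborel_Icc_eq)
    show "AE x in lborel. (cmod (h n x - g x))\<^sup>2 \<le> (2 * real N)\<^sup>2 * indicator {-(real N + 1)..real N + 1} x" for n
    proof (intro AE_I2)
      fix x
      have "cmod (h n x - g x) \<le> 2 * real N * indicator {-(real N + 1)..real N + 1} x"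
        using hb[of n x] gb[of x] norm_triangle_ineq4[of "h n x" "g x"] by (auto simp: indicator_def split: if_splits)
      then have "(cmod (h n x - g x))\<^sup>2 \<le> (2 * real N * indicator {-(real N + 1)..real N + 1} x)\<^sup>2"
        by (intro power_mono) auto
      also have "\<dots> = (2 * real N)\<^sup>2 * indicator {-(real N + 1)..real N + 1} x"
        by (simp add: indicator_def)
      finally show "(cmod (h n x - g x))\<^sup>2 \<le> (2 * real N)\<^sup>2 * indicator {-(real N + 1)..real N + 1} x" .
    qed
  qed measurable
  then have "eventually (\<lambda>n. L2_norm (\<lambda>x. h n x - g x) < e / 2) sequentially"
    using e by (intro order_tendstoD(2)) auto
  then obtain n where n: "L2_norm (\<lambda>x. h n x - g x) < e / 2" by (auto simp: eventually_sequentially)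
  have h2: "h n \<in> L2" by (rule L2_compact_support(1)[OF _ hb]) auto
  have g2: "g \<in> L2"
    by (rule L2_compact_support(1)[where C = "real N" and R = "real N"]) (use gb in \<open>auto simp: indicator_def\<close>)
  have "L2_norm (\<lambda>x. f x - h n x) < e"
    using L2_triangle[OF f g2 h2] n N L2_norm_minus_commute[of f g] L2_norm_minus_commute[of g "h n"] by (simp add: g_def)
  then show ?thesis by (intro that[OF hc _ hb]) auto
qed

text \<open>The limit is not assumed to be in L^2; membership is part of the conclusion, as
  completeness requires.\<close>

lemma L2_fatou:
  fixes a :: "nat \<Rightarrow> real \<Rightarrow> complex"
  assumes a: "\<And>k. a k \<in> L2" and b[measurable]: "b \<in> borel_measurable borel"
    and lim: "AE x in lborel. (\<lambda>k. a k x) \<longlonglongrightarrow> b x"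
    and e: "eventually (\<lambda>k. L2_norm (a k) \<le> e) sequentially" "0 \<le> e"
  shows "b \<in> L2" "L2_norm b \<le> e"
proof -
  note [measurable] = L2_measurable[OF a]
  have "(\<integral>\<^sup>+x. (ennreal (cmod (b x)))\<^sup>2 \<partial>lborel) = (\<integral>\<^sup>+x. liminf (\<lambda>k. ennreal ((cmod (a k x))\<^sup>2)) \<partial>lborel)"
  proof (rule nn_integral_cong_AE)
    show "AE x in lborel. (ennreal (cmod (b x)))\<^sup>2 = liminf (\<lambda>k. ennreal ((cmod (a k x))\<^sup>2))"
      using lim
    proof eventually_elim
      case (elim x)
      have "(\<lambda>k. ennreal ((cmod (a k x))\<^sup>2)) \<longlonglongrightarrow> ennreal ((cmod (b x))\<^sup>2)"
        by (intro tendsto_ennrealI tendsto_intros elim)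
      from lim_imp_Liminf[OF trivial_limit_sequentially this] show ?case by (simp add: ennreal_power)
    qed
  qed
  also have "\<dots> \<le> liminf (\<lambda>k. \<integral>\<^sup>+x. ennreal ((cmod (a k x))\<^sup>2) \<partial>lborel)"
    by (rule nn_integral_liminf) measurable
  also have "\<dots> \<le> ennreal (e\<^sup>2)"
  proof -
    have "eventually (\<lambda>k. (\<integral>\<^sup>+x. ennreal ((cmod (a k x))\<^sup>2) \<partial>lborel) \<le> ennreal (e\<^sup>2)) sequentially"
      using e(1) by eventually_elim (simp add: L2_nn[OF a] ennreal_leI power_mono)
    then show ?thesis by (rule Liminf_le[rotated]) simp
  qed
  finally have "L2b (\<lambda>x. ennreal (cmod (b x))) e" using e(2) by (simp add: L2b_def)
  from L2I[OF this b] show "b \<in> L2" "L2_norm b \<le> e" .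
qed

text \<open>Against the weight \<open>1 / jb \<in> L\<^sup>2\<close> a Cauchy sequence in \<open>L\<^sup>2\<close> is one in \<open>L\<^sup>1\<close>, which yields
  a subsequence that converges almost everywhere.\<close>

lemma L2_complete:
  fixes u :: "nat \<Rightarrow> real \<Rightarrow> complex"
  assumes u: "\<And>n. u n \<in> L2" and cauchy: "\<And>e. 0 < e \<Longrightarrow> \<exists>N. \<forall>m\<ge>N. \<forall>n\<ge>N. L2_norm (\<lambda>x. u m x - u n x) < e"
  obtains g where "g \<in> L2" "(\<lambda>n. L2_norm (\<lambda>x. u n x - g x)) \<longlonglongrightarrow> 0"
proof -
  note [measurable] = L2_measurable[OF u]
  define w :: "real \<Rightarrow> complex" where "w x = of_real (1 / jb x)" for x
  have w: "w \<in> L2" unfolding w_def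
    by (rule L2I(1)[where A = 2]) (use L2b_inverse_jb jb_ge(3) in \<open>simp_all add: norm_divide less_imp_le\<close>)
  have dL: "(\<lambda>x. u m x - u n x) \<in> L2" for m n by (rule L2_diff(1)[OF u u])
  have l1: "(LINT x|lborel. norm (u i x * w x - u j x * w x)) \<le> L2_norm (\<lambda>x. u i x - u j x) * L2_norm w" for i j
  proof -
    have "(\<lambda>x. complex_of_real (cmod (u i x - u j x))) \<in> L2" using dL[of i j] by (simp add: L2_def)
    from L2_mult(2)[OF this w]
    have "cmod (LINT x|lborel. of_real (cmod (u i x - u j x)) * w x) \<le> L2_norm (\<lambda>x. u i x - u j x) * L2_norm w"
      by (simp add: L2_norm_def)
    moreover have "of_real (cmod (u i x - u j x)) * w x = complex_of_real (norm (u i x * w x - u j x * w x))" for x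
      unfolding left_diff_distrib[symmetric] norm_mult using jb_ge(3)[of x] by (simp add: w_def norm_divide less_imp_le)
    ultimately have "cmod (LINT x|lborel. complex_of_real (norm (u i x * w x - u j x * w x))) \<le> L2_norm (\<lambda>x. u i x - u j x) * L2_norm w"
      by (simp only:)
    then show ?thesis by simp
  qed
  obtain r where r: "strict_mono r" and ae: "AE x in lborel. Cauchy (\<lambda>i. u (r i) x * w x)"
  proof (rule cauchy_L1_AE_cauchy_subseq[of lborel "\<lambda>n x. u n x * w x"])
    show "integrable lborel (\<lambda>x. u n x * w x)" for n by (rule L2_mult(1)[OF u w])
    fix e :: real assume "0 < e"
    then have "0 < e / (L2_norm w + 1)" by (simp add: add_nonneg_pos)
    from cauchy[OF this] obtain N where N: "\<And>m n. N \<le> m \<Longrightarrow> N \<le> n \<Longrightarrow> L2_norm (\<lambda>x. u m x - u n x) < e / (L2_norm w + 1)" by blast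
    have "(LINT x|lborel. norm (u i x * w x - u j x * w x)) < e" if "N \<le> i" "N \<le> j" for i j
    proof -
      have "L2_norm (\<lambda>x. u i x - u j x) * (L2_norm w + 1) < e"
        using N[OF that] by (simp add: pos_less_divide_eq add_nonneg_pos)
      moreover have "L2_norm (\<lambda>x. u i x - u j x) * L2_norm w \<le> L2_norm (\<lambda>x. u i x - u j x) * (L2_norm w + 1)"
        by (intro mult_left_mono) auto
      ultimately show ?thesis using l1[of i j] by linarith
    qed
    then show "\<exists>N. \<forall>i\<ge>N. \<forall>j\<ge>N. (LINT x|lborel. norm (u i x * w x - u j x * w x)) < e" by blast
  qed
  define g where "g x = lim (\<lambda>k. u (r k) x)" for x
  have [measurable]: "g \<in> borel_measurable borel" unfolding g_def by measurable
  have lim: "AE x in lborel. (\<lambda>k. u (r k) x) \<longlonglongrightarrow> g x"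
    using ae
  proof eventually_elim
    case (elim x)
    have "convergent (\<lambda>k. u (r k) x * w x * of_real (jb x))"
      by (rule convergent_mult[OF _ convergent_const]) (use elim in \<open>simp add: Cauchy_convergent_iff\<close>)
    moreover have "u (r k) x * w x * of_real (jb x) = u (r k) x" for k
      using jb_ge(3)[of x] by (simp add: w_def)
    ultimately show ?case by (simp add: g_def convergent_LIMSEQ_iff)
  qed
  \<comment> \<open>Fatou along the subsequence carries the Cauchy estimate over to the
    limit.\<close>
  have est: "(\<lambda>x. u n x - g x) \<in> L2" "L2_norm (\<lambda>x. u n x - g x) \<le> e"
    if "0 < e" and N: "\<And>m n. N \<le> m \<Longrightarrow> N \<le> n \<Longrightarrow> L2_norm (\<lambda>x. u m x - u n x) < e" and n: "N \<le> n" for e N n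
  proof -
    have "eventually (\<lambda>k. L2_norm (\<lambda>x. u n x - u (r k) x) \<le> e) sequentially"
      using eventually_ge_at_top[of N]
    proof eventually_elim
      case (elim k)
      then have "N \<le> r k" using seq_suble[OF r, of k] by simp
      then show ?case using N[OF n] by (simp add: less_imp_le)
    qed
    moreover have "AE x in lborel. (\<lambda>k. u n x - u (r k) x) \<longlonglongrightarrow> u n x - g x"
      using lim by eventually_elim (intro tendsto_intros)
    ultimately show "(\<lambda>x. u n x - g x) \<in> L2" "L2_norm (\<lambda>x. u n x - g x) \<le> e"
      using L2_fatou[where a = "\<lambda>k x. u n x - u (r k) x" and b = "\<lambda>x. u n x - g x" and e = e] dL that(1) by simp_all
  qed
  have "g \<in> L2"
  proof -
    obtain N where N: "\<And>m n. N \<le> m \<Longrightarrow> N \<le> n \<Longrightarrow> L2_norm (\<lambda>x. u m x - u n x) < 1" using cauchy[of 1] by auto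
    have "(\<lambda>x. u N x - g x) \<in> L2" by (rule est(1)[of 1 N]) (use N in auto)
    from L2_diff(1)[OF u[of N] this] show ?thesis by simp
  qed
  moreover have "(\<lambda>n. L2_norm (\<lambda>x. u n x - g x)) \<longlonglongrightarrow> 0"
  proof (rule LIMSEQ_I)
    fix e :: real assume e: "0 < e"
    then obtain N where N: "\<And>m n. N \<le> m \<Longrightarrow> N \<le> n \<Longrightarrow> L2_norm (\<lambda>x. u m x - u n x) < e / 2" using cauchy[of "e / 2"] by auto
    have "norm (L2_norm (\<lambda>x. u n x - g x) - 0) < e" if "N \<le> n" for n using est(2)[OF _ N that] e by simp
    then show "\<exists>N. \<forall>n\<ge>N. norm (L2_norm (\<lambda>x. u n x - g x) - 0) < e" by blast
  qed
  ultimately show ?thesis by (rule that)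
qed

section \<open>The Fourier transform of integrable functions\<close>

definition fhat :: "(real \<Rightarrow> complex) \<Rightarrow> real \<Rightarrow> complex" where
  "fhat f \<xi> = complex_of_real (1 / sqrt (2 * pi)) * (LINT x|lborel. cis (- (\<xi> * x)) * f x)"

lemma integrable_cis_mult:
  assumes "integrable lborel f" and [measurable]: "\<theta> \<in> borel_measurable borel"
  shows "integrable lborel (\<lambda>x :: real. cis (\<theta> x) * f x)"
proof (rule Bochner_Integration.integrable_bound[OF assms(1)])
  have [measurable]: "f \<in> borel_measurable borel" using borel_measurable_integrable[OF assms(1)] by simp
  show "(\<lambda>x. cis (\<theta> x) * f x) \<in> borel_measurable lborel" by measurable
qed (simp add: norm_mult)

text \<open>The sign k allows both the transform (k = -1) and the kernel of its conjugate (k =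
  1).\<close>

lemma fourier_swap:
  fixes a b :: "real \<Rightarrow> complex" and k :: real
  assumes a: "integrable lborel a" and b: "integrable lborel b"
  shows "(LINT \<xi>|lborel. a \<xi> * (LINT x|lborel. cis (k * (\<xi> * x)) * b x)) = (LINT x|lborel. b x * (LINT \<xi>|lborel. cis (k * (\<xi> * x)) * a \<xi>))"
proof -
  have [measurable]: "a \<in> borel_measurable borel" "b \<in> borel_measurable borel"
    using borel_measurable_integrable[OF a] borel_measurable_integrable[OF b] by simp_all
  have "integrable lborel2 (\<lambda>(\<xi>, x). a \<xi> * (cis (k * (\<xi> * x)) * b x))"
  proof (rule lborel_pair.Fubini_integrable)
    show "integrable lborel (\<lambda>\<xi>. LINT x|lborel. norm (case (\<xi>, x) of (\<xi>, x) \<Rightarrow> a \<xi> * (cis (k * (\<xi> * x)) * b x)))"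
      using a by (simp add: norm_mult)
    show "AE \<xi> in lborel. integrable lborel (\<lambda>x. case (\<xi>, x) of (\<xi>, x) \<Rightarrow> a \<xi> * (cis (k * (\<xi> * x)) * b x))"
      using b by (auto intro!: integrable_mult_right integrable_cis_mult)
  qed measurable
  from lborel_pair.Fubini_integral[OF this]
  have "(LINT \<xi>|lborel. LINT x|lborel. a \<xi> * (cis (k * (\<xi> * x)) * b x)) = (LINT x|lborel. LINT \<xi>|lborel. a \<xi> * (cis (k * (\<xi> * x)) * b x))"
    by simp
  also have "\<dots> = (LINT x|lborel. LINT \<xi>|lborel. b x * (cis (k * (\<xi> * x)) * a \<xi>))"
    by (simp add: mult_ac)
  finally show ?thesis by simp
qed

lemma fhat_diff:
  assumes "integrable lborel f" "integrable lborel g"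
  shows "fhat (\<lambda>x. f x - g x) \<xi> = fhat f \<xi> - fhat g \<xi>"
  using integrable_cis_mult[OF assms(1), of "\<lambda>x. - (\<xi> * x)"] integrable_cis_mult[OF assms(2), of "\<lambda>x. - (\<xi> * x)"]
  by (simp add: fhat_def right_diff_distrib)

lemma measurable_fhat [measurable (raw)]:
  assumes [measurable]: "f \<in> borel_measurable borel"
  shows "fhat f \<in> borel_measurable borel"
proof -
  have "fhat f \<in> borel_measurable lborel"
    unfolding fhat_def[abs_def] by measurable
  then show ?thesis by simp
qed

lemma fhat_bound:
  assumes "integrable lborel f"
  shows "cmod (fhat f \<xi>) \<le> 1 / sqrt (2 * pi) * (LINT x|lborel. cmod (f x))"
proof -
  have "cmod (LINT x|lborel. cis (- (\<xi> * x)) * f x) \<le> (LINT x|lborel. cmod (cis (- (\<xi> * x)) * f x))"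
    by (rule integral_norm_bound)
  then have "cmod (LINT x|lborel. cis (- (\<xi> * x)) * f x) \<le> (LINT x|lborel. cmod (f x))"
    by (simp add: norm_mult)
  then show ?thesis
    unfolding fhat_def norm_mult norm_of_real by (intro mult_mono) auto
qed

definition gauss :: "real \<Rightarrow> real \<Rightarrow> real" where
  "gauss d \<xi> = exp (- (d * \<xi>)\<^sup>2 / 2)"

lemma gauss_eq: "0 < d \<Longrightarrow> gauss d \<xi> = sqrt (2 * pi) * std_normal_density (d * \<xi>)"
  by (simp add: gauss_def std_normal_density_def)

lemma integrable_gauss: 
  assumes "0 < d" shows "integrable lborel (gauss d)"
proof -
  have "gauss d = (\<lambda>\<xi>. sqrt (2 * pi) * std_normal_density (0 + d * \<xi>))"
    using gauss_eq[OF assms] by (intro ext) simp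
  moreover have "integrable lborel (\<lambda>\<xi>. std_normal_density (0 + d * \<xi>))"
    by (rule lborel_integrable_real_affine) (use assms in auto)
  ultimately show ?thesis by (simp only: integrable_mult_right)
qed

text \<open>The characteristic function of the standard normal distribution, rescaled by d.\<close>

lemma gauss_fourier:
  assumes d: "0 < d"
  shows "(LINT \<xi>|lborel. cis (u * \<xi>) * complex_of_real (gauss d \<xi>)) = complex_of_real (2 * pi * normal_density 0 d u)"
proof -
  have "complex_of_real (exp (- (u / d)\<^sup>2 / 2)) = char std_normal_distribution (u / d)"
    by (simp add: char_std_normal_distribution)
  also have "\<dots> = (LINT x|lborel. std_normal_density x *\<^sub>R iexp (u / d * x))"
    unfolding char_def by (subst integral_density) auto
  also have "\<dots> = (LINT x|lborel. complex_of_real (std_normal_density x) * cis (u / d * x))"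
    by (simp add: cis_conv_exp scaleR_conv_of_real)
  also have "\<dots> = \<bar>d\<bar> *\<^sub>R (LINT \<xi>|lborel. complex_of_real (std_normal_density (0 + d * \<xi>)) * cis (u / d * (0 + d * \<xi>)))"
    by (rule lborel_integral_real_affine) (use d in simp)
  also have "\<dots> = (complex_of_real d / complex_of_real (sqrt (2 * pi))) * (LINT \<xi>|lborel. cis (u * \<xi>) * complex_of_real (gauss d \<xi>))"
  proof -
    have "(LINT \<xi>|lborel. cis (u * \<xi>) * complex_of_real (gauss d \<xi>))
       = (LINT \<xi>|lborel. complex_of_real (sqrt (2 * pi)) * (complex_of_real (std_normal_density (0 + d * \<xi>)) * cis (u / d * (0 + d * \<xi>))))"
      using d by (intro Bochner_Integration.integral_cong refl) (simp add: gauss_eq)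
    also have "\<dots> = complex_of_real (sqrt (2 * pi)) * (LINT \<xi>|lborel. complex_of_real (std_normal_density (0 + d * \<xi>)) * cis (u / d * (0 + d * \<xi>)))"
      by (rule Bochner_Integration.integral_mult_right_zero)
    finally show ?thesis using d by (simp add: scaleR_conv_of_real)
  qed
  finally have "(LINT \<xi>|lborel. cis (u * \<xi>) * complex_of_real (gauss d \<xi>)) = complex_of_real (sqrt (2 * pi) / d * exp (- (u / d)\<^sup>2 / 2))"
    using d by (simp add: field_simps)
  also have "sqrt (2 * pi) / d * exp (- (u / d)\<^sup>2 / 2) = 2 * pi * normal_density 0 d u"
  proof -
    have "sqrt (2 * pi) * sqrt (2 * pi) = 2 * pi" by simp
    then show ?thesis using d by (simp add: normal_density_def real_sqrt_mult power_divide field_simps)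
  qed
  finally show ?thesis .
qed

text \<open>The Gaussian factor makes the frequency integral absolutely convergent, so Fubini
  applies; its transform is a normal density of standard deviation d, an approximate identity as d
  tends to 0.\<close>

lemma gauss_plancherel:
  assumes f: "integrable lborel f" and d: "0 < d"
  shows "(LINT \<xi>|lborel. complex_of_real (gauss d \<xi>) * (fhat f \<xi> * cnj (fhat f \<xi>)))
     = (LINT y|lborel. cnj (f y) * (LINT x|lborel. f x * complex_of_real (normal_density 0 d (y - x))))"
    and "integrable lborel (\<lambda>\<xi>. gauss d \<xi> * (cmod (fhat f \<xi>))\<^sup>2)"
proof -
  define c where "c = complex_of_real (1 / sqrt (2 * pi))"
  have cc: "c * c * complex_of_real (2 * pi) = 1"
    by (simp add: c_def flip: of_real_mult)
  have [measurable]: "f \<in> borel_measurable borel" using borel_measurable_integrable[OF f] by simp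
  have [measurable]: "gauss d \<in> borel_measurable borel" unfolding gauss_def[abs_def] by measurable
  define a where "a = (\<lambda>\<xi>. complex_of_real (gauss d \<xi>) * fhat f \<xi>)"
  define C where "C = 1 / sqrt (2 * pi) * (LINT x|lborel. cmod (f x))"
  have C: "cmod (fhat f \<xi>) \<le> C" for \<xi> unfolding C_def by (rule fhat_bound[OF f])
  have g0: "0 \<le> gauss d \<xi>" for \<xi> by (simp add: gauss_def)
  have a: "integrable lborel a"
    unfolding a_def
  proof (rule Bochner_Integration.integrable_bound[OF integrable_mult_right[OF integrable_gauss[OF d], of C]])
    show "AE \<xi> in lborel. norm (complex_of_real (gauss d \<xi>) * fhat f \<xi>) \<le> norm (C * gauss d \<xi>)"
    proof (intro AE_I2)
      fix \<xi>
      have "gauss d \<xi> * cmod (fhat f \<xi>) \<le> gauss d \<xi> * C" by (intro mult_left_mono C g0)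
      then show "norm (complex_of_real (gauss d \<xi>) * fhat f \<xi>) \<le> norm (C * gauss d \<xi>)"
        using g0[of \<xi>] order_trans[OF norm_ge_zero C] by (simp add: norm_mult mult.commute)
    qed
  qed measurable
  have "C \<ge> 0" using order_trans[OF norm_ge_zero C] .
  show "integrable lborel (\<lambda>\<xi>. gauss d \<xi> * (cmod (fhat f \<xi>))\<^sup>2)"
  proof (rule Bochner_Integration.integrable_bound[OF integrable_mult_right[OF integrable_gauss[OF d], of "C\<^sup>2"]])
    have "(cmod (fhat f \<xi>))\<^sup>2 \<le> C\<^sup>2" for \<xi> by (intro power_mono C) simp
    then have "gauss d \<xi> * (cmod (fhat f \<xi>))\<^sup>2 \<le> gauss d \<xi> * C\<^sup>2" for \<xi> by (intro mult_left_mono g0)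
    then show "AE \<xi> in lborel. norm (gauss d \<xi> * (cmod (fhat f \<xi>))\<^sup>2) \<le> norm (C\<^sup>2 * gauss d \<xi>)"
      using g0 by (intro AE_I2) (simp add: abs_mult mult.commute)
  qed measurable
  \<comment> \<open>Inverting the damped transform returns the convolution of f with that
    density.\<close>
  have inner: "(LINT \<xi>|lborel. cis (1 * (\<xi> * y)) * a \<xi>) = c * complex_of_real (2 * pi) * (LINT x|lborel. f x * complex_of_real (normal_density 0 d (y - x)))" for y
  proof -
    define b where "b = (\<lambda>\<xi>. cis (\<xi> * y) * complex_of_real (gauss d \<xi>))"
    have b: "integrable lborel b"
      unfolding b_def using integrable_gauss[OF d] by (intro integrable_cis_mult) auto
    have "(LINT \<xi>|lborel. cis (1 * (\<xi> * y)) * a \<xi>) = (LINT \<xi>|lborel. c * (b \<xi> * (LINT x|lborel. cis (-1 * (\<xi> * x)) * f x)))"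
      by (intro Bochner_Integration.integral_cong refl) (simp add: a_def b_def fhat_def c_def)
    also have "\<dots> = c * (LINT \<xi>|lborel. b \<xi> * (LINT x|lborel. cis (-1 * (\<xi> * x)) * f x))"
      by (rule Bochner_Integration.integral_mult_right_zero)
    also have "\<dots> = c * (LINT x|lborel. f x * (LINT \<xi>|lborel. cis (-1 * (\<xi> * x)) * b \<xi>))"
      by (subst fourier_swap[OF b f]) simp
    also have "(\<lambda>x. LINT \<xi>|lborel. cis (-1 * (\<xi> * x)) * b \<xi>) = (\<lambda>x. complex_of_real (2 * pi * normal_density 0 d (y - x)))"
    proof
      fix x
      have "(LINT \<xi>|lborel. cis (-1 * (\<xi> * x)) * b \<xi>) = (LINT \<xi>|lborel. cis ((y - x) * \<xi>) * complex_of_real (gauss d \<xi>))"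
        by (intro Bochner_Integration.integral_cong refl) (simp add: b_def mult.assoc[symmetric] cis_mult algebra_simps)
      then show "(LINT \<xi>|lborel. cis (-1 * (\<xi> * x)) * b \<xi>) = complex_of_real (2 * pi * normal_density 0 d (y - x))"
        by (simp only: gauss_fourier[OF d])
    qed
    also have "c * (LINT x|lborel. f x * complex_of_real (2 * pi * normal_density 0 d (y - x)))
       = c * (LINT x|lborel. complex_of_real (2 * pi) * (f x * complex_of_real (normal_density 0 d (y - x))))"
      by (simp add: mult_ac)
    also have "\<dots> = c * (complex_of_real (2 * pi) * (LINT x|lborel. f x * complex_of_real (normal_density 0 d (y - x))))"
      by (subst Bochner_Integration.integral_mult_right_zero) (rule refl)
    finally show ?thesis by (simp only: mult.assoc)
  qed
  have cnjf: "integrable lborel (\<lambda>y. cnj (f y))" using f by simp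
  have cnjfhat: "cnj (fhat f \<xi>) = c * (LINT y|lborel. cis (1 * (\<xi> * y)) * cnj (f y))" for \<xi>
  proof -
    have "cnj (LINT x|lborel. cis (- (\<xi> * x)) * f x) = (LINT x|lborel. cnj (cis (- (\<xi> * x)) * f x))"
      by (simp del: complex_cnj_mult)
    then show ?thesis by (simp add: fhat_def c_def cis_cnj)
  qed
  have "(LINT \<xi>|lborel. complex_of_real (gauss d \<xi>) * (fhat f \<xi> * cnj (fhat f \<xi>)))
     = (LINT \<xi>|lborel. c * (a \<xi> * (LINT y|lborel. cis (1 * (\<xi> * y)) * cnj (f y))))"
    unfolding cnjfhat by (intro Bochner_Integration.integral_cong refl) (simp add: a_def)
  also have "\<dots> = c * (LINT \<xi>|lborel. a \<xi> * (LINT y|lborel. cis (1 * (\<xi> * y)) * cnj (f y)))"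
    by (rule Bochner_Integration.integral_mult_right_zero)
  also have "\<dots> = c * (LINT y|lborel. cnj (f y) * (LINT \<xi>|lborel. cis (1 * (\<xi> * y)) * a \<xi>))"
    by (subst fourier_swap[OF a cnjf]) (rule refl)
  also have "\<dots> = c * (LINT y|lborel. (c * complex_of_real (2 * pi)) * (cnj (f y) * (LINT x|lborel. f x * complex_of_real (normal_density 0 d (y - x)))))"
    unfolding inner by (simp add: mult_ac)
  also have "\<dots> = c * ((c * complex_of_real (2 * pi)) * (LINT y|lborel. cnj (f y) * (LINT x|lborel. f x * complex_of_real (normal_density 0 d (y - x)))))"
    by (subst Bochner_Integration.integral_mult_right_zero) (rule refl)
  also have "\<dots> = (LINT y|lborel. cnj (f y) * (LINT x|lborel. f x * complex_of_real (normal_density 0 d (y - x))))"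
    unfolding mult.assoc[symmetric] cc by simp
  finally show "(LINT \<xi>|lborel. complex_of_real (gauss d \<xi>) * (fhat f \<xi> * cnj (fhat f \<xi>)))
     = (LINT y|lborel. cnj (f y) * (LINT x|lborel. f x * complex_of_real (normal_density 0 d (y - x))))" .
qed

lemma gauss_real:
  assumes f: "integrable lborel f" and d: "0 < d"
  shows "complex_of_real (LINT \<xi>|lborel. gauss d \<xi> * (cmod (fhat f \<xi>))\<^sup>2)
     = (LINT y|lborel. cnj (f y) * (LINT x|lborel. f x * complex_of_real (normal_density 0 d (y - x))))"
proof -
  have "complex_of_real (LINT \<xi>|lborel. gauss d \<xi> * (cmod (fhat f \<xi>))\<^sup>2) = (LINT \<xi>|lborel. complex_of_real (gauss d \<xi> * (cmod (fhat f \<xi>))\<^sup>2))"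
    by (rule integral_complex_of_real[symmetric])
  also have "\<dots> = (LINT \<xi>|lborel. complex_of_real (gauss d \<xi>) * (fhat f \<xi> * cnj (fhat f \<xi>)))"
    by (intro Bochner_Integration.integral_cong refl) (simp only: of_real_mult complex_norm_square)
  also note gauss_plancherel(1)[OF f d]
  finally show ?thesis .
qed

text \<open>The normal density has L^1 norm 1, so Young and Cauchy-Schwarz bound the regularised
  integral by the squared norm of f for every d; Fatou removes the Gaussian.\<close>

lemma bessel_inequality:
  assumes f: "integrable lborel f" "f \<in> L2"
  shows "fhat f \<in> L2" "L2_norm (fhat f) \<le> L2_norm f"
proof -
  have [measurable]: "f \<in> borel_measurable borel" using f by (rule_tac L2_measurable)
  have bound: "(LINT \<xi>|lborel. gauss d \<xi> * (cmod (fhat f \<xi>))\<^sup>2) \<le> (L2_norm f)\<^sup>2" if d: "0 < d" for d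
  proof -
    define F where "F = (\<lambda>x. ennreal (cmod (f x)))"
    define k where "k = (\<lambda>x. ennreal (normal_density 0 d x))"
    have [measurable]: "F \<in> borel_measurable borel" "k \<in> borel_measurable borel" unfolding F_def k_def by measurable
    have k: "L1b k 1"
      unfolding L1b_def k_def using d by (subst nn_integral_eq_integral) auto
    have inner: "ennreal (cmod (LINT x|lborel. f x * complex_of_real (normal_density 0 d (y - x)))) \<le> conv k F y" for y
    proof -
      have "ennreal (cmod (LINT x|lborel. f x * complex_of_real (normal_density 0 d (y - x)))) \<le> (\<integral>\<^sup>+x. ennreal (cmod (f x * complex_of_real (normal_density 0 d (y - x)))) \<partial>lborel)"
      proof (cases "integrable lborel (\<lambda>x. f x * complex_of_real (normal_density 0 d (y - x)))")
        case True then show ?thesis by (rule integral_norm_bound_ennreal)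
      qed (simp add: not_integrable_integral_eq)
      also have "\<dots> = conv F k y"
        unfolding conv_def F_def k_def by (intro nn_integral_cong) (simp add: norm_mult ennreal_mult)
      also have "\<dots> = conv k F y" by (rule conv_commute) measurable
      finally show ?thesis .
    qed
    have "ennreal (cmod (LINT y|lborel. cnj (f y) * (LINT x|lborel. f x * complex_of_real (normal_density 0 d (y - x)))))
      \<le> (\<integral>\<^sup>+y. ennreal (cmod (cnj (f y) * (LINT x|lborel. f x * complex_of_real (normal_density 0 d (y - x))))) \<partial>lborel)"
    proof (cases "integrable lborel (\<lambda>y. cnj (f y) * (LINT x|lborel. f x * complex_of_real (normal_density 0 d (y - x))))")
      case True then show ?thesis by (rule integral_norm_bound_ennreal)
    qed (simp add: not_integrable_integral_eq)
    also have "\<dots> \<le> (\<integral>\<^sup>+y. F y * conv k F y \<partial>lborel)"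
    proof (intro nn_integral_mono)
      fix y
      have "ennreal (cmod (cnj (f y) * (LINT x|lborel. f x * complex_of_real (normal_density 0 d (y - x)))))
         = F y * ennreal (cmod (LINT x|lborel. f x * complex_of_real (normal_density 0 d (y - x))))"
        by (simp only: F_def norm_mult complex_mod_cnj ennreal_mult norm_ge_zero)
      also have "\<dots> \<le> F y * conv k F y"
        by (intro mult_left_mono inner) simp
      finally show "ennreal (cmod (cnj (f y) * (LINT x|lborel. f x * complex_of_real (normal_density 0 d (y - x))))) \<le> F y * conv k F y" .
    qed
    also have "\<dots> \<le> ennreal (L2_norm f * (1 * L2_norm f))"
      using L1bD(3)[OF L1b_mult[OF L2D[OF f(2)] L2b_conv[OF k L2D[OF f(2)]]]] by (simp add: F_def)
    finally have "cmod (LINT y|lborel. cnj (f y) * (LINT x|lborel. f x * complex_of_real (normal_density 0 d (y - x)))) \<le> (L2_norm f)\<^sup>2"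
      by (subst (asm) ennreal_le_iff) (auto simp: power2_eq_square)
    then show ?thesis
      unfolding gauss_real[OF f(1) d, symmetric] by simp
  qed
  have "(\<integral>\<^sup>+\<xi>. (ennreal (cmod (fhat f \<xi>)))\<^sup>2 \<partial>lborel) = (\<integral>\<^sup>+\<xi>. liminf (\<lambda>n. ennreal (gauss (1 / real (Suc n)) \<xi> * (cmod (fhat f \<xi>))\<^sup>2)) \<partial>lborel)"
  proof (intro nn_integral_cong)
    fix \<xi>
    have "(\<lambda>n. 1 / real (Suc n)) \<longlonglongrightarrow> 0" by (rule LIMSEQ_Suc[OF lim_1_over_n])
    then have "(\<lambda>n. gauss (1 / real (Suc n)) \<xi>) \<longlonglongrightarrow> gauss 0 \<xi>"
      unfolding gauss_def by (intro tendsto_intros) auto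
    then have "(\<lambda>n. ennreal (gauss (1 / real (Suc n)) \<xi> * (cmod (fhat f \<xi>))\<^sup>2)) \<longlonglongrightarrow> ennreal (gauss 0 \<xi> * (cmod (fhat f \<xi>))\<^sup>2)"
      by (intro tendsto_ennrealI tendsto_intros)
    from lim_imp_Liminf[OF trivial_limit_sequentially this]
    show "(ennreal (cmod (fhat f \<xi>)))\<^sup>2 = liminf (\<lambda>n. ennreal (gauss (1 / real (Suc n)) \<xi> * (cmod (fhat f \<xi>))\<^sup>2))"
      by (simp add: gauss_def ennreal_power)
  qed
  also have "\<dots> \<le> liminf (\<lambda>n. \<integral>\<^sup>+\<xi>. ennreal (gauss (1 / real (Suc n)) \<xi> * (cmod (fhat f \<xi>))\<^sup>2) \<partial>lborel)"
    by (rule nn_integral_liminf) (simp add: gauss_def)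
  also have "\<dots> \<le> ennreal ((L2_norm f)\<^sup>2)"
  proof (rule Liminf_le[OF trivial_limit_sequentially always_eventually[OF allI]])
    fix n
    have d: "0 < 1 / real (Suc n)" by simp
    show "(\<integral>\<^sup>+\<xi>. ennreal (gauss (1 / real (Suc n)) \<xi> * (cmod (fhat f \<xi>))\<^sup>2) \<partial>lborel) \<le> ennreal ((L2_norm f)\<^sup>2)"
    proof (subst nn_integral_eq_integral[OF gauss_plancherel(2)[OF f(1) d]])
      show "AE \<xi> in lborel. 0 \<le> gauss (1 / real (Suc n)) \<xi> * (cmod (fhat f \<xi>))\<^sup>2"
        by (simp add: gauss_def)
    qed (rule ennreal_leI[OF bound[OF d]])
  qed
  finally have L: "L2b (\<lambda>\<xi>. ennreal (cmod (fhat f \<xi>))) (L2_norm f)"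
    by (simp add: L2b_def)
  show "fhat f \<in> L2" "L2_norm (fhat f) \<le> L2_norm f" by (rule L2I[OF L], measurable)+
qed

text \<open>The converse inequality for nice functions: by continuity the approximate identity
  converges at every point, and the Gaussian factor is at most 1.\<close>

lemma plancherel_compact_support:
  assumes h: "continuous_on UNIV h" "0 \<le> C" "\<And>x. cmod (h x) \<le> C * indicator {-R..R} x"
  shows "L2_norm h \<le> L2_norm (fhat h)"
proof -
  have hm[measurable]: "h \<in> borel_measurable borel" by (rule borel_measurable_continuous_onI[OF h(1)])
  have hL: "h \<in> L2" "integrable lborel h" by (rule L2_compact_support[OF hm h(3,2)])+
  have hC: "cmod (h x) \<le> C" for x
    using h(3)[of x] h(2) by (cases "x \<in> {-R..R}") simp_all
  define d where "d n = 1 / real (Suc n)" for n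
  have d: "0 < d n" for n by (simp add: d_def)
  have d0: "d \<longlonglongrightarrow> 0" unfolding d_def by (rule LIMSEQ_Suc[OF lim_1_over_n])
  \<comment> \<open>The convolution with the normal density after the substitution x = y - d z,
    which moves the dependence on d into the argument of h.\<close>
  define K where "K n y = (LINT z|lborel. h (y - d n * z) * complex_of_real (std_normal_density z))" for n y
  have K: "(LINT x|lborel. h x * complex_of_real (normal_density 0 (d n) (y - x))) = K n y" for n y
  proof -
    have "(LINT x|lborel. h x * complex_of_real (normal_density 0 (d n) (y - x)))
       = \<bar>- d n\<bar> *\<^sub>R (LINT z|lborel. h (y + - d n * z) * complex_of_real (normal_density 0 (d n) (y - (y + - d n * z))))"
      by (rule lborel_integral_real_affine) (use d[of n] in simp)
    also have "\<dots> = (LINT z|lborel. \<bar>- d n\<bar> *\<^sub>R (h (y + - d n * z) * complex_of_real (normal_density 0 (d n) (y - (y + - d n * z)))))"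
      by simp
    also have "\<dots> = K n y"
      unfolding K_def
    proof (intro Bochner_Integration.integral_cong refl)
      fix z
      have "d n * normal_density 0 (d n) (d n * z) = std_normal_density z"
        using d[of n] by (simp add: normal_density_def real_sqrt_mult power_mult_distrib)
      then have "complex_of_real (d n) * complex_of_real (normal_density 0 (d n) (d n * z)) = complex_of_real (std_normal_density z)"
        by (simp only: of_real_mult[symmetric])
      then show "\<bar>- d n\<bar> *\<^sub>R (h (y + - d n * z) * complex_of_real (normal_density 0 (d n) (y - (y + - d n * z)))) = h (y - d n * z) * complex_of_real (std_normal_density z)"
        using d[of n] by (simp add: scaleR_conv_of_real mult.left_commute)
    qed
    finally show ?thesis .
  qed
  have Kb: "cmod (K n y) \<le> C" for n y
  proof -
    have "cmod (K n y) \<le> (LINT z|lborel. cmod (h (y - d n * z) * complex_of_real (std_normal_density z)))"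
      unfolding K_def by (rule integral_norm_bound)
    also have "\<dots> \<le> (LINT z|lborel. C * std_normal_density z)"
    proof (rule integral_mono')
      show "integrable lborel (\<lambda>z. C * std_normal_density z)" by simp
    qed (use hC h(2) in \<open>auto simp: norm_mult intro!: mult_right_mono\<close>)
    also have "\<dots> = C" by simp
    finally show ?thesis .
  qed
  have Kl: "(\<lambda>n. K n y) \<longlonglongrightarrow> h y" for y
  proof -
    have "(\<lambda>n. K n y) \<longlonglongrightarrow> (LINT z|lborel. h y * complex_of_real (std_normal_density z))"
      unfolding K_def
    proof (rule Bochner_Integration.integral_dominated_convergence[where w = "\<lambda>z. C * std_normal_density z"])
      show "AE z in lborel. (\<lambda>n. h (y - d n * z) * complex_of_real (std_normal_density z)) \<longlonglongrightarrow> h y * complex_of_real (std_normal_density z)"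
      proof (intro AE_I2 tendsto_mult_right)
        fix z
        have "isCont h (y - 0 * z)" using h(1) by (simp add: continuous_on_eq_continuous_at)
        moreover have "(\<lambda>n. y - d n * z) \<longlonglongrightarrow> y - 0 * z" by (intro tendsto_intros d0)
        ultimately have "(\<lambda>n. h (y - d n * z)) \<longlonglongrightarrow> h (y - 0 * z)" by (rule isCont_tendsto_compose)
        then show "(\<lambda>n. h (y - d n * z)) \<longlonglongrightarrow> h y" by simp
      qed
      show "AE z in lborel. norm (h (y - d n * z) * complex_of_real (std_normal_density z)) \<le> C * std_normal_density z" for n
        using hC by (intro AE_I2) (simp add: norm_mult mult_right_mono)
    qed simp_all
    also have "(LINT z|lborel. h y * complex_of_real (std_normal_density z)) = h y * (LINT z|lborel. complex_of_real (std_normal_density z))"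
      by (rule Bochner_Integration.integral_mult_right_zero)
    also have "(LINT z|lborel. complex_of_real (std_normal_density z)) = 1"
      by (subst integral_complex_of_real) simp
    finally show ?thesis by simp
  qed
  have [measurable]: "K n \<in> borel_measurable borel" for n
  proof -
    have "K n \<in> borel_measurable lborel" unfolding K_def[abs_def] by measurable
    then show ?thesis by simp
  qed
  have "(\<lambda>n. LINT y|lborel. cnj (h y) * K n y) \<longlonglongrightarrow> (LINT y|lborel. cnj (h y) * h y)"
  proof (rule Bochner_Integration.integral_dominated_convergence[where w = "\<lambda>y. cmod (h y) * C"])
    show "AE y in lborel. (\<lambda>n. cnj (h y) * K n y) \<longlonglongrightarrow> cnj (h y) * h y"
      by (intro AE_I2 tendsto_mult_left Kl)
    show "AE y in lborel. norm (cnj (h y) * K n y) \<le> cmod (h y) * C" for n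
      using Kb by (intro AE_I2) (simp add: norm_mult mult_left_mono)
  qed (use hL in simp_all)
  moreover have "(LINT y|lborel. cnj (h y) * K n y) = complex_of_real (LINT \<xi>|lborel. gauss (d n) \<xi> * (cmod (fhat h \<xi>))\<^sup>2)" for n
    unfolding gauss_real[OF hL(2) d] K ..
  moreover have "(LINT y|lborel. cnj (h y) * h y) = complex_of_real ((L2_norm h)\<^sup>2)"
  proof -
    have "(LINT y|lborel. cnj (h y) * h y) = (LINT y|lborel. complex_of_real ((cmod (h y))\<^sup>2))"
      by (intro Bochner_Integration.integral_cong refl) (simp only: complex_norm_square mult.commute)
    then show ?thesis by (simp only: integral_complex_of_real L2_norm_power2)
  qed
  ultimately have "(\<lambda>n. complex_of_real (LINT \<xi>|lborel. gauss (d n) \<xi> * (cmod (fhat h \<xi>))\<^sup>2)) \<longlonglongrightarrow> complex_of_real ((L2_norm h)\<^sup>2)"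
    by simp
  then have lim: "(\<lambda>n. LINT \<xi>|lborel. gauss (d n) \<xi> * (cmod (fhat h \<xi>))\<^sup>2) \<longlonglongrightarrow> (L2_norm h)\<^sup>2"
    by (simp only: tendsto_of_real_iff)
  have "(L2_norm h)\<^sup>2 \<le> (L2_norm (fhat h))\<^sup>2"
  proof (rule LIMSEQ_le_const2[OF lim], intro exI allI impI)
    fix n
    have "fhat h \<in> L2" by (rule bessel_inequality(1)[OF hL(2,1)])
    then have i: "integrable lborel (\<lambda>\<xi>. (cmod (fhat h \<xi>))\<^sup>2)" by (simp add: L2_def)
    show "(LINT \<xi>|lborel. gauss (d n) \<xi> * (cmod (fhat h \<xi>))\<^sup>2) \<le> (L2_norm (fhat h))\<^sup>2"
      unfolding L2_norm_power2
    proof (rule integral_mono'[OF i])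
      fix \<xi>
      have "gauss (d n) \<xi> \<le> 1" by (simp add: gauss_def)
      then show "gauss (d n) \<xi> * (cmod (fhat h \<xi>))\<^sup>2 \<le> (cmod (fhat h \<xi>))\<^sup>2"
        by (intro mult_left_le_one_le) (auto simp: gauss_def)
    qed simp
  qed
  then show ?thesis by (rule power2_le_imp_le) simp
qed

text \<open>One inequality is \<open>bessel_inequality\<close>. For the other, f is replaced by a
  continuous function of compact support, and \<open>bessel_inequality\<close> controls the error on
  the Fourier side as well.\<close>

theorem fhat_isometry:
  assumes f: "integrable lborel f" "f \<in> L2"
  shows "L2_norm (fhat f) = L2_norm f"
proof (rule antisym[OF bessel_inequality(2)[OF f]], rule field_le_epsilon)
  fix e :: real assume "0 < e"
  then obtain h C R where h: "continuous_on UNIV h" "0 \<le> C" "\<And>x. cmod (h x) \<le> C * indicator {-R..R} x"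
    and e: "L2_norm (\<lambda>x. f x - h x) < e / 2"
    using L2_dense[OF f(2), of "e / 2"] by auto
  have hm[measurable]: "h \<in> borel_measurable borel" by (rule borel_measurable_continuous_onI[OF h(1)])
  have hL: "h \<in> L2" "integrable lborel h" by (rule L2_compact_support[OF hm h(3,2)])+
  have "fhat (\<lambda>x. f x - h x) = (\<lambda>\<xi>. fhat f \<xi> - fhat h \<xi>)"
    by (rule ext, rule fhat_diff) (use f hL in auto)
  then have "L2_norm (\<lambda>\<xi>. fhat f \<xi> - fhat h \<xi>) \<le> L2_norm (\<lambda>x. f x - h x)"
    using bessel_inequality(2)[of "\<lambda>x. f x - h x"] f hL L2_diff(1)[OF f(2) hL(1)] by simp
  moreover have "L2_norm (fhat h) \<le> L2_norm (fhat f) + L2_norm (\<lambda>\<xi>. fhat f \<xi> - fhat h \<xi>)"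
    using L2_norm_triangle_diff[OF bessel_inequality(1)[OF f] bessel_inequality(1)[OF hL(2,1)]] by simp
  moreover have "L2_norm h \<le> L2_norm (fhat h)" by (rule plancherel_compact_support[OF h])
  moreover have "L2_norm f \<le> L2_norm h + L2_norm (\<lambda>x. f x - h x)"
    using L2_norm_triangle_diff[OF f(2) hL(1)] by simp
  ultimately show "L2_norm f \<le> L2_norm (fhat f) + e" using e by simp
qed

section \<open>Extension of the transform to L^2, Plancherel and Parseval\<close>

lemma truncation_L2:
  assumes "f \<in> L2"
  shows "(\<lambda>x. indicator {-real N..real N} x *\<^sub>R f x) \<in> L2"
    "integrable lborel (\<lambda>x. indicator {-real N..real N} x *\<^sub>R f x)"
    "truncated_fourier N f = fhat (\<lambda>x. indicator {-real N..real N} x *\<^sub>R f x)"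
proof -
  have [measurable]: "f \<in> borel_measurable borel" using assms by (rule L2_measurable)
  define g where "g = (\<lambda>x. indicator {-real N..real N} x *\<^sub>R f x)"
  have [measurable]: "g \<in> borel_measurable borel" unfolding g_def by measurable
  have "L2b (\<lambda>x. ennreal (cmod (g x))) (L2_norm f)"
    by (rule L2b_mono[OF L2D[OF assms]]) (auto simp: g_def indicator_def)
  then show g: "g \<in> L2" by (rule L2I(1)) measurable
  have "(\<lambda>x. complex_of_real (indicator {-real N..real N} x)) \<in> L2"
    by (rule L2_compact_support(1)[where C = 1 and R = "real N"]) (auto simp: indicator_def)
  from L2_mult(1)[OF this g] show "integrable lborel g"
    by (rule back_subst[where P = "integrable lborel"]) (auto simp: g_def indicator_def)
  show "truncated_fourier N f = fhat g"
    by (rule ext) (simp add: truncated_fourier_def fhat_def set_lebesgue_integral_def g_def)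
qed

lemma truncated_fourier_L2:
  assumes "f \<in> L2"
  shows "truncated_fourier N f \<in> L2"
    "L2_norm (truncated_fourier N f) = L2_norm (\<lambda>x. indicator {-real N..real N} x *\<^sub>R f x)"
  unfolding truncation_L2(3)[OF assms]
  by (rule bessel_inequality(1) fhat_isometry; rule truncation_L2[OF assms])+

lemma truncation_tendsto:
  assumes "f \<in> L2"
  shows "(\<lambda>N. L2_norm (\<lambda>x. indicator {-real N..real N} x *\<^sub>R f x - f x)) \<longlonglongrightarrow> 0"
proof (rule L2_dominated[where w = "\<lambda>x. (cmod (f x))\<^sup>2"])
  have [measurable]: "f \<in> borel_measurable borel" using assms by (rule L2_measurable)
  show "(\<lambda>x. indicator {-real N..real N} x *\<^sub>R f x) \<in> borel_measurable borel" for N by measurable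
  show "f \<in> borel_measurable borel" by measurable
  show "AE x in lborel. (\<lambda>N. indicator {-real N..real N} x *\<^sub>R f x) \<longlonglongrightarrow> f x"
  proof (intro AE_I2)
    fix x
    obtain M where M: "\<bar>x\<bar> \<le> real M" using real_arch_simple by blast
    have "eventually (\<lambda>N. indicator {-real N..real N} x *\<^sub>R f x = f x) sequentially"
      using eventually_ge_at_top[of M] by eventually_elim (use M in \<open>auto simp: indicator_def\<close>)
    then show "(\<lambda>N. indicator {-real N..real N} x *\<^sub>R f x) \<longlonglongrightarrow> f x" by (rule tendsto_eventually)
  qed
  show "AE x in lborel. (cmod (indicator {-real N..real N} x *\<^sub>R f x - f x))\<^sup>2 \<le> (cmod (f x))\<^sup>2" for N
    by (intro AE_I2) (auto simp: indicator_def)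
  show "integrable lborel (\<lambda>x. (cmod (f x))\<^sup>2)" using assms by (simp add: L2_def)
qed

text \<open>Once the truncated transforms are known to lie in L^2, the extended distance can be
  replaced by the real norm.\<close>

lemma L2_fourier_iff:
  "L2_fourier f g \<longleftrightarrow> f \<in> L2 \<and> g \<in> L2 \<and> (\<lambda>N. L2_norm (\<lambda>\<xi>. truncated_fourier N f \<xi> - g \<xi>)) \<longlonglongrightarrow> 0"
proof (cases "f \<in> L2 \<and> g \<in> L2")
  case True
  have "(\<integral>\<^sup>+\<xi>. ennreal ((cmod (truncated_fourier N f \<xi> - g \<xi>))\<^sup>2) \<partial>lborel) = ennreal ((L2_norm (\<lambda>\<xi>. truncated_fourier N f \<xi> - g \<xi>))\<^sup>2)" for N
    by (rule L2_nn) (use True in \<open>auto intro: L2_diff(1) truncated_fourier_L2(1)\<close>)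
  moreover have "(\<lambda>N. ennreal ((L2_norm (\<lambda>\<xi>. truncated_fourier N f \<xi> - g \<xi>))\<^sup>2)) \<longlonglongrightarrow> 0
     \<longleftrightarrow> (\<lambda>N. L2_norm (\<lambda>\<xi>. truncated_fourier N f \<xi> - g \<xi>)) \<longlonglongrightarrow> 0"
  proof -
    have "(\<lambda>N. (L2_norm (\<lambda>\<xi>. truncated_fourier N f \<xi> - g \<xi>))\<^sup>2) \<longlonglongrightarrow> 0\<^sup>2
       \<longleftrightarrow> (\<lambda>N. L2_norm (\<lambda>\<xi>. truncated_fourier N f \<xi> - g \<xi>)) \<longlonglongrightarrow> 0"
    proof
      assume "(\<lambda>N. (L2_norm (\<lambda>\<xi>. truncated_fourier N f \<xi> - g \<xi>))\<^sup>2) \<longlonglongrightarrow> 0\<^sup>2"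
      then have "(\<lambda>N. sqrt ((L2_norm (\<lambda>\<xi>. truncated_fourier N f \<xi> - g \<xi>))\<^sup>2)) \<longlonglongrightarrow> sqrt (0\<^sup>2)"
        by (rule tendsto_real_sqrt)
      then show "(\<lambda>N. L2_norm (\<lambda>\<xi>. truncated_fourier N f \<xi> - g \<xi>)) \<longlonglongrightarrow> 0" by simp
    qed (rule tendsto_power)
    moreover have "(\<lambda>N. ennreal ((L2_norm (\<lambda>\<xi>. truncated_fourier N f \<xi> - g \<xi>))\<^sup>2)) \<longlonglongrightarrow> ennreal 0
      \<longleftrightarrow> (\<lambda>N. (L2_norm (\<lambda>\<xi>. truncated_fourier N f \<xi> - g \<xi>))\<^sup>2) \<longlonglongrightarrow> 0"
      by (rule tendsto_ennreal_iff) auto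
    ultimately show ?thesis by simp
  qed
  ultimately show ?thesis by (simp add: L2_fourier_def)
qed (auto simp: L2_fourier_def)

lemma L2_fourierD:
  assumes "L2_fourier f g"
  shows "f \<in> L2" "g \<in> L2" "(\<lambda>N. L2_norm (\<lambda>\<xi>. truncated_fourier N f \<xi> - g \<xi>)) \<longlonglongrightarrow> 0"
  using assms by (auto simp: L2_fourier_iff)

theorem plancherel:
  assumes "L2_fourier f g"
  shows "L2_norm g = L2_norm f"
proof (rule LIMSEQ_unique)
  note d = L2_fourierD[OF assms]
  show "(\<lambda>N. L2_norm (truncated_fourier N f)) \<longlonglongrightarrow> L2_norm g"
    by (rule L2_tendsto_norm[OF truncated_fourier_L2(1)[OF d(1)] d(2,3)])
  show "(\<lambda>N. L2_norm (truncated_fourier N f)) \<longlonglongrightarrow> L2_norm f"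
    unfolding truncated_fourier_L2(2)[OF d(1)]
    by (rule L2_tendsto_norm[OF truncation_L2(1)[OF d(1)] d(1) truncation_tendsto[OF d(1)]])
qed

lemma truncated_fourier_diff:
  assumes "f \<in> L2" "g \<in> L2"
  shows "truncated_fourier N (\<lambda>x. f x - g x) = (\<lambda>\<xi>. truncated_fourier N f \<xi> - truncated_fourier N g \<xi>)"
  unfolding truncation_L2(3)[OF assms(1)] truncation_L2(3)[OF assms(2)] truncation_L2(3)[OF L2_diff(1)[OF assms]]
  by (rule ext) (simp add: fhat_diff[OF truncation_L2(2)[OF assms(1)] truncation_L2(2)[OF assms(2)], symmetric] scaleR_diff_right)

lemma L2_fourier_diff:
  assumes "L2_fourier f f'" "L2_fourier g g'"
  shows "L2_fourier (\<lambda>x. f x - g x) (\<lambda>\<xi>. f' \<xi> - g' \<xi>)"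
  unfolding L2_fourier_iff
proof (intro conjI)
  note f = L2_fourierD[OF assms(1)] and g = L2_fourierD[OF assms(2)]
  show "(\<lambda>x. f x - g x) \<in> L2" "(\<lambda>x. f' x - g' x) \<in> L2" using f g by (auto intro: L2_diff)
  show "(\<lambda>N. L2_norm (\<lambda>\<xi>. truncated_fourier N (\<lambda>x. f x - g x) \<xi> - (f' \<xi> - g' \<xi>))) \<longlonglongrightarrow> 0"
  proof (rule Lim_null_comparison)
    show "(\<lambda>N. L2_norm (\<lambda>\<xi>. truncated_fourier N f \<xi> - f' \<xi>) + L2_norm (\<lambda>\<xi>. truncated_fourier N g \<xi> - g' \<xi>)) \<longlonglongrightarrow> 0"
      using tendsto_add[OF f(3) g(3)] by simp
    show "eventually (\<lambda>N. norm (L2_norm (\<lambda>\<xi>. truncated_fourier N (\<lambda>x. f x - g x) \<xi> - (f' \<xi> - g' \<xi>)))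
       \<le> L2_norm (\<lambda>\<xi>. truncated_fourier N f \<xi> - f' \<xi>) + L2_norm (\<lambda>\<xi>. truncated_fourier N g \<xi> - g' \<xi>)) sequentially"
    proof (intro always_eventually allI)
      fix N
      have "(\<lambda>\<xi>. truncated_fourier N (\<lambda>x. f x - g x) \<xi> - (f' \<xi> - g' \<xi>)) = (\<lambda>\<xi>. (truncated_fourier N f \<xi> - f' \<xi>) - (truncated_fourier N g \<xi> - g' \<xi>))"
        by (simp add: truncated_fourier_diff[OF f(1) g(1)] algebra_simps)
      then show "norm (L2_norm (\<lambda>\<xi>. truncated_fourier N (\<lambda>x. f x - g x) \<xi> - (f' \<xi> - g' \<xi>)))
       \<le> L2_norm (\<lambda>\<xi>. truncated_fourier N f \<xi> - f' \<xi>) + L2_norm (\<lambda>\<xi>. truncated_fourier N g \<xi> - g' \<xi>)"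
        using L2_diff(2)[OF L2_diff(1)[OF truncated_fourier_L2(1)[OF f(1), of N] f(2)] L2_diff(1)[OF truncated_fourier_L2(1)[OF g(1), of N] g(2)]]
        by simp
    qed
  qed
qed

lemma L2_fourier_unique_norm:
  assumes "L2_fourier f g" "L2_fourier f' g'" "L2_norm (\<lambda>x. f x - f' x) = 0"
  shows "AE \<xi> in lborel. g \<xi> = g' \<xi>"
proof -
  have d: "L2_fourier (\<lambda>x. f x - f' x) (\<lambda>\<xi>. g \<xi> - g' \<xi>)" by (rule L2_fourier_diff[OF assms(1,2)])
  have "AE \<xi> in lborel. g \<xi> - g' \<xi> = 0"
    by (rule L2_norm_eq_0[OF L2_fourierD(2)[OF d]]) (simp add: plancherel[OF d] assms(3))
  then show ?thesis by eventually_elim simp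
qed

lemma L2_fourier_unique:
  assumes "L2_fourier f g" "L2_fourier f g'"
  shows "AE \<xi> in lborel. g \<xi> = g' \<xi>"
  by (rule L2_fourier_unique_norm[OF assms]) (simp add: L2_norm_def)

lemma L2_fourier_cong_right:
  assumes "L2_fourier f g" "AE \<xi> in lborel. g \<xi> = g' \<xi>" "g' \<in> borel_measurable borel"
  shows "L2_fourier f g'"
proof -
  note d = L2_fourierD[OF assms(1)]
  have g': "g' \<in> L2" by (rule L2_cong_AE(1)[OF d(2) assms(2,3)])
  have "L2_norm (\<lambda>\<xi>. truncated_fourier N f \<xi> - g' \<xi>) = L2_norm (\<lambda>\<xi>. truncated_fourier N f \<xi> - g \<xi>)" for N
  proof (rule L2_cong_AE(2)[OF L2_diff(1)[OF truncated_fourier_L2(1)[OF d(1)] d(2)]])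
    show "AE \<xi> in lborel. truncated_fourier N f \<xi> - g \<xi> = truncated_fourier N f \<xi> - g' \<xi>"
      using assms(2) by eventually_elim simp
    show "(\<lambda>\<xi>. truncated_fourier N f \<xi> - g' \<xi>) \<in> borel_measurable borel"
      by (rule L2_measurable[OF L2_diff(1)[OF truncated_fourier_L2(1)[OF d(1)] g']])
  qed
  then show ?thesis using d g' by (simp add: L2_fourier_iff)
qed

lemma L2_fourier_cong_left:
  assumes "L2_fourier f g" "AE x in lborel. f x = f' x" "f' \<in> borel_measurable borel"
  shows "L2_fourier f' g"
proof -
  note d = L2_fourierD[OF assms(1)]
  have f': "f' \<in> L2" by (rule L2_cong_AE(1)[OF d(1) assms(2,3)])
  have [measurable]: "f \<in> borel_measurable borel" using d(1) by (rule L2_measurable)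
  note assms(3)[measurable]
  have "truncated_fourier N f' \<xi> = truncated_fourier N f \<xi>" for N \<xi>
    unfolding truncated_fourier_def set_lebesgue_integral_def
    by (rule arg_cong[where f = "\<lambda>z. complex_of_real (1 / sqrt (2 * pi)) * z"], rule integral_cong_AE)
      (measurable, use assms(2) in \<open>auto elim: eventually_mono\<close>)
  then show ?thesis using d f' by (simp add: L2_fourier_iff)
qed

text \<open>The isometry turns the Cauchy property of the truncations into that of their transforms;
  completeness supplies the limit.\<close>

theorem L2_fourier_exists:
  assumes f: "f \<in> L2"
  obtains g where "L2_fourier f g"
proof -
  define t where "t N = (\<lambda>x. indicator {-real N..real N} x *\<^sub>R f x)" for N
  note tL = truncation_L2[OF f, folded t_def]
  have "\<exists>N. \<forall>m\<ge>N. \<forall>n\<ge>N. L2_norm (\<lambda>\<xi>. truncated_fourier m f \<xi> - truncated_fourier n f \<xi>) < e" if "0 < e" for e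
  proof -
    have "eventually (\<lambda>N. L2_norm (\<lambda>x. t N x - f x) < e / 2) sequentially"
      using truncation_tendsto[OF f] that unfolding t_def by (intro order_tendstoD(2)) auto
    then obtain N where N: "\<And>n. N \<le> n \<Longrightarrow> L2_norm (\<lambda>x. t n x - f x) < e / 2" by (auto simp: eventually_sequentially)
    have "L2_norm (\<lambda>\<xi>. truncated_fourier m f \<xi> - truncated_fourier n f \<xi>) < e" if mn: "N \<le> m" "N \<le> n" for m n
    proof -
      have "L2_norm (\<lambda>\<xi>. truncated_fourier m f \<xi> - truncated_fourier n f \<xi>) = L2_norm (fhat (\<lambda>x. t m x - t n x))"
        unfolding tL(3) by (simp add: fhat_diff[OF tL(2) tL(2), symmetric])
      also have "\<dots> = L2_norm (\<lambda>x. t m x - t n x)"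
        by (rule fhat_isometry) (use tL in \<open>auto intro: L2_diff(1)\<close>)
      also have "\<dots> \<le> L2_norm (\<lambda>x. t m x - f x) + L2_norm (\<lambda>x. f x - t n x)"
        by (rule L2_triangle[OF tL(1) f tL(1)])
      also have "\<dots> < e" using N[OF mn(1)] N[OF mn(2)] L2_norm_minus_commute[of f "t n"] by simp
      finally show ?thesis .
    qed
    then show ?thesis by blast
  qed
  then obtain g where "g \<in> L2" "(\<lambda>N. L2_norm (\<lambda>\<xi>. truncated_fourier N f \<xi> - g \<xi>)) \<longlonglongrightarrow> 0"
    using L2_complete[of "\<lambda>N. truncated_fourier N f", OF truncated_fourier_L2(1)[OF f]] by blast
  then show ?thesis using f by (intro that) (simp add: L2_fourier_iff)
qed

lemma L2_tendsto_mult: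
  assumes "\<And>n. u n \<in> L2" "\<And>n. v n \<in> L2" "f \<in> L2" "g \<in> L2"
    and u: "(\<lambda>n. L2_norm (\<lambda>x. u n x - f x)) \<longlonglongrightarrow> 0" and v: "(\<lambda>n. L2_norm (\<lambda>x. v n x - g x)) \<longlonglongrightarrow> 0"
  shows "(\<lambda>n. LINT x|lborel. u n x * v n x) \<longlonglongrightarrow> (LINT x|lborel. f x * g x)"
proof (rule LIM_zero_cancel, rule Lim_null_comparison)
  show "eventually (\<lambda>n. norm ((LINT x|lborel. u n x * v n x) - (LINT x|lborel. f x * g x))
     \<le> L2_norm (\<lambda>x. u n x - f x) * L2_norm (v n) + L2_norm f * L2_norm (\<lambda>x. v n x - g x)) sequentially"
  proof (intro always_eventually allI)
    fix n
    note i = L2_mult(1)[OF assms(1,2), of n n] L2_mult(1)[OF assms(3,4)] L2_mult(1)[OF assms(3,2), of n]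
    have d: "(\<lambda>x. u n x - f x) \<in> L2" "(\<lambda>x. v n x - g x) \<in> L2" using assms by (auto intro: L2_diff)
    have "(LINT x|lborel. u n x * v n x) - (LINT x|lborel. f x * g x)
       = (LINT x|lborel. (u n x - f x) * v n x) + (LINT x|lborel. f x * (v n x - g x))"
      using i by (simp add: left_diff_distrib right_diff_distrib)
    also have "norm \<dots> \<le> L2_norm (\<lambda>x. u n x - f x) * L2_norm (v n) + L2_norm f * L2_norm (\<lambda>x. v n x - g x)"
      by (intro norm_triangle_le add_mono L2_mult(2) d assms)
    finally show "norm ((LINT x|lborel. u n x * v n x) - (LINT x|lborel. f x * g x))
     \<le> L2_norm (\<lambda>x. u n x - f x) * L2_norm (v n) + L2_norm f * L2_norm (\<lambda>x. v n x - g x)" .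
  qed
  have "(\<lambda>n. L2_norm (\<lambda>x. u n x - f x) * L2_norm (v n) + L2_norm f * L2_norm (\<lambda>x. v n x - g x)) \<longlonglongrightarrow> 0 * L2_norm g + L2_norm f * 0"
    by (intro tendsto_intros u v L2_tendsto_norm[OF assms(2,4) v])
  then show "(\<lambda>n. L2_norm (\<lambda>x. u n x - f x) * L2_norm (v n) + L2_norm f * L2_norm (\<lambda>x. v n x - g x)) \<longlonglongrightarrow> 0" by simp
qed

text \<open>Fubini for the truncations, which are integrable, followed by the limit in L^2 on both
  sides.\<close>

lemma multiplication_formula:
  assumes "L2_fourier f f'" "L2_fourier g g'"
  shows "(LINT x|lborel. f' x * g x) = (LINT x|lborel. f x * g' x)"
proof (rule LIMSEQ_unique)
  note f = L2_fourierD[OF assms(1)] and g = L2_fourierD[OF assms(2)]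
  define t s where "t N = (\<lambda>x. indicator {-real N..real N} x *\<^sub>R f x)" and "s N = (\<lambda>x. indicator {-real N..real N} x *\<^sub>R g x)" for N
  note tL = truncation_L2[OF f(1), folded t_def] and sL = truncation_L2[OF g(1), folded s_def]
  have tT: "(\<lambda>N. L2_norm (\<lambda>x. t N x - f x)) \<longlonglongrightarrow> 0" and sT: "(\<lambda>N. L2_norm (\<lambda>x. s N x - g x)) \<longlonglongrightarrow> 0"
    using truncation_tendsto[OF f(1)] truncation_tendsto[OF g(1)] by (simp_all add: t_def s_def)
  show "(\<lambda>N. LINT x|lborel. truncated_fourier N f x * s N x) \<longlonglongrightarrow> (LINT x|lborel. f' x * g x)"
    by (rule L2_tendsto_mult[OF truncated_fourier_L2(1)[OF f(1)] sL(1) f(2) g(1) f(3) sT])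
  have "(LINT x|lborel. truncated_fourier N f x * s N x) = (LINT x|lborel. t N x * truncated_fourier N g x)" for N
  proof -
    define c where "c = complex_of_real (1 / sqrt (2 * pi))"
    have "(LINT x|lborel. truncated_fourier N f x * s N x) = (LINT \<xi>|lborel. c * (s N \<xi> * (LINT x|lborel. cis (-1 * (\<xi> * x)) * t N x)))"
      unfolding tL(3) fhat_def c_def by (simp add: mult_ac)
    also have "\<dots> = c * (LINT \<xi>|lborel. s N \<xi> * (LINT x|lborel. cis (-1 * (\<xi> * x)) * t N x))"
      by (rule Bochner_Integration.integral_mult_right_zero)
    also have "\<dots> = c * (LINT x|lborel. t N x * (LINT \<xi>|lborel. cis (-1 * (\<xi> * x)) * s N \<xi>))"
      by (subst fourier_swap[OF sL(2) tL(2)]) (rule refl)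
    also have "\<dots> = (LINT x|lborel. c * (t N x * (LINT \<xi>|lborel. cis (-1 * (\<xi> * x)) * s N \<xi>)))"
      by (rule Bochner_Integration.integral_mult_right_zero[symmetric])
    also have "\<dots> = (LINT x|lborel. t N x * truncated_fourier N g x)"
      unfolding sL(3) fhat_def c_def by (simp add: mult_ac)
    finally show ?thesis .
  qed
  then show "(\<lambda>N. LINT x|lborel. truncated_fourier N f x * s N x) \<longlonglongrightarrow> (LINT x|lborel. f x * g' x)"
    using L2_tendsto_mult[OF tL(1) truncated_fourier_L2(1)[OF g(1)] f(1) g(2) tT g(3)] by simp
qed

lemma L2_cnj: "f \<in> L2 \<Longrightarrow> (\<lambda>x. cnj (f x)) \<in> L2" "L2_norm (\<lambda>x. cnj (f x)) = L2_norm f"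
  unfolding L2_def L2_norm_def by auto

lemma L2_inner_self: "(LINT x|lborel. f x * cnj (f x)) = complex_of_real ((L2_norm f)\<^sup>2)"
  unfolding L2_norm_power2 integral_complex_of_real[symmetric] complex_norm_square ..

lemma L2_norm_diff_square:
  assumes "f \<in> L2" "g \<in> L2"
  shows "(L2_norm (\<lambda>x. f x - g x))\<^sup>2 = (L2_norm f)\<^sup>2 + (L2_norm g)\<^sup>2 - 2 * Re (LINT x|lborel. f x * cnj (g x))"
proof -
  have i: "integrable lborel (\<lambda>x. f x * cnj (g x))" by (rule L2_mult(1)[OF assms(1) L2_cnj(1)[OF assms(2)]])
  have "(cmod (f x - g x))\<^sup>2 = (cmod (f x))\<^sup>2 + (cmod (g x))\<^sup>2 - 2 * Re (f x * cnj (g x))" for x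
    unfolding cmod_power2 by (simp add: power2_eq_square algebra_simps)
  then have "(L2_norm (\<lambda>x. f x - g x))\<^sup>2 = (LINT x|lborel. (cmod (f x))\<^sup>2 + (cmod (g x))\<^sup>2 - 2 * Re (f x * cnj (g x)))"
    by (simp add: L2_norm_power2)
  also have "\<dots> = (LINT x|lborel. (cmod (f x))\<^sup>2 + (cmod (g x))\<^sup>2) - (LINT x|lborel. 2 * Re (f x * cnj (g x)))"
    using assms by (intro Bochner_Integration.integral_diff Bochner_Integration.integrable_add integrable_mult_right integrable_Re i)
      (simp_all add: L2_def)
  also have "(LINT x|lborel. (cmod (f x))\<^sup>2 + (cmod (g x))\<^sup>2) = (LINT x|lborel. (cmod (f x))\<^sup>2) + (LINT x|lborel. (cmod (g x))\<^sup>2)"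
    by (rule Bochner_Integration.integral_add) (use assms in \<open>auto simp: L2_def\<close>)
  also have "(LINT x|lborel. 2 * Re (f x * cnj (g x))) = 2 * Re (LINT x|lborel. f x * cnj (g x))"
    unfolding integral_Re[OF i, symmetric] by (rule Bochner_Integration.integral_mult_right_zero)
  finally show ?thesis by (simp add: L2_norm_power2)
qed

text \<open>The Fourier transform is an isometry and so is its transpose; hence it is onto.\<close>

lemma L2_fourier_inverse:
  assumes g: "g \<in> L2" and k: "L2_fourier (\<lambda>x. cnj (g x)) k"
  shows "L2_fourier (\<lambda>x. cnj (k x)) g"
proof -
  note kd = L2_fourierD[OF k]
  obtain f' where f': "L2_fourier (\<lambda>x. cnj (k x)) f'" using L2_fourier_exists[OF L2_cnj(1)[OF kd(2)]] .
  note fd = L2_fourierD[OF f']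
  have nk: "L2_norm k = L2_norm g" using plancherel[OF k] by (simp add: L2_cnj(2))
  have nf: "L2_norm f' = L2_norm g" using plancherel[OF f'] by (simp add: L2_cnj(2) nk)
  have "(LINT x|lborel. f' x * cnj (g x)) = (LINT x|lborel. cnj (k x) * k x)"
    by (rule multiplication_formula[OF f' k])
  also have "\<dots> = complex_of_real ((L2_norm g)\<^sup>2)"
    using L2_inner_self[of k] by (simp add: mult.commute nk)
  finally have "(L2_norm (\<lambda>x. f' x - g x))\<^sup>2 = 0"
    unfolding L2_norm_diff_square[OF fd(2) g] nf by simp
  then have "AE x in lborel. f' x - g x = 0"
    by (intro L2_norm_eq_0 L2_diff(1) fd g) simp
  then have "AE x in lborel. f' x = g x" by eventually_elim simp
  then show ?thesis by (rule L2_fourier_cong_right[OF f' _ L2_measurable[OF g]])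
qed

corollary L2_fourier_surj:
  assumes "g \<in> L2"
  obtains f where "L2_fourier f g"
  using L2_fourier_exists[OF L2_cnj(1)[OF assms]] L2_fourier_inverse[OF assms] by blast

text \<open>By inversion the transform of the conjugate of b' is the conjugate of b; the
  multiplication formula then applies to a and that conjugate.\<close>

theorem parseval:
  assumes a: "L2_fourier a a'" and b: "L2_fourier b b'"
  shows "(LINT x|lborel. a' x * cnj (b' x)) = (LINT x|lborel. a x * cnj (b x))"
proof -
  note bd = L2_fourierD[OF b]
  obtain k where k: "L2_fourier (\<lambda>x. cnj (b' x)) k" using L2_fourier_exists[OF L2_cnj(1)[OF bd(2)]] .
  have kb: "L2_fourier (\<lambda>x. cnj (k x)) b'" by (rule L2_fourier_inverse[OF bd(2) k])
  have kL: "k \<in> L2" by (rule L2_fourierD(2)[OF k])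
  have d: "L2_fourier (\<lambda>x. cnj (k x) - b x) (\<lambda>\<xi>. b' \<xi> - b' \<xi>)" by (rule L2_fourier_diff[OF kb b])
  have "L2_norm (\<lambda>x. cnj (k x) - b x) = 0"
    using plancherel[OF d] by (simp add: L2_norm_def)
  then have "AE x in lborel. cnj (k x) - b x = 0"
    by (intro L2_norm_eq_0 L2_diff(1) L2_cnj(1) kL bd)
  then have "AE x in lborel. k x = cnj (b x)" 
  proof eventually_elim
    case (elim x)
    then have "cnj (k x) = b x" by simp
    then show ?case by (metis complex_cnj_cnj)
  qed
  then have "L2_fourier (\<lambda>x. cnj (b' x)) (\<lambda>x. cnj (b x))"
    by (rule L2_fourier_cong_right[OF k _ L2_measurable[OF L2_cnj(1)[OF bd(1)]]])
  from multiplication_formula[OF a this] show ?thesis .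
qed

section \<open>Translations, modulations and real functions\<close>

lemma L2_shift:
  assumes "f \<in> L2"
  shows "(\<lambda>x. f (x - c)) \<in> L2" "L2_norm (\<lambda>x. f (x - c)) = L2_norm f"
proof -
  have [measurable]: "f \<in> borel_measurable borel" using assms by (rule L2_measurable)
  have "integrable lborel (\<lambda>x. (cmod (f (- c + 1 * x)))\<^sup>2)"
    by (rule lborel_integrable_real_affine) (use assms in \<open>auto simp: L2_def\<close>)
  then show "(\<lambda>x. f (x - c)) \<in> L2" by (simp add: L2_def)
  show "L2_norm (\<lambda>x. f (x - c)) = L2_norm f"
    unfolding L2_norm_def using lborel_integral_real_affine[of 1 "\<lambda>x. (cmod (f x))\<^sup>2" "- c"] by simp
qed

lemma L2_reflect:
  assumes "f \<in> L2"
  shows "(\<lambda>x. f (- x)) \<in> L2" "L2_norm (\<lambda>x. f (- x)) = L2_norm f"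
proof -
  have [measurable]: "f \<in> borel_measurable borel" using assms by (rule L2_measurable)
  have "integrable lborel (\<lambda>x. (cmod (f (0 + - 1 * x)))\<^sup>2)"
    by (rule lborel_integrable_real_affine) (use assms in \<open>auto simp: L2_def\<close>)
  then show "(\<lambda>x. f (- x)) \<in> L2" by (simp add: L2_def)
  show "L2_norm (\<lambda>x. f (- x)) = L2_norm f"
    unfolding L2_norm_def using lborel_integral_real_affine[of "-1" "\<lambda>x. (cmod (f x))\<^sup>2" 0] by simp
qed

lemma L2_fourier_modulate:
  assumes "L2_fourier f g"
  shows "L2_fourier (\<lambda>x. cis (c * x) * f x) (\<lambda>\<xi>. g (\<xi> - c))"
  unfolding L2_fourier_iff
proof (intro conjI)
  note d = L2_fourierD[OF assms]
  have [measurable]: "f \<in> borel_measurable borel" using d(1) by (rule L2_measurable)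
  have "(\<lambda>x. cis (c * x) * f x) \<in> borel_measurable borel" by measurable
  then show "(\<lambda>x. cis (c * x) * f x) \<in> L2"
    using d(1) by (simp add: L2_def norm_mult)
  show "(\<lambda>\<xi>. g (\<xi> - c)) \<in> L2" by (rule L2_shift[OF d(2)])
  have "truncated_fourier N (\<lambda>x. cis (c * x) * f x) \<xi> = truncated_fourier N f (\<xi> - c)" for N \<xi>
  proof -
    have "cis (- (\<xi> * x)) * (cis (c * x) * f x) = cis (- ((\<xi> - c) * x)) * f x" for x
    proof -
      have "cis (- (\<xi> * x)) * cis (c * x) = cis (- ((\<xi> - c) * x))"
        by (simp add: cis_mult algebra_simps)
      then show ?thesis by (simp only: mult.assoc[symmetric])
    qed
    then show ?thesis by (simp only: truncated_fourier_def)
  qed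
  then show "(\<lambda>N. L2_norm (\<lambda>\<xi>. truncated_fourier N (\<lambda>x. cis (c * x) * f x) \<xi> - g (\<xi> - c))) \<longlonglongrightarrow> 0"
    using d(3) L2_shift(2)[OF L2_diff(1)[OF truncated_fourier_L2(1)[OF d(1)] d(2)], of _ c] by simp
qed

text \<open>The symmetry holds exactly for the truncated transforms, but in the limit only almost
  everywhere.\<close>

lemma L2_fourier_real:
  assumes "L2_fourier (\<lambda>x. complex_of_real (f x)) g"
  shows "AE \<xi> in lborel. g (- \<xi>) = cnj (g \<xi>)"
proof -
  note d = L2_fourierD[OF assms]
  have tf: "truncated_fourier N (\<lambda>x. complex_of_real (f x)) (- \<xi>) = cnj (truncated_fourier N (\<lambda>x. complex_of_real (f x)) \<xi>)" for N \<xi>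
  proof -
    have "cnj (LINT x:{- real N..real N}|lborel. cis (- (\<xi> * x)) * complex_of_real (f x)) = (LINT x|lborel. cnj (indicator {- real N..real N} x *\<^sub>R (cis (- (\<xi> * x)) * complex_of_real (f x))))"
      unfolding set_lebesgue_integral_def by (simp del: complex_cnj_mult complex_cnj_scaleR)
    also have "\<dots> = (LINT x:{- real N..real N}|lborel. cis (- ((- \<xi>) * x)) * complex_of_real (f x))"
      unfolding set_lebesgue_integral_def by (simp add: cis_cnj)
    finally show ?thesis by (simp add: truncated_fourier_def)
  qed
  have "L2_fourier (\<lambda>x. complex_of_real (f x)) (\<lambda>\<xi>. cnj (g (- \<xi>)))"
    unfolding L2_fourier_iff
  proof (intro conjI)
    show "(\<lambda>\<xi>. cnj (g (- \<xi>))) \<in> L2" by (intro L2_cnj(1) L2_reflect(1) d(2))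
    have "L2_norm (\<lambda>\<xi>. truncated_fourier N (\<lambda>x. complex_of_real (f x)) \<xi> - cnj (g (- \<xi>)))
      = L2_norm (\<lambda>\<xi>. truncated_fourier N (\<lambda>x. complex_of_real (f x)) \<xi> - g \<xi>)" for N
    proof -
      define u where "u = (\<lambda>\<xi>. truncated_fourier N (\<lambda>x. complex_of_real (f x)) \<xi> - g \<xi>)"
      have u: "u \<in> L2" unfolding u_def by (rule L2_diff(1)[OF truncated_fourier_L2(1)[OF d(1)] d(2)])
      have "truncated_fourier N (\<lambda>x. complex_of_real (f x)) \<xi> - cnj (g (- \<xi>)) = cnj (u (- \<xi>))" for \<xi>
        unfolding u_def tf by simp
      then have "L2_norm (\<lambda>\<xi>. truncated_fourier N (\<lambda>x. complex_of_real (f x)) \<xi> - cnj (g (- \<xi>))) = L2_norm (\<lambda>\<xi>. cnj (u (- \<xi>)))"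
        by (simp only:)
      also have "\<dots> = L2_norm u"
        by (simp only: L2_cnj(2) L2_reflect(2)[OF u])
      finally show ?thesis by (simp only: u_def)
    qed
    then show "(\<lambda>N. L2_norm (\<lambda>\<xi>. truncated_fourier N (\<lambda>x. complex_of_real (f x)) \<xi> - cnj (g (- \<xi>)))) \<longlonglongrightarrow> 0"
      using d(3) by simp
  qed (rule d(1))
  from L2_fourier_unique[OF assms this] have "AE \<xi> in lborel. g \<xi> = cnj (g (- \<xi>))" .
  then show ?thesis by eventually_elim simp
qed

lemma L2_fourier_integrable:
  assumes "f \<in> L2" "integrable lborel f"
  shows "L2_fourier f (fhat f)"
  unfolding L2_fourier_iff
proof (intro conjI)
  show "fhat f \<in> L2" by (rule bessel_inequality(1)[OF assms(2,1)])
  define t where "t N = (\<lambda>x. indicator {-real N..real N} x *\<^sub>R f x)" for N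
  note tL = truncation_L2[OF assms(1), folded t_def]
  have "L2_norm (\<lambda>\<xi>. truncated_fourier N f \<xi> - fhat f \<xi>) = L2_norm (\<lambda>x. t N x - f x)" for N
  proof -
    have "(\<lambda>\<xi>. truncated_fourier N f \<xi> - fhat f \<xi>) = fhat (\<lambda>x. t N x - f x)"
      unfolding tL(3) by (rule ext) (rule fhat_diff[OF tL(2) assms(2), symmetric])
    then show ?thesis
      using fhat_isometry[of "\<lambda>x. t N x - f x"] tL assms by (simp add: L2_diff(1))
  qed
  then show "(\<lambda>N. L2_norm (\<lambda>\<xi>. truncated_fourier N f \<xi> - fhat f \<xi>)) \<longlonglongrightarrow> 0"
    using truncation_tendsto[OF assms(1)] by (simp add: t_def)
qed (rule assms)

section \<open>Sobolev spaces\<close>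

lemma bessel_weight: "(1 + \<bar>\<xi>\<bar>\<^sup>2) powr (s / 2) = jb \<xi> powr s"
proof -
  have "0 < 1 + \<xi>\<^sup>2" by (simp add: add_pos_nonneg)
  then have "jb \<xi> = (1 + \<xi>\<^sup>2) powr (1 / 2)" by (simp add: jb_def powr_half_sqrt)
  then show ?thesis by (simp add: powr_powr)
qed

abbreviation (input) cor :: "(real \<Rightarrow> real) \<Rightarrow> real \<Rightarrow> complex" where
  "cor f \<equiv> (\<lambda>x. complex_of_real (f x))"

definition jbs :: "real \<Rightarrow> (real \<Rightarrow> complex) \<Rightarrow> real \<Rightarrow> complex" where
  "jbs s g = (\<lambda>\<xi>. complex_of_real (jb \<xi> powr s) * g \<xi>)"

lemma measurable_jbs [measurable (raw)]: "g \<in> borel_measurable borel \<Longrightarrow> jbs s g \<in> borel_measurable borel"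
  unfolding jbs_def by measurable

lemma jbs_diff: "(\<lambda>\<xi>. jbs s f \<xi> - jbs s g \<xi>) = jbs s (\<lambda>\<xi>. f \<xi> - g \<xi>)"
  by (simp add: jbs_def right_diff_distrib)

lemma is_bessel_iff: "is_bessel s f h \<longleftrightarrow> (\<exists>g. L2_fourier f g \<and> L2_fourier h (jbs s g))"
  unfolding is_bessel_def bessel_weight jbs_def ..

text \<open>\<open>bessel\<close> is an arbitrary choice, but by uniqueness of the transform and
  Plancherel every choice has the same norm, computed on the Fourier side.\<close>

lemma HsI:
  assumes g: "L2_fourier (cor f) g" and w: "jbs s g \<in> L2"
  shows "f \<in> Hs s" "Hs_norm s f = L2_norm (jbs s g)"
proof -
  obtain h where "L2_fourier h (jbs s g)" using L2_fourier_surj[OF w] .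
  then have ex: "is_bessel s (cor f) h" using g by (auto simp: is_bessel_iff)
  then show "f \<in> Hs s" by (auto simp: Hs_def)
  have "is_bessel s (cor f) (bessel s (cor f))" unfolding bessel_def by (rule someI[of "is_bessel s (cor f)", OF ex])
  then obtain g' where g': "L2_fourier (cor f) g'" and h': "L2_fourier (bessel s (cor f)) (jbs s g')"
    by (auto simp: is_bessel_iff)
  have "AE \<xi> in lborel. g' \<xi> = g \<xi>" by (rule L2_fourier_unique[OF g' g])
  then have "AE \<xi> in lborel. jbs s g' \<xi> = jbs s g \<xi>" by eventually_elim (simp add: jbs_def)
  from L2_cong_AE(2)[OF L2_fourierD(2)[OF h'] this] L2_measurable[OF w]
  show "Hs_norm s f = L2_norm (jbs s g)"
    unfolding Hs_norm_def using plancherel[OF h'] by simp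
qed

lemma HsE:
  assumes "f \<in> Hs s"
  obtains g where "L2_fourier (cor f) g" "jbs s g \<in> L2"
proof -
  obtain h g where "L2_fourier (cor f) g" "L2_fourier h (jbs s g)"
    using assms by (auto simp: Hs_def is_bessel_iff)
  then show ?thesis using that L2_fourierD(2) by blast
qed

lemma HsD:
  assumes "f \<in> Hs s" "L2_fourier (cor f) g"
  shows "jbs s g \<in> L2" "Hs_norm s f = L2_norm (jbs s g)"
proof -
  obtain g' where g': "L2_fourier (cor f) g'" "jbs s g' \<in> L2" using HsE[OF assms(1)] .
  have "AE \<xi> in lborel. g' \<xi> = g \<xi>" by (rule L2_fourier_unique[OF g'(1) assms(2)])
  then have "AE \<xi> in lborel. jbs s g' \<xi> = jbs s g \<xi>" by eventually_elim (simp add: jbs_def)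
  then show w: "jbs s g \<in> L2"
    by (rule L2_cong_AE(1)[OF g'(2)]) (use L2_measurable[OF L2_fourierD(2)[OF assms(2)]] in measurable)
  show "Hs_norm s f = L2_norm (jbs s g)" by (rule HsI(2)[OF assms(2) w])
qed

lemma Hs_norm_nonneg [simp]: "0 \<le> Hs_norm s f"
  by (simp add: Hs_norm_def)

lemma Hs_L2: "f \<in> Hs s \<Longrightarrow> cor f \<in> L2"
  by (erule HsE) (rule L2_fourierD(1))

lemma Hs_diff:
  assumes "f \<in> Hs s" "h \<in> Hs s"
  shows "(\<lambda>x. f x - h x) \<in> Hs s" "Hs_norm s (\<lambda>x. f x - h x) \<le> Hs_norm s f + Hs_norm s h"
    "\<bar>Hs_norm s f - Hs_norm s h\<bar> \<le> Hs_norm s (\<lambda>x. f x - h x)"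
proof -
  obtain g k where g: "L2_fourier (cor f) g" "jbs s g \<in> L2" and k: "L2_fourier (cor h) k" "jbs s k \<in> L2"
    using HsE assms by metis
  have d: "L2_fourier (cor (\<lambda>x. f x - h x)) (\<lambda>\<xi>. g \<xi> - k \<xi>)"
    using L2_fourier_diff[OF g(1) k(1)] by simp
  have dl: "jbs s (\<lambda>\<xi>. g \<xi> - k \<xi>) \<in> L2" unfolding jbs_diff[symmetric] by (rule L2_diff(1)[OF g(2) k(2)])
  show "(\<lambda>x. f x - h x) \<in> Hs s" by (rule HsI(1)[OF d dl])
  show "Hs_norm s (\<lambda>x. f x - h x) \<le> Hs_norm s f + Hs_norm s h"
    unfolding HsI(2)[OF d dl] HsI(2)[OF g] HsI(2)[OF k] jbs_diff[symmetric] by (rule L2_diff(2)[OF g(2) k(2)])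
  show "\<bar>Hs_norm s f - Hs_norm s h\<bar> \<le> Hs_norm s (\<lambda>x. f x - h x)"
    unfolding HsI(2)[OF d dl] HsI(2)[OF g] HsI(2)[OF k] jbs_diff[symmetric] by (rule L2_norm_triangle_diff[OF g(2) k(2)])
qed

lemma jbs_mono:
  assumes "r \<le> s" "jbs s g \<in> L2" "g \<in> borel_measurable borel"
  shows "jbs r g \<in> L2" "L2_norm (jbs r g) \<le> L2_norm (jbs s g)"
proof -
  have [measurable]: "jbs r g \<in> borel_measurable borel" using assms(3) by measurable
  have "L2b (\<lambda>x. ennreal (cmod (jbs r g x))) (L2_norm (jbs s g))"
  proof (rule L2b_mono[OF L2D[OF assms(2)] _ _ order_refl])
    fix x
    have "jb x powr r \<le> jb x powr s" using assms(1) jb_ge(1)[of x] by (intro powr_mono) auto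
    then show "ennreal (cmod (jbs r g x)) \<le> ennreal (cmod (jbs s g x))"
      by (simp add: jbs_def norm_mult ennreal_leI mult_right_mono)
  qed measurable
  then show "jbs r g \<in> L2" "L2_norm (jbs r g) \<le> L2_norm (jbs s g)" by (rule L2I, measurable)+
qed

lemma Hs_mono:
  assumes "r \<le> s" "f \<in> Hs s"
  shows "f \<in> Hs r" "Hs_norm r f \<le> Hs_norm s f"
proof -
  obtain g where g: "L2_fourier (cor f) g" "jbs s g \<in> L2" using HsE[OF assms(2)] .
  note j = jbs_mono[OF assms(1) g(2) L2_measurable[OF L2_fourierD(2)[OF g(1)]]]
  show "f \<in> Hs r" by (rule HsI(1)[OF g(1) j(1)])
  show "Hs_norm r f \<le> Hs_norm s f" unfolding HsI(2)[OF g] HsI(2)[OF g(1) j(1)] by (rule j(2))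
qed

lemma wn_jbs: "wn (\<lambda>\<xi>. jb \<xi> powr s) g = (\<integral>\<^sup>+\<xi>. ennreal ((cmod (jbs s g \<xi>))\<^sup>2) \<partial>lborel)"
  unfolding wn_def jbs_def
  by (intro nn_integral_cong) (simp add: norm_mult power_mult_distrib ennreal_power ennreal_mult)

lemma wn_jbs_L2: "jbs s g \<in> L2 \<Longrightarrow> wn (\<lambda>\<xi>. jb \<xi> powr s) g = ennreal ((L2_norm (jbs s g))\<^sup>2)"
  unfolding wn_jbs by (rule L2_nn)

lemma L2_of_wn:
  assumes "wn (\<lambda>\<xi>. jb \<xi> powr s) g \<le> ennreal (A\<^sup>2)" "0 \<le> A" "g \<in> borel_measurable borel"
  shows "jbs s g \<in> L2" "L2_norm (jbs s g) \<le> A"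
proof -
  have [measurable]: "jbs s g \<in> borel_measurable borel" using assms(3) by measurable
  have "L2b (\<lambda>x. ennreal (cmod (jbs s g x))) A"
    using assms unfolding wn_jbs by (simp add: L2b_def ennreal_power)
  then show "jbs s g \<in> L2" "L2_norm (jbs s g) \<le> A" by (rule L2I, measurable)+
qed

lemma jbs_1: "jbs 1 g = (\<lambda>\<xi>. complex_of_real (jb \<xi>) * g \<xi>)"
  using jb_ge(3) by (simp add: jbs_def less_imp_le)

lemma h1n_jbs: "h1n g = (L2_norm (jbs 1 g))\<^sup>2"
  using jb_ge(3) by (simp add: h1n_def L2_norm_power2 jbs_1 norm_mult power_mult_distrib)

lemma integrable_h1n: "jbs 1 g \<in> L2 \<Longrightarrow> integrable lborel (\<lambda>x. (jb x)\<^sup>2 * (cmod (g x))\<^sup>2)"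
  using jb_ge(3) by (simp add: L2_def jbs_1 norm_mult power_mult_distrib)

section \<open>Test functions\<close>

text \<open>A function is carried along with all its derivatives, so that products and rescalings
  stay explicit and iterated \<open>deriv\<close> is needed only at the interface to
  \<open>test_function\<close>.\<close>

definition derivs :: "(nat \<Rightarrow> real \<Rightarrow> real) \<Rightarrow> bool" where
  "derivs g \<longleftrightarrow> (\<forall>k x. (g k has_real_derivative g (Suc k) x) (at x))"

lemma derivs_deriv:
  assumes "derivs g"
  shows "(deriv ^^ k) (g 0) = g k"
proof (induction k)
  case (Suc k)
  then show ?case using assms by (auto simp: derivs_def intro!: DERIV_imp_deriv)
qed simp

lemma derivs_test_function:
  assumes "derivs g" "bounded {x. g 0 x \<noteq> 0}"
  shows "test_function (g 0)"
  unfolding test_function_def derivs_deriv[OF assms(1)]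
  using assms by (auto simp: derivs_def real_differentiable_def)

lemma derivs_affine:
  assumes "derivs g"
  shows "derivs (\<lambda>k x. a ^ k * g k (a * x + b))"
  unfolding derivs_def
proof (intro allI)
  fix k x
  have "(g k has_real_derivative g (Suc k) (a * x + b)) (at (a * x + b))"
    using assms by (simp add: derivs_def)
  then have "((\<lambda>x. g k (a * x + b)) has_real_derivative g (Suc k) (a * x + b) * a) (at x)"
    by (rule DERIV_chain2) (auto intro!: derivative_eq_intros)
  from DERIV_cmult[OF this, of "a ^ k"]
  show "((\<lambda>x. a ^ k * g k (a * x + b)) has_real_derivative a ^ Suc k * g (Suc k) (a * x + b)) (at x)"
    by (simp add: mult_ac)
qed

lemma derivs_cmult: "derivs g \<Longrightarrow> derivs (\<lambda>k x. c * g k x)"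
  by (auto simp: derivs_def intro!: DERIV_cmult)

text \<open>Pascal's rule, isolated as the inductive step of the Leibniz formula.\<close>

lemma binomial_sum_Suc:
  fixes h :: "nat \<Rightarrow> nat \<Rightarrow> real"
  shows "(\<Sum>k\<le>n. real (n choose k) * (h (Suc k) (n - k) + h k (Suc (n - k)))) =
    (\<Sum>k\<le>Suc n. real (Suc n choose k) * h k (Suc n - k))"
proof -
  have "(\<Sum>k\<le>Suc n. real (Suc n choose k) * h k (Suc n - k)) =
      h 0 (Suc n) + (\<Sum>k\<le>n. real (n choose k) * h (Suc k) (n - k)) + (\<Sum>k\<le>n. real (n choose Suc k) * h (Suc k) (n - k))"
    by (subst sum.atMost_Suc_shift) (simp add: sum.distrib distrib_right)
  also have "h 0 (Suc n) + (\<Sum>k\<le>n. real (n choose Suc k) * h (Suc k) (n - k)) = (\<Sum>k\<le>Suc n. real (n choose k) * h k (Suc n - k))"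
    by (subst sum.atMost_Suc_shift) simp
  then have "h 0 (Suc n) + (\<Sum>k\<le>n. real (n choose k) * h (Suc k) (n - k)) + (\<Sum>k\<le>n. real (n choose Suc k) * h (Suc k) (n - k))
     = (\<Sum>k\<le>n. real (n choose k) * h (Suc k) (n - k)) + (\<Sum>k\<le>n. real (n choose k) * h k (Suc (n - k)))"
    by (simp add: Suc_diff_le)
  finally show ?thesis by (simp add: sum.distrib distrib_left)
qed

lemma derivs_mult:
  assumes "derivs f" "derivs g"
  shows "derivs (\<lambda>n x. \<Sum>k\<le>n. real (n choose k) * (f k x * g (n - k) x))"
  unfolding derivs_def
proof (intro allI)
  fix n x
  have "((\<lambda>x. \<Sum>k\<le>n. real (n choose k) * (f k x * g (n - k) x)) has_real_derivative
      (\<Sum>k\<le>n. real (n choose k) * (f (Suc k) x * g (n - k) x + f k x * g (Suc (n - k)) x))) (at x)"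
    using assms by (auto simp: derivs_def algebra_simps intro!: derivative_eq_intros sum.cong)
  then show "((\<lambda>x. \<Sum>k\<le>n. real (n choose k) * (f k x * g (n - k) x)) has_real_derivative
      (\<Sum>k\<le>Suc n. real (Suc n choose k) * (f k x * g (Suc n - k) x))) (at x)"
    unfolding binomial_sum_Suc[of n "\<lambda>k l. f k x * g l x"] .
qed

lemma poly_exp_tendsto_0: "((\<lambda>y :: real. poly p y * exp (- y)) \<longlongrightarrow> 0) at_top"
proof -
  have "((\<lambda>y :: real. \<Sum>i\<le>degree p. coeff p i * (y ^ i / exp y)) \<longlongrightarrow> (\<Sum>i\<le>degree p. coeff p i * 0)) at_top"
    by (intro tendsto_intros tendsto_power_div_exp_0)
  then show ?thesis by (simp add: poly_altdef exp_minus sum_distrib_right divide_inverse mult.assoc)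
qed

text \<open>Polynomials in 1/x times exp (-1/x), extended by 0: a class closed under
  differentiation, so smoothness at 0 needs no separate induction.\<close>

definition flat :: "real poly \<Rightarrow> real \<Rightarrow> real" where
  "flat p x = (if 0 < x then poly p (1 / x) * exp (- (1 / x)) else 0)"

lemma flat_tendsto: "((\<lambda>x. flat p x) \<longlongrightarrow> 0) (at_right 0)"
proof -
  have "((\<lambda>x. poly p (inverse x) * exp (- inverse x)) \<longlongrightarrow> 0) (at_right 0)"
    by (rule filterlim_compose[OF poly_exp_tendsto_0 filterlim_inverse_at_top_right])
  then show ?thesis
    by (rule Lim_transform_eventually) (auto simp: flat_def eventually_at_filter divide_inverse)
qed

text \<open>With y = 1/x the derivative of p(y) exp(-y) in x is y^2 (p - p')(y) exp(-y), and
  \<open>[:0, 0, 1:]\<close> is y^2.\<close>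

lemma flat_derivative:
  "(flat p has_real_derivative flat ([:0, 0, 1:] * (p - pderiv p)) x) (at x)"
proof -
  consider "x < 0" | "0 < x" | "x = 0" by linarith
  then show ?thesis
  proof cases
    case 1
    have "((\<lambda>_. 0) has_real_derivative 0) (at x)" by simp
    then have "(flat p has_real_derivative 0) (at x)"
      by (rule has_field_derivative_transform_within_open[of _ _ _ "{..<0}"]) (use 1 in \<open>auto simp: flat_def\<close>)
    then show ?thesis using 1 by (simp add: flat_def)
  next
    case 2
    have "((\<lambda>x. poly p (1 / x) * exp (- (1 / x))) has_real_derivative
        poly (pderiv p) (1 / x) * (- (1 / x\<^sup>2)) * exp (- (1 / x)) + poly p (1 / x) * (exp (- (1 / x)) * (1 / x\<^sup>2))) (at x)"
      using 2 by (auto intro!: derivative_eq_intros DERIV_chain2[OF poly_DERIV] simp: power2_eq_square divide_inverse)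
    then have "(flat p has_real_derivative
        poly (pderiv p) (1 / x) * (- (1 / x\<^sup>2)) * exp (- (1 / x)) + poly p (1 / x) * (exp (- (1 / x)) * (1 / x\<^sup>2))) (at x)"
      by (rule has_field_derivative_transform_within_open[of _ _ _ "{0<..}"]) (use 2 in \<open>auto simp: flat_def\<close>)
    then show ?thesis using 2 by (simp add: flat_def power2_eq_square field_simps)
  next
    case 3
    \<comment> \<open>At 0 the right difference quotient is again of this form: division by h
      multiplies the polynomial by y.\<close>
    have "((\<lambda>h. flat ([:0, 1:] * p) h) \<longlongrightarrow> 0) (at_right 0)" by (rule flat_tendsto)
    then have r: "((\<lambda>h. flat p h / h) \<longlongrightarrow> 0) (at_right 0)"
      by (rule Lim_transform_eventually) (auto simp: flat_def eventually_at_filter)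
    have "((\<lambda>h. 0) \<longlongrightarrow> 0) (at_left (0::real))" by simp
    then have l: "((\<lambda>h. flat p h / h) \<longlongrightarrow> 0) (at_left 0)"
      by (rule Lim_transform_eventually) (auto simp: flat_def eventually_at_filter)
    have "((\<lambda>h. flat p h / h) \<longlongrightarrow> 0) (at 0)" by (rule filterlim_split_at[OF l r])
    then show ?thesis using 3 by (simp add: DERIV_def flat_def)
  qed
qed

locale bump =
  fixes X :: "nat \<Rightarrow> real \<Rightarrow> real"
  assumes smooth: "derivs X" and one: "X 0 0 = 1" and zero: "\<And>k x. 1 < \<bar>x\<bar> \<Longrightarrow> X k x = 0" and bdd: "\<And>k. \<exists>C. \<forall>x. \<bar>X k x\<bar> \<le> C"

lemma smooth_bump:
  obtains X where "bump X"
proof -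
  define p where "p = rec_nat [:1 :: real:] (\<lambda>_ p. [:0, 0, 1:] * (p - pderiv p))"
  define f where "f k = flat (p k)" for k
  have f: "derivs f" unfolding derivs_def f_def using flat_derivative by (simp add: p_def)
  \<comment> \<open>The Leibniz derivatives of the product of the flat functions at 1 + x and at 1 -
    x. Outside [-1, 1] one of the two factors vanishes, and \<open>exp 2\<close> normalises the
    value at 0.\<close>
  define X where "X n x = exp 2 * (\<Sum>k\<le>n. real (n choose k) * ((1 ^ k * f k (1 * x + 1)) * ((- 1) ^ (n - k) * f (n - k) (- 1 * x + 1))))" for n x
  have X: "derivs X" unfolding X_def[abs_def]
    by (intro derivs_cmult derivs_mult derivs_affine f)
  have z: "X k x = 0" if "1 < \<bar>x\<bar>" for k x
    using that by (auto simp: X_def f_def flat_def intro!: sum.neutral)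
  have "X 0 0 = exp 2 * (exp (- 1) * exp (- 1))" by (simp add: X_def f_def flat_def p_def)
  then have 1: "X 0 0 = 1" by (simp add: mult_exp_exp)
  have "\<exists>C. \<forall>x. \<bar>X k x\<bar> \<le> C" for k
  proof -
    have "continuous_on {-1..1} (X k)"
      using X by (auto simp: derivs_def intro!: continuous_at_imp_continuous_on DERIV_isCont)
    then have "bounded (X k ` {-1..1})" by (intro compact_imp_bounded compact_continuous_image) auto
    then obtain C where C: "\<forall>x\<in>{-1..1}. \<bar>X k x\<bar> \<le> C" by (auto simp: bounded_iff)
    have "\<bar>X k x\<bar> \<le> max C 0" for x
      
    proof (cases "1 < \<bar>x\<bar>")
      case False
      then have "x \<in> {-1..1}" by (auto simp: abs_le_iff not_less)
      from bspec[OF C this] show ?thesis by (simp add: le_max_iff_disj)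
    qed (simp add: z)
    then show ?thesis by blast
  qed
  then have "bump X" using X 1 z by unfold_locales auto
  then show ?thesis by (rule that)
qed

text \<open>The \<open>x\<close>-derivatives of \<open>X (x / R) exp (- i \<xi> x)\<close>.\<close>

definition cutexp :: "(nat \<Rightarrow> real \<Rightarrow> real) \<Rightarrow> real \<Rightarrow> real \<Rightarrow> nat \<Rightarrow> real \<Rightarrow> complex" where
  "cutexp X R \<xi> m x = (\<Sum>k\<le>m. of_nat (m choose k) * (of_real ((1 / R) ^ k * X k (x / R)) * ((- \<i> * of_real \<xi>) ^ (m - k) * cis (- (\<xi> * x)))))"

lemma cis_derivs:
  "derivs (\<lambda>k x. Re ((- \<i> * of_real \<xi>) ^ k * cis (- (\<xi> * x))))"
  "derivs (\<lambda>k x. Im ((- \<i> * of_real \<xi>) ^ k * cis (- (\<xi> * x))))"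
proof -
  have "((\<lambda>x. (- \<i> * of_real \<xi>) ^ k * cis (- (\<xi> * x))) has_vector_derivative (- \<i> * of_real \<xi>) ^ Suc k * cis (- (\<xi> * x))) (at x)" for k x
  proof -
    have "((\<lambda>x. cis (- (\<xi> * x))) has_vector_derivative (- \<i> * of_real \<xi>) * cis (- (\<xi> * x))) (at x)"
      unfolding has_vector_derivative_complex_iff
      by (auto intro!: derivative_eq_intros)
    from has_vector_derivative_mult_right[OF this, of "(- \<i> * of_real \<xi>) ^ k"] show ?thesis by (simp add: mult_ac)
  qed
  then show "derivs (\<lambda>k x. Re ((- \<i> * of_real \<xi>) ^ k * cis (- (\<xi> * x))))"
    "derivs (\<lambda>k x. Im ((- \<i> * of_real \<xi>) ^ k * cis (- (\<xi> * x))))"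
    unfolding derivs_def has_vector_derivative_complex_iff by auto
qed

lemma (in bump) cutexp_derivs:
  shows "derivs (\<lambda>m x. Re (cutexp X R \<xi> m x))" "derivs (\<lambda>m x. Im (cutexp X R \<xi> m x))"
  using derivs_mult[OF derivs_affine[OF smooth, of "1 / R" 0] cis_derivs(1)[of \<xi>]]
    derivs_mult[OF derivs_affine[OF smooth, of "1 / R" 0] cis_derivs(2)[of \<xi>]]
  by (simp_all add: cutexp_def)

lemma cutexp_split:
  "cutexp X R \<xi> m x = of_real (X 0 (x / R)) * ((- \<i> * of_real \<xi>) ^ m * cis (- (\<xi> * x))) +
    (\<Sum>k\<in>{1..m}. of_nat (m choose k) * (of_real ((1 / R) ^ k * X k (x / R)) * ((- \<i> * of_real \<xi>) ^ (m - k) * cis (- (\<xi> * x)))))"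
proof -
  have "{..m} = insert 0 {1..m}" by auto
  then show ?thesis by (simp add: cutexp_def)
qed

lemma cutexp_0: "cutexp X R \<xi> 0 x = of_real (X 0 (x / R)) * cis (- (\<xi> * x))"
  by (simp add: cutexp_def)

text \<open>In the Leibniz sum only the term with no derivative on the cut-off lacks a factor 1/R.
  The rest is at most C/R on an interval of length 2R, so it tends to 0 in L^2.\<close>

lemma (in bump) cutexp_remainder:
  obtains C where "0 \<le> C"
    "\<And>R x. 1 \<le> R \<Longrightarrow> cmod (cutexp X R \<xi> m x - (- \<i> * of_real \<xi>) ^ m * cutexp X R \<xi> 0 x) \<le> C / R * indicator {-R..R} x"
proof -
  obtain B where B: "\<And>k x. \<bar>X k x\<bar> \<le> B k" using bdd by metis
  have B0: "0 \<le> B k" for k using B[of k 0] by (meson abs_ge_zero order_trans)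
  define C where "C = (\<Sum>k\<in>{1..m}. real (m choose k) * (B k * \<bar>\<xi>\<bar> ^ (m - k)))"
  have C0: "0 \<le> C" unfolding C_def by (intro sum_nonneg mult_nonneg_nonneg) (auto simp: B0)
  show ?thesis
  proof (rule that[OF C0])
    fix R x :: real assume R: "1 \<le> R"
    have e: "cutexp X R \<xi> m x - (- \<i> * of_real \<xi>) ^ m * cutexp X R \<xi> 0 x =
      (\<Sum>k\<in>{1..m}. of_nat (m choose k) * (of_real ((1 / R) ^ k * X k (x / R)) * ((- \<i> * of_real \<xi>) ^ (m - k) * cis (- (\<xi> * x)))))"
      unfolding cutexp_split[of X R \<xi> m] cutexp_0 by simp
    show "cmod (cutexp X R \<xi> m x - (- \<i> * of_real \<xi>) ^ m * cutexp X R \<xi> 0 x) \<le> C / R * indicator {-R..R} x"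
    proof (cases "x \<in> {-R..R}")
      case True
      have "cmod (\<Sum>k\<in>{1..m}. of_nat (m choose k) * (of_real ((1 / R) ^ k * X k (x / R)) * ((- \<i> * of_real \<xi>) ^ (m - k) * cis (- (\<xi> * x)))))
          \<le> (\<Sum>k\<in>{1..m}. real (m choose k) * (((1 / R) * B k) * \<bar>\<xi>\<bar> ^ (m - k)))"
      proof (rule sum_norm_le)
        fix k assume "k \<in> {1..m}"
        then have "(1 / R) ^ k \<le> (1 / R) ^ 1" using R by (intro power_decreasing) auto
        then have "\<bar>(1 / R) ^ k * X k (x / R)\<bar> \<le> (1 / R) * B k"
          unfolding abs_mult using R B[of k "x / R"] by (intro mult_mono) auto
        then show "cmod (of_nat (m choose k) * (of_real ((1 / R) ^ k * X k (x / R)) * ((- \<i> * of_real \<xi>) ^ (m - k) * cis (- (\<xi> * x)))))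
            \<le> real (m choose k) * (((1 / R) * B k) * \<bar>\<xi>\<bar> ^ (m - k))"
          unfolding norm_mult norm_power norm_of_real
          by (intro mult_mono) auto
      qed
      also have "\<dots> = C / R" by (simp add: C_def sum_divide_distrib)
      finally show ?thesis unfolding e using True by simp
    next
      case False
      then have "1 < \<bar>x / R\<bar>" using R by (auto simp: abs_if field_simps)
      then have "X k (x / R) = 0" for k by (rule zero)
      then show ?thesis unfolding e using False by simp
    qed
  qed
qed

lemma (in bump) cutexp_L2:
  assumes "1 \<le> R"
  shows "cutexp X R \<xi> m \<in> L2" "\<And>x. R < \<bar>x\<bar> \<Longrightarrow> cutexp X R \<xi> m x = 0" "\<exists>C\<ge>0. \<forall>x. cmod (cutexp X R \<xi> m x) \<le> C"
proof -
  show z: "cutexp X R \<xi> m x = 0" if "R < \<bar>x\<bar>" for x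
  proof -
    have "1 < \<bar>x / R\<bar>" using that assms by (auto simp: abs_if field_simps)
    then show ?thesis using zero by (simp add: cutexp_def)
  qed
  have c: "continuous_on UNIV (cutexp X R \<xi> m)"
  proof -
    have "continuous_on UNIV (\<lambda>x. Re (cutexp X R \<xi> m x))" "continuous_on UNIV (\<lambda>x. Im (cutexp X R \<xi> m x))"
      using cutexp_derivs[of R \<xi>] by (auto simp: derivs_def intro!: continuous_at_imp_continuous_on DERIV_isCont)
    then have "continuous_on UNIV (\<lambda>x. Complex (Re (cutexp X R \<xi> m x)) (Im (cutexp X R \<xi> m x)))" by (rule continuous_on_Complex)
    then show ?thesis by simp
  qed
  have "compact (cutexp X R \<xi> m ` {-R..R})"
    by (intro compact_continuous_image continuous_on_subset[OF c]) auto
  then have "bounded (cutexp X R \<xi> m ` {-R..R})" by (rule compact_imp_bounded)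
  then obtain C where "\<forall>x\<in>{-R..R}. cmod (cutexp X R \<xi> m x) \<le> C" by (auto simp: bounded_iff)
  then have C: "x \<in> {-R..R} \<Longrightarrow> cmod (cutexp X R \<xi> m x) \<le> C" for x by blast
  have b: "cmod (cutexp X R \<xi> m x) \<le> max C 0 * indicator {-R..R} x" for x
  proof (cases "x \<in> {-R..R}")
    case True
    then show ?thesis using C[OF True] by (simp add: le_max_iff_disj)
  next
    case False
    then show ?thesis using z[of x] by (auto simp: abs_if)
  qed
  show "cutexp X R \<xi> m \<in> L2"
    by (rule L2_compact_support(1)[OF borel_measurable_continuous_onI[OF c] b]) simp
  have "cmod (cutexp X R \<xi> m x) \<le> max C 0" for x
    by (rule order_trans[OF b mult_left_le]) (auto simp: indicator_def)
  then show "\<exists>C\<ge>0. \<forall>x. cmod (cutexp X R \<xi> m x) \<le> C" by (intro exI[of _ "max C 0"]) auto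
qed

section \<open>Profiles of Kawahara solutions\<close>

lemma antiderivative:
  fixes f :: "real \<Rightarrow> complex"
  assumes "continuous_on UNIV f"
  obtains P where "P 0 = 0" "\<And>t. (P has_vector_derivative f t) (at t)"
proof (rule that[of "\<lambda>u. LBINT y=(0::real)..u. f y"])
  show "(LBINT y=(0::real)..ereal 0. f y) = 0" by simp
  fix t :: real
  have "((\<lambda>u. LBINT y=(0::real)..u. f y) has_vector_derivative f t) (at t within {-\<bar>t\<bar>-1..\<bar>t\<bar>+1})"
    by (rule interval_integral_FTC2) (auto intro: continuous_on_subset[OF assms])
  moreover have "t \<in> interior {-\<bar>t\<bar>-1..\<bar>t\<bar>+1}" by (auto simp: abs_if)
  ultimately show "((\<lambda>u. LBINT y=(0::real)..u. f y) has_vector_derivative f t) (at t)"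
    by (metis at_within_interior)
qed

text \<open>Passes to the limit in the integrated equation. The derivatives \<open>d n\<close> are
  not assumed continuous, hence the gauge integral, whose fundamental theorem needs no integrability
  hypothesis.\<close>

lemma limit_of_antiderivatives:
  fixes V :: "nat \<Rightarrow> real \<Rightarrow> complex"
  assumes V: "\<And>n \<tau>. (V n has_vector_derivative d n \<tau>) (at \<tau>)"
    and P: "\<And>\<tau>. (P has_vector_derivative D \<tau>) (at \<tau>)"
    and lim: "\<And>\<tau>. (\<lambda>n. d n \<tau>) \<longlonglongrightarrow> D \<tau>"
    and bdd: "\<And>a b. \<exists>M. \<forall>n. \<forall>\<tau>\<in>{a..b}. cmod (d n \<tau>) \<le> M"
  shows "(\<lambda>n. V n t - V n s) \<longlonglongrightarrow> P t - P s"
proof -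
  have *: "(\<lambda>n. V n b - V n a) \<longlonglongrightarrow> P b - P a" if ab: "a \<le> b" for a b
  proof -
    have v: "(d n has_integral V n b - V n a) {a..b}" for n
      by (rule fundamental_theorem_of_calculus[OF ab]) (rule has_vector_derivative_at_within[OF V])
    have p: "(D has_integral P b - P a) {a..b}"
      by (rule fundamental_theorem_of_calculus[OF ab]) (rule has_vector_derivative_at_within[OF P])
    obtain M where M: "\<And>n \<tau>. \<tau> \<in> {a..b} \<Longrightarrow> cmod (d n \<tau>) \<le> M" using bdd[of a b] by blast
    have "(\<lambda>n. integral {a..b} (d n)) \<longlonglongrightarrow> integral {a..b} D"
      by (rule dominated_convergence(2)[where h = "\<lambda>_. M"])
        (use v M lim in \<open>auto simp: has_integral_integrable\<close>)
    then show ?thesis unfolding integral_unique[OF v] integral_unique[OF p] .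
  qed
  show ?thesis
  proof (cases "s \<le> t")
    case False
    then have "(\<lambda>n. - (V n s - V n t)) \<longlonglongrightarrow> - (P s - P t)" by (intro tendsto_minus *) simp
    then show ?thesis by simp
  qed (rule *)
qed

lemma Hs_norm_zero [simp]: "Hs_norm s (\<lambda>x. 0) = 0"
proof -
  have z: "(\<lambda>x. 0 :: complex) \<in> L2" by (simp add: L2_def)
  have "L2_fourier (\<lambda>x. 0) (fhat (\<lambda>x. 0))" by (rule L2_fourier_integrable[OF z]) simp
  then have f: "L2_fourier (cor (\<lambda>x. 0)) (\<lambda>\<xi>. 0)" by (simp add: fhat_def[abs_def])
  have "jbs s (\<lambda>\<xi>. 0) \<in> L2" using z by (simp add: jbs_def)
  from HsI(2)[OF f this] show ?thesis by (simp add: jbs_def L2_norm_def)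
qed

lemma L2_norm_le_Hs_norm:
  assumes "f \<in> Hs s" "0 \<le> s"
  shows "L2_norm (cor f) \<le> Hs_norm s f"
proof -
  obtain g where g: "L2_fourier (cor f) g" "jbs s g \<in> L2" using HsE[OF assms(1)] .
  have 0: "jbs 0 g = g" by (simp add: jbs_def fun_eq_iff) (metis jb_ge(3) less_irrefl)
  show ?thesis
    using jbs_mono(2)[OF assms(2) g(2) L2_measurable[OF L2_fourierD(2)[OF g(1)]]]
    by (simp add: 0 HsI(2)[OF g] plancherel[OF g(1)])
qed

text \<open>The filter \<open>at t\<close> excludes t, while a sequence may hit it; the norm of the
  zero difference fills in the missing value.\<close>

lemma C_Hs_tendsto:
  assumes "u \<in> C_Hs s UNIV" "X \<longlonglongrightarrow> t"
  shows "(\<lambda>n. Hs_norm s (\<lambda>x. u (X n) x - u t x)) \<longlonglongrightarrow> 0"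
proof -
  have "((\<lambda>\<tau>. Hs_norm s (\<lambda>x. u \<tau> x - u t x)) \<longlongrightarrow> Hs_norm s (\<lambda>x. u t x - u t x)) (at t)"
    using assms(1) by (simp add: C_Hs_def)
  then have "((\<lambda>\<tau>. Hs_norm s (\<lambda>x. u \<tau> x - u t x)) \<longlongrightarrow> Hs_norm s (\<lambda>x. u t x - u t x)) (nhds t)"
    unfolding tendsto_at_iff_tendsto_nhds[of "\<lambda>\<tau>. Hs_norm s (\<lambda>x. u \<tau> x - u t x)" t] .
  from filterlim_compose[OF this assms(2)] show ?thesis using assms(1) by (simp add: C_Hs_def)
qed

lemma C_Hs_tendsto_L2:
  assumes "u \<in> C_Hs s UNIV" "X \<longlonglongrightarrow> t" "0 \<le> s"
  shows "(\<lambda>n. L2_norm (\<lambda>x. complex_of_real (u (X n) x) - complex_of_real (u t x))) \<longlonglongrightarrow> 0"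
proof (rule tendsto_sandwich[OF _ _ tendsto_const C_Hs_tendsto[OF assms(1,2)]])
  have "(\<lambda>x. u (X n) x - u t x) \<in> Hs s" for n using assms(1) by (intro Hs_diff(1)) (auto simp: C_Hs_def)
  from L2_norm_le_Hs_norm[OF this assms(3)]
  show "\<forall>\<^sub>F n in sequentially. L2_norm (\<lambda>x. complex_of_real (u (X n) x) - complex_of_real (u t x)) \<le> Hs_norm s (\<lambda>x. u (X n) x - u t x)"
    by simp
qed simp

lemma C_Hs_norm_continuous:
  assumes "u \<in> C_Hs s UNIV"
  shows "continuous_on UNIV (\<lambda>t. Hs_norm s (u t))"
proof (rule continuous_at_imp_continuous_on, intro ballI)
  fix t
  have h: "u \<tau> \<in> Hs s" for \<tau> using assms by (auto simp: C_Hs_def)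
  have "((\<lambda>\<tau>. Hs_norm s (u \<tau>) - Hs_norm s (u t)) \<longlongrightarrow> 0) (at t)"
    by (rule Lim_null_comparison[where g = "\<lambda>\<tau>. Hs_norm s (\<lambda>x. u \<tau> x - u t x)"])
      (use assms Hs_diff(3)[OF h h] in \<open>auto simp: C_Hs_def\<close>)
  then show "isCont (\<lambda>\<tau>. Hs_norm s (u \<tau>)) t" by (simp add: isCont_def LIM_zero_iff)
qed

lemma (in bump) cutexp_bounded:
  obtains C where "0 \<le> C" "\<And>R x. 1 \<le> R \<Longrightarrow> cmod (cutexp X R \<xi> m x) \<le> C"
proof -
  obtain C where C: "0 \<le> C" "\<And>R x. 1 \<le> R \<Longrightarrow> cmod (cutexp X R \<xi> m x - (- \<i> * of_real \<xi>) ^ m * cutexp X R \<xi> 0 x) \<le> C / R * indicator {-R..R} x"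
    using cutexp_remainder[of \<xi> m] by metis
  obtain B where B: "\<And>x. \<bar>X 0 x\<bar> \<le> B" using bdd by blast
  have B0: "0 \<le> B" using B[of 0] by linarith
  show ?thesis
  proof
    show "0 \<le> \<bar>\<xi>\<bar> ^ m * B + C" using B0 C(1) by simp
    fix R x :: real assume R: "1 \<le> R"
    have "C / R * indicator {-R..R} x \<le> C * 1"
      using R C(1) by (intro mult_mono) (auto simp: indicator_def divide_le_eq mult_le_cancel_left1)
    then have 1: "cmod (cutexp X R \<xi> m x - (- \<i> * of_real \<xi>) ^ m * cutexp X R \<xi> 0 x) \<le> C" using C(2)[OF R, of x] by simp
    have 2: "cmod ((- \<i> * of_real \<xi>) ^ m * cutexp X R \<xi> 0 x) \<le> \<bar>\<xi>\<bar> ^ m * B"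
      unfolding cutexp_0 norm_mult norm_power using B[of "x / R"] by (simp add: mult_left_mono)
    show "cmod (cutexp X R \<xi> m x) \<le> \<bar>\<xi>\<bar> ^ m * B + C"
      using norm_triangle_ineq[of "(- \<i> * of_real \<xi>) ^ m * cutexp X R \<xi> 0 x" "cutexp X R \<xi> m x - (- \<i> * of_real \<xi>) ^ m * cutexp X R \<xi> 0 x"] 1 2
      by simp
  qed
qed

lemma (in bump) cutexp_limit:
  shows "(\<lambda>n. cutexp X (real (Suc n)) \<xi> m x) \<longlonglongrightarrow> (- \<i> * of_real \<xi>) ^ m * cis (- (\<xi> * x))"
proof -
  obtain C where C: "0 \<le> C" "\<And>R x. 1 \<le> R \<Longrightarrow> cmod (cutexp X R \<xi> m x - (- \<i> * of_real \<xi>) ^ m * cutexp X R \<xi> 0 x) \<le> C / R * indicator {-R..R} x"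
    using cutexp_remainder[of \<xi> m] by metis
  have inv: "(\<lambda>n. c / real (Suc n)) \<longlonglongrightarrow> 0" for c :: real
    by (rule LIMSEQ_Suc[OF lim_const_over_n])
  have "isCont (X 0) 0" using smooth by (auto simp: derivs_def intro: DERIV_isCont)
  from isCont_tendsto_compose[OF this inv[of x]]
  have x: "(\<lambda>n. X 0 (x / real (Suc n))) \<longlonglongrightarrow> 1" by (simp add: one)
  have "(\<lambda>n. of_real (X 0 (x / real (Suc n))) * cis (- (\<xi> * x))) \<longlonglongrightarrow> of_real 1 * cis (- (\<xi> * x))"
    by (intro tendsto_mult tendsto_of_real x tendsto_const)
  from tendsto_mult[OF tendsto_const this]
  have 0: "(\<lambda>n. (- \<i> * of_real \<xi>) ^ m * cutexp X (real (Suc n)) \<xi> 0 x) \<longlonglongrightarrow> (- \<i> * of_real \<xi>) ^ m * (of_real 1 * cis (- (\<xi> * x)))"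
    unfolding cutexp_0 .
  have "(\<lambda>n. cutexp X (real (Suc n)) \<xi> m x - (- \<i> * of_real \<xi>) ^ m * cutexp X (real (Suc n)) \<xi> 0 x) \<longlonglongrightarrow> 0"
  proof (rule Lim_null_comparison[OF _ inv[of C]], intro always_eventually allI)
    fix n
    have "C / real (Suc n) * indicator {-real (Suc n)..real (Suc n)} x \<le> C / real (Suc n)"
      using C(1) by (intro mult_left_le) (auto simp: indicator_def)
    then show "cmod (cutexp X (real (Suc n)) \<xi> m x - (- \<i> * of_real \<xi>) ^ m * cutexp X (real (Suc n)) \<xi> 0 x) \<le> C / real (Suc n)"
      using C(2)[of "real (Suc n)" x] by simp
  qed
  from tendsto_add[OF this 0] show ?thesis by simp
qed

text \<open>By \<open>cutexp_remainder\<close> the squared norm is at most (C/R)^2 times 2R.\<close>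

lemma (in bump) cutexp_tail:
  shows "(\<lambda>n. L2_norm (\<lambda>x. cutexp X (real (Suc n)) \<xi> m x - (- \<i> * of_real \<xi>) ^ m * cutexp X (real (Suc n)) \<xi> 0 x)) \<longlonglongrightarrow> 0"
proof -
  obtain C where C: "0 \<le> C" "\<And>R x. 1 \<le> R \<Longrightarrow> cmod (cutexp X R \<xi> m x - (- \<i> * of_real \<xi>) ^ m * cutexp X R \<xi> 0 x) \<le> C / R * indicator {-R..R} x"
    using cutexp_remainder[of \<xi> m] by metis
  define r where "r n = (\<lambda>x. cutexp X (real (Suc n)) \<xi> m x - (- \<i> * of_real \<xi>) ^ m * cutexp X (real (Suc n)) \<xi> 0 x)" for n
  have rL: "r n \<in> L2" for n
    unfolding r_def by (intro L2_diff(1) L2_cmult(1) cutexp_L2(1)) auto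
  have b: "L2_norm (r n) \<le> sqrt (2 * C\<^sup>2 / real (Suc n))" for n
  proof -
    define R where "R = real (Suc n)"
    have R: "1 \<le> R" by (simp add: R_def)
    have i: "integrable lborel (\<lambda>x. (C / R)\<^sup>2 * indicator {-R..R} x)"
      by (intro integrable_mult_right integrable_real_indicator) (auto simp: emeasure_lborel_Icc_eq)
    have "(LINT x|lborel. (cmod (r n x))\<^sup>2) \<le> (LINT x|lborel. (C / R)\<^sup>2 * indicator {-R..R} x)"
    proof (rule integral_mono[OF _ i])
      show "integrable lborel (\<lambda>x. (cmod (r n x))\<^sup>2)" using rL[of n] by (simp add: L2_def)
      fix x
      have "(cmod (r n x))\<^sup>2 \<le> (C / R * indicator {-R..R} x)\<^sup>2"
        unfolding r_def R_def[symmetric] by (intro power_mono C(2)[OF R]) simp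
      also have "\<dots> = (C / R)\<^sup>2 * indicator {-R..R} x" by (simp add: power_mult_distrib indicator_def)
      finally show "(cmod (r n x))\<^sup>2 \<le> (C / R)\<^sup>2 * indicator {-R..R} x" .
    qed
    also have "\<dots> = (C / R)\<^sup>2 * (2 * R)" using R by simp
    also have "\<dots> = 2 * C\<^sup>2 / R" using R by (simp add: power2_eq_square field_simps)
    finally show ?thesis unfolding L2_norm_def R_def by (rule real_sqrt_le_mono)
  qed
  have "(\<lambda>n. sqrt (2 * C\<^sup>2 / real (Suc n))) \<longlonglongrightarrow> sqrt 0"
    by (intro tendsto_real_sqrt LIMSEQ_Suc[OF lim_const_over_n])
  then have l: "(\<lambda>n. sqrt (2 * C\<^sup>2 / real (Suc n))) \<longlonglongrightarrow> 0" by simp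
  have "(\<lambda>n. L2_norm (r n)) \<longlonglongrightarrow> 0"
    by (rule tendsto_sandwich[OF _ _ tendsto_const l]) (simp, intro always_eventually allI b)
  then show ?thesis unfolding r_def .
qed

lemma solution_facts:
  assumes "kawahara_solution \<epsilon> \<phi> u"
  shows "u \<in> C_Hs 1 UNIV" "u t \<in> Hs 1" "cor (u t) \<in> L2" "AE x in lborel. u 0 x = \<phi> x"
    "integrable lborel (\<lambda>x. complex_of_real ((u t x)\<^sup>2))" "u t \<in> borel_measurable borel"
proof -
  show 1: "u \<in> C_Hs 1 UNIV" "AE x in lborel. u 0 x = \<phi> x" using assms by (auto simp: kawahara_solution_def)
  show 2: "u t \<in> Hs 1" using 1 by (auto simp: C_Hs_def)
  show 3: "cor (u t) \<in> L2" by (rule Hs_L2[OF 2])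
  then have "integrable lborel (\<lambda>x. (u t x)\<^sup>2)" by (simp add: L2_def)
  then show "integrable lborel (\<lambda>x. complex_of_real ((u t x)\<^sup>2))" by (rule integrable_of_real)
  have "(\<lambda>x. Re (complex_of_real (u t x))) \<in> borel_measurable borel" using L2_measurable[OF 3] by measurable
  then show "u t \<in> borel_measurable borel" by simp
qed

text \<open>Test functions are real, so the equation is tested with the real and imaginary parts
  separately.\<close>

lemma (in bump) cutexp_derivative:
  assumes sol: "kawahara_solution \<epsilon> \<phi> u"
    and R: "1 \<le> R"
  shows "((\<lambda>\<tau>. LINT x|lborel. of_real (u \<tau> x) * cutexp X R \<xi> 0 x) has_vector_derivative
      (LINT x|lborel. of_real (u t x) * cutexp X R \<xi> 3 x) + of_real \<epsilon> * (LINT x|lborel. of_real (u t x) * cutexp X R \<xi> 5 x)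
        + (LINT x|lborel. of_real ((u t x)\<^sup>2) * (cutexp X R \<xi> 1 x / 2))) (at t)"
    and "integrable lborel (\<lambda>x. of_real ((u t x)\<^sup>2) * (cutexp X R \<xi> 1 x / 2))"
proof -
  have E: "cutexp X R \<xi> m \<in> L2" "\<exists>C\<ge>0. \<forall>x. cmod (cutexp X R \<xi> m x) \<le> C" for m
    by (rule cutexp_L2[OF R])+
  have E0: "cutexp X R \<xi> m x = 0" if "R < \<bar>x\<bar>" for m x
    by (rule cutexp_L2(2)[OF R that])
  note u = solution_facts[OF sol]
  have i: "integrable lborel (\<lambda>x. of_real (u t x) * cutexp X R \<xi> m x)" for t m
    by (rule L2_mult(1)[OF u(3) E(1)])
  show i2: "integrable lborel (\<lambda>x. of_real ((u t x)\<^sup>2) * (cutexp X R \<xi> 1 x / 2))" for t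
  proof -
    obtain C where C: "0 \<le> C" "\<And>x. cmod (cutexp X R \<xi> 1 x) \<le> C" using E(2) by blast
    have [measurable]: "u t \<in> borel_measurable borel" "cutexp X R \<xi> 1 \<in> borel_measurable borel"
      by (rule u, rule L2_measurable[OF E(1)])
    have iu: "integrable lborel (\<lambda>x. of_real (C / 2) * complex_of_real ((u t x)\<^sup>2))" by (intro integrable_mult_right u(5))
    show ?thesis
    proof (rule Bochner_Integration.integrable_bound[OF iu])
      show "AE x in lborel. cmod (of_real ((u t x)\<^sup>2) * (cutexp X R \<xi> 1 x / 2)) \<le> cmod (of_real (C / 2) * complex_of_real ((u t x)\<^sup>2))"
        using C by (auto simp: norm_mult norm_divide norm_power mult.commute[of C] intro!: AE_I2 mult_left_mono)
    qed measurable
  qed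
  have supp: "bounded {x. f (cutexp X R \<xi> 0 x) \<noteq> (0 :: real)}" if "f 0 = 0" for f
  proof (rule bounded_subset[OF bounded_closed_interval[of "-R" R]], rule subsetI)
    fix x assume x: "x \<in> {x. f (cutexp X R \<xi> 0 x) \<noteq> 0}"
    have "\<not> R < \<bar>x\<bar>"
    proof
      assume "R < \<bar>x\<bar>"
      with x E0[OF this, of 0] that show False by simp
    qed
    then show "x \<in> {-R..R}" by (auto simp: abs_le_iff not_less)
  qed
  have part: "((\<lambda>\<tau>. LINT x|lborel. u \<tau> x * g 0 x) has_real_derivative
      (LINT x|lborel. u t x * g 3 x + \<epsilon> * (u t x * g 5 x) + (u t x)\<^sup>2 / 2 * g 1 x)) (at t)"
    if "derivs g" "bounded {x. g 0 x \<noteq> 0}" for g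
  proof -
    have "test_function (g 0)" by (rule derivs_test_function[OF that])
    moreover have "deriv (g 0) = g 1" using derivs_deriv[OF that(1), of 1] by simp
    ultimately show ?thesis
      using sol unfolding kawahara_solution_def by (auto simp only: derivs_deriv[OF that(1)])
  qed
  note d = cutexp_derivs[of R \<xi>]
  have re: "(LINT x|lborel. Re (f x)) = Re (LINT x|lborel. f x)" "(LINT x|lborel. Im (f x)) = Im (LINT x|lborel. f x)"
    if "integrable lborel f" for f :: "real \<Rightarrow> complex" using that by auto
  define G where "G x = of_real (u t x) * cutexp X R \<xi> 3 x + of_real \<epsilon> * (of_real (u t x) * cutexp X R \<xi> 5 x)
    + of_real ((u t x)\<^sup>2) * (cutexp X R \<xi> 1 x / 2)" for x
  have G: "integrable lborel G" unfolding G_def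
    by (intro Bochner_Integration.integrable_add integrable_mult_right i i2)
  have "((\<lambda>\<tau>. LINT x|lborel. of_real (u \<tau> x) * cutexp X R \<xi> 0 x) has_vector_derivative (LINT x|lborel. G x)) (at t)"
    unfolding has_vector_derivative_complex_iff
  proof
    have "bounded {x. Re (cutexp X R \<xi> 0 x) \<noteq> 0}" "bounded {x. Im (cutexp X R \<xi> 0 x) \<noteq> 0}"
      by (rule supp, simp)+
    note p = part[OF d(1) this(1)] part[OF d(2) this(2)]
    have g: "Re (LINT x|lborel. of_real (u \<tau> x) * cutexp X R \<xi> 0 x) = (LINT x|lborel. u \<tau> x * Re (cutexp X R \<xi> 0 x))"
      "Im (LINT x|lborel. of_real (u \<tau> x) * cutexp X R \<xi> 0 x) = (LINT x|lborel. u \<tau> x * Im (cutexp X R \<xi> 0 x))" for \<tau>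
      unfolding re[OF i, symmetric] by simp_all
    have G': "Re (LINT x|lborel. G x) = (LINT x|lborel. u t x * Re (cutexp X R \<xi> 3 x) + \<epsilon> * (u t x * Re (cutexp X R \<xi> 5 x)) + (u t x)\<^sup>2 / 2 * Re (cutexp X R \<xi> 1 x))"
      "Im (LINT x|lborel. G x) = (LINT x|lborel. u t x * Im (cutexp X R \<xi> 3 x) + \<epsilon> * (u t x * Im (cutexp X R \<xi> 5 x)) + (u t x)\<^sup>2 / 2 * Im (cutexp X R \<xi> 1 x))"
      unfolding re[OF G, symmetric] by (rule Bochner_Integration.integral_cong; simp add: G_def del: of_real_power)+
    show "((\<lambda>\<tau>. Re (LINT x|lborel. of_real (u \<tau> x) * cutexp X R \<xi> 0 x)) has_real_derivative Re (LINT x|lborel. G x)) (at t)"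
      unfolding g G' by (rule p(1))
    show "((\<lambda>\<tau>. Im (LINT x|lborel. of_real (u \<tau> x) * cutexp X R \<xi> 0 x)) has_real_derivative Im (LINT x|lborel. G x)) (at t)"
      unfolding g G' by (rule p(2))
  qed
  also have "(LINT x|lborel. G x) = (LINT x|lborel. of_real (u t x) * cutexp X R \<xi> 3 x) + of_real \<epsilon> * (LINT x|lborel. of_real (u t x) * cutexp X R \<xi> 5 x)
        + (LINT x|lborel. of_real ((u t x)\<^sup>2) * (cutexp X R \<xi> 1 x / 2))"
    unfolding G_def
    by (subst Bochner_Integration.integral_add | intro Bochner_Integration.integrable_add integrable_mult_right i i2
      | subst integral_mult_right_zero | rule refl)+
  finally show "((\<lambda>\<tau>. LINT x|lborel. of_real (u \<tau> x) * cutexp X R \<xi> 0 x) has_vector_derivative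
      (LINT x|lborel. of_real (u t x) * cutexp X R \<xi> 3 x) + of_real \<epsilon> * (LINT x|lborel. of_real (u t x) * cutexp X R \<xi> 5 x)
        + (LINT x|lborel. of_real ((u t x)\<^sup>2) * (cutexp X R \<xi> 1 x / 2))) (at t)" .
qed

text \<open>The transform of -(u^2/2)_x without the factor 1/sqrt(2\<pi>), pulled back by the linear
  evolution; it is the expected time derivative of the unnormalised profile.\<close>

definition burgers :: "real \<Rightarrow> (real \<Rightarrow> real \<Rightarrow> real) \<Rightarrow> real \<Rightarrow> real \<Rightarrow> complex" where
  "burgers \<epsilon> u \<xi> \<tau> = cis (- (\<tau> * phase \<epsilon> \<xi>)) * (- \<i> * of_real \<xi> / 2 * (LINT x|lborel. of_real ((u \<tau> x)\<^sup>2) * cis (- (\<xi> * x))))"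

definition cutoff_transform :: "(nat \<Rightarrow> real \<Rightarrow> real) \<Rightarrow> (real \<Rightarrow> real \<Rightarrow> real) \<Rightarrow> nat \<Rightarrow> real \<Rightarrow> real \<Rightarrow> complex" where
  "cutoff_transform X u n t \<xi> = (LINT x|lborel. of_real (u t x) * cutexp X (real (Suc n)) \<xi> 0 x)"

text \<open>A transform of an L^2 function has no value at a given frequency, but the increments in
  time of the cut-off transforms converge at every frequency, because their time derivatives do so
  boundedly on compact time intervals.\<close>

lemma (in bump) solution_limit:
  assumes sol: "kawahara_solution \<epsilon> \<phi> u"
    and P: "\<And>\<tau>. (P has_vector_derivative burgers \<epsilon> u \<xi> \<tau>) (at \<tau>)"
  shows "(\<lambda>n. cis (- (t * phase \<epsilon> \<xi>)) * cutoff_transform X u n t \<xi> - cutoff_transform X u n 0 \<xi>) \<longlonglongrightarrow> P t - P 0"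
proof -
  note uf = solution_facts[OF sol]
  define E where "E n m = cutexp X (real (Suc n)) \<xi> m" for n m
  have EL: "E n m \<in> L2" for n m
    unfolding E_def by (rule cutexp_L2(1)) simp
  define r where "r n m = (\<lambda>x. E n m x - (- \<i> * of_real \<xi>) ^ m * E n 0 x)" for n m
  have rL: "r n m \<in> L2" for n m unfolding r_def by (intro L2_diff(1) L2_cmult(1) EL)
  have r0: "(\<lambda>n. L2_norm (r n m)) \<longlonglongrightarrow> 0" for m
    unfolding r_def E_def by (rule cutexp_tail)
  have "Bseq (\<lambda>n. L2_norm (r n m))" for m using r0 by (auto intro: convergent_imp_Bseq convergentI)
  then obtain B where B: "L2_norm (r n m) \<le> B m" for n m
    unfolding Bseq_def by (metis abs_le_D1 real_norm_def)
  obtain C where C: "0 \<le> C" "\<And>n x. cmod (E n 1 x) \<le> C"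
    unfolding E_def using cutexp_bounded[of \<xi> 1] by (metis of_nat_le_iff of_nat_1 le_add1 plus_1_eq_Suc)
  define W where "W t = L2_norm (cor (u t))" for t
  define J where "J n \<tau> = (LINT x|lborel. of_real ((u \<tau> x)\<^sup>2) * (E n 1 x / 2))" for n \<tau>
  define p where "p = phase \<epsilon> \<xi>"
  define d where "d n \<tau> = cis (- (\<tau> * p)) * ((LINT x|lborel. of_real (u \<tau> x) * r n 3 x) + of_real \<epsilon> * (LINT x|lborel. of_real (u \<tau> x) * r n 5 x) + J n \<tau>)" for n \<tau>
  have iE: "integrable lborel (\<lambda>x. of_real (u \<tau> x) * E n m x)" for n m \<tau>
    by (rule L2_mult(1)[OF uf(3) EL])
  have split: "(LINT x|lborel. of_real (u \<tau> x) * E n m x) = (LINT x|lborel. of_real (u \<tau> x) * r n m x) + (- \<i> * of_real \<xi>) ^ m * cutoff_transform X u n \<tau> \<xi>" for n m \<tau>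
  proof -
    have "(LINT x|lborel. of_real (u \<tau> x) * r n m x) = (LINT x|lborel. of_real (u \<tau> x) * E n m x - (- \<i> * of_real \<xi>) ^ m * (of_real (u \<tau> x) * E n 0 x))"
      by (intro Bochner_Integration.integral_cong) (simp_all add: r_def algebra_simps)
    also have "\<dots> = (LINT x|lborel. of_real (u \<tau> x) * E n m x) - (- \<i> * of_real \<xi>) ^ m * (LINT x|lborel. of_real (u \<tau> x) * E n 0 x)"
      by (subst Bochner_Integration.integral_diff) (intro iE integrable_mult_right, intro iE integrable_mult_right, simp only: integral_mult_right_zero)
    finally show ?thesis by (simp add: cutoff_transform_def E_def)
  qed
  \<comment> \<open>The third and fifth derivatives of the exponential reproduce i times the
    dispersion relation.\<close>
  have symb: "(- \<i> * of_real \<xi>) ^ 3 + of_real \<epsilon> * (- \<i> * of_real \<xi>) ^ 5 = \<i> * of_real p"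
    by (simp add: p_def phase_def power_mult_distrib power3_eq_cube power_numeral_odd power_numeral_even algebra_simps)
  \<comment> \<open>The integrating factor cancels that contribution; what remains is the nonlinear
    term and the remainders \<open>r\<close>, which vanish in L^2.\<close>
  have V: "((\<lambda>\<tau>. cis (- (\<tau> * p)) * cutoff_transform X u n \<tau> \<xi>) has_vector_derivative d n \<tau>) (at \<tau>)" for n \<tau>
  proof -
    have 1: "((\<lambda>\<tau>. cutoff_transform X u n \<tau> \<xi>) has_vector_derivative
        (LINT x|lborel. of_real (u \<tau> x) * E n 3 x) + of_real \<epsilon> * (LINT x|lborel. of_real (u \<tau> x) * E n 5 x) + J n \<tau>) (at \<tau>)"
      unfolding cutoff_transform_def J_def E_def by (rule cutexp_derivative(1)[OF sol]) simp
    have 2: "((\<lambda>\<tau>. cis (- (\<tau> * p))) has_vector_derivative - \<i> * of_real p * cis (- (\<tau> * p))) (at \<tau>)"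
      unfolding has_vector_derivative_complex_iff by (auto intro!: derivative_eq_intros)
    have "(LINT x|lborel. of_real (u \<tau> x) * E n 3 x) + of_real \<epsilon> * (LINT x|lborel. of_real (u \<tau> x) * E n 5 x) + J n \<tau> =
      (LINT x|lborel. of_real (u \<tau> x) * r n 3 x) + of_real \<epsilon> * (LINT x|lborel. of_real (u \<tau> x) * r n 5 x) + J n \<tau> + \<i> * of_real p * cutoff_transform X u n \<tau> \<xi>"
      unfolding split symb[symmetric] by (simp only: algebra_simps)
    then have "cis (- (\<tau> * p)) * ((LINT x|lborel. of_real (u \<tau> x) * E n 3 x) + of_real \<epsilon> * (LINT x|lborel. of_real (u \<tau> x) * E n 5 x) + J n \<tau>)
        + (- \<i> * of_real p * cis (- (\<tau> * p))) * cutoff_transform X u n \<tau> \<xi> = d n \<tau>"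
      by (simp only: d_def) (simp add: algebra_simps)
    with has_vector_derivative_mult[OF 2 1] show ?thesis by (simp add: add.commute)
  qed
  have rb: "cmod (LINT x|lborel. of_real (u \<tau> x) * r n m x) \<le> W \<tau> * L2_norm (r n m)" for n m \<tau>
    unfolding W_def by (rule L2_mult(2)[OF uf(3) rL])
  have Jb: "cmod (J n \<tau>) \<le> C / 2 * (W \<tau>)\<^sup>2" for n \<tau>
  proof -
    have i: "integrable lborel (\<lambda>x. of_real ((u \<tau> x)\<^sup>2) * (E n 1 x / 2))"
      unfolding E_def by (rule cutexp_derivative(2)[OF sol]) simp
    have "cmod (J n \<tau>) \<le> (LINT x|lborel. cmod (of_real ((u \<tau> x)\<^sup>2) * (E n 1 x / 2)))"
      unfolding J_def by (rule integral_norm_bound)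
    also have "\<dots> \<le> (LINT x|lborel. C / 2 * (cmod (of_real (u \<tau> x)))\<^sup>2)"
    proof (rule integral_mono[OF integrable_norm[OF i]])
      show "integrable lborel (\<lambda>x. C / 2 * (cmod (of_real (u \<tau> x)))\<^sup>2)"
        using uf(3)[of \<tau>] by (intro integrable_mult_right) (simp add: L2_def)
      show "cmod (of_real ((u \<tau> x)\<^sup>2) * (E n 1 x / 2)) \<le> C / 2 * (cmod (of_real (u \<tau> x)))\<^sup>2" for x
        using mult_left_mono[OF C(2)[of n x], of "(u \<tau> x)\<^sup>2 / 2"] by (simp add: norm_mult norm_divide norm_power mult_ac)
    qed
    also have "\<dots> = C / 2 * (W \<tau>)\<^sup>2" unfolding W_def L2_norm_power2 by (rule integral_mult_right_zero)
    finally show ?thesis .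
  qed
  have lim: "(\<lambda>n. d n \<tau>) \<longlonglongrightarrow> burgers \<epsilon> u \<xi> \<tau>" for \<tau>
  proof -
    have z: "(\<lambda>n. LINT x|lborel. of_real (u \<tau> x) * r n m x) \<longlonglongrightarrow> 0" for m
      by (rule Lim_null_comparison[OF always_eventually tendsto_mult_right_zero[OF r0[of m], of "W \<tau>"]]) (use rb in auto)
    have [measurable]: "u \<tau> \<in> borel_measurable borel" by (rule uf(6))
    have "(\<lambda>n. J n \<tau>) \<longlonglongrightarrow> (LINT x|lborel. of_real ((u \<tau> x)\<^sup>2) * ((- \<i> * of_real \<xi>) ^ 1 * cis (- (\<xi> * x)) / 2))"
      unfolding J_def
    proof (rule Bochner_Integration.integral_dominated_convergence[where w = "\<lambda>x. C / 2 * (u \<tau> x)\<^sup>2"])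
      have [measurable]: "E n 1 \<in> borel_measurable borel" for n by (rule L2_measurable[OF EL])
      show "(\<lambda>x. of_real ((u \<tau> x)\<^sup>2) * (E n 1 x / 2)) \<in> borel_measurable lborel" for n by measurable
      show "(\<lambda>x. of_real ((u \<tau> x)\<^sup>2) * ((- \<i> * of_real \<xi>) ^ 1 * cis (- (\<xi> * x)) / 2)) \<in> borel_measurable lborel" by measurable
      show "integrable lborel (\<lambda>x. C / 2 * (u \<tau> x)\<^sup>2)"
        using uf(3)[of \<tau>] by (intro integrable_mult_right) (simp add: L2_def)
      show "AE x in lborel. (\<lambda>n. of_real ((u \<tau> x)\<^sup>2) * (E n 1 x / 2)) \<longlonglongrightarrow> of_real ((u \<tau> x)\<^sup>2) * ((- \<i> * of_real \<xi>) ^ 1 * cis (- (\<xi> * x)) / 2)"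
      proof (intro AE_I2 tendsto_mult tendsto_const)
        fix x
        have "(\<lambda>n. E n 1 x) \<longlonglongrightarrow> (- \<i> * of_real \<xi>) ^ 1 * cis (- (\<xi> * x))"
          unfolding E_def by (rule cutexp_limit)
        from tendsto_divide[OF this tendsto_const, of 2]
        show "(\<lambda>n. E n 1 x / 2) \<longlonglongrightarrow> (- \<i> * of_real \<xi>) ^ 1 * cis (- (\<xi> * x)) / 2" by simp
      qed
      show "AE x in lborel. cmod (of_real ((u \<tau> x)\<^sup>2) * (E n 1 x / 2)) \<le> C / 2 * (u \<tau> x)\<^sup>2" for n
      proof (rule AE_I2)
        fix x show "cmod (of_real ((u \<tau> x)\<^sup>2) * (E n 1 x / 2)) \<le> C / 2 * (u \<tau> x)\<^sup>2"
          using mult_left_mono[OF C(2)[of n x], of "(u \<tau> x)\<^sup>2 / 2"] by (simp add: norm_mult norm_divide norm_power mult_ac)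
      qed
    qed
    also have "(LINT x|lborel. of_real ((u \<tau> x)\<^sup>2) * ((- \<i> * of_real \<xi>) ^ 1 * cis (- (\<xi> * x)) / 2))
        = (LINT x|lborel. - \<i> * of_real \<xi> / 2 * (of_real ((u \<tau> x)\<^sup>2) * cis (- (\<xi> * x))))"
      by (intro Bochner_Integration.integral_cong) (simp_all add: mult_ac)
    also have "\<dots> = - \<i> * of_real \<xi> / 2 * (LINT x|lborel. of_real ((u \<tau> x)\<^sup>2) * cis (- (\<xi> * x)))"
      by (rule integral_mult_right_zero)
    finally have J: "(\<lambda>n. J n \<tau>) \<longlonglongrightarrow> - \<i> * of_real \<xi> / 2 * (LINT x|lborel. of_real ((u \<tau> x)\<^sup>2) * cis (- (\<xi> * x)))" .
    have "(\<lambda>n. d n \<tau>) \<longlonglongrightarrow> cis (- (\<tau> * p)) * (0 + of_real \<epsilon> * 0 + - \<i> * of_real \<xi> / 2 * (LINT x|lborel. of_real ((u \<tau> x)\<^sup>2) * cis (- (\<xi> * x))))"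
      unfolding d_def by (intro tendsto_intros z J)
    then show ?thesis by (simp only: burgers_def p_def add_0_left mult_zero_right)
  qed
  \<comment> \<open>Continuity in H^1 bounds the L^2 norm of the solution on compact time intervals,
    which gives the domination.\<close>
  have bdd: "\<exists>M. \<forall>n. \<forall>\<tau>\<in>{a..b}. cmod (d n \<tau>) \<le> M" for a b
  proof -
    have "bounded ((\<lambda>t. Hs_norm 1 (u t)) ` {a..b})"
      by (intro compact_imp_bounded compact_continuous_image continuous_on_subset[OF C_Hs_norm_continuous[OF uf(1)]]) auto
    then obtain K where "\<forall>t\<in>{a..b}. \<bar>Hs_norm 1 (u t)\<bar> \<le> K" by (auto simp: bounded_iff)
    then have K: "W t \<le> K" if "t \<in> {a..b}" for t
      using L2_norm_le_Hs_norm[OF uf(2), of t] that by (force simp: W_def)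
    have W0: "0 \<le> W t" for t by (simp add: W_def)
    have "cmod (d n \<tau>) \<le> K * B 3 + \<bar>\<epsilon>\<bar> * (K * B 5) + C / 2 * K\<^sup>2" if t: "\<tau> \<in> {a..b}" for n \<tau>
    proof -
      have K0: "0 \<le> K" using K[OF t] W0[of \<tau>] by linarith
      have rK: "cmod (LINT x|lborel. of_real (u \<tau> x) * r n m x) \<le> K * B m" for m
        by (rule order_trans[OF rb mult_mono[OF K[OF t] B K0 L2_norm_nonneg]])
      have "C / 2 * (W \<tau>)\<^sup>2 \<le> C / 2 * K\<^sup>2" using C(1) K[OF t] W0[of \<tau>] by (intro mult_left_mono power_mono) auto
      then have JK: "cmod (J n \<tau>) \<le> C / 2 * K\<^sup>2" using Jb[of n \<tau>] by linarith
      have "cmod (of_real \<epsilon> * (LINT x|lborel. of_real (u \<tau> x) * r n 5 x)) \<le> \<bar>\<epsilon>\<bar> * (K * B 5)"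
        unfolding norm_mult norm_of_real by (intro mult_left_mono rK) simp
      then show ?thesis
        unfolding d_def norm_mult[of "cis (- (\<tau> * p))"] norm_cis mult_1 by (intro norm_triangle_mono rK JK)
    qed
    then show ?thesis by blast
  qed
  show ?thesis
    using limit_of_antiderivatives[OF V P lim bdd, of t 0] by (simp add: p_def)
qed

text \<open>Identifies a limit in L^2 with a limit at every point; Fatou bounds the norm of the
  difference by every positive number.\<close>

lemma L2_limit_AE:
  fixes a :: "nat \<Rightarrow> real \<Rightarrow> complex"
  assumes a: "\<And>n. a n \<in> L2" and l: "l \<in> L2" and b: "\<And>x. (\<lambda>n. a n x) \<longlonglongrightarrow> b x"
    and n: "(\<lambda>n. L2_norm (\<lambda>x. a n x - l x)) \<longlonglongrightarrow> 0"
  shows "AE x in lborel. l x = b x"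
proof -
  note [measurable] = L2_measurable[OF a] L2_measurable[OF l]
  have [measurable]: "b \<in> borel_measurable borel" by (rule borel_measurable_LIMSEQ_metric[OF _ b]) measurable
  have "(\<lambda>x. b x - l x) \<in> L2 \<and> L2_norm (\<lambda>x. b x - l x) \<le> e" if "0 < e" for e
  proof -
    have "eventually (\<lambda>n. L2_norm (\<lambda>x. a n x - l x) \<le> e) sequentially"
      using order_tendstoD(2)[OF n that] by eventually_elim simp
    moreover have "AE x in lborel. (\<lambda>n. a n x - l x) \<longlonglongrightarrow> b x - l x" by (intro AE_I2 tendsto_intros b)
    ultimately show ?thesis
      using L2_fatou[where a = "\<lambda>n x. a n x - l x" and b = "\<lambda>x. b x - l x" and e = e] L2_diff(1)[OF a l] that by simp
  qed
  then have "(\<lambda>x. b x - l x) \<in> L2" "L2_norm (\<lambda>x. b x - l x) \<le> 0"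
    by (auto intro: zero_less_one field_le_epsilon)
  then have "AE x in lborel. b x - l x = 0" by (intro L2_norm_eq_0 antisym) simp_all
  then show ?thesis by eventually_elim simp
qed

text \<open>Parseval for f against its modulation, whose transform is the translate by \<xi>. The
  symmetry of g converts the correlation into a convolution at every \<xi>.\<close>

lemma autoconvolution:
  assumes f: "L2_fourier (cor f) g" and sym: "\<And>\<eta>. g (- \<eta>) = cnj (g \<eta>)"
  shows "(LINT \<eta>|lborel. g \<eta> * g (\<xi> - \<eta>)) = (LINT x|lborel. of_real ((f x)\<^sup>2) * cis (- (\<xi> * x)))"
proof -
  have "(LINT \<eta>|lborel. g \<eta> * cnj (g (\<eta> - \<xi>))) = (LINT x|lborel. of_real (f x) * cnj (cis (\<xi> * x) * of_real (f x)))"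
    by (rule parseval[OF f L2_fourier_modulate[OF f]])
  moreover have "cnj (g (\<eta> - \<xi>)) = g (\<xi> - \<eta>)" for \<eta> using sym[of "\<eta> - \<xi>"] by simp
  moreover have "of_real (f x) * cnj (cis (\<xi> * x) * of_real (f x)) = of_real ((f x)\<^sup>2) * cis (- (\<xi> * x))" for x
    by (simp add: cis_cnj power2_eq_square)
  ultimately show ?thesis by (simp only:)
qed

lemma continuous_burgers:
  assumes sol: "kawahara_solution \<epsilon> \<phi> u"
  shows "continuous_on UNIV (burgers \<epsilon> u \<xi>)"
proof -
  note uf = solution_facts[OF sol]
  define Q where "Q \<tau> = (LINT x|lborel. of_real ((u \<tau> x)\<^sup>2) * cis (- (\<xi> * x)))" for \<tau>
  have "isCont Q t" for t
    unfolding continuous_at_sequentially o_def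
  proof (intro allI impI)
    fix Z :: "nat \<Rightarrow> real" assume Z: "Z \<longlonglongrightarrow> t"
    have e: "Q \<tau> = (LINT x|lborel. of_real (u \<tau> x) * (cis (- (\<xi> * x)) * of_real (u \<tau> x)))" for \<tau>
      unfolding Q_def by (intro Bochner_Integration.integral_cong) (simp_all add: power2_eq_square mult_ac)
    have [measurable]: "u \<tau> \<in> borel_measurable borel" for \<tau> by (rule uf(6))
    have cL: "(\<lambda>x. cis (- (\<xi> * x)) * of_real (u \<tau> x)) \<in> L2" for \<tau>
      using uf(3)[of \<tau>] by (simp add: L2_def norm_mult)
    have "L2_norm (\<lambda>x. cis (- (\<xi> * x)) * of_real (u \<tau> x) - cis (- (\<xi> * x)) * of_real (u \<sigma> x)) = L2_norm (\<lambda>x. of_real (u \<tau> x) - of_real (u \<sigma> x))" for \<tau> \<sigma>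
      unfolding right_diff_distrib[symmetric] L2_norm_def norm_mult by simp
    then show "(\<lambda>n. Q (Z n)) \<longlonglongrightarrow> Q t"
      unfolding e using C_Hs_tendsto_L2[OF uf(1) Z]
      by (intro L2_tendsto_mult uf(3) cL) simp_all
  qed
  then have Q: "continuous_on UNIV Q" by (simp add: continuous_at_imp_continuous_on)
  have "continuous_on UNIV (\<lambda>\<tau>. cis (- (\<tau> * phase \<epsilon> \<xi>)) * (- \<i> * of_real \<xi> / 2 * Q \<tau>))"
    by (intro continuous_intros Q)
  then show ?thesis by (simp add: burgers_def[abs_def] Q_def)
qed

lemma measurable_burgers:
  assumes sol: "kawahara_solution \<epsilon> \<phi> u"
  shows "(\<lambda>\<xi>. burgers \<epsilon> u \<xi> \<tau>) \<in> borel_measurable borel"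
proof -
  note uf = solution_facts[OF sol]
  have [measurable]: "u \<tau> \<in> borel_measurable borel" by (rule uf(6))
  have "(LINT x|lborel. of_real ((u \<tau> x)\<^sup>2) * cis (- (\<xi> * x))) = of_real (sqrt (2 * pi)) * fhat (\<lambda>x. of_real ((u \<tau> x)\<^sup>2)) \<xi>" for \<xi>
    by (simp add: fhat_def mult.commute)
  then show ?thesis unfolding burgers_def by simp
qed

definition cutoff :: "(nat \<Rightarrow> real \<Rightarrow> real) \<Rightarrow> (real \<Rightarrow> real \<Rightarrow> real) \<Rightarrow> nat \<Rightarrow> real \<Rightarrow> real \<Rightarrow> complex" where
  "cutoff X u n t x = of_real (u t x) * of_real (X 0 (x / real (Suc n)))"

lemma (in bump) cutoff_facts:
  assumes sol: "kawahara_solution \<epsilon> \<phi> u"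
  shows "cutoff X u n t \<in> L2" "integrable lborel (cutoff X u n t)"
    "(\<lambda>n. L2_norm (\<lambda>x. cutoff X u n t x - of_real (u t x))) \<longlonglongrightarrow> 0"
    "cutoff_transform X u n t \<xi> = of_real (sqrt (2 * pi)) * fhat (cutoff X u n t) \<xi>"
proof -
  note uf = solution_facts[OF sol]
  have ce: "cutoff X u n t = (\<lambda>x. of_real (u t x) * cutexp X (real (Suc n)) 0 0 x)" for n
    by (simp add: cutoff_def cutexp_0 fun_eq_iff)
  have [measurable]: "u t \<in> borel_measurable borel" by (rule uf(6))
  have "continuous_on UNIV (X 0)"
    using smooth by (auto simp: derivs_def intro!: continuous_at_imp_continuous_on DERIV_isCont)
  then have [measurable]: "X 0 \<in> borel_measurable borel" by (rule borel_measurable_continuous_onI)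
  have m: "cutoff X u n t \<in> borel_measurable borel" for n unfolding cutoff_def by measurable
  note [measurable] = m
  obtain B where B: "\<And>x. \<bar>X 0 x\<bar> \<le> B" using bdd by blast
  have iu: "integrable lborel (\<lambda>x. c * (u t x)\<^sup>2)" for c :: real
    using uf(3)[of t] by (intro integrable_mult_right) (simp add: L2_def)
  have "integrable lborel (\<lambda>x. (cmod (cutoff X u n t x))\<^sup>2)"
  proof (rule Bochner_Integration.integrable_bound[OF iu[of "B\<^sup>2"]])
    show "AE x in lborel. norm ((cmod (cutoff X u n t x))\<^sup>2) \<le> norm (B\<^sup>2 * (u t x)\<^sup>2)"
    proof (rule AE_I2)
      fix x
      have "(X 0 (x / real (Suc n)))\<^sup>2 \<le> B\<^sup>2" using B[of "x / real (Suc n)"] by (rule abs_le_square_iff[THEN iffD1, OF order_trans]) simp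
      then show "norm ((cmod (cutoff X u n t x))\<^sup>2) \<le> norm (B\<^sup>2 * (u t x)\<^sup>2)"
        by (simp add: cutoff_def norm_mult power_mult_distrib mult_right_mono mult.commute[of "(u t x)\<^sup>2"])
    qed
  qed measurable
  then show "cutoff X u n t \<in> L2" by (simp add: L2_def)
  have "cutexp X (real (Suc n)) 0 0 \<in> L2" by (rule cutexp_L2(1)) simp
  then show "integrable lborel (cutoff X u n t)" unfolding ce by (rule L2_mult(1)[OF uf(3)])
  show "cutoff_transform X u n t \<xi> = of_real (sqrt (2 * pi)) * fhat (cutoff X u n t) \<xi>"
    by (simp add: cutoff_transform_def fhat_def cutoff_def cutexp_0 mult_ac)
  show "(\<lambda>n. L2_norm (\<lambda>x. cutoff X u n t x - of_real (u t x))) \<longlonglongrightarrow> 0"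
  proof (rule L2_dominated[where w = "\<lambda>x. (B + 1)\<^sup>2 * (u t x)\<^sup>2"])
    show "AE x in lborel. (\<lambda>n. cutoff X u n t x) \<longlonglongrightarrow> of_real (u t x)"
    proof (rule AE_I2)
      fix x
      have "(\<lambda>n. cutexp X (real (Suc n)) 0 0 x) \<longlonglongrightarrow> 1" using cutexp_limit[of 0 0 x] by simp
      from tendsto_mult[OF tendsto_const this] show "(\<lambda>n. cutoff X u n t x) \<longlonglongrightarrow> of_real (u t x)" by (simp add: ce)
    qed
    show "AE x in lborel. (cmod (cutoff X u n t x - of_real (u t x)))\<^sup>2 \<le> (B + 1)\<^sup>2 * (u t x)\<^sup>2" for n
    proof (rule AE_I2)
      fix x
      have e: "cutoff X u n t x - of_real (u t x) = of_real (u t x * (X 0 (x / real (Suc n)) - 1))"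
        by (simp add: cutoff_def algebra_simps)
      have "\<bar>X 0 (x / real (Suc n)) - 1\<bar> \<le> B + 1" using B[of "x / real (Suc n)"] by linarith
      then have "\<bar>X 0 (x / real (Suc n)) - 1\<bar>\<^sup>2 \<le> (B + 1)\<^sup>2" by (intro power_mono) auto
      then have "(u t x)\<^sup>2 * (X 0 (x / real (Suc n)) - 1)\<^sup>2 \<le> (u t x)\<^sup>2 * (B + 1)\<^sup>2" by (intro mult_left_mono) auto
      then show "(cmod (cutoff X u n t x - of_real (u t x)))\<^sup>2 \<le> (B + 1)\<^sup>2 * (u t x)\<^sup>2"
        unfolding e norm_of_real power2_abs power_mult_distrib by (simp only: mult.commute)
    qed
    show "integrable lborel (\<lambda>x. (B + 1)\<^sup>2 * (u t x)\<^sup>2)" by (rule iu)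
  qed auto
qed

text \<open>The transforms are determined only up to null sets that depend on t. The profile is
  therefore built as an initial value plus an antiderivative in time taken at each frequency, and
  only afterwards identified almost everywhere with the transform of the solution.\<close>

theorem kawahara_profile:
  assumes sol: "kawahara_solution \<epsilon> \<phi> u"
  obtains F where "profile \<epsilon> F" "\<And>t. L2_fourier (cor (u t)) (\<lambda>\<xi>. cis (t * phase \<epsilon> \<xi>) * F t \<xi>)"
proof -
  note uf = solution_facts[OF sol]
  obtain X where "bump X" by (rule smooth_bump)
  then interpret bump X .
  define c where "c = sqrt (2 * pi)"
  have c: "0 < c" by (simp add: c_def)
  have "\<exists>P. P 0 = 0 \<and> (\<forall>t. (P has_vector_derivative burgers \<epsilon> u \<xi> t) (at t))" for \<xi>
    using antiderivative[OF continuous_burgers[OF sol, of \<xi>]] by metis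
  then obtain P where P0: "P \<xi> 0 = 0" and P: "(P \<xi> has_vector_derivative burgers \<epsilon> u \<xi> t) (at t)" for \<xi> t
    by metis
  have "\<exists>G. L2_fourier (cor (u t)) G" for t using L2_fourier_exists[OF uf(3)] by metis
  then obtain G where G: "L2_fourier (cor (u t)) (G t)" for t by metis
  note Gm[measurable] = L2_measurable[OF L2_fourierD(2)[OF G]]
  note cf = cutoff_facts[OF sol, folded c_def]
  define Y where "Y n t \<xi> = cis (- (t * phase \<epsilon> \<xi>)) * fhat (cutoff X u n t) \<xi>" for n t \<xi>
  have fL: "L2_fourier (cutoff X u n t) (fhat (cutoff X u n t))" for n t by (rule L2_fourier_integrable[OF cf(1,2)])
  have cisL: "(\<lambda>\<xi>. cis (- (t * phase \<epsilon> \<xi>)) * g \<xi>) \<in> L2" "L2_norm (\<lambda>\<xi>. cis (- (t * phase \<epsilon> \<xi>)) * g \<xi>) = L2_norm g" if "g \<in> L2" for g t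
  proof -
    have [measurable]: "g \<in> borel_measurable borel" by (rule L2_measurable[OF that])
    show "(\<lambda>\<xi>. cis (- (t * phase \<epsilon> \<xi>)) * g \<xi>) \<in> L2" using that by (simp add: L2_def norm_mult)
  qed (simp add: L2_norm_def norm_mult)
  have YL: "Y n t \<in> L2" for n t unfolding Y_def by (rule cisL(1)[OF L2_fourierD(2)[OF fL]])
  have Yl: "(\<lambda>n. L2_norm (\<lambda>\<xi>. Y n t \<xi> - cis (- (t * phase \<epsilon> \<xi>)) * G t \<xi>)) \<longlonglongrightarrow> 0" for t
  proof -
    have "L2_norm (\<lambda>\<xi>. Y n t \<xi> - cis (- (t * phase \<epsilon> \<xi>)) * G t \<xi>) = L2_norm (\<lambda>x. cutoff X u n t x - of_real (u t x))" for n
    proof -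
      note d = L2_fourier_diff[OF fL[of n t] G[of t]]
      show ?thesis unfolding Y_def right_diff_distrib[symmetric] cisL(2)[OF L2_fourierD(2)[OF d]] by (rule plancherel[OF d])
    qed
    then show ?thesis using cf(3) by simp
  qed
  have lim: "(\<lambda>n. Y n t \<xi> - Y n 0 \<xi>) \<longlonglongrightarrow> P \<xi> t / of_real c" for t \<xi>
  proof -
    have "(\<lambda>n. cis (- (t * phase \<epsilon> \<xi>)) * cutoff_transform X u n t \<xi> - cutoff_transform X u n 0 \<xi>) \<longlonglongrightarrow> P \<xi> t - P \<xi> 0"
      by (rule solution_limit[OF sol P])
    from tendsto_divide[OF this tendsto_const, of "of_real c"]
    have "(\<lambda>n. (cis (- (t * phase \<epsilon> \<xi>)) * cutoff_transform X u n t \<xi> - cutoff_transform X u n 0 \<xi>) / of_real c) \<longlonglongrightarrow> P \<xi> t / of_real c"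
      using c by (simp add: P0)
    moreover have "(cis (- (t * phase \<epsilon> \<xi>)) * cutoff_transform X u n t \<xi> - cutoff_transform X u n 0 \<xi>) / of_real c = Y n t \<xi> - Y n 0 \<xi>" for n
      using c by (simp add: cf(4) Y_def field_simps)
    ultimately show ?thesis by simp
  qed
  \<comment> \<open>The antiderivatives were chosen frequency by frequency; their measurability in
    \<xi> comes from the limit.\<close>
  have Pm[measurable]: "(\<lambda>\<xi>. P \<xi> t / of_real c) \<in> borel_measurable borel" for t
    by (rule borel_measurable_LIMSEQ_metric[OF _ lim]) (use L2_measurable[OF L2_diff(1)[OF YL YL]] in simp)
  \<comment> \<open>The same increments converge in L^2 to those of the pulled back transforms, so
    the two limits agree almost everywhere.\<close>
  have Pae: "AE \<xi> in lborel. cis (- (t * phase \<epsilon> \<xi>)) * G t \<xi> - G 0 \<xi> = P \<xi> t / of_real c" for t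
  proof (rule L2_limit_AE[OF L2_diff(1)[OF YL YL] _ lim])
    show cL: "(\<lambda>\<xi>. cis (- (t * phase \<epsilon> \<xi>)) * G t \<xi> - G 0 \<xi>) \<in> L2"
      by (intro L2_diff(1) cisL(1) L2_fourierD(2)[OF G])
    have e: "Y n t \<xi> - Y n 0 \<xi> - (cis (- (t * phase \<epsilon> \<xi>)) * G t \<xi> - G 0 \<xi>)
        = (Y n t \<xi> - cis (- (t * phase \<epsilon> \<xi>)) * G t \<xi>) - (Y n 0 \<xi> - cis (- (0 * phase \<epsilon> \<xi>)) * G 0 \<xi>)" for n \<xi>
      by simp
    have YG: "(\<lambda>\<xi>. Y n t \<xi> - cis (- (t * phase \<epsilon> \<xi>)) * G t \<xi>) \<in> L2" for n t
      by (intro L2_diff(1) YL cisL(1) L2_fourierD(2)[OF G])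
    show "(\<lambda>n. L2_norm (\<lambda>\<xi>. Y n t \<xi> - Y n 0 \<xi> - (cis (- (t * phase \<epsilon> \<xi>)) * G t \<xi> - G 0 \<xi>))) \<longlonglongrightarrow> 0"
    proof (rule tendsto_sandwich[OF _ _ tendsto_const tendsto_add_zero[OF Yl[of t] Yl[of 0]]])
      show "\<forall>\<^sub>F n in sequentially. L2_norm (\<lambda>\<xi>. Y n t \<xi> - Y n 0 \<xi> - (cis (- (t * phase \<epsilon> \<xi>)) * G t \<xi> - G 0 \<xi>))
          \<le> L2_norm (\<lambda>\<xi>. Y n t \<xi> - cis (- (t * phase \<epsilon> \<xi>)) * G t \<xi>) + L2_norm (\<lambda>\<xi>. Y n 0 \<xi> - cis (- (0 * phase \<epsilon> \<xi>)) * G 0 \<xi>)"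
        unfolding e by (intro always_eventually allI L2_diff(2) YG)
    qed simp
  qed
  \<comment> \<open>The average with the reflected conjugate equals \<open>G 0\<close> almost
    everywhere and has the symmetry of a real function at every frequency.\<close>
  define F where "F t \<xi> = (G 0 \<xi> + cnj (G 0 (- \<xi>))) / 2 + P \<xi> t / of_real c" for t \<xi>
  have Fm[measurable]: "F t \<in> borel_measurable borel" for t unfolding F_def by measurable
  have FL: "L2_fourier (cor (u t)) (\<lambda>\<xi>. cis (t * phase \<epsilon> \<xi>) * F t \<xi>)" for t
  proof (rule L2_fourier_cong_right[OF G])
    show "AE \<xi> in lborel. G t \<xi> = cis (t * phase \<epsilon> \<xi>) * F t \<xi>"
      using Pae[of t] L2_fourier_real[OF G[of 0]]
    proof eventually_elim
      case (elim \<xi>)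
      have "F t \<xi> = cis (- (t * phase \<epsilon> \<xi>)) * G t \<xi>" using elim(2) by (simp add: F_def elim(1)[symmetric])
      then show ?case by (simp add: mult.assoc[symmetric] cis_mult)
    qed
  qed measurable
  have sym: "F t (- \<xi>) = cnj (F t \<xi>)" for t \<xi>
  proof -
    have ft: "fhat (cutoff X u n t) (- \<xi>) = cnj (fhat (cutoff X u n t) \<xi>)" for n t
    proof -
      have "cis (- (- \<xi> * x)) * cutoff X u n t x = cnj (cis (- (\<xi> * x)) * cutoff X u n t x)" for x
        by (simp add: cutoff_def cis_cnj)
      then show ?thesis
        unfolding fhat_def complex_cnj_mult[of "of_real (1 / sqrt (2 * pi))"] Bochner_Integration.integral_cnj[symmetric] complex_cnj_complex_of_real
        by presburger
    qed
    have Yc: "Y n t (- \<xi>) = cnj (Y n t \<xi>)" for n t by (simp add: Y_def ft phase_minus cis_cnj)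
    have "(\<lambda>n. Y n t (- \<xi>) - Y n 0 (- \<xi>)) \<longlonglongrightarrow> cnj (P \<xi> t / of_real c)"
      unfolding Yc complex_cnj_diff[symmetric] by (rule tendsto_cnj[OF lim])
    then have "P (- \<xi>) t / of_real c = cnj (P \<xi> t / of_real c)" by (rule LIMSEQ_unique[OF lim])
    then show ?thesis by (simp add: F_def add.commute)
  qed
  \<comment> \<open>Consistency of constants: \<open>c_nl\<close> is 1/(2c), so the 1/2 of
    \<open>burgers\<close> divided by c appears.\<close>
  have D: "profile_rhs \<epsilon> F \<tau> \<xi> = burgers \<epsilon> u \<xi> \<tau> / of_real c" for \<tau> \<xi>
  proof -
    have "interaction \<epsilon> \<tau> (F \<tau>) (F \<tau>) \<xi>
        = (LINT x|lborel. of_real ((u \<tau> x)\<^sup>2) * cis (- (\<xi> * x)))"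
      by (rule autoconvolution[OF FL]) (simp add: sym phase_minus cis_cnj)
    then show ?thesis unfolding profile_rhs_def burgers_def by (simp add: c_nl_def c_def)
  qed
  have h: "jbs 1 (F t) \<in> L2" "h1n (F t) = (Hs_norm 1 (u t))\<^sup>2" for t
  proof -
    note hd = HsD[OF uf(2) FL[of t]]
    have n: "cmod (jbs 1 (\<lambda>\<xi>. cis (t * phase \<epsilon> \<xi>) * F t \<xi>) x) = cmod (jbs 1 (F t) x)" for x
      by (simp add: jbs_def norm_mult)
    show "jbs 1 (F t) \<in> L2" using hd(1) by (simp add: L2_def n)
    show "h1n (F t) = (Hs_norm 1 (u t))\<^sup>2" unfolding hd(2) h1n_jbs L2_norm_def n ..
  qed
  have "profile \<epsilon> F"
    unfolding profile_def
  proof (intro conjI allI)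
    show "curve F (profile_rhs \<epsilon> F)"
      unfolding curve_def
    proof (intro conjI allI)
      show "F \<tau> \<in> borel_measurable borel" for \<tau> by (rule Fm)
      show "profile_rhs \<epsilon> F \<tau> \<in> borel_measurable borel" for \<tau>
        using measurable_burgers[OF sol, of \<tau>] by (simp add: D[abs_def])
      show "((\<lambda>\<tau>. F \<tau> \<xi>) has_vector_derivative profile_rhs \<epsilon> F \<tau> \<xi>) (at \<tau>)" for \<tau> \<xi>
        unfolding F_def D by (auto intro!: derivative_eq_intros has_vector_derivative_divide P)
      show "continuous_on UNIV (\<lambda>\<tau>. profile_rhs \<epsilon> F \<tau> \<xi>)" for \<xi>
        unfolding D by (intro continuous_intros continuous_burgers[OF sol]) (use c in simp)
    qed
    show "F \<tau> (- \<xi>) = cnj (F \<tau> \<xi>)" for \<tau> \<xi> by (rule sym)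
    show "integrable lborel (\<lambda>x. (jb x)\<^sup>2 * (cmod (F \<tau> x))\<^sup>2)" for \<tau> by (rule integrable_h1n[OF h(1)])
    show "continuous_on UNIV (\<lambda>\<tau>. h1n (F \<tau>))" unfolding h(2) by (intro continuous_intros C_Hs_norm_continuous uf(1))
  qed
  then show ?thesis using FL that by blast
qed

section \<open>Tightness and equicontinuity\<close>

lemma wn_cong_AE:
  assumes "AE x in lborel. cmod (f x) = cmod (g x)"
  shows "wn a f = wn a g"
  unfolding wn_def by (rule nn_integral_cong_AE) (use assms in eventually_elim, simp)

lemma wn_mono:
  assumes "\<And>x. a x \<le> b x"
  shows "wn a f \<le> wn b f"
  unfolding wn_def by (intro nn_integral_mono power_mono mult_right_mono ennreal_leI assms) auto

lemma wn_diff: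
  assumes [measurable]: "a \<in> borel_measurable borel" "f \<in> borel_measurable borel" "g \<in> borel_measurable borel"
  shows "wn a (\<lambda>x. f x - g x) \<le> 2 * wn a f + 2 * wn a g"
proof -
  have "wn a (\<lambda>x. f x - g x) \<le> (\<integral>\<^sup>+x. 2 * (ennreal (a x) * ennreal (cmod (f x)))\<^sup>2 + 2 * (ennreal (a x) * ennreal (cmod (g x)))\<^sup>2 \<partial>lborel)"
    unfolding wn_def
  proof (rule nn_integral_mono)
    fix x
    have "(cmod (f x - g x))\<^sup>2 \<le> (cmod (f x) + cmod (g x))\<^sup>2"
      by (intro power_mono norm_triangle_ineq4) simp
    also have "\<dots> \<le> 2 * (cmod (f x))\<^sup>2 + 2 * (cmod (g x))\<^sup>2"
      using zero_le_power2[of "cmod (f x) - cmod (g x)"] by (simp add: power2_eq_square algebra_simps)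
    finally have "ennreal ((cmod (f x - g x))\<^sup>2) \<le> ennreal (2 * (cmod (f x))\<^sup>2 + 2 * (cmod (g x))\<^sup>2)"
      by (rule ennreal_leI)
    also have "\<dots> = 2 * ennreal ((cmod (f x))\<^sup>2) + 2 * ennreal ((cmod (g x))\<^sup>2)"
      by (simp add: ennreal_mult)
    finally have "ennreal ((cmod (f x - g x))\<^sup>2) \<le> 2 * ennreal ((cmod (f x))\<^sup>2) + 2 * ennreal ((cmod (g x))\<^sup>2)" .
    from mult_left_mono[OF this, of "(ennreal (a x))\<^sup>2"]
    show "(ennreal (a x) * ennreal (cmod (f x - g x)))\<^sup>2 \<le> 2 * (ennreal (a x) * ennreal (cmod (f x)))\<^sup>2 + 2 * (ennreal (a x) * ennreal (cmod (g x)))\<^sup>2"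
      by (simp add: power_mult_distrib ennreal_power distrib_left mult_ac)
  qed
  also have "\<dots> = 2 * wn a f + 2 * wn a g"
    unfolding wn_def by (simp add: nn_integral_add nn_integral_cmult)
  finally show ?thesis .
qed

lemma wn_1: "f \<in> L2 \<Longrightarrow> wn (\<lambda>_. 1) f = ennreal ((L2_norm f)\<^sup>2)"
  unfolding wn_def using L2_nn[of f] by (simp add: ennreal_power)

text \<open>A soft high-frequency cut-off: the full weight once the bracket reaches N + 1, and small
  for fixed frequency as N grows. A sharp cut-off would vanish at low frequency and violate the
  growth condition of \<open>weight\<close>; the soft one costs one more power.\<close>

definition tail_weight :: "real \<Rightarrow> nat \<Rightarrow> real \<Rightarrow> real" where
  "tail_weight s N \<xi> = jb \<xi> powr s * min (jb \<xi> * inverse (real (Suc N))) 1"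

lemma measurable_tail_weight [measurable]: "tail_weight s N \<in> borel_measurable borel"
  unfolding tail_weight_def[abs_def] by measurable

lemma tail_weight_bounds: "0 \<le> tail_weight s N \<xi>" "tail_weight s N \<xi> \<le> jb \<xi> powr s"
proof -
  have "0 \<le> min (jb \<xi> * inverse (real (Suc N))) 1" using jb_ge(3)[of \<xi>] by (simp add: less_imp_le)
  then show "0 \<le> tail_weight s N \<xi>" unfolding tail_weight_def by simp
  show "tail_weight s N \<xi> \<le> jb \<xi> powr s" unfolding tail_weight_def
    by (rule order_trans[OF mult_left_mono[of _ 1]]) auto
qed

lemma weight_tail_weight:
  assumes "0 \<le> s" "s \<le> real q"
  shows "weight (Suc q) (tail_weight s N)"
proof -
  have "weight (1 + 0) (\<lambda>x. jb x * inverse (real (Suc N)))"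
    by (intro weight_mult weight_jb weight_const) simp
  then have "weight 1 (\<lambda>x. jb x * inverse (real (Suc N)))" by simp
  from weight_mult[OF weight_jb_powr[OF assms] weight_min[OF this, of 1]]
  show ?thesis by (simp add: tail_weight_def[abs_def])
qed

text \<open>Below frequency N + 1 the Sobolev weight is bounded by (N + 1)^s, so the low part is
  controlled in L^2.\<close>

lemma wn_split:
  assumes [measurable]: "g \<in> borel_measurable borel" and s: "0 \<le> s"
  shows "wn (\<lambda>\<xi>. jb \<xi> powr s) g \<le> wn (tail_weight s N) g + ennreal ((real (Suc N) powr s)\<^sup>2) * wn (\<lambda>_. 1) g"
proof -
  have "wn (\<lambda>\<xi>. jb \<xi> powr s) g \<le> (\<integral>\<^sup>+x. (ennreal (tail_weight s N x) * ennreal (cmod (g x)))\<^sup>2 + ennreal ((real (Suc N) powr s)\<^sup>2) * (ennreal 1 * ennreal (cmod (g x)))\<^sup>2 \<partial>lborel)"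
    unfolding wn_def
  proof (rule nn_integral_mono)
    fix x
    show "(ennreal (jb x powr s) * ennreal (cmod (g x)))\<^sup>2 \<le> (ennreal (tail_weight s N x) * ennreal (cmod (g x)))\<^sup>2 + ennreal ((real (Suc N) powr s)\<^sup>2) * (ennreal 1 * ennreal (cmod (g x)))\<^sup>2"
    proof (cases "real (Suc N) \<le> jb x")
      case True
      then have "1 \<le> jb x * inverse (real (Suc N))" by (simp add: field_simps)
      then have "tail_weight s N x = jb x powr s" by (simp add: tail_weight_def)
      then show ?thesis by simp
    next
      case False
      then have "jb x powr s \<le> real (Suc N) powr s" using s jb_ge(3)[of x] by (intro powr_mono2) auto
      then have "(ennreal (jb x powr s) * ennreal (cmod (g x)))\<^sup>2 \<le> (ennreal (real (Suc N) powr s) * ennreal (cmod (g x)))\<^sup>2"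
        by (intro power_mono mult_right_mono ennreal_leI) auto
      also have "\<dots> = ennreal ((real (Suc N) powr s)\<^sup>2) * (ennreal 1 * ennreal (cmod (g x)))\<^sup>2"
        by (simp add: power_mult_distrib ennreal_power)
      finally show ?thesis by (rule order_trans) simp
    qed
  qed
  also have "\<dots> = wn (tail_weight s N) g + ennreal ((real (Suc N) powr s)\<^sup>2) * wn (\<lambda>_. 1) g"
    unfolding wn_def by (subst nn_integral_add) (simp_all add: nn_integral_cmult)
  finally show ?thesis .
qed

text \<open>Dominated convergence with the H^s density as majorant.\<close>

lemma tail_tendsto_0:
  assumes "jbs s g \<in> L2" "g \<in> borel_measurable borel"
  obtains \<theta> where "\<theta> \<longlonglongrightarrow> (0::real)" "\<And>N. wn (tail_weight s N) g = ennreal (\<theta> N)" "\<And>N. 0 \<le> \<theta> N"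
proof -
  note [measurable] = assms(2)
  define v where "v N x = complex_of_real (tail_weight s N x) * g x" for N x
  have m: "v N \<in> borel_measurable borel" for N unfolding v_def by measurable
  have b: "(cmod (v N x))\<^sup>2 \<le> (cmod (jbs s g x))\<^sup>2" for N x
    unfolding v_def jbs_def norm_mult norm_of_real using tail_weight_bounds[of s N x]
    by (intro power_mono mult_right_mono) auto
  have i: "integrable lborel (\<lambda>x. (cmod (jbs s g x))\<^sup>2)" using assms(1) by (simp add: L2_def)
  have vL: "v N \<in> L2" for N
  proof -
    note [measurable] = m[of N]
    have "integrable lborel (\<lambda>x. (cmod (v N x))\<^sup>2)"
      by (rule Bochner_Integration.integrable_bound[OF i]) (use b in simp_all)
    then show ?thesis using m[of N] by (simp add: L2_def)
  qed
  have w: "wn (tail_weight s N) g = ennreal ((L2_norm (v N))\<^sup>2)" for N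
    unfolding L2_nn[OF vL, symmetric] wn_def
    by (intro nn_integral_cong) (simp add: v_def norm_mult tail_weight_bounds ennreal_mult ennreal_power power_mult_distrib)
  have "(\<lambda>N. L2_norm (\<lambda>x. v N x - 0)) \<longlonglongrightarrow> 0"
  proof (rule L2_dominated[OF m _ _ i])
    show "AE x in lborel. (\<lambda>N. v N x) \<longlonglongrightarrow> 0"
    proof (rule AE_I2)
      fix x
      have 0: "(\<lambda>N. jb x * inverse (real (Suc N))) \<longlonglongrightarrow> jb x * 0"
        by (intro tendsto_intros LIMSEQ_inverse_real_of_nat)
      have "(\<lambda>N. min (jb x * inverse (real (Suc N))) 1) \<longlonglongrightarrow> min (jb x * 0) 1"
        by (intro tendsto_min 0 tendsto_const)
      from tendsto_mult[OF tendsto_const this, of "jb x powr s"]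
      have "(\<lambda>N. tail_weight s N x) \<longlonglongrightarrow> 0" unfolding tail_weight_def by simp
      from tendsto_mult[OF tendsto_of_real[OF this] tendsto_const, of "g x"]
      show "(\<lambda>N. v N x) \<longlonglongrightarrow> 0" unfolding v_def by simp
    qed
  qed (use b in auto)
  then have "(\<lambda>N. L2_norm (v N)) \<longlonglongrightarrow> 0" unfolding diff_0_right .
  from tendsto_power[OF this, of 2] have "(\<lambda>N. (L2_norm (v N))\<^sup>2) \<longlonglongrightarrow> 0" unfolding zero_power2 .
  then show ?thesis by (rule that[of "\<lambda>N. (L2_norm (v N))\<^sup>2", OF _ w zero_le_power2])
qed

text \<open>Both conclusions of the profile analysis for one radius R of H^1 data.
  \<open>h1n\<close> is a squared norm, hence \<open>R\<^sup>2\<close>.\<close>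

definition control_time :: "nat \<Rightarrow> real \<Rightarrow> real \<Rightarrow> bool" where
  "control_time q R T \<longleftrightarrow> T \<in> {0<..<1} \<and>
    (\<forall>\<epsilon> F a t. 0 < \<epsilon> \<longrightarrow> profile \<epsilon> F \<longrightarrow> h1n (F 0) \<le> R\<^sup>2 \<longrightarrow> weight q a \<longrightarrow> 0 \<le> t \<longrightarrow> t \<le> T \<longrightarrow>
       wn a (F t) \<le> 2 * wn a (F 0)) \<and>
    (\<forall>\<epsilon> F G t. 0 < \<epsilon> \<longrightarrow> profile \<epsilon> F \<longrightarrow> profile \<epsilon> G \<longrightarrow> h1n (F 0) \<le> R\<^sup>2 \<longrightarrow> h1n (G 0) \<le> R\<^sup>2 \<longrightarrow> 0 \<le> t \<longrightarrow> t \<le> T \<longrightarrow>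
       wn (\<lambda>_. 1) (\<lambda>x. F t x - G t x) \<le> 2 * wn (\<lambda>_. 1) (\<lambda>x. F 0 x - G 0 x))"

lemma control_time_exists:
  assumes "0 \<le> R" "1 \<le> q"
  shows "\<exists>T. control_time q R T"
proof -
  obtain T1 where T1: "0 < T1" "T1 < 1"
    and a1: "\<And>\<epsilon> F a t. 0 < \<epsilon> \<Longrightarrow> profile \<epsilon> F \<Longrightarrow> h1n (F 0) \<le> R\<^sup>2 \<Longrightarrow> weight q a \<Longrightarrow> 0 \<le> t \<Longrightarrow> t \<le> T1 \<Longrightarrow>
       wn a (F t) \<le> 2 * wn a (F 0)"
    and a2: "\<And>\<epsilon> F t. 0 < \<epsilon> \<Longrightarrow> profile \<epsilon> F \<Longrightarrow> h1n (F 0) \<le> R\<^sup>2 \<Longrightarrow> 0 \<le> t \<Longrightarrow> t \<le> T1 \<Longrightarrow>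
       L2b (\<lambda>x. ennreal (jb x) * nrm F t x) (2 * R + 1)"
    using apriori[OF assms] by blast
  have R1: "0 \<le> 2 * R + 1" using assms by simp
  obtain T2 where T2: "0 < T2" "T2 < 1"
    and d: "\<And>\<epsilon> F G t. 0 < \<epsilon> \<Longrightarrow> profile \<epsilon> F \<Longrightarrow> profile \<epsilon> G \<Longrightarrow> 0 \<le> t \<Longrightarrow> t \<le> T2 \<Longrightarrow>
       (\<And>\<tau>. 0 \<le> \<tau> \<Longrightarrow> \<tau> \<le> t \<Longrightarrow> L2b (\<lambda>x. ennreal (jb x) * nrm F \<tau> x) (2 * R + 1)) \<Longrightarrow>
       (\<And>\<tau>. 0 \<le> \<tau> \<Longrightarrow> \<tau> \<le> t \<Longrightarrow> L2b (\<lambda>x. ennreal (jb x) * nrm G \<tau> x) (2 * R + 1)) \<Longrightarrow>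
       wn (\<lambda>_. 1) (\<lambda>x. F t x - G t x) \<le> 2 * wn (\<lambda>_. 1) (\<lambda>x. F 0 x - G 0 x)"
    using difference[OF R1] by blast
  have "wn a (F t) \<le> 2 * wn a (F 0)"
    if "0 < \<epsilon>" "profile \<epsilon> F" "h1n (F 0) \<le> R\<^sup>2" "weight q a" "0 \<le> t" "t \<le> min T1 T2" for \<epsilon> F a t
    by (rule a1) (use that in auto)
  moreover have "wn (\<lambda>_. 1) (\<lambda>x. F t x - G t x) \<le> 2 * wn (\<lambda>_. 1) (\<lambda>x. F 0 x - G 0 x)"
    if "0 < \<epsilon>" "profile \<epsilon> F" "profile \<epsilon> G" "h1n (F 0) \<le> R\<^sup>2" "h1n (G 0) \<le> R\<^sup>2" "0 \<le> t" "t \<le> min T1 T2" for \<epsilon> F G t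
  proof (rule d[OF that(1-3,6)])
    show "t \<le> T2" using that by simp
    fix \<tau> assume "0 \<le> \<tau>" "\<tau> \<le> t"
    then have "0 \<le> \<tau>" "\<tau> \<le> T1" using that by auto
    then show "L2b (\<lambda>x. ennreal (jb x) * nrm F \<tau> x) (2 * R + 1)" "L2b (\<lambda>x. ennreal (jb x) * nrm G \<tau> x) (2 * R + 1)"
      using a2[OF that(1,2,4)] a2[OF that(1,3,5)] by blast+
  qed
  ultimately have "control_time q R (min T1 T2)"
    unfolding control_time_def using T1 T2 by auto
  then show ?thesis ..
qed

lemma solution_profile:
  assumes sol: "kawahara_solution \<epsilon> \<phi> u" and \<phi>: "\<phi> \<in> Hs s" and s: "1 \<le> s"
  obtains F where "profile \<epsilon> F" "\<And>t. L2_fourier (cor (u t)) (\<lambda>\<xi>. cis (t * phase \<epsilon> \<xi>) * F t \<xi>)"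
    "L2_fourier (cor \<phi>) (F 0)" "h1n (F 0) = (Hs_norm 1 \<phi>)\<^sup>2" "\<And>t. F t \<in> borel_measurable borel"
proof -
  obtain F where F: "profile \<epsilon> F" "\<And>t. L2_fourier (cor (u t)) (\<lambda>\<xi>. cis (t * phase \<epsilon> \<xi>) * F t \<xi>)"
    using kawahara_profile[OF sol] by blast
  have "L2_fourier (cor (u 0)) (F 0)" using F(2)[of 0] by simp
  then have 0: "L2_fourier (cor \<phi>) (F 0)"
    by (rule L2_fourier_cong_left) (use solution_facts(4)[OF sol] L2_measurable[OF Hs_L2[OF \<phi>]] in auto)
  have h: "h1n (F 0) = (Hs_norm 1 \<phi>)\<^sup>2" by (simp add: h1n_jbs HsD(2)[OF Hs_mono(1)[OF s \<phi>] 0])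
  show ?thesis by (rule that[OF F 0 h]) (use F(1) in \<open>auto simp: profile_def curve_def\<close>)
qed

lemma wn_phase: "wn a (\<lambda>\<xi>. cis (\<theta> \<xi>) * f \<xi>) = wn a f"
  by (rule wn_cong_AE) (simp add: norm_mult)

lemma control_timeD:
  assumes "control_time q R T" "0 < \<epsilon>" "0 \<le> t" "t \<le> T" "profile \<epsilon> F" "h1n (F 0) \<le> R\<^sup>2"
  shows "weight q a \<Longrightarrow> wn a (F t) \<le> 2 * wn a (F 0)"
    "profile \<epsilon> G \<Longrightarrow> h1n (G 0) \<le> R\<^sup>2 \<Longrightarrow> wn (\<lambda>_. 1) (\<lambda>x. F t x - G t x) \<le> 2 * wn (\<lambda>_. 1) (\<lambda>x. F 0 x - G 0 x)"
  using assms unfolding control_time_def by blast+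

lemma wn_Hs_norm:
  assumes "f \<in> Hs s" "L2_fourier (cor f) g"
  shows "wn (\<lambda>\<xi>. jb \<xi> powr s) g = ennreal ((Hs_norm s f)\<^sup>2)"
  using wn_jbs_L2[OF HsD(1)[OF assms]] HsD(2)[OF assms] by simp

text \<open>The doubling estimate concerns squared norms, hence the factor sqrt 2. That
  \<open>u t\<close> lies in H^s is a consequence of finiteness, since the solution is only given in
  H^1.\<close>

lemma persistence:
  assumes T: "control_time q R T" and sq: "1 \<le> s" "s \<le> real q"
    and sol: "kawahara_solution \<epsilon> \<phi> u" and \<epsilon>: "0 < \<epsilon>" and \<phi>: "\<phi> \<in> Hs s" "Hs_norm 1 \<phi> \<le> R" and t: "0 \<le> t" "t \<le> T"
  shows "u t \<in> Hs s" "Hs_norm s (u t) \<le> sqrt 2 * Hs_norm s \<phi>"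
proof -
  obtain F where F: "profile \<epsilon> F" "\<And>t. L2_fourier (cor (u t)) (\<lambda>\<xi>. cis (t * phase \<epsilon> \<xi>) * F t \<xi>)"
    "L2_fourier (cor \<phi>) (F 0)" "h1n (F 0) = (Hs_norm 1 \<phi>)\<^sup>2" "\<And>t. F t \<in> borel_measurable borel"
    using solution_profile[OF sol \<phi>(1) sq(1)] by blast
  have h: "h1n (F 0) \<le> R\<^sup>2" unfolding F(4) using \<phi>(2) by (intro power_mono) auto
  have "wn (\<lambda>\<xi>. jb \<xi> powr s) (F t) \<le> 2 * wn (\<lambda>\<xi>. jb \<xi> powr s) (F 0)"
    by (rule control_timeD(1)[OF T \<epsilon> t F(1) h weight_jb_powr]) (use sq in auto)
  also have "\<dots> = ennreal ((sqrt 2 * Hs_norm s \<phi>)\<^sup>2)"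
    unfolding wn_Hs_norm[OF \<phi>(1) F(3)] by (simp add: power_mult_distrib ennreal_mult)
  finally have "wn (\<lambda>\<xi>. jb \<xi> powr s) (\<lambda>\<xi>. cis (t * phase \<epsilon> \<xi>) * F t \<xi>) \<le> ennreal ((sqrt 2 * Hs_norm s \<phi>)\<^sup>2)"
    unfolding wn_phase .
  note w = L2_of_wn[OF this _ L2_measurable[OF L2_fourierD(2)[OF F(2)]]]
  show "u t \<in> Hs s" by (rule HsI(1)[OF F(2) w(1)]) simp
  show "Hs_norm s (u t) \<le> sqrt 2 * Hs_norm s \<phi>" unfolding HsI(2)[OF F(2) w(1), simplified] by (rule w(2)) simp
qed

lemma Hs_norm_split:
  assumes f: "f \<in> Hs s" "L2_fourier (cor f) g" and s: "0 \<le> s" and b: "wn (tail_weight s N) g \<le> ennreal b" "0 \<le> b"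
  shows "(Hs_norm s f)\<^sup>2 \<le> b + (real (Suc N) powr s)\<^sup>2 * (L2_norm (cor f))\<^sup>2"
proof -
  note d = L2_fourierD[OF f(2)]
  have "ennreal ((Hs_norm s f)\<^sup>2) \<le> wn (tail_weight s N) g + ennreal ((real (Suc N) powr s)\<^sup>2) * wn (\<lambda>_. 1) g"
    unfolding wn_Hs_norm[OF f, symmetric] by (rule wn_split[OF L2_measurable[OF d(2)] s])
  also have "\<dots> \<le> ennreal b + ennreal ((real (Suc N) powr s)\<^sup>2) * ennreal ((L2_norm (cor f))\<^sup>2)"
    unfolding wn_1[OF d(2)] plancherel[OF f(2)] by (intro add_right_mono b(1))
  also have "\<dots> = ennreal (b + (real (Suc N) powr s)\<^sup>2 * (L2_norm (cor f))\<^sup>2)"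
    using b(2) by (simp add: ennreal_plus ennreal_mult)
  finally show ?thesis using b(2) by (subst (asm) ennreal_le_iff) auto
qed

text \<open>Continuity in H^1 gives continuity in L^2; the tails are uniformly small in time, so the
  split at frequency N + 1 lifts it to H^s. The exponent \<open>Suc p\<close> makes
  \<open>tail_weight\<close> admissible.\<close>

lemma solution_C_Hs:
  assumes T: "control_time (Suc p) R T" and sp: "1 \<le> s" "s \<le> real p"
    and sol: "kawahara_solution \<epsilon> \<phi> u" and \<epsilon>: "0 < \<epsilon>" and \<phi>: "\<phi> \<in> Hs s" "Hs_norm 1 \<phi> \<le> R"
  shows "u \<in> C_Hs s {0..T}"
proof -
  obtain F where F: "profile \<epsilon> F" "\<And>t. L2_fourier (cor (u t)) (\<lambda>\<xi>. cis (t * phase \<epsilon> \<xi>) * F t \<xi>)"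
    "L2_fourier (cor \<phi>) (F 0)" "h1n (F 0) = (Hs_norm 1 \<phi>)\<^sup>2" "\<And>t. F t \<in> borel_measurable borel"
    using solution_profile[OF sol \<phi>(1) sp(1)] by blast
  have h: "h1n (F 0) \<le> R\<^sup>2" unfolding F(4) using \<phi>(2) by (intro power_mono) auto
  have Fm: "(\<lambda>\<xi>. cis (t * phase \<epsilon> \<xi>) * F t \<xi>) \<in> borel_measurable borel" for t
    by (rule L2_measurable[OF L2_fourierD(2)[OF F(2)]])
  obtain \<theta> where \<theta>: "\<theta> \<longlonglongrightarrow> (0::real)" "\<And>N. wn (tail_weight s N) (F 0) = ennreal (\<theta> N)" "\<And>N. 0 \<le> \<theta> N"
    using tail_tendsto_0[OF HsD(1)[OF \<phi>(1) F(3)] F(5)] by blast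
  have uH: "u t \<in> Hs s" if "t \<in> {0..T}" for t
    by (rule persistence(1)[OF T sp(1) _ sol \<epsilon> \<phi>]) (use that sp in auto)
  have wt: "weight (Suc p) (tail_weight s N)" for N by (rule weight_tail_weight) (use sp in auto)
  \<comment> \<open>The constant 8 collects a factor 2 from the squared triangle inequality and a
    factor 2 from the doubling, at each of the two times.\<close>
  have main: "(Hs_norm s (\<lambda>x. u t x - u t' x))\<^sup>2 \<le> 8 * \<theta> N + (real (Suc N) powr s)\<^sup>2 * (L2_norm (\<lambda>x. of_real (u t x) - of_real (u t' x)))\<^sup>2"
    if t: "t \<in> {0..T}" "t' \<in> {0..T}" for t t' N
  proof -
    let ?g = "\<lambda>\<xi>. cis (t * phase \<epsilon> \<xi>) * F t \<xi> - cis (t' * phase \<epsilon> \<xi>) * F t' \<xi>"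
    have d: "L2_fourier (cor (\<lambda>x. u t x - u t' x)) ?g" using L2_fourier_diff[OF F(2)[of t] F(2)[of t']] by simp
    have tail: "wn (tail_weight s N) (F \<tau>) \<le> 2 * ennreal (\<theta> N)" if "\<tau> \<in> {0..T}" for \<tau>
      unfolding \<theta>(2)[symmetric] by (rule control_timeD(1)[OF T \<epsilon> _ _ F(1) h wt]) (use that in auto)
    have "wn (tail_weight s N) ?g \<le> 2 * wn (tail_weight s N) (F t) + 2 * wn (tail_weight s N) (F t')"
      using wn_diff[OF measurable_tail_weight Fm Fm, of s N t t'] by (simp add: wn_phase)
    also have "\<dots> \<le> 2 * (2 * ennreal (\<theta> N)) + 2 * (2 * ennreal (\<theta> N))"
      by (intro add_mono mult_left_mono tail t) auto
    also have "\<dots> = ennreal (8 * \<theta> N)"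
      using \<theta>(3)[of N] by (simp add: ennreal_mult[symmetric] ennreal_plus[symmetric] del: ennreal_plus flip: ennreal_numeral)
    finally show ?thesis
      using Hs_norm_split[OF Hs_diff(1)[OF uH uH, OF t] d, of N "8 * \<theta> N"] sp(1) \<theta>(3)[of N] by simp
  qed
  show ?thesis
    unfolding C_Hs_def
  proof (intro CollectI conjI ballI uH)
    fix t0 assume t0: "t0 \<in> {0..T}"
    have sH: "u t \<in> Hs 1" for t by (rule solution_facts(2)[OF sol])
    have l2: "((\<lambda>t. L2_norm (\<lambda>x. of_real (u t x) - of_real (u t0 x))) \<longlongrightarrow> 0) (at t0 within {0..T})"
    proof (rule Lim_null_comparison)
      have "((\<lambda>t. Hs_norm 1 (\<lambda>x. u t x - u t0 x)) \<longlongrightarrow> 0) (at t0)" using solution_facts(1)[OF sol] by (simp add: C_Hs_def)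
      then show "((\<lambda>t. Hs_norm 1 (\<lambda>x. u t x - u t0 x)) \<longlongrightarrow> 0) (at t0 within {0..T})"
        by (rule tendsto_within_subset) simp
      show "\<forall>\<^sub>F t in at t0 within {0..T}. norm (L2_norm (\<lambda>x. of_real (u t x) - of_real (u t0 x))) \<le> Hs_norm 1 (\<lambda>x. u t x - u t0 x)"
        using L2_norm_le_Hs_norm[OF Hs_diff(1)[OF sH sH]] by simp
    qed
    show "((\<lambda>t. Hs_norm s (\<lambda>x. u t x - u t0 x)) \<longlongrightarrow> 0) (at t0 within {0..T})"
    proof (rule tendstoI)
      fix e :: real assume e: "0 < e"
      then have "\<forall>\<^sub>F N in sequentially. \<theta> N < e\<^sup>2 / 16" by (intro order_tendstoD[OF \<theta>(1)]) simp
      then obtain N where N: "\<theta> N < e\<^sup>2 / 16" by (auto simp: eventually_sequentially)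
      have "((\<lambda>t. (real (Suc N) powr s)\<^sup>2 * (L2_norm (\<lambda>x. of_real (u t x) - of_real (u t0 x)))\<^sup>2) \<longlongrightarrow> (real (Suc N) powr s)\<^sup>2 * 0\<^sup>2) (at t0 within {0..T})"
        by (intro tendsto_intros l2)
      then have "\<forall>\<^sub>F t in at t0 within {0..T}. (real (Suc N) powr s)\<^sup>2 * (L2_norm (\<lambda>x. of_real (u t x) - of_real (u t0 x)))\<^sup>2 < e\<^sup>2 / 2"
        by (rule order_tendstoD) (use e in simp)
      moreover have "\<forall>\<^sub>F t in at t0 within {0..T}. t \<in> {0..T}" by (simp add: eventually_at_filter)
      ultimately show "\<forall>\<^sub>F t in at t0 within {0..T}. dist (Hs_norm s (\<lambda>x. u t x - u t0 x)) 0 < e"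
      proof eventually_elim
        case (elim t)
        have "(Hs_norm s (\<lambda>x. u t x - u t0 x))\<^sup>2 < e\<^sup>2" using main[OF elim(2) t0, of N] N elim(1) by linarith
        then show ?case using e by (simp add: power2_less_imp_less)
      qed
    qed
  qed
qed

text \<open>N is chosen from the tail of \<phi> alone and \<delta> from N, before \<epsilon> and the
  perturbed datum appear. The tail of nearby data is controlled by that of \<phi> and the
  distance.\<close>

lemma equicontinuity:
  assumes T: "control_time (Suc p) R T" and sp: "1 \<le> s" "s \<le> real p"
    and \<phi>: "\<phi> \<in> Hs s" "Hs_norm 1 \<phi> \<le> R" and e: "0 < e"
  obtains \<delta> where "0 < \<delta>"
    "\<And>\<epsilon> \<psi> u v t. 0 < \<epsilon> \<Longrightarrow> \<psi> \<in> Hs s \<Longrightarrow> Hs_norm 1 \<psi> \<le> R \<Longrightarrow> Hs_norm s (\<lambda>x. \<psi> x - \<phi> x) < \<delta> \<Longrightarrow>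
       kawahara_solution \<epsilon> \<phi> u \<Longrightarrow> kawahara_solution \<epsilon> \<psi> v \<Longrightarrow> t \<in> {0..T} \<Longrightarrow> Hs_norm s (\<lambda>x. u t x - v t x) \<le> e"
proof -
  obtain G where G: "L2_fourier (cor \<phi>) G" "jbs s G \<in> L2" using HsE[OF \<phi>(1)] .
  note Gm = L2_measurable[OF L2_fourierD(2)[OF G(1)]]
  obtain \<theta> where \<theta>: "\<theta> \<longlonglongrightarrow> (0::real)" "\<And>N. wn (tail_weight s N) G = ennreal (\<theta> N)" "\<And>N. 0 \<le> \<theta> N"
    using tail_tendsto_0[OF G(2) Gm] by blast
  \<comment> \<open>The tails will contribute 12 times this value, that is, less than half of the
    square of e.\<close>
  have "\<forall>\<^sub>F N in sequentially. \<theta> N < e\<^sup>2 / 24" using e by (intro order_tendstoD[OF \<theta>(1)]) simp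
  then obtain N where N: "\<theta> N < e\<^sup>2 / 24" by (auto simp: eventually_sequentially)
  \<comment> \<open>8 is the share of the squared distance in the tails; the other summand is the
    low-frequency part, with the factor 2 from the L^2 estimate of differences.\<close>
  define K where "K = 8 + 2 * (real (Suc N) powr s)\<^sup>2"
  have K: "0 < K" by (simp add: K_def add_pos_nonneg)
  define \<delta> where "\<delta> = e / sqrt (2 * K)"
  have \<delta>: "0 < \<delta>" using e K by (simp add: \<delta>_def)
  have K\<delta>: "K * \<delta>\<^sup>2 = e\<^sup>2 / 2" using K by (simp add: \<delta>_def power_divide)
  show ?thesis
  proof (rule that[OF \<delta>])
    fix \<epsilon> \<psi> u v t
    assume \<epsilon>: "0 < \<epsilon>" and \<psi>: "\<psi> \<in> Hs s" "Hs_norm 1 \<psi> \<le> R" and close: "Hs_norm s (\<lambda>x. \<psi> x - \<phi> x) < \<delta>"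
      and u: "kawahara_solution \<epsilon> \<phi> u" and v: "kawahara_solution \<epsilon> \<psi> v" and t: "t \<in> {0..T}"
    define \<eta> where "\<eta> = Hs_norm s (\<lambda>x. \<psi> x - \<phi> x)"
    have t': "0 \<le> t" "t \<le> T" using t by auto
    obtain F where F: "profile \<epsilon> F" "\<And>t. L2_fourier (cor (u t)) (\<lambda>\<xi>. cis (t * phase \<epsilon> \<xi>) * F t \<xi>)"
      "L2_fourier (cor \<phi>) (F 0)" "h1n (F 0) = (Hs_norm 1 \<phi>)\<^sup>2" "\<And>t. F t \<in> borel_measurable borel"
      using solution_profile[OF u \<phi>(1) sp(1)] by blast
    obtain H where H: "profile \<epsilon> H" "\<And>t. L2_fourier (cor (v t)) (\<lambda>\<xi>. cis (t * phase \<epsilon> \<xi>) * H t \<xi>)"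
      "L2_fourier (cor \<psi>) (H 0)" "h1n (H 0) = (Hs_norm 1 \<psi>)\<^sup>2" "\<And>t. H t \<in> borel_measurable borel"
      using solution_profile[OF v \<psi>(1) sp(1)] by blast
    note [measurable] = F(5) H(5)
    have hF: "h1n (F 0) \<le> R\<^sup>2" unfolding F(4) using \<phi>(2) by (intro power_mono) auto
    have hH: "h1n (H 0) \<le> R\<^sup>2" unfolding H(4) using \<psi>(2) by (intro power_mono) auto
    have wt: "weight (Suc p) (tail_weight s N)" by (rule weight_tail_weight) (use sp in auto)
    have d0: "L2_fourier (cor (\<lambda>x. \<psi> x - \<phi> x)) (\<lambda>\<xi>. H 0 \<xi> - F 0 \<xi>)" using L2_fourier_diff[OF H(3) F(3)] by simp
    note w0 = wn_Hs_norm[OF Hs_diff(1)[OF \<psi>(1) \<phi>(1)] d0, folded \<eta>_def]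
    have tF0: "wn (tail_weight s N) (F 0) = ennreal (\<theta> N)"
    proof -
      have "AE \<xi> in lborel. F 0 \<xi> = G \<xi>" by (rule L2_fourier_unique[OF F(3) G(1)])
      then have "AE \<xi> in lborel. cmod (F 0 \<xi>) = cmod (G \<xi>)" by eventually_elim simp
      from wn_cong_AE[OF this] show ?thesis unfolding \<theta>(2)[symmetric] .
    qed
    \<comment> \<open>The perturbed datum is written as difference plus \<phi>; the difference is
      measured in the full H^s norm.\<close>
    have "wn (tail_weight s N) (H 0) \<le> 2 * wn (tail_weight s N) (\<lambda>\<xi>. H 0 \<xi> - F 0 \<xi>) + 2 * wn (tail_weight s N) (\<lambda>\<xi>. - F 0 \<xi>)"
      using wn_diff[OF measurable_tail_weight, of "\<lambda>\<xi>. H 0 \<xi> - F 0 \<xi>" "\<lambda>\<xi>. - F 0 \<xi>" s N] by simp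
    also have "wn (tail_weight s N) (\<lambda>\<xi>. - F 0 \<xi>) = ennreal (\<theta> N)" unfolding tF0[symmetric] by (rule wn_cong_AE) simp
    also have "wn (tail_weight s N) (\<lambda>\<xi>. H 0 \<xi> - F 0 \<xi>) \<le> ennreal (\<eta>\<^sup>2)"
      unfolding w0[symmetric] by (rule wn_mono[OF tail_weight_bounds(2)])
    finally have tH0: "wn (tail_weight s N) (H 0) \<le> 2 * ennreal (\<eta>\<^sup>2) + 2 * ennreal (\<theta> N)"
      by (simp add: add_right_mono mult_left_mono)
    let ?g = "\<lambda>\<xi>. cis (t * phase \<epsilon> \<xi>) * F t \<xi> - cis (t * phase \<epsilon> \<xi>) * H t \<xi>"
    have d: "L2_fourier (cor (\<lambda>x. u t x - v t x)) ?g" using L2_fourier_diff[OF F(2)[of t] H(2)[of t]] by simp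
    have uH: "u t \<in> Hs s" "v t \<in> Hs s"
      using persistence(1)[OF T sp(1) _ u \<epsilon> \<phi> t'] persistence(1)[OF T sp(1) _ v \<epsilon> \<psi> t'] sp by auto
    have "wn (tail_weight s N) ?g \<le> 2 * wn (tail_weight s N) (F t) + 2 * wn (tail_weight s N) (H t)"
      using wn_diff[OF measurable_tail_weight L2_measurable[OF L2_fourierD(2)[OF F(2)]] L2_measurable[OF L2_fourierD(2)[OF H(2)]], of s N t t]
      by (simp add: wn_phase)
    also have "\<dots> \<le> 2 * (2 * wn (tail_weight s N) (F 0)) + 2 * (2 * wn (tail_weight s N) (H 0))"
      by (intro add_mono mult_left_mono control_timeD(1)[OF T \<epsilon> t' F(1) hF wt] control_timeD(1)[OF T \<epsilon> t' H(1) hH wt]) auto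
    also have "\<dots> \<le> 2 * (2 * ennreal (\<theta> N)) + 2 * (2 * (2 * ennreal (\<eta>\<^sup>2) + 2 * ennreal (\<theta> N)))"
      unfolding tF0 by (intro add_mono mult_left_mono tH0) auto
    also have "\<dots> = ennreal (12 * \<theta> N + 8 * \<eta>\<^sup>2)"
      using \<theta>(3)[of N] by (simp add: ennreal_mult[symmetric] ennreal_plus[symmetric] del: ennreal_plus flip: ennreal_numeral)
    finally have tail: "wn (tail_weight s N) ?g \<le> ennreal (12 * \<theta> N + 8 * \<eta>\<^sup>2)" .
    have "(Hs_norm s (\<lambda>x. u t x - v t x))\<^sup>2 \<le> 12 * \<theta> N + 8 * \<eta>\<^sup>2 + (real (Suc N) powr s)\<^sup>2 * (L2_norm (cor (\<lambda>x. u t x - v t x)))\<^sup>2"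
      by (rule Hs_norm_split[OF Hs_diff(1)[OF uH] d _ tail]) (use sp \<theta>(3)[of N] in auto)
    also have "(L2_norm (cor (\<lambda>x. u t x - v t x)))\<^sup>2 \<le> 2 * \<eta>\<^sup>2"
    proof -
      have "ennreal ((L2_norm (cor (\<lambda>x. u t x - v t x)))\<^sup>2) = wn (\<lambda>_. 1) ?g"
        unfolding wn_1[OF L2_fourierD(2)[OF d]] plancherel[OF d] ..
      also have "\<dots> = wn (\<lambda>_. 1) (\<lambda>\<xi>. F t \<xi> - H t \<xi>)"
        unfolding right_diff_distrib[symmetric] by (rule wn_phase)
      also have "\<dots> \<le> 2 * wn (\<lambda>_. 1) (\<lambda>\<xi>. F 0 \<xi> - H 0 \<xi>)"
        by (rule control_timeD(2)[OF T \<epsilon> t' F(1) hF H(1) hH])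
      also have "wn (\<lambda>_. 1) (\<lambda>\<xi>. F 0 \<xi> - H 0 \<xi>) = wn (\<lambda>_. 1) (\<lambda>\<xi>. H 0 \<xi> - F 0 \<xi>)"
        by (rule wn_cong_AE) (simp add: norm_minus_commute)
      also have "\<dots> \<le> wn (\<lambda>\<xi>. jb \<xi> powr s) (\<lambda>\<xi>. H 0 \<xi> - F 0 \<xi>)"
        by (rule wn_mono) (use sp jb_ge(1) in \<open>auto intro: ge_one_powr_ge_zero\<close>)
      also have "\<dots> = ennreal (\<eta>\<^sup>2)" by (rule w0)
      finally have "ennreal ((L2_norm (cor (\<lambda>x. u t x - v t x)))\<^sup>2) \<le> ennreal (2 * \<eta>\<^sup>2)"
        by (simp add: ennreal_mult mult_left_mono)
      then show ?thesis by (subst (asm) ennreal_le_iff) auto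
    qed
    finally have "(Hs_norm s (\<lambda>x. u t x - v t x))\<^sup>2 \<le> 12 * \<theta> N + 8 * \<eta>\<^sup>2 + (real (Suc N) powr s)\<^sup>2 * (2 * \<eta>\<^sup>2)"
      by (simp only: add_le_cancel_left mult_left_mono zero_le_power2)
    also have "\<dots> = 12 * \<theta> N + K * \<eta>\<^sup>2" by (simp only: K_def algebra_simps)
    also have "K * \<eta>\<^sup>2 \<le> K * \<delta>\<^sup>2"
      using close K by (intro mult_left_mono power_mono) (auto simp: \<eta>_def)
    also have "12 * \<theta> N + K * \<delta>\<^sup>2 \<le> e\<^sup>2" using N by (simp add: K\<delta>)
    finally have "(Hs_norm s (\<lambda>x. u t x - v t x))\<^sup>2 \<le> e\<^sup>2" by (simp only: add_le_cancel_left)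
    then show "Hs_norm s (\<lambda>x. u t x - v t x) \<le> e" by (rule power2_le_imp_le) (use e in simp)
  qed
qed

text \<open>A bound at every time is not enough: \<open>esssup_I\<close> also asks for measurability
  in time, which comes from the continuity of both curves in H^s.\<close>

lemma Linf_Hs_norm_le:
  assumes u: "u \<in> C_Hs s {0..T}" and v: "v \<in> C_Hs s {0..T}"
    and b: "\<And>t. t \<in> {0..T} \<Longrightarrow> Hs_norm s (\<lambda>x. u t x - v t x) \<le> e"
  shows "Linf_Hs_norm s T (\<lambda>t x. u t x - v t x) \<le> ennreal e"
proof -
  let ?d = "\<lambda>t x. u t x - v t x"
  have uH: "u t \<in> Hs s" and vH: "v t \<in> Hs s" if "t \<in> {0..T}" for t
    using u v that by (auto simp: C_Hs_def)
  have dH: "?d t \<in> Hs s" if "t \<in> {0..T}" for t by (rule Hs_diff(1)[OF uH vH, OF that that])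
  have cont: "continuous_on {0..T} (\<lambda>t. Hs_norm s (?d t))"
    unfolding continuous_on_def
  proof
    fix t0 assume t0: "t0 \<in> {0..T}"
    have l: "((\<lambda>t. Hs_norm s (\<lambda>x. u t x - u t0 x) + Hs_norm s (\<lambda>x. v t x - v t0 x)) \<longlongrightarrow> 0) (at t0 within {0..T})"
      using u v t0 by (intro tendsto_add_zero) (auto simp: C_Hs_def)
    have "((\<lambda>t. Hs_norm s (?d t) - Hs_norm s (?d t0)) \<longlongrightarrow> 0) (at t0 within {0..T})"
    proof (rule Lim_null_comparison[OF _ l])
      have "\<forall>\<^sub>F t in at t0 within {0..T}. t \<in> {0..T}" by (simp add: eventually_at_filter)
      then show "\<forall>\<^sub>F t in at t0 within {0..T}. norm (Hs_norm s (?d t) - Hs_norm s (?d t0))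
          \<le> Hs_norm s (\<lambda>x. u t x - u t0 x) + Hs_norm s (\<lambda>x. v t x - v t0 x)"
      proof eventually_elim
        case (elim t)
        have "\<bar>Hs_norm s (?d t) - Hs_norm s (?d t0)\<bar> \<le> Hs_norm s (\<lambda>x. ?d t x - ?d t0 x)"
          by (rule Hs_diff(3)[OF dH[OF elim] dH[OF t0]])
        also have "(\<lambda>x. ?d t x - ?d t0 x) = (\<lambda>x. (u t x - u t0 x) - (v t x - v t0 x))" by (simp add: fun_eq_iff)
        also have "Hs_norm s \<dots> \<le> Hs_norm s (\<lambda>x. u t x - u t0 x) + Hs_norm s (\<lambda>x. v t x - v t0 x)"
          by (rule Hs_diff(2)[OF Hs_diff(1)[OF uH[OF elim] uH[OF t0]] Hs_diff(1)[OF vH[OF elim] vH[OF t0]]])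
        finally show ?case by simp
      qed
    qed
    then show "((\<lambda>t. Hs_norm s (?d t)) \<longlongrightarrow> Hs_norm s (?d t0)) (at t0 within {0..T})" by (simp add: LIM_zero_iff)
  qed
  have en: "Hs_enorm s (?d t) = ennreal (Hs_norm s (?d t))" if "t \<in> {0<..<T}" for t
    using dH[of t] that by (simp add: Hs_enorm_def)
  have "(\<lambda>t. ennreal (Hs_norm s (?d t))) \<in> borel_measurable (restrict_space borel {0<..<T})"
    by (intro measurable_compose[OF borel_measurable_continuous_on_restrict measurable_ennreal] continuous_on_subset[OF cont]) auto
  then have m: "(\<lambda>t. Hs_enorm s (?d t)) \<in> borel_measurable (restrict_space lborel {0<..<T})"
    by (subst measurable_cong[where g = "\<lambda>t. ennreal (Hs_norm s (?d t))"])
      (auto simp: space_restrict_space en measurable_restrict_space1 cong: measurable_cong_sets)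
  show ?thesis
    unfolding Linf_Hs_norm_def
  proof (rule esssup_I[OF m AE_I2])
    fix t assume "t \<in> space (restrict_space lborel {0<..<T})"
    then have t: "t \<in> {0<..<T}" by (simp add: space_restrict_space)
    show "Hs_enorm s (?d t) \<le> ennreal e" unfolding en[OF t] by (rule ennreal_leI[OF b]) (use t in auto)
  qed
qed

text \<open>One function T serves both claims: at the radius given by the H^1 norm of the datum for
  the bound, and at R for equicontinuity, because an H^s ball lies in the H^1 ball of the same
  radius.\<close>

theorem theorem1p2:
  fixes s :: real
  assumes "s \<ge> 1"
  shows "\<exists>T :: real \<Rightarrow> real. (\<forall>r\<ge>0. T r \<in> {0<..<1}) \<and>
    (\<forall>\<phi>\<in>Hs s. \<exists>C>0. \<forall>\<epsilon>\<in>{0<..<1}. \<forall>u. kawahara_solution \<epsilon> \<phi> u \<longrightarrow>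
       (SUP t\<in>{0..T (Hs_norm 1 \<phi>)}. Hs_enorm s (u t)) \<le> ennreal (C * Hs_norm s \<phi>)) \<and>
    (\<forall>R>0. \<forall>S. kawahara_solution_maps s S \<longrightarrow>
       (\<forall>\<epsilon>\<in>{0<..<1}. \<forall>\<phi>\<in>Hs_ball s R. S \<epsilon> \<phi> \<in> C_Hs s {0..T R}) \<and>
       (\<forall>\<phi>\<in>Hs s. \<forall>\<phi>n :: nat \<Rightarrow> real \<Rightarrow> real.
          (\<forall>n. \<phi>n n \<in> Hs_ball s R) \<longrightarrow>
          (\<lambda>n. Hs_norm s (\<lambda>x. \<phi>n n x - \<phi> x)) \<longlonglongrightarrow> 0 \<longrightarrow>
          (\<lambda>n. SUP \<epsilon>\<in>{0<..<1}. Linf_Hs_norm s (T R) (\<lambda>t x. S \<epsilon> \<phi> t x - S \<epsilon> (\<phi>n n) t x))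
            \<longlonglongrightarrow> 0))"
proof -
  \<comment> \<open>The growth exponent of a weight is a natural number; \<open>Suc p\<close> below
    leaves room for the extra power in \<open>tail_weight\<close>.\<close>
  define p where "p = nat \<lceil>s\<rceil>"
  have p: "s \<le> real p" unfolding p_def by (rule real_nat_ceiling_ge)
  \<comment> \<open>The implication makes the choice possible for every real R, so that T becomes a
    total function of the radius.\<close>
  have "\<exists>T. 0 \<le> R \<longrightarrow> control_time (Suc p) R T" for R
    using control_time_exists[of R "Suc p"] by auto
  then obtain T where T: "\<And>R. 0 \<le> R \<Longrightarrow> control_time (Suc p) R (T R)" by metis
  show ?thesis
  proof (intro exI[of _ T] conjI allI impI)
    show "T r \<in> {0<..<1}" if "0 \<le> r" for r using T[OF that] unfolding control_time_def by blast
  next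
    show "\<forall>\<phi>\<in>Hs s. \<exists>C>0. \<forall>\<epsilon>\<in>{0<..<1}. \<forall>u. kawahara_solution \<epsilon> \<phi> u \<longrightarrow>
       (SUP t\<in>{0..T (Hs_norm 1 \<phi>)}. Hs_enorm s (u t)) \<le> ennreal (C * Hs_norm s \<phi>)"
    proof
      fix \<phi> assume \<phi>: "\<phi> \<in> Hs s"
      show "\<exists>C>0. \<forall>\<epsilon>\<in>{0<..<1}. \<forall>u. kawahara_solution \<epsilon> \<phi> u \<longrightarrow>
         (SUP t\<in>{0..T (Hs_norm 1 \<phi>)}. Hs_enorm s (u t)) \<le> ennreal (C * Hs_norm s \<phi>)"
      \<comment> \<open>The constant is the one of \<open>persistence\<close>, independent even of
        the datum.\<close>
      proof (intro exI[of _ "sqrt 2"] conjI ballI allI impI SUP_least)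
        fix \<epsilon> u t
        assume \<epsilon>: "\<epsilon> \<in> {0<..<1::real}" and sol: "kawahara_solution \<epsilon> \<phi> u" and t: "t \<in> {0..T (Hs_norm 1 \<phi>)}"
        have "u t \<in> Hs s \<and> Hs_norm s (u t) \<le> sqrt 2 * Hs_norm s \<phi>"
          using persistence[OF T[of "Hs_norm 1 \<phi>"] assms _ sol _ \<phi> order_refl] \<epsilon> t p by auto
        then show "Hs_enorm s (u t) \<le> ennreal (sqrt 2 * Hs_norm s \<phi>)" by (simp add: Hs_enorm_def ennreal_leI)
      qed simp
    qed
  next
    fix R :: real and S
    assume R: "0 < R" and S: "kawahara_solution_maps s S"
    show "\<forall>\<epsilon>\<in>{0<..<1}. \<forall>\<phi>\<in>Hs_ball s R. S \<epsilon> \<phi> \<in> C_Hs s {0..T R}"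
    proof (intro ballI)
      fix \<epsilon> :: real and \<phi> assume \<epsilon>: "\<epsilon> \<in> {0<..<1}" and \<phi>: "\<phi> \<in> Hs_ball s R"
      have h: "\<phi> \<in> Hs s" "Hs_norm s \<phi> < R" using \<phi> by (auto simp: Hs_ball_def)
      have sol: "kawahara_solution \<epsilon> \<phi> (S \<epsilon> \<phi>)" using S \<epsilon> h by (auto simp: kawahara_solution_maps_def)
      show "S \<epsilon> \<phi> \<in> C_Hs s {0..T R}"
      proof (rule solution_C_Hs[OF _ assms p sol _ h(1)])
        show "control_time (Suc p) R (T R)" using T R by simp
        show "0 < \<epsilon>" using \<epsilon> by simp
        show "Hs_norm 1 \<phi> \<le> R" using Hs_mono(2)[OF assms h(1)] h(2) by linarith
      qed
    qed
  next
    fix R :: real and S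
    assume R: "0 < R" and S: "kawahara_solution_maps s S"
    show "\<forall>\<phi>\<in>Hs s. \<forall>\<phi>n :: nat \<Rightarrow> real \<Rightarrow> real.
          (\<forall>n. \<phi>n n \<in> Hs_ball s R) \<longrightarrow>
          (\<lambda>n. Hs_norm s (\<lambda>x. \<phi>n n x - \<phi> x)) \<longlonglongrightarrow> 0 \<longrightarrow>
          (\<lambda>n. SUP \<epsilon>\<in>{0<..<1}. Linf_Hs_norm s (T R) (\<lambda>t x. S \<epsilon> \<phi> t x - S \<epsilon> (\<phi>n n) t x)) \<longlonglongrightarrow> 0"
    proof (intro ballI allI impI)
      fix \<phi> and \<phi>n :: "nat \<Rightarrow> real \<Rightarrow> real"
      assume \<phi>: "\<phi> \<in> Hs s"
        and \<phi>n: "\<forall>n. \<phi>n n \<in> Hs_ball s R" and lim: "(\<lambda>n. Hs_norm s (\<lambda>x. \<phi>n n x - \<phi> x)) \<longlonglongrightarrow> 0"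
      have \<phi>nH: "\<phi>n n \<in> Hs s" "Hs_norm s (\<phi>n n) \<le> R" for n using \<phi>n by (auto simp: Hs_ball_def less_imp_le)
      have \<phi>n1: "Hs_norm 1 (\<phi>n n) \<le> R" for n using Hs_mono(2)[OF assms \<phi>nH(1)] \<phi>nH(2) by (rule order_trans)
      \<comment> \<open>The limit \<phi> need not lie in the open ball, but its norm is at most R,
        and that is all that \<open>control_time\<close> asks for.\<close>
      have "(\<lambda>n. Hs_norm s (\<phi>n n) - Hs_norm s \<phi>) \<longlonglongrightarrow> 0"
        by (rule Lim_null_comparison[OF _ lim]) (use Hs_diff(3)[OF \<phi>nH(1) \<phi>] in simp)
      then have "(\<lambda>n. Hs_norm s (\<phi>n n)) \<longlonglongrightarrow> Hs_norm s \<phi>" by (simp add: LIM_zero_iff)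
      then have "Hs_norm s \<phi> \<le> R" by (rule LIMSEQ_le_const2) (use \<phi>nH(2) in blast)
      with Hs_mono(2)[OF assms \<phi>] have \<phi>1: "Hs_norm 1 \<phi> \<le> R" by (rule order_trans)
      have TR: "control_time (Suc p) R (T R)" using T R by simp
      have sol: "kawahara_solution \<epsilon> \<psi> (S \<epsilon> \<psi>)" if "\<epsilon> \<in> {0<..<1}" "\<psi> \<in> Hs s" for \<epsilon> \<psi>
        using S that by (auto simp: kawahara_solution_maps_def)
      have C: "S \<epsilon> \<psi> \<in> C_Hs s {0..T R}" if "\<epsilon> \<in> {0<..<1}" "\<psi> \<in> Hs s" "Hs_norm 1 \<psi> \<le> R" for \<epsilon> \<psi>
        by (rule solution_C_Hs[OF TR assms p sol[OF that(1,2)] _ that(2,3)]) (use that in auto)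
      show "(\<lambda>n. SUP \<epsilon>\<in>{0<..<1}. Linf_Hs_norm s (T R) (\<lambda>t x. S \<epsilon> \<phi> t x - S \<epsilon> (\<phi>n n) t x)) \<longlonglongrightarrow> 0"
      proof (rule order_tendstoI)
        fix a :: ennreal assume "0 < a"
        \<comment> \<open>A real number strictly between 0 and a turns the bound \<le> e of
          \<open>equicontinuity\<close> into a strict one.\<close>
        then obtain b where b: "0 < b" "b < a" using dense by blast
        then have "b \<noteq> top" by (auto simp: top_unique)
        then obtain e where e: "0 \<le> e" "b = ennreal e" by (cases b) auto
        then have e0: "0 < e" using b(1) by simp
        obtain \<delta> where \<delta>: "0 < \<delta>"
          and eq: "\<And>\<epsilon> \<psi> u v t. 0 < \<epsilon> \<Longrightarrow> \<psi> \<in> Hs s \<Longrightarrow> Hs_norm 1 \<psi> \<le> R \<Longrightarrow> Hs_norm s (\<lambda>x. \<psi> x - \<phi> x) < \<delta> \<Longrightarrow>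
            kawahara_solution \<epsilon> \<phi> u \<Longrightarrow> kawahara_solution \<epsilon> \<psi> v \<Longrightarrow> t \<in> {0..T R} \<Longrightarrow> Hs_norm s (\<lambda>x. u t x - v t x) \<le> e"
          using equicontinuity[OF TR assms p \<phi> \<phi>1 e0] by blast
        have "\<forall>\<^sub>F n in sequentially. Hs_norm s (\<lambda>x. \<phi>n n x - \<phi> x) < \<delta>" by (rule order_tendstoD(2)[OF lim \<delta>])
        then show "\<forall>\<^sub>F n in sequentially. (SUP \<epsilon>\<in>{0<..<1}. Linf_Hs_norm s (T R) (\<lambda>t x. S \<epsilon> \<phi> t x - S \<epsilon> (\<phi>n n) t x)) < a"
        proof eventually_elim
          case (elim n)
          have "(SUP \<epsilon>\<in>{0<..<1}. Linf_Hs_norm s (T R) (\<lambda>t x. S \<epsilon> \<phi> t x - S \<epsilon> (\<phi>n n) t x)) \<le> ennreal e"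
          proof (rule SUP_least)
            fix \<epsilon> :: real assume \<epsilon>: "\<epsilon> \<in> {0<..<1}"
            show "Linf_Hs_norm s (T R) (\<lambda>t x. S \<epsilon> \<phi> t x - S \<epsilon> (\<phi>n n) t x) \<le> ennreal e"
              by (rule Linf_Hs_norm_le[OF C[OF \<epsilon> \<phi> \<phi>1] C[OF \<epsilon> \<phi>nH(1) \<phi>n1]], rule eq[OF _ \<phi>nH(1) \<phi>n1 elim sol[OF \<epsilon> \<phi>] sol[OF \<epsilon> \<phi>nH(1)]])
                (use \<epsilon> in auto)
          qed
          also have "\<dots> < a" using b e by simp
          finally show ?case .
        qed
      qed simp
    qed
  qed
qed

end
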